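(* Let $\Sigma=\Sigma_{g,p}$. Let $n\in\mathbb Z$ and $s\in\{+1,0,-1\}^p$ with $p_0(s)\geqslant1$. Then the space $\mathrm{HP}_n^s(\Sigma)$ of representations with the mixed boundary condition with relative Euler class $n$ and sign $s$ is non-empty if and only if $$\chi(\Sigma)+p_+(s)\leqslant n\leqslant-\chi(\Sigma)-p_-(s).$$ Moreover, each non-empty $\mathrm{HP}_n^s(\Sigma)$ above is connected.
   Context: $\Sigma_{g,p}$ ($p\geqslant 1$) is the surface obtained from a closed connected oriented surface of genus $g$ by removing $p$ points; $\chi(\Sigma_{g,p})=2-2g-p$. Fix a presentation $\pi_1(\Sigma)=\langle a_1,b_1,\dots,a_g,b_g,c_1,\dots,c_p\mid [a_1,b_1]\cdots[a_g,b_g]c_1\cdots c_p\rangle$, where $c_1,\dots,c_p$ are the preferred peripheral elements, $c_i$ being represented by a loop freely homotopic to a circle around the $i$-th puncture. A non-trivial element $\pm A\in\mathrm{PSL}(2,\mathbb R)$ is hyperbolic, parabolic, or elliptic if $|\mathrm{tr}(A)|>2$, $=2$, or $<2$ respectively. A parabolic element is positive if it is $\mathrm{PSL}(2,\mathbb R)$-conjugate to $\pm\begin{bmatrix}1&1\\0&1\end{bmatrix}$ and negative if it is conjugate to $\pm\begin{bmatrix}1&-1\\0&1\end{bmatrix}$. A representation $\phi:\pi_1(\Sigma)\to\mathrm{PSL}(2,\mathbb R)$ satisfies the mixed boundary condition if every $\phi(c_i)$ is hyperbolic or parabolic. Its sign $s(\phi)\in\{-1,0,+1\}^p$ has $i$-th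 component $+1$, $0$, $-1$ according to whether $\phi(c_i)$ is positive parabolic, hyperbolic, or negative parabolic. For $s\in\{-1,0,+1\}^p$, $p_+(s),p_0(s),p_-(s)$ are the numbers of components equal to $+1$, $0$, $-1$. Relative Euler class: let $\widetilde{\mathrm{SL}}(2,\mathbb R)$ be the universal covering group of $\mathrm{PSL}(2,\mathbb R)$, with exponential map $\widetilde{\exp}$, and let $z=\widetilde{\exp}\begin{bmatrix}0&\pi\\-\pi&0\end{bmatrix}$, a generator of the center. A hyperbolic or parabolic element of $\mathrm{PSL}(2,\mathbb R)$ has a unique lift lying in the image of $\widetilde{\exp}$. Let $\widetilde{\phi(c_i)}$ be this lift of $\phi(c_i)$, and $\widetilde{\phi(a_j)},\widetilde{\phi(b_j)}$ arbitrary lifts. Then $e(\phi)=n$ is the integer with $[\widetilde{\phi(a_1)},\widetilde{\phi(b_1)}]\cdots[\widetilde{\phi(a_g)},\widetilde{\phi(b_g)}]\,\widetilde{\phi(c_1)}\cdots\widetilde{\phi(c_p)}=z^n$. $\mathrm{HP}_n^s(\Sigma)$ is the set of such $\phi$ with $e(\phi)=n$ and $s(\phi)=s$, with the subspace topology from $\mathrm{Hom}(\pi_1(\Sigma),\mathrm{PSL}(2,\mathbb R))$ with the compact-open topology. *)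

theory Defs
  imports "HOL-Analysis.Analysis" "HOL-Algebra.Coset"
begin

section \<open>The topological group PSL(2,R)\<close>

definition mat2 :: "real \<Rightarrow> real \<Rightarrow> real \<Rightarrow> real \<Rightarrow> real^2^2" where
  "mat2 a b c d = vector [vector [a, b], vector [c, d]]"

definition SL2 :: "(real^2^2) monoid" where
  "SL2 = \<lparr>carrier = {A. det A = 1}, monoid.mult = (**), one = mat 1\<rparr>"

definition PSL2 :: "(real^2^2) set monoid" where
  "PSL2 = SL2 Mod {mat 1, - mat 1}"

definition pm :: "real^2^2 \<Rightarrow> (real^2^2) set" where
  "pm A = {A, - A}"

definition quotient_top :: "'a topology \<Rightarrow> ('a \<Rightarrow> 'b) \<Rightarrow> 'b topology" where
  "quotient_top X q =
     topology (\<lambda>U. U \<subseteq> q ` topspace X \<and> openin X {x \<in> topspace X. q x \<in> U})"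

lemma istopology_quotient_top:
  "istopology (\<lambda>U. U \<subseteq> q ` topspace X \<and> openin X {x \<in> topspace X. q x \<in> U})"
proof -
  have "openin X {x \<in> topspace X. q x \<in> S \<inter> T}"
    if "openin X {x \<in> topspace X. q x \<in> S}" "openin X {x \<in> topspace X. q x \<in> T}" for S T
  proof -
    have "{x \<in> topspace X. q x \<in> S \<inter> T} =
          {x \<in> topspace X. q x \<in> S} \<inter> {x \<in> topspace X. q x \<in> T}" by auto
    then show ?thesis using that by auto
  qed
  moreover have "openin X {x \<in> topspace X. q x \<in> \<Union>\<K>}"
    if "\<And>K. K \<in> \<K> \<Longrightarrow> openin X {x \<in> topspace X. q x \<in> K}" for \<K>
  proof -
    have "{x \<in> topspace X. q x \<in> \<Union>\<K>} = (\<Union>K\<in>\<K>. {x \<in> topspace X. q x \<in> K})" by auto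
    then show ?thesis using that by auto
  qed
  ultimately show ?thesis unfolding istopology_def by blast
qed

lemma quotient_map_quotient_top: "quotient_map X (quotient_top X q) q"
proof -
  have o: "openin (quotient_top X q) U \<longleftrightarrow>
      U \<subseteq> q ` topspace X \<and> openin X {x \<in> topspace X. q x \<in> U}" for U
    unfolding quotient_top_def topology_inverse'[OF istopology_quotient_top] ..
  have "{x \<in> topspace X. q x \<in> q ` topspace X} = topspace X" by auto
  then have "openin (quotient_top X q) (q ` topspace X)" by (simp add: o)
  moreover have "U \<subseteq> q ` topspace X" if "openin (quotient_top X q) U" for U
    using that o by blast
  ultimately have "topspace (quotient_top X q) = q ` topspace X"
    by (metis openin_subset openin_topspace subset_antisym)
  then show ?thesis by (auto simp: quotient_map_def o)
qed

definition PSL2_top :: "(real^2^2) set topology" where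
  "PSL2_top = quotient_top (top_of_set (carrier SL2)) pm"

definition hyperbolic :: "(real^2^2) set \<Rightarrow> bool" where
  "hyperbolic x \<longleftrightarrow> x \<in> carrier PSL2 \<and> x \<noteq> \<one>\<^bsub>PSL2\<^esub> \<and> (\<exists>A\<in>x. \<bar>trace A\<bar> > 2)"

definition parabolic :: "(real^2^2) set \<Rightarrow> bool" where
  "parabolic x \<longleftrightarrow> x \<in> carrier PSL2 \<and> x \<noteq> \<one>\<^bsub>PSL2\<^esub> \<and> (\<exists>A\<in>x. \<bar>trace A\<bar> = 2)"

definition PSL2_conjugate :: "(real^2^2) set \<Rightarrow> (real^2^2) set \<Rightarrow> bool" where
  "PSL2_conjugate x y \<longleftrightarrow>
     (\<exists>h\<in>carrier PSL2. x = h \<otimes>\<^bsub>PSL2\<^esub> y \<otimes>\<^bsub>PSL2\<^esub> inv\<^bsub>PSL2\<^esub> h)"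

definition positive_parabolic :: "(real^2^2) set \<Rightarrow> bool" where
  "positive_parabolic x \<longleftrightarrow> parabolic x \<and> PSL2_conjugate x (pm (mat2 1 1 0 1))"

definition negative_parabolic :: "(real^2^2) set \<Rightarrow> bool" where
  "negative_parabolic x \<longleftrightarrow> parabolic x \<and> PSL2_conjugate x (pm (mat2 1 (-1) 0 1))"


section \<open>Universal covering groups\<close>

text \<open>
  The universal covering group of a path-connected topological group \<open>G\<close> (with topology \<open>X\<close>),
  realised as usual by homotopy classes, relative to the end points, of paths that start at the
  identity; the group law is induced by pointwise multiplication of paths, and the covering
  projection sends a class to its end point.
\<close>

definition paths_from_one :: "'a topology \<Rightarrow> ('a, 'b) monoid_scheme \<Rightarrow> (real \<Rightarrow> 'a) set" where
  "paths_from_one X G = {r. pathin X r \<and> r 0 = \<one>\<^bsub>G\<^esub>}"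

definition path_homotopic :: "'a topology \<Rightarrow> (real \<Rightarrow> 'a) \<Rightarrow> (real \<Rightarrow> 'a) \<Rightarrow> bool" where
  "path_homotopic X q r \<longleftrightarrow>
     homotopic_with (\<lambda>f. f 0 = q 0 \<and> f 1 = q 1) (top_of_set {0..1}) X q r"

definition path_class :: "'a topology \<Rightarrow> (real \<Rightarrow> 'a) \<Rightarrow> (real \<Rightarrow> 'a) set" where
  "path_class X q = {r. path_homotopic X q r}"

definition universal_cover ::
    "'a topology \<Rightarrow> ('a, 'b) monoid_scheme \<Rightarrow> (real \<Rightarrow> 'a) set monoid" where
  "universal_cover X G =
     \<lparr>carrier = path_class X ` paths_from_one X G,
      monoid.mult = (\<lambda>U V. \<Union>q\<in>U. \<Union>r\<in>V. path_class X (\<lambda>t. q t \<otimes>\<^bsub>G\<^esub> r t)),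
      one = path_class X (\<lambda>_. \<one>\<^bsub>G\<^esub>)\<rparr>"

definition lifts :: "'a topology \<Rightarrow> ('a, 'b) monoid_scheme \<Rightarrow> 'a \<Rightarrow> (real \<Rightarrow> 'a) set set" where
  "lifts X G x = {U \<in> carrier (universal_cover X G). \<exists>q\<in>U. q 1 = x}"


section \<open>The universal cover of PSL(2,R) and its exponential map\<close>

abbreviation SL2_tilde :: "(real \<Rightarrow> (real^2^2) set) set monoid" where
  "SL2_tilde \<equiv> universal_cover PSL2_top PSL2"

text \<open>The library's \<open>exp\<close> and \<open>^\<close> are not available here: multiplication on the type
  \<open>real^2^2\<close> is entrywise, and the matrix product is \<open>**\<close>.\<close>

definition mat_exp :: "real^2^2 \<Rightarrow> real^2^2" where
  "mat_exp X = (\<Sum>k. (1 / fact k) *\<^sub>R ((\<lambda>Y. X ** Y) ^^ k) (mat 1))"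

definition sl2 :: "(real^2^2) set" where
  "sl2 = {X. trace X = 0}"

text \<open>The one-parameter subgroup generated by \<open>X\<close>, lifted to the universal cover and evaluated
  at time 1.\<close>

definition exp_tilde :: "real^2^2 \<Rightarrow> (real \<Rightarrow> (real^2^2) set) set" where
  "exp_tilde X = path_class PSL2_top (\<lambda>t. pm (mat_exp (t *\<^sub>R X)))"

definition z_tilde :: "(real \<Rightarrow> (real^2^2) set) set" where
  "z_tilde = exp_tilde (mat2 0 pi (- pi) 0)"

text \<open>Well defined for hyperbolic and parabolic \<open>x\<close>.\<close>

definition exp_lift :: "(real^2^2) set \<Rightarrow> (real \<Rightarrow> (real^2^2) set) set" where
  "exp_lift x = (THE U. U \<in> exp_tilde ` sl2 \<and> U \<in> lifts PSL2_top PSL2 x)"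


section \<open>Group presentations\<close>

text \<open>Words in the letters \<open>x\<close> and \<open>x\<inverse>\<close>, encoded as \<open>(x, True)\<close> and \<open>(x, False)\<close>. The group
  presented by generators \<open>S\<close> and relators \<open>R\<close> consists of the words over \<open>S\<close> modulo insertion
  and deletion of trivial pairs and of relators.\<close>

inductive pres_eq ::
    "'x set \<Rightarrow> ('x \<times> bool) list set \<Rightarrow> ('x \<times> bool) list \<Rightarrow> ('x \<times> bool) list \<Rightarrow> bool"
  for S R where
  refl: "pres_eq S R u u"
| sym: "pres_eq S R u v \<Longrightarrow> pres_eq S R v u"
| trans: "pres_eq S R u v \<Longrightarrow> pres_eq S R v w \<Longrightarrow> pres_eq S R u w"
| cancel: "x \<in> S \<Longrightarrow> pres_eq S R (u @ [(x, e), (x, \<not> e)] @ v) (u @ v)"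
| relator: "r \<in> R \<Longrightarrow> pres_eq S R (u @ r @ v) (u @ v)"

definition word_class ::
    "'x set \<Rightarrow> ('x \<times> bool) list set \<Rightarrow> ('x \<times> bool) list \<Rightarrow> ('x \<times> bool) list set" where
  "word_class S R u = {v \<in> lists (S \<times> UNIV). pres_eq S R u v}"

definition presented_group ::
    "'x set \<Rightarrow> ('x \<times> bool) list set \<Rightarrow> ('x \<times> bool) list set monoid" where
  "presented_group S R =
     \<lparr>carrier = word_class S R ` lists (S \<times> UNIV),
      monoid.mult = (\<lambda>U V. \<Union>u\<in>U. \<Union>v\<in>V. word_class S R (u @ v)),
      one = word_class S R []\<rparr>"


section \<open>The surface and its fundamental group\<close>

definition euler_char :: "nat \<Rightarrow> nat \<Rightarrow> int" where
  "euler_char g p = 2 - 2 * int g - int p"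

text \<open>Generators are numbered from 0.\<close>

datatype gen = GenA nat | GenB nat | GenC nat

definition surface_gens :: "nat \<Rightarrow> nat \<Rightarrow> gen set" where
  "surface_gens g p = GenA ` {..<g} \<union> GenB ` {..<g} \<union> GenC ` {..<p}"

definition surface_relator :: "nat \<Rightarrow> nat \<Rightarrow> (gen \<times> bool) list" where
  "surface_relator g p =
     concat (map (\<lambda>j. [(GenA j, True), (GenB j, True), (GenA j, False), (GenB j, False)]) [0..<g])
     @ map (\<lambda>i. (GenC i, True)) [0..<p]"

definition surface_group :: "nat \<Rightarrow> nat \<Rightarrow> (gen \<times> bool) list set monoid" where
  "surface_group g p = presented_group (surface_gens g p) {surface_relator g p}"

definition gen_elem :: "nat \<Rightarrow> nat \<Rightarrow> gen \<Rightarrow> (gen \<times> bool) list set" where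
  "gen_elem g p x = word_class (surface_gens g p) {surface_relator g p} [(x, True)]"


section \<open>Spaces of representations\<close>

definition compact_open_topology :: "'a topology \<Rightarrow> 'b topology \<Rightarrow> ('a \<Rightarrow> 'b) topology" where
  "compact_open_topology X Y = topology_generated_by
     {{f \<in> extensional (topspace X). continuous_map X Y f \<and> f ` K \<subseteq> U} | K U.
        compactin X K \<and> openin Y U}"

type_synonym rep = "(gen \<times> bool) list set \<Rightarrow> (real^2^2) set"

definition Hom_PSL2 :: "nat \<Rightarrow> nat \<Rightarrow> rep set" where
  "Hom_PSL2 g p = hom (surface_group g p) PSL2 \<inter> extensional (carrier (surface_group g p))"

definition Hom_PSL2_top :: "nat \<Rightarrow> nat \<Rightarrow> rep topology" where
  "Hom_PSL2_top g p = subtopology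
     (compact_open_topology (discrete_topology (carrier (surface_group g p))) PSL2_top)
     (Hom_PSL2 g p)"

definition mixed_boundary :: "nat \<Rightarrow> nat \<Rightarrow> rep \<Rightarrow> bool" where
  "mixed_boundary g p \<phi> \<longleftrightarrow>
     (\<forall>i<p. hyperbolic (\<phi> (gen_elem g p (GenC i))) \<or> parabolic (\<phi> (gen_elem g p (GenC i))))"

text \<open>The value for elements that are neither hyperbolic nor parabolic is irrelevant; a parabolic
  element is either positive or negative.\<close>

definition rep_sign :: "nat \<Rightarrow> nat \<Rightarrow> rep \<Rightarrow> nat \<Rightarrow> int" where
  "rep_sign g p \<phi> = (\<lambda>i\<in>{..<p}.
     if positive_parabolic (\<phi> (gen_elem g p (GenC i))) then 1
     else if negative_parabolic (\<phi> (gen_elem g p (GenC i))) then -1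
     else 0)"

definition commutator :: "('a, 'b) monoid_scheme \<Rightarrow> 'a \<Rightarrow> 'a \<Rightarrow> 'a" where
  "commutator G x y = x \<otimes>\<^bsub>G\<^esub> y \<otimes>\<^bsub>G\<^esub> inv\<^bsub>G\<^esub> x \<otimes>\<^bsub>G\<^esub> inv\<^bsub>G\<^esub> y"

definition list_prod :: "('a, 'b) monoid_scheme \<Rightarrow> 'a list \<Rightarrow> 'a" where
  "list_prod G xs = foldr (monoid.mult G) xs \<one>\<^bsub>G\<^esub>"

definition rel_euler_class :: "nat \<Rightarrow> nat \<Rightarrow> rep \<Rightarrow> int" where
  "rel_euler_class g p \<phi> = (THE n. \<forall>\<alpha> \<beta>.
     (\<forall>j<g. \<alpha> j \<in> lifts PSL2_top PSL2 (\<phi> (gen_elem g p (GenA j))) \<and>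
            \<beta> j \<in> lifts PSL2_top PSL2 (\<phi> (gen_elem g p (GenB j)))) \<longrightarrow>
     list_prod SL2_tilde
       (map (\<lambda>j. commutator SL2_tilde (\<alpha> j) (\<beta> j)) [0..<g] @
        map (\<lambda>i. exp_lift (\<phi> (gen_elem g p (GenC i)))) [0..<p])
     = z_tilde [^]\<^bsub>SL2_tilde\<^esub> n)"

definition HP :: "nat \<Rightarrow> nat \<Rightarrow> int \<Rightarrow> (nat \<Rightarrow> int) \<Rightarrow> rep set" where
  "HP g p n s = {\<phi> \<in> Hom_PSL2 g p.
     mixed_boundary g p \<phi> \<and> rel_euler_class g p \<phi> = n \<and> rep_sign g p \<phi> = s}"

definition num_sign :: "nat \<Rightarrow> int \<Rightarrow> (nat \<Rightarrow> int) \<Rightarrow> nat" where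
  "num_sign p k s = card {i \<in> {..<p}. s i = k}"

end

theory Submission
  imports Defs
begin

text \<open>The universal covering group of \<open>PSL(2,\<real>)\<close> acts faithfully on the universal cover of the circle of
  directions, so its elements are homeomorphisms of the line commuting with \<open>z(x) = x + \<pi>\<close>. An element \<open>k\<close> lies
  strictly between \<open>Hyp\<^sub>a\<close> and \<open>Hyp\<^sub>b\<close> (\<open>a \<le> b\<close>) iff \<open>k(x) > x + a \<pi>\<close> for some \<open>x\<close> and \<open>k(x) < x + b \<pi>\<close> for some
  \<open>x\<close>; both are linear conditions along suitable families of matrices.

  For fixed \<open>k\<close>, the elements \<open>c\<close> of a hyperbolic or parabolic class, or the commutators \<open>c = [x, y]\<close>, with \<open>k c\<close> in
  the interval \<open>[a, b]\<close> form a connected set (up to signs of \<open>x\<close> and \<open>y\<close>), which is non-empty iff \<open>k\<close> lies in the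
  interval widened by \<open>1\<close> at both ends; for a parabolic class only one of the ends moves. Since the fibres are
  connected and small perturbations of \<open>k\<close> do not leave them, a locally constant function on the total
  space descends to the widened interval. Peeling off the factors one at a time thus reduces a word in commutators
  and boundary elements to the question whether the identity lies in an interval.

  A hyperbolic boundary element \<open>c\<^sub>i\<close> is solved for in the relator: the representations correspond to arbitrary
  values of the other generators for which the product of the remaining blocks lies in \<open>Hyp\<^sub>n\<close>, which is the word problem
  above with \<open>a = b = n\<close>.\<close>

subsection \<open>Two by two matrices acting on the plane\<close>

lemma mat2_nth [simp]:
  "mat2 a b c d $ 1 $ 1 = a" "mat2 a b c d $ 1 $ 2 = b"
  "mat2 a b c d $ 2 $ 1 = c" "mat2 a b c d $ 2 $ 2 = d"
  by (simp_all add: mat2_def)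

lemma matrix_mult_nth2 [simp]:
  fixes A B :: "real^2^2"
  shows "(A ** B) $ 1 $ 1 = A$1$1 * B$1$1 + A$1$2 * B$2$1"
    "(A ** B) $ 1 $ 2 = A$1$1 * B$1$2 + A$1$2 * B$2$2"
    "(A ** B) $ 2 $ 1 = A$2$1 * B$1$1 + A$2$2 * B$2$1"
    "(A ** B) $ 2 $ 2 = A$2$1 * B$1$2 + A$2$2 * B$2$2"
  by (simp_all add: matrix_matrix_mult_def sum_2)

lemma mat_1_nth2 [simp]:
  "(mat 1 :: real^2^2) $ 1 $ 1 = 1" "(mat 1 :: real^2^2) $ 1 $ 2 = 0"
  "(mat 1 :: real^2^2) $ 2 $ 1 = 0" "(mat 1 :: real^2^2) $ 2 $ 2 = 1"
  by (simp_all add: mat_def)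

lemma mat2_eq_iff:
  fixes A B :: "real^2^2"
  shows "A = B \<longleftrightarrow> A$1$1 = B$1$1 \<and> A$1$2 = B$1$2 \<and> A$2$1 = B$2$1 \<and> A$2$2 = B$2$2"
  by (auto simp: vec_eq_iff forall_2)

lemma trace_2: "trace (A :: real^2^2) = A$1$1 + A$2$2"
  by (simp add: trace_def sum_2)

lemma det_minus_2 [simp]: "det (- A :: real^2^2) = det A"
  by (simp add: det_2)

lemma trace_minus [simp]: "trace (- A :: real^2^2) = - trace A"
  by (simp add: trace_2)

lemma matrix_mult_minus [simp]:
  fixes A B :: "real^2^2"
  shows "(- A) ** B = - (A ** B)" "A ** (- B) = - (A ** B)"
  by (simp_all add: mat2_eq_iff)

definition sinv :: "real^2^2 \<Rightarrow> real^2^2" where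
  "sinv A = mat2 (A$2$2) (- A$1$2) (- A$2$1) (A$1$1)"

lemma sinv_mult:
  assumes "det A = 1"
  shows "A ** sinv A = mat 1" "sinv A ** A = mat 1"
  using assms by (simp_all add: sinv_def mat2_eq_iff det_2 algebra_simps)

lemma det_sinv [simp]: "det (sinv A) = det A"
  by (simp add: sinv_def det_2 algebra_simps)

lemma trace_sinv [simp]: "trace (sinv A) = trace A"
  by (simp add: sinv_def trace_2)

lemma sinv_sinv [simp]: "sinv (sinv A) = A"
  by (simp add: sinv_def mat2_eq_iff)

lemma sinv_mult_distrib: "sinv (A ** B) = sinv B ** sinv A"
  by (simp add: sinv_def mat2_eq_iff algebra_simps)

lemma sinv_minus: "sinv (- A) = - sinv A"
  by (simp add: sinv_def mat2_eq_iff)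

lemma sinv_mat_1 [simp]: "sinv (mat 1) = mat 1"
  by (simp add: sinv_def mat2_eq_iff)

lemma sinv_cancel [simp]:
  assumes "det A = 1"
  shows "sinv A ** (A ** B) = B" "A ** (sinv A ** B) = B"
  by (simp_all add: assms matrix_mul_assoc sinv_mult)

lemma trace_conj: "det P = 1 \<Longrightarrow> trace (P ** A ** sinv P) = trace A"
  by (metis matrix_mul_assoc matrix_mul_lid sinv_mult(2) trace_mul_sym)

lemma continuous_on_mat2 [continuous_intros]:
  assumes "continuous_on S a" "continuous_on S b" "continuous_on S c" "continuous_on S d"
  shows "continuous_on S (\<lambda>x. mat2 (a x) (b x) (c x) (d x))"
proof -
  have 1: "(\<lambda>x. mat2 (a x) (b x) (c x) (d x)) =
      (\<lambda>x. \<chi> i j. if i = 1 then (if j = 1 then a x else b x) else (if j = 1 then c x else d x))"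
    by (rule ext) (simp add: mat2_eq_iff)
  show ?thesis unfolding 1
  proof (intro continuous_on_vec_lambda)
    fix i j :: 2
    show "continuous_on S (\<lambda>x. if i = 1 then if j = 1 then a x else b x else if j = 1 then c x else d x)"
      by (cases "i = 1"; cases "j = 1") (simp_all add: assms)
  qed
qed

lemma continuous_on_mat_mult [continuous_intros]:
  fixes A B :: "'a::topological_space \<Rightarrow> real^2^2"
  assumes "continuous_on S A" "continuous_on S B"
  shows "continuous_on S (\<lambda>x. A x ** B x)"
proof -
  show ?thesis
    unfolding matrix_matrix_mult_def
    by (intro continuous_on_vec_lambda continuous_intros assms)
qed

lemma continuous_on_sinv [continuous_intros]:
  assumes "continuous_on S A"
  shows "continuous_on S (\<lambda>x. sinv (A x))"
  unfolding sinv_def by (intro continuous_intros assms)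

text \<open>The vector \<open>(v\<^sub>1, v\<^sub>2)\<close> is identified with the complex number \<open>v\<^sub>1 - \<i> v\<^sub>2\<close>, so that
  \<open>exp (t (0, \<pi>; - \<pi>, 0))\<close> acts as the rotation by \<open>+ t \<pi>\<close> and positive parabolics
  move directions forward.\<close>

definition mact :: "real^2^2 \<Rightarrow> complex \<Rightarrow> complex" where
  "mact A z = Complex (A$1$1 * Re z - A$1$2 * Im z) (A$2$2 * Im z - A$2$1 * Re z)"

lemma mact_mult: "mact (A ** B) z = mact A (mact B z)"
  by (simp add: mact_def algebra_simps)

lemma mact_1 [simp]: "mact (mat 1) z = z"
  by (simp add: mact_def)

lemma mact_scaleR: "mact A (r *\<^sub>R z) = r *\<^sub>R mact A z"
  by (simp add: mact_def complex_eq_iff algebra_simps)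

lemma mact_minus: "mact (- A) z = - mact A z" "mact A (- z) = - mact A z"
  by (simp_all add: mact_def complex_eq_iff)

lemma mact_sinv: "det A = 1 \<Longrightarrow> mact (sinv A) (mact A z) = z"
  by (simp add: mact_mult[symmetric] sinv_mult)

lemma mact_eq_0: "det A = 1 \<Longrightarrow> mact A z = 0 \<longleftrightarrow> z = 0"
  by (metis mact_sinv mact_scaleR scaleR_zero_left)

lemma continuous_on_mact [continuous_intros]:
  assumes "continuous_on S A" "continuous_on S z"
  shows "continuous_on S (\<lambda>x. mact (A x) (z x))"
  unfolding mact_def by (intro continuous_intros assms)

lemma eigen_det:
  assumes "z \<noteq> 0" "mact A z = r *\<^sub>R z"
  shows "r\<^sup>2 - r * trace A + det A = 0"
proof -
  let ?p = "Re z" and ?q = "Im z"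
  have e: "(A$1$1 - r) * ?p = A$1$2 * ?q" "(A$2$2 - r) * ?q = A$2$1 * ?p"
    using assms(2) by (simp_all add: mact_def complex_eq_iff algebra_simps)
  have 1: "((A$1$1 - r) * (A$2$2 - r) - A$1$2 * A$2$1) * ?p = 0"
  proof -
    have "((A$1$1 - r) * (A$2$2 - r) - A$1$2 * A$2$1) * ?p
      = (A$2$2 - r) * ((A$1$1 - r) * ?p) - A$1$2 * (A$2$1 * ?p)" by (simp add: algebra_simps)
    also have "\<dots> = 0" unfolding e(1) e(2)[symmetric] by simp
    finally show ?thesis .
  qed
  have 2: "((A$1$1 - r) * (A$2$2 - r) - A$1$2 * A$2$1) * ?q = 0"
  proof -
    have "((A$1$1 - r) * (A$2$2 - r) - A$1$2 * A$2$1) * ?q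
      = (A$1$1 - r) * ((A$2$2 - r) * ?q) - A$2$1 * (A$1$2 * ?q)" by (simp add: algebra_simps)
    also have "\<dots> = 0" unfolding e(2) e(1)[symmetric] by simp
    finally show ?thesis .
  qed
  have "?p \<noteq> 0 \<or> ?q \<noteq> 0" using assms(1) by (auto simp: complex_eq_iff)
  then have "(A$1$1 - r) * (A$2$2 - r) - A$1$2 * A$2$1 = 0" using 1 2 by auto
  then show ?thesis by (simp add: trace_2 det_2 power2_eq_square algebra_simps)
qed


subsection \<open>Lifts to the line of the action on directions\<close>

definition angle_lift :: "real^2^2 \<Rightarrow> (real \<Rightarrow> real) \<Rightarrow> bool" where
  "angle_lift A f \<longleftrightarrow> continuous_on UNIV f \<and> (\<forall>x. \<exists>r>0. mact A (cis x) = r *\<^sub>R cis (f x))"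

lemma angle_liftE:
  assumes "angle_lift A f"
  obtains r where "r > 0" "mact A (cis x) = r *\<^sub>R cis (f x)"
  using assms unfolding angle_lift_def by blast

lemma angle_lift_cont: "angle_lift A f \<Longrightarrow> continuous_on S f"
  unfolding angle_lift_def using continuous_on_subset by blast

lemma angle_lift_id: "angle_lift (mat 1) (\<lambda>x. x)"
  unfolding angle_lift_def by (auto intro: exI[of _ 1])

lemma angle_lift_comp:
  assumes "angle_lift A f" "angle_lift B h"
  shows "angle_lift (A ** B) (f \<circ> h)"
  unfolding angle_lift_def
proof safe
  show "continuous_on UNIV (f \<circ> h)"
    using assms by (intro continuous_on_compose) (auto intro: angle_lift_cont)
  fix x
  obtain r where r: "r > 0" "mact B (cis x) = r *\<^sub>R cis (h x)" using assms(2) by (rule angle_liftE)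
  obtain t where t: "t > 0" "mact A (cis (h x)) = t *\<^sub>R cis (f (h x))"
    using assms(1) by (rule angle_liftE)
  show "\<exists>r>0. mact (A ** B) (cis x) = r *\<^sub>R cis ((f \<circ> h) x)"
    using r t by (intro exI[of _ "r * t"]) (simp add: mact_mult mact_scaleR)
qed

lemma cis_add_pi: "cis (x + pi) = - cis x"
  by (simp add: complex_eq_iff)

lemma cis_add_int_pi: "cis (x + pi * of_int j) = (if even j then cis x else - cis x)"
proof -
  have "cis (x + pi * of_int j) = cis x * cis (pi * of_int j)"
    by (simp add: cis_mult)
  also have "cis (pi * of_int j) = (if even j then 1 else - 1)"
  proof (cases "even j")
    case True
    then obtain i where "j = 2 * i" by blast
    then have "pi * of_int j = 2 * pi * of_int i" by simp
    moreover have "cis (2 * pi * of_int i) = 1" by (rule cis_multiple_2pi) simp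
    ultimately show ?thesis using True by presburger
  next
    case False
    then obtain i where "j = 2 * i + 1" by (elim oddE)
    then have "pi * of_int j = 2 * pi * of_int i + pi" by (simp add: algebra_simps)
    moreover have "cis (2 * pi * of_int i) = 1" by (rule cis_multiple_2pi) simp
    ultimately show ?thesis using False by (simp add: cis_add_pi del: cis_mult)
  qed
  finally show ?thesis by simp
qed

lemma angle_lift_shift:
  assumes "angle_lift A f"
  shows "angle_lift (if even j then A else - A) (\<lambda>x. f x + pi * of_int j)"
  unfolding angle_lift_def
proof safe
  show "continuous_on UNIV (\<lambda>x. f x + pi * of_int j)"
    using assms by (intro continuous_intros angle_lift_cont)
  fix x
  obtain r where r: "r > 0" "mact A (cis x) = r *\<^sub>R cis (f x)" using assms by (rule angle_liftE)
  then show "\<exists>r>0. mact (if even j then A else - A) (cis x) = r *\<^sub>R cis (f x + pi * of_int j)"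
    by (intro exI[of _ r]) (auto simp: cis_add_int_pi mact_minus)
qed

lemma scaleR_cis_eqD:
  assumes "r *\<^sub>R cis x = s *\<^sub>R cis y" "r > 0" "s > 0"
  shows "r = s" "cis x = cis y"
proof -
  have "norm (r *\<^sub>R cis x) = norm (s *\<^sub>R cis y)" using assms by simp
  then show "r = s" using assms(2,3) by (simp only: norm_scaleR norm_cis)
  then show "cis x = cis y" using assms by simp
qed

lemma cis_eq_imp:
  assumes "cis x = cis y"
  shows "\<exists>j::int. x = y + 2 * pi * of_int j"
proof -
  have "cos x = cos y" "sin x = sin y" using assms by (simp_all add: complex_eq_iff)
  then show ?thesis by (metis sin_cos_eq_iff)
qed

lemma connected_int_valued_const:
  fixes f :: "'a::topological_space \<Rightarrow> real"
  assumes "connected S" "continuous_on S f" "\<And>x. x \<in> S \<Longrightarrow> f x \<in> \<int>" "x \<in> S" "y \<in> S"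
  shows "f x = f y"
proof -
  have c: "connected (f ` S)" using assms by (intro connected_continuous_image)
  have *: "\<not> f u < f v" if uv: "u \<in> S" "v \<in> S" for u v
  proof
    assume l: "f u < f v"
    obtain i where i: "f u = of_int i" using assms(3)[OF uv(1)] by (auto elim: Ints_cases)
    obtain j where j: "f v = of_int j" using assms(3)[OF uv(2)] by (auto elim: Ints_cases)
    have "i + 1 \<le> j" using l i j by simp
    then have "real_of_int i + 1 \<le> of_int j" by linarith
    then have "of_int i + 1/2 \<in> f ` S"
      using connectedD_interval[OF c, of "f u" "f v" "of_int i + 1/2"] imageI[OF uv(1), of f] imageI[OF uv(2), of f] i j by auto
    then obtain w where "w \<in> S" "f w = of_int i + 1/2" by auto
    then obtain k where "of_int i + 1/2 = real_of_int k"
      using assms(3)[OF \<open>w \<in> S\<close>] by (auto elim: Ints_cases)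
    then have "real_of_int (2 * i + 1) = real_of_int (2 * k)" by simp
    then have "2 * i + 1 = 2 * k" by linarith
    then show False by presburger
  qed
  show ?thesis using *[of x y] *[of y x] assms by fastforce
qed

lemma angle_lift_unique:
  assumes "angle_lift A f" "angle_lift A h"
  obtains j :: int where "\<And>x. f x = h x + 2 * pi * of_int j"
proof -
  have 1: "\<exists>j::int. f x = h x + 2 * pi * of_int j" for x
  proof -
    obtain r where r: "r > 0" "mact A (cis x) = r *\<^sub>R cis (f x)" using assms(1) by (rule angle_liftE)
    obtain s where s: "s > 0" "mact A (cis x) = s *\<^sub>R cis (h x)" using assms(2) by (rule angle_liftE)
    show ?thesis using r s scaleR_cis_eqD(2)[of r "f x" s "h x"] by (intro cis_eq_imp) simp
  qed
  define d where "d x = (f x - h x) / (2 * pi)" for x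
  have d: "d x \<in> \<int>" for x using 1[of x] by (auto simp: d_def)
  have "continuous_on UNIV d"
    unfolding d_def
    by (intro continuous_intros angle_lift_cont[OF assms(1)] angle_lift_cont[OF assms(2)]) auto
  then have c: "d x = d 0" for x
    by (intro connected_int_valued_const[of UNIV]) (auto simp: d)
  obtain j where "d 0 = of_int j" using d[of 0] by (auto elim: Ints_cases)
  then have "f x = h x + 2 * pi * of_int j" for x
    using c[of x] by (simp add: d_def field_simps)
  then show thesis by (rule that)
qed


subsection \<open>The principal lift\<close>

definition plift :: "real^2^2 \<Rightarrow> real \<Rightarrow> real" where
  "plift A x = x + Arg (mact A (cis x) * cis (- x))"

lemma plift_nonpos:
  assumes "det A = 1" "trace A > -2"
  shows "mact A (cis x) * cis (- x) \<notin> \<real>\<^sub>\<le>\<^sub>0"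
proof
  assume "mact A (cis x) * cis (- x) \<in> \<real>\<^sub>\<le>\<^sub>0"
  then obtain r where r: "r \<le> 0" "mact A (cis x) * cis (- x) = of_real r"
    by (auto elim!: nonpos_Reals_cases)
  have "mact A (cis x) = mact A (cis x) * cis (- x) * cis x"
    by (simp add: mult.assoc cis_mult)
  also have "\<dots> = r *\<^sub>R cis x" unfolding r(2) by (simp add: scaleR_conv_of_real)
  finally have "mact A (cis x) = r *\<^sub>R cis x" .
  then have e: "r\<^sup>2 - r * trace A + 1 = 0"
    using eigen_det[of "cis x" A r] assms by simp
  show False
  proof (cases "r = 0")
    case False
    then have "r * trace A < r * (-2)"
      using r assms by (intro mult_strict_left_mono_neg) auto
    then have "r\<^sup>2 + 2 * r + 1 < 0" using e by linarith
    moreover have "(r + 1)\<^sup>2 \<ge> 0" by simp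
    ultimately show False by (simp add: power2_sum)
  qed (use e in simp)
qed

lemma continuous_on_plift_joint:
  assumes "continuous_on S A" "continuous_on S h"
    and "\<And>m. m \<in> S \<Longrightarrow> det (A m) = 1 \<and> trace (A m) > -2"
  shows "continuous_on S (\<lambda>m. plift (A m) (h m))"
  unfolding plift_def
  using assms by (intro continuous_intros plift_nonpos) auto

lemma angle_lift_plift:
  assumes "det A = 1" "trace A > -2"
  shows "angle_lift A (plift A)"
  unfolding angle_lift_def
proof safe
  show "continuous_on UNIV (plift A)"
    using continuous_on_plift_joint[of UNIV "\<lambda>_. A" "\<lambda>x. x"] assms by simp
  fix x
  let ?w = "mact A (cis x) * cis (- x)"
  have "?w \<noteq> 0" using plift_nonpos[OF assms, of x] by auto
  have "mact A (cis x) = ?w * cis x" by (simp add: mult.assoc cis_mult)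
  also have "?w = cmod ?w *\<^sub>R cis (Arg ?w)"
    by (metis rcis_cmod_Arg rcis_def scaleR_conv_of_real)
  finally have "mact A (cis x) = cmod ?w *\<^sub>R cis (plift A x)"
    by (simp add: plift_def cis_mult add.commute)
  then show "\<exists>r>0. mact A (cis x) = r *\<^sub>R cis (plift A x)"
    using \<open>?w \<noteq> 0\<close> by (intro exI[of _ "cmod ?w"]) simp
qed

lemma plift_minus_bounds:
  assumes "det A = 1" "trace A > -2"
  shows "- pi < plift A x - x" "plift A x - x < pi"
proof -
  let ?w = "mact A (cis x) * cis (- x)"
  have "- pi < Arg ?w" "Arg ?w \<le> pi" using Arg_bounded by blast+
  moreover have "Arg ?w \<noteq> pi"
    using plift_nonpos[OF assms, of x] by (auto simp: Arg_eq_pi complex_nonpos_Reals_iff)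
  ultimately show "- pi < plift A x - x" "plift A x - x < pi" by (auto simp: plift_def)
qed

lemma plift_periodic: "plift A (x + pi) = plift A x + pi"
proof -
  have "cis (- (x + pi)) = - cis (- x)" by (simp add: complex_eq_iff)
  then show ?thesis unfolding plift_def by (simp add: cis_add_pi mact_minus)
qed

lemma angle_lift_exists:
  assumes "det A = 1"
  shows "\<exists>f. angle_lift A f"
proof (cases "trace A > -2")
  case True
  then show ?thesis using angle_lift_plift assms by blast
next
  case False
  then have "angle_lift (- A) (plift (- A))" using assms by (intro angle_lift_plift) auto
  from angle_lift_shift[OF this, of 1] show ?thesis by auto
qed

lemma angle_lift_periodic:
  assumes "angle_lift A f" "det A = 1"
  shows "f (x + pi) = f x + pi"
proof (cases "trace A > -2")
  case True
  then obtain j :: int where "\<And>x. f x = plift A x + 2 * pi * of_int j"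
    using angle_lift_unique[OF assms(1) angle_lift_plift[OF assms(2)]] by blast
  then show ?thesis by (simp add: plift_periodic)
next
  case False
  then have "angle_lift (- A) (plift (- A))" using assms by (intro angle_lift_plift) auto
  from angle_lift_shift[OF this, of 1] have "angle_lift A (\<lambda>x. plift (- A) x + pi)" by simp
  then obtain j :: int where "\<And>x. f x = plift (- A) x + pi + 2 * pi * of_int j"
    using angle_lift_unique[OF assms(1)] by blast
  then show ?thesis by (simp add: plift_periodic)
qed

lemma periodic_int:
  fixes f :: "real \<Rightarrow> real"
  assumes "\<And>x. f (x + pi) = f x + pi"
  shows "f (x + pi * of_int j) = f x + pi * of_int j"
proof (induction j rule: int_induct[where k = 0])
  case (step1 i)
  then show ?case using assms[of "x + pi * of_int i"] by (simp add: algebra_simps)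
next
  case (step2 i)
  then show ?case using assms[of "x + pi * of_int (i - 1)"] by (simp add: algebra_simps)
qed simp

lemma angle_lift_periodic_int:
  assumes "angle_lift A f" "det A = 1"
  shows "f (x + pi * of_int j) = f x + pi * of_int j"
  using periodic_int angle_lift_periodic[OF assms] by blast

lemma angle_lift_inj:
  assumes "angle_lift A f" "det A = 1"
  shows "inj f"
proof (rule injI)
  fix x y assume e: "f x = f y"
  obtain r where r: "r > 0" "mact A (cis x) = r *\<^sub>R cis (f x)" using assms(1) by (rule angle_liftE)
  obtain s where s: "s > 0" "mact A (cis y) = s *\<^sub>R cis (f y)" using assms(1) by (rule angle_liftE)
  have "mact A (s *\<^sub>R cis x) = mact A (r *\<^sub>R cis y)" using r s e by (simp add: mact_scaleR)
  then have "s *\<^sub>R cis x = r *\<^sub>R cis y" by (metis mact_sinv assms(2))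
  then have "cis x = cis y" using r s scaleR_cis_eqD(2) by blast
  then obtain j :: int where j: "x = y + 2 * pi * of_int j" using cis_eq_imp by blast
  then have "x = y + pi * of_int (2 * j)" by simp
  then have "f x = f y + pi * of_int (2 * j)"
    using angle_lift_periodic_int[OF assms, of y "2 * j"] by simp
  then have "j = 0" using e by simp
  then show "x = y" using j by simp
qed

lemma angle_lift_strict_mono:
  assumes "angle_lift A f" "det A = 1"
  shows "strict_mono f"
proof (rule strict_monoI)
  fix x y :: real assume xy: "x < y"
  obtain n :: nat where "y - x < of_nat n * pi"
    using reals_Archimedean3[OF pi_gt_zero] by blast
  then have n: "y < x + pi * of_nat n" by (simp add: algebra_simps)
  define w where "w = x + pi * of_int (int n)"
  have yw: "y < w" using n by (simp add: w_def)
  have fw: "f w = f x + pi * of_nat n"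
    using angle_lift_periodic_int[OF assms, of x "int n"] by (simp add: w_def)
  have "n > 0" using n xy by (cases n) auto
  have "(f x < f y \<and> f y < f w) \<or> (f w < f y \<and> f y < f x)"
    using continuous_inj_imp_mono[OF xy yw angle_lift_cont[OF assms(1)]]
      inj_on_subset[OF angle_lift_inj[OF assms] subset_UNIV] by blast
  moreover have "f w > f x" using fw \<open>n > 0\<close> by simp
  ultimately show "f x < f y" by auto
qed

abbreviation (input) finv :: "(real \<Rightarrow> real) \<Rightarrow> real \<Rightarrow> real" where
  "finv \<equiv> inv_into UNIV"

definition AL :: "(real \<Rightarrow> real) set" where
  "AL = {f. \<exists>A. det A = 1 \<and> angle_lift A f}"

lemma AL_E:
  assumes "f \<in> AL"
  obtains A where "det A = 1" "angle_lift A f"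
  using assms unfolding AL_def by blast

lemma AL_I: "det A = 1 \<Longrightarrow> angle_lift A f \<Longrightarrow> f \<in> AL"
  unfolding AL_def by blast

lemma AL_comp:
  assumes "f \<in> AL" "h \<in> AL" shows "f \<circ> h \<in> AL"
proof -
  obtain A B where "det A = 1" "angle_lift A f" "det B = 1" "angle_lift B h"
    using assms by (metis AL_E)
  then show ?thesis by (intro AL_I[of "A ** B"] angle_lift_comp) (simp_all add: det_mul)
qed

lemma AL_id: "(\<lambda>x. x) \<in> AL"
  by (rule AL_I[OF _ angle_lift_id]) simp

lemma AL_shift:
  assumes "f \<in> AL" shows "(\<lambda>x. f x + pi * of_int j) \<in> AL"
proof -
  obtain A where A: "det A = 1" "angle_lift A f" using assms by (rule AL_E)
  show ?thesis by (rule AL_I[OF _ angle_lift_shift[OF A(2), of j]]) (simp add: A)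
qed

lemma AL_cont: "f \<in> AL \<Longrightarrow> continuous_on S f"
  by (elim AL_E) (rule angle_lift_cont)

lemma AL_mono: "f \<in> AL \<Longrightarrow> strict_mono f"
  by (elim AL_E) (rule angle_lift_strict_mono)

lemma AL_less_iff: "f \<in> AL \<Longrightarrow> f x < f y \<longleftrightarrow> x < y"
  using AL_mono strict_mono_less by blast

lemma AL_le_iff: "f \<in> AL \<Longrightarrow> f x \<le> f y \<longleftrightarrow> x \<le> y"
  using AL_mono strict_mono_less_eq by blast

lemma AL_periodic: "f \<in> AL \<Longrightarrow> f (x + pi * of_int j) = f x + pi * of_int j"
  by (elim AL_E) (rule angle_lift_periodic_int)

lemma AL_periodic_pi: "f \<in> AL \<Longrightarrow> f (x + pi) = f x + pi"
  using AL_periodic[of f x 1] by simp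

lemma angle_lift_inverse:
  assumes "angle_lift A f" "det A = 1"
  obtains h where "angle_lift (sinv A) h" "\<And>x. f (h x) = x" "\<And>x. h (f x) = x"
proof -
  obtain h0 where h0: "angle_lift (sinv A) h0" using angle_lift_exists[of "sinv A"] assms by auto
  have "angle_lift (mat 1) (f \<circ> h0)"
    using angle_lift_comp[OF assms(1) h0] assms(2) by (simp add: sinv_mult)
  then obtain j :: int where j: "\<And>x. (f \<circ> h0) x = x + 2 * pi * of_int j"
    using angle_lift_unique[OF _ angle_lift_id] by blast
  define h where "h x = h0 x + pi * of_int (- 2 * j)" for x
  have 1: "angle_lift (sinv A) h"
    using angle_lift_shift[OF h0, of "- 2 * j"] by (simp add: h_def[abs_def])
  have 2: "f (h x) = x" for x
    unfolding h_def using angle_lift_periodic_int[OF assms, of "h0 x" "- 2 * j"] j[of x]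
    by simp
  have 3: "h (f x) = x" for x
    using 2[of "f x"] angle_lift_inj[OF assms] by (simp add: inj_eq)
  show thesis using that 1 2 3 by blast
qed

lemma AL_bij: "f \<in> AL \<Longrightarrow> bij f"
proof (elim AL_E)
  fix A assume "det A = 1" "angle_lift A f"
  then obtain h where "\<And>x. f (h x) = x" "\<And>x. h (f x) = x" using angle_lift_inverse by metis
  then show "bij f" by (metis bijI')
qed

lemma angle_lift_inv:
  assumes "angle_lift A f" "det A = 1"
  shows "angle_lift (sinv A) (finv f)"
proof -
  obtain h where h: "angle_lift (sinv A) h" "\<And>x. f (h x) = x" "\<And>x. h (f x) = x"
    using angle_lift_inverse[OF assms] by metis
  have "finv f = h" by (rule inv_equality) (use h in auto)
  then show ?thesis using h by simp
qed

lemma AL_inv: "f \<in> AL \<Longrightarrow> finv f \<in> AL"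
  by (metis AL_E AL_I angle_lift_inv det_sinv)

lemma AL_inv_f: "f \<in> AL \<Longrightarrow> finv f (f x) = x" and AL_f_inv: "f \<in> AL \<Longrightarrow> f (finv f x) = x"
  by (auto simp: AL_bij bij_is_inj bij_is_surj surj_f_inv_f)

lemma angle_lift_matrix_unique:
  assumes "angle_lift A f" "angle_lift B f" "det A = 1" "det B = 1"
  shows "A = B"
proof -
  have "angle_lift (sinv A ** B) (finv f \<circ> f)"
    using angle_lift_comp[OF angle_lift_inv[OF assms(1,3)] assms(2)] .
  moreover have "finv f \<circ> f = (\<lambda>x. x)" using AL_inv_f[OF AL_I[OF assms(3,1)]] by auto
  ultimately have "angle_lift (sinv A ** B) (\<lambda>x. x)" by simp
  moreover define C where "C = sinv A ** B"
  ultimately have C: "angle_lift C (\<lambda>x. x)" by simp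
  have dC: "det C = 1" using assms by (simp add: C_def det_mul)
  obtain r where r: "r > 0" "mact C (cis 0) = r *\<^sub>R cis 0" using C by (rule angle_liftE)
  obtain s where s: "s > 0" "mact C (cis (pi/2)) = s *\<^sub>R cis (pi/2)" using C by (rule angle_liftE)
  obtain t where t: "t > 0" "mact C (cis (pi/4)) = t *\<^sub>R cis (pi/4)" using C by (rule angle_liftE)
  have "C$1$1 = r" "C$2$1 = 0" "C$1$2 = 0" "C$2$2 = s"
    using r s by (auto simp: mact_def complex_eq_iff)
  moreover have "C$1$1 = C$2$2"
    using t(2) calculation by (simp add: mact_def complex_eq_iff cos_45 sin_45)
  ultimately have "C = mat 1"
    using dC r(1) by (auto simp: det_2 mat2_eq_iff power2_eq_1_iff power2_eq_square[symmetric])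
  then have "A ** C = A" by simp
  then show ?thesis using assms(3) by (simp add: C_def)
qed

subsection \<open>Rotations and triangular matrices\<close>

definition rot :: "real \<Rightarrow> real^2^2" where
  "rot \<beta> = mat2 (cos \<beta>) (sin \<beta>) (- sin \<beta>) (cos \<beta>)"

definition tri :: "real \<Rightarrow> real \<Rightarrow> real^2^2" where
  "tri l s = mat2 l s 0 (1 / l)"

definition cc :: "real \<Rightarrow> real \<Rightarrow> real \<Rightarrow> real^2^2" where
  "cc l \<beta> s = rot \<beta> ** tri l s ** rot (- \<beta>)"

lemma mact_rot: "mact (rot \<beta>) z = cis \<beta> * z"
  by (simp add: mact_def rot_def complex_eq_iff algebra_simps)

lemma det_rot [simp]: "det (rot \<beta>) = 1"
  by (simp add: det_2 rot_def flip: power2_eq_square)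

lemma rot_add: "rot \<beta> ** rot \<gamma> = rot (\<beta> + \<gamma>)"
  by (simp add: rot_def mat2_eq_iff cos_add sin_add algebra_simps)

lemma rot_0 [simp]: "rot 0 = mat 1"
  by (simp add: rot_def mat2_eq_iff)

lemma sinv_rot: "sinv (rot \<beta>) = rot (- \<beta>)"
  by (simp add: sinv_def rot_def mat2_eq_iff)

lemma rot_add_pi: "rot (\<beta> + pi) = - rot \<beta>"
  by (simp add: rot_def mat2_eq_iff)

lemma det_tri [simp]: "l \<noteq> 0 \<Longrightarrow> det (tri l s) = 1"
  by (simp add: det_2 tri_def)

lemma tri_mult: "l \<noteq> 0 \<Longrightarrow> m \<noteq> 0 \<Longrightarrow> tri l s ** tri m t = tri (l * m) (l * t + s / m)"
  by (simp add: tri_def mat2_eq_iff)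

lemma tri_1_0 [simp]: "tri 1 0 = mat 1"
  by (simp add: tri_def mat2_eq_iff)

lemma det_cc [simp]: "l \<noteq> 0 \<Longrightarrow> det (cc l \<beta> s) = 1"
  by (simp add: cc_def det_mul)

lemma trace_cc [simp]: "trace (cc l \<beta> s) = l + 1 / l"
proof -
  have "trace (cc l \<beta> s) = trace (tri l s)"
    unfolding cc_def sinv_rot[symmetric] by (rule trace_conj) simp
  then show ?thesis by (simp add: trace_2 tri_def)
qed

lemma trace_tri [simp]: "trace (tri l s) = l + 1 / l"
  by (simp add: trace_2 tri_def)

lemma cc_0 [simp]: "cc l 0 s = tri l s"
  by (simp add: cc_def)

lemma cc_add_pi: "cc l (\<beta> + pi) s = cc l \<beta> s"
proof -
  have "rot (- (\<beta> + pi)) = - rot (- \<beta>)"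
    by (simp add: rot_def mat2_eq_iff)
  then show ?thesis by (simp add: cc_def rot_add_pi)
qed

lemma add_inverse_pos: "l > 0 \<Longrightarrow> -2 < l + 1 / (l :: real)"
  by (smt (verit) divide_pos_pos)

lemma plift_fixed:
  assumes "mact A (cis x) = r *\<^sub>R cis x" "r > 0"
  shows "plift A x = x"
proof -
  have "mact A (cis x) * cis (- x) = of_real r"
    by (simp add: assms scaleR_conv_of_real mult.assoc cis_mult)
  then show ?thesis using assms(2) by (simp add: plift_def)
qed

lemma mact_cc: "mact (cc l \<beta> s) (cis x) = cis \<beta> * mact (tri l s) (cis (x - \<beta>))"
  by (simp add: cc_def mact_mult mact_rot cis_mult)

lemma plift_cc: "plift (cc l \<beta> s) x = \<beta> + plift (tri l s) (x - \<beta>)"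
proof -
  have "mact (cc l \<beta> s) (cis x) * cis (- x) = mact (tri l s) (cis (x - \<beta>)) * (cis \<beta> * cis (- x))"
    by (simp add: mact_cc del: cis_mult)
  also have "cis \<beta> * cis (- x) = cis (- (x - \<beta>))" by (simp add: cis_mult)
  finally show ?thesis by (simp add: plift_def)
qed

lemma AL_plift: "det A = 1 \<Longrightarrow> trace A > -2 \<Longrightarrow> plift A \<in> AL"
  by (rule AL_I[OF _ angle_lift_plift])

lemma AL_plift_cc: "l > 0 \<Longrightarrow> plift (cc l \<beta> s) \<in> AL"
  by (rule AL_plift) (simp_all add: add_inverse_pos)

lemma AL_plift_tri: "l > 0 \<Longrightarrow> plift (tri l s) \<in> AL"
  using AL_plift_cc[of l 0 s] by simp

lemma plift_tri_0 [simp]: "l > 0 \<Longrightarrow> plift (tri l s) 0 = 0"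
  by (rule plift_fixed[where r = l]) (simp_all add: mact_def tri_def complex_eq_iff)

lemma plift_tri_minus_pi [simp]: "l > 0 \<Longrightarrow> plift (tri l s) (- pi) = - pi"
  using plift_periodic[of "tri l s" "- pi"] by simp

lemma plift_cc_self [simp]: "l > 0 \<Longrightarrow> plift (cc l \<beta> s) \<beta> = \<beta>"
  by (simp add: plift_cc)

lemma angle_lift_eqI:
  assumes "angle_lift A f" "angle_lift A h" "f x = h x"
  shows "f = h"
proof -
  obtain j :: int where j: "\<And>x. f x = h x + 2 * pi * of_int j"
    using angle_lift_unique[OF assms(1,2)] by blast
  then have "j = 0" using assms(3) by simp
  then show ?thesis using j by auto
qed

lemma plift_tri_mult:
  assumes "l > 0" "m > 0"
  shows "plift (tri (l * m) (l * t + s / m)) = plift (tri l s) \<circ> plift (tri m t)"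
proof -
  have 1: "angle_lift (tri l s) (plift (tri l s))" if "l > 0" for l s
    using that by (intro angle_lift_plift) (auto simp: add_inverse_pos)
  show ?thesis
    using angle_lift_comp[OF 1 1, of l m s t] assms 1[of "l * m" "l * t + s / m"]
    by (intro angle_lift_eqI[where x = 0]) (auto simp: tri_mult)
qed

lemma plift_unipotent_ge:
  assumes "t \<ge> 0"
  shows "x \<le> plift (tri 1 t) x" "t > 0 \<Longrightarrow> sin x \<noteq> 0 \<Longrightarrow> x < plift (tri 1 t) x"
proof -
  let ?w = "mact (tri 1 t) (cis x) * cis (- x)"
  have im: "Im ?w = t * (sin x)\<^sup>2"
    by (simp add: mact_def tri_def algebra_simps power2_eq_square)
  then have "Arg ?w \<ge> 0" using assms by (simp add: Arg_less_0)
  then show "x \<le> plift (tri 1 t) x" by (simp add: plift_def)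
  assume "t > 0" "sin x \<noteq> 0"
  then have "Arg ?w > 0" unfolding Arg_pos_iff im by simp
  then show "x < plift (tri 1 t) x" by (simp add: plift_def)
qed

lemma plift_tri_mono:
  assumes "l > 0" "s \<le> s'"
  shows "plift (tri l s) x \<le> plift (tri l s') x"
proof -
  have "plift (tri l s') = plift (tri l s) \<circ> plift (tri 1 ((s' - s) / l))"
    using plift_tri_mult[of l 1 "(s' - s) / l" s] assms by simp
  moreover have "x \<le> plift (tri 1 ((s' - s) / l)) x"
    using assms by (intro plift_unipotent_ge) auto
  ultimately show ?thesis using AL_le_iff[OF AL_plift_tri[OF assms(1)]] by simp
qed

lemma plift_cc_mono:
  assumes "l > 0" "s \<le> s'"
  shows "plift (cc l \<beta> s) x \<le> plift (cc l \<beta> s') x"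
  using plift_tri_mono[OF assms] by (simp add: plift_cc)

lemma plift_tri_bounds:
  assumes "l > 0" "- pi < x" "x < 0"
  shows "- pi < plift (tri l s) x" "plift (tri l s) x < 0"
  using AL_less_iff[OF AL_plift_tri[OF assms(1)], of s "-pi" x]
    AL_less_iff[OF AL_plift_tri[OF assms(1)], of s x 0] assms by auto

lemma sin_neg_interval: "- pi < x \<Longrightarrow> x < 0 \<Longrightarrow> sin x < 0"
  using sin_gt_zero[of "- x"] by simp

lemma plift_tri_surj:
  assumes "l > 0" "- pi < x" "x < 0" "- pi < y" "y < 0"
  shows "\<exists>s. plift (tri l s) x = y"
proof -
  have sx: "sin x < 0" "sin y < 0" using assms sin_neg_interval by auto
  define r where "r = sin x / (l * sin y)"
  define s where "s = (l * cos x - r * cos y) / sin x"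
  have r: "r > 0" using sx assms by (simp add: r_def zero_less_divide_iff mult_less_0_iff)
  have "mact (tri l s) (cis x) = r *\<^sub>R cis y"
    using sx assms by (simp add: mact_def tri_def complex_eq_iff s_def r_def)
  moreover obtain r' where r': "r' > 0" "mact (tri l s) (cis x) = r' *\<^sub>R cis (plift (tri l s) x)"
  proof (rule angle_liftE)
    show "angle_lift (tri l s) (plift (tri l s))"
      using assms by (intro angle_lift_plift) (auto simp: add_inverse_pos)
  qed
  ultimately have "cis (plift (tri l s) x) = cis y"
    using scaleR_cis_eqD(2)[OF _ r'(1) r] by metis
  then obtain j :: int where j: "plift (tri l s) x = y + 2 * pi * of_int j" using cis_eq_imp by blast
  have "\<bar>plift (tri l s) x - y\<bar> < pi"
    using plift_tri_bounds[OF assms(1-3), of s] assms(4,5) by linarith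
  then have "pi * \<bar>2 * of_int j\<bar> < pi * 1" using j by (simp add: abs_mult)
  then have "\<bar>2 * of_int j :: real\<bar> < 1" by (subst (asm) mult_less_cancel_left_pos) auto
  then have "j = 0" by linarith
  then show ?thesis using j by auto
qed

lemma plift_tri_sign:
  assumes "l > 0" "- pi < y" "y < 0"
  shows "plift (tri l s) y > y \<longleftrightarrow> s * sin y + (1 / l - l) * cos y < 0"
    "plift (tri l s) y < y \<longleftrightarrow> s * sin y + (1 / l - l) * cos y > 0"
proof -
  let ?w = "mact (tri l s) (cis y) * cis (- y)"
  have sy: "sin y < 0" using assms sin_neg_interval by auto
  have im: "Im ?w = sin y * (s * sin y + (1 / l - l) * cos y)"
    by (simp add: mact_def tri_def algebra_simps diff_divide_distrib)
  have np: "?w \<notin> \<real>\<^sub>\<le>\<^sub>0" using assms by (intro plift_nonpos) (auto simp: add_inverse_pos)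
  have "Arg ?w > 0 \<longleftrightarrow> Im ?w > 0"
    using np unfolding Arg_pos_iff by (auto simp: complex_nonpos_Reals_iff)
  then show "plift (tri l s) y > y \<longleftrightarrow> s * sin y + (1 / l - l) * cos y < 0"
    using sy unfolding im by (simp add: plift_def zero_less_mult_iff)
  have "Arg ?w < 0 \<longleftrightarrow> Im ?w < 0" by (rule Arg_neg_iff)
  then show "plift (tri l s) y < y \<longleftrightarrow> s * sin y + (1 / l - l) * cos y > 0"
    using sy unfolding im by (simp add: plift_def mult_less_0_iff)
qed

lemma sin_cos_form_interpolate:
  fixes s t :: real
  shows "sin (x3 - x1) * (s * sin x2 + t * cos x2) =
    sin (x3 - x2) * (s * sin x1 + t * cos x1) + sin (x2 - x1) * (s * sin x3 + t * cos x3)"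
  unfolding sin_diff by (simp add: algebra_simps)

lemma sin_cos_form_neg:
  assumes "x1 < x2" "x2 < x3" "x3 < x1 + pi"
    and "s * sin x1 + t * cos x1 < 0" "s * sin x3 + t * cos x3 < 0"
  shows "s * sin x2 + t * cos x2 < 0"
proof -
  have p: "sin (x3 - x1) > 0" "sin (x3 - x2) > 0" "sin (x2 - x1) > 0"
    using assms by (auto intro!: sin_gt_zero)
  have "sin (x3 - x1) * (s * sin x2 + t * cos x2) < 0"
    using add_neg_neg[OF mult_pos_neg[OF p(2) assms(4)] mult_pos_neg[OF p(3) assms(5)]]
    by (simp only: sin_cos_form_interpolate[of x3 x1 s x2 t])
  then show ?thesis using p(1) by (simp add: mult_less_0_iff)
qed

lemma translate_int_pi:
  obtains j :: int where "c \<le> x + pi * of_int j" "x + pi * of_int j < c + pi"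
proof -
  define j where "j = - \<lfloor>(x - c) / pi\<rfloor>"
  have "of_int (- j) \<le> (x - c) / pi" "(x - c) / pi < of_int (- j) + 1"
    unfolding j_def by linarith+
  then have "pi * of_int (- j) \<le> x - c" "x - c < pi * of_int (- j) + pi"
    by (simp_all add: field_simps)
  then show thesis by (intro that[of j]) simp_all
qed

lemma translate_int_pi':
  obtains j :: int where "c - pi < x + pi * of_int j" "x + pi * of_int j \<le> c"
proof -
  obtain i :: int where i: "- c \<le> - x + pi * of_int i" "- x + pi * of_int i < - c + pi"
    by (rule translate_int_pi)
  then show thesis by (intro that[of "- i"]) simp_all
qed


subsection \<open>Displacement ranges\<close>

text \<open>For \<open>a \<le> b\<close>, \<open>disp_range a b\<close> consists of the elements of the universal covering group
  between \<open>Hyp\<^sub>a = z\<^sup>a Hyp\<^sub>0\<close> and \<open>Hyp\<^sub>b\<close>; in particular \<open>disp_range n n\<close> is \<open>Hyp\<^sub>n\<close>.\<close>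

definition disp_above :: "int \<Rightarrow> (real \<Rightarrow> real) \<Rightarrow> bool" where
  "disp_above a k \<longleftrightarrow> (\<exists>x. k x > x + pi * of_int a)"

definition disp_below :: "int \<Rightarrow> (real \<Rightarrow> real) \<Rightarrow> bool" where
  "disp_below b k \<longleftrightarrow> (\<exists>x. k x < x + pi * of_int b)"

definition disp_range :: "int \<Rightarrow> int \<Rightarrow> (real \<Rightarrow> real) \<Rightarrow> bool" where
  "disp_range a b k \<longleftrightarrow> disp_above a k \<and> disp_below b k"

lemma above_commute_imp: "g \<in> AL \<Longrightarrow> disp_above a (f \<circ> g) \<Longrightarrow> disp_above a (g \<circ> f)"
  unfolding disp_above_def comp_def by (metis AL_less_iff AL_periodic)

lemma below_commute_imp: "g \<in> AL \<Longrightarrow> disp_below a (f \<circ> g) \<Longrightarrow> disp_below a (g \<circ> f)"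
  unfolding disp_below_def comp_def by (metis AL_less_iff AL_periodic)

lemma disp_range_commute:
  "f \<in> AL \<Longrightarrow> g \<in> AL \<Longrightarrow> disp_range a b (f \<circ> g) \<longleftrightarrow> disp_range a b (g \<circ> f)"
  unfolding disp_range_def using above_commute_imp below_commute_imp by blast

lemma above_inv: "f \<in> AL \<Longrightarrow> disp_above a (finv f) \<longleftrightarrow> disp_below (- a) f"
proof -
  assume f: "f \<in> AL"
  have "finv f x > x + pi * of_int a \<longleftrightarrow> f (finv f x) < finv f x + pi * of_int (- a)" for x
    by (auto simp: AL_f_inv[OF f])
  moreover have "f x < x + pi * of_int (- a) \<longleftrightarrow> finv f (f x) > f x + pi * of_int a" for x
    by (auto simp: AL_inv_f[OF f])
  ultimately show ?thesis unfolding disp_above_def disp_below_def by blast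
qed

lemma below_inv: "f \<in> AL \<Longrightarrow> disp_below a (finv f) \<longleftrightarrow> disp_above (- a) f"
proof -
  assume f: "f \<in> AL"
  have "finv f x < x + pi * of_int a \<longleftrightarrow> f (finv f x) > finv f x + pi * of_int (- a)" for x
    by (auto simp: AL_f_inv[OF f])
  moreover have "f x > x + pi * of_int (- a) \<longleftrightarrow> finv f (f x) < f x + pi * of_int a" for x
    by (auto simp: AL_inv_f[OF f])
  ultimately show ?thesis unfolding disp_above_def disp_below_def by blast
qed

lemma disp_range_inv: "f \<in> AL \<Longrightarrow> disp_range a b (finv f) \<longleftrightarrow> disp_range (- b) (- a) f"
  unfolding disp_range_def by (auto simp: above_inv below_inv)

lemma disp_range_shift: "disp_range a b (\<lambda>x. k x + pi * of_int j) \<longleftrightarrow> disp_range (a - j) (b - j) k"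
  unfolding disp_range_def disp_above_def disp_below_def by (simp add: algebra_simps)

lemma not_above_not_below:
  assumes "\<not> disp_above a k" "\<not> disp_below b k" "a \<le> b"
  shows "a = b" "k x = x + pi * of_int a"
proof -
  have 1: "k x \<le> x + pi * of_int a" "k x \<ge> x + pi * of_int b" for x
    using assms by (auto simp: disp_above_def disp_below_def not_less)
  then have "pi * of_int b \<le> pi * of_int a" using order_trans[OF 1(2) 1(1)] by simp
  then show "a = b" using assms(3) by simp
  then show "k x = x + pi * of_int a" using 1[of x] by simp
qed

lemma cc_of_eigenvector:
  assumes "det A = 1" "mact A (cis e) = r *\<^sub>R cis e" "r \<noteq> 0"
  shows "\<exists>s. A = cc r e s"
proof -
  define T where "T = rot (- e) ** A ** rot e"
  have dT: "det T = 1" using assms by (simp add: T_def det_mul)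
  have "mact T (cis 0) = cis (- e) * mact A (cis e)"
    by (simp add: T_def mact_mult mact_rot)
  also have "\<dots> = r *\<^sub>R cis 0"
    unfolding assms(2) by (simp add: cis_mult)
  finally have "T$1$1 = r" "T$2$1 = 0" by (simp_all add: mact_def complex_eq_iff)
  then have "T = tri r (T$1$2)" using dT assms(3)
    by (simp add: mat2_eq_iff tri_def det_2 field_simps)
  moreover have "A = rot e ** T ** rot (- e)"
  proof -
    have "rot e ** T ** rot (- e) = (rot e ** rot (- e)) ** A ** (rot e ** rot (- e))"
      by (simp only: T_def matrix_mul_assoc)
    then show ?thesis by (simp add: rot_add)
  qed
  ultimately show ?thesis unfolding cc_def by metis
qed

lemma AL_fixed_point:
  assumes "k \<in> AL" "k e = e + pi * of_int m"
  obtains r s where "r > 0" "\<And>x. k x = plift (cc r e s) x + pi * of_int m"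
proof -
  define h where "h x = k x + pi * of_int (- m)" for x
  have "h \<in> AL" unfolding h_def[abs_def] by (rule AL_shift[OF assms(1)])
  then obtain A where A: "det A = 1" "angle_lift A h" by (rule AL_E)
  have he: "h e = e" using assms(2) by (simp add: h_def)
  obtain r where r: "r > 0" "mact A (cis e) = r *\<^sub>R cis e"
    using angle_liftE[OF A(2), of e] he by metis
  obtain s where s: "A = cc r e s" using cc_of_eigenvector[OF A(1) r(2)] r by auto
  have "angle_lift A (plift A)"
    using r(1) unfolding s by (intro angle_lift_plift) (auto simp: add_inverse_pos)
  then have "h = plift A"
    by (intro angle_lift_eqI[OF A(2), of _ e]) (use r he s in auto)
  then have "k x = plift (cc r e s) x + pi * of_int m" for x
    using s by (simp add: h_def fun_eq_iff algebra_simps)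
  then show thesis using that r(1) by blast
qed

lemma closed_segment_real_subset:
  fixes x y :: real
  assumes "\<And>z. min x y \<le> z \<Longrightarrow> z \<le> max x y \<Longrightarrow> z \<in> B"
  shows "closed_segment x y \<subseteq> B"
  using assms by (auto simp: closed_segment_eq_real_ivl split: if_splits)

text \<open>The directions moved forward by more than \<open>m \<pi>\<close> form an arc of the projective line: in an
  affine coordinate centred at a fixed direction, they are given by a linear inequality.\<close>

lemma arc_aux:
  fixes \<sigma> :: real
  assumes k: "k \<in> AL" and \<sigma>: "\<sigma> = 1 \<or> \<sigma> = -1"
    and D: "D = {\<beta>. \<sigma> * (k \<beta> - \<beta> - pi * of_int m) > 0}"
    and "\<beta>1 \<in> D" "\<beta>2 \<in> D"
  shows "\<exists>j::int. closed_segment \<beta>1 (\<beta>2 + pi * of_int j) \<subseteq> D"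
proof (cases "D = UNIV")
  case False
  define d where "d \<beta> = \<sigma> * (k \<beta> - \<beta> - pi * of_int m)" for \<beta>
  have dD: "D = {\<beta>. d \<beta> > 0}" by (simp add: D d_def)
  have cd: "continuous_on S d" for S
    unfolding d_def by (intro continuous_intros AL_cont[OF k])
  have per: "d (\<beta> + pi * of_int j) = d \<beta>" for \<beta> j by (simp add: d_def AL_periodic[OF k])
  obtain e0 where "e0 \<notin> D" using False by blast
  then have e0: "d e0 \<le> 0" by (simp add: dD)
  have "connected (range d)" by (intro connected_continuous_image cd) simp
  moreover have "d \<beta>1 > 0" using assms(4) by (simp add: dD)
  ultimately have "0 \<in> range d" using e0 connectedD_interval[of "range d" "d e0" "d \<beta>1" 0] by auto
  then obtain e where "d e = 0" by auto
  then have e: "k e = e + pi * of_int m" using \<sigma> by (auto simp: d_def)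
  obtain r s where r: "r > 0" and krs: "\<And>x. k x = plift (cc r e s) x + pi * of_int m"
    using AL_fixed_point[OF k e] by blast
  define F where "F y = (- \<sigma>) * (s * sin y + (1 / r - r) * cos y)" for y
  have dF: "d \<beta> > 0 \<longleftrightarrow> F (\<beta> - e) > 0" if "- pi < \<beta> - e" "\<beta> - e < 0" for \<beta>
    using \<sigma> plift_tri_sign[OF r that, of s] by (auto simp: d_def F_def krs plift_cc)
  obtain i1 :: int where i1: "e - pi < \<beta>1 + pi * of_int i1" "\<beta>1 + pi * of_int i1 \<le> e"
    by (rule translate_int_pi')
  obtain i2 :: int where i2: "e - pi < \<beta>2 + pi * of_int i2" "\<beta>2 + pi * of_int i2 \<le> e"
    by (rule translate_int_pi')
  define c1 c2 where "c1 = \<beta>1 + pi * of_int i1" and "c2 = \<beta>2 + pi * of_int i2"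
  have dc: "d c1 > 0" "d c2 > 0" using assms(4,5) by (simp_all add: c1_def c2_def per dD)
  then have ne: "c1 \<noteq> e" "c2 \<noteq> e" using \<open>d e = 0\<close> by auto
  have key: "d z > 0" if "x1 \<le> z" "z \<le> x3" "d x1 > 0" "d x3 > 0" "e - pi < x1" "x3 < e" for x1 x3 z
  proof (cases "z = x1 \<or> z = x3")
    case False
    then have z: "x1 < z" "z < x3" using that by auto
    have "F (x1 - e) > 0" "F (x3 - e) > 0" using dF that z by auto
    moreover have F': "F y > 0 \<longleftrightarrow> (\<sigma> * s) * sin y + (\<sigma> * (1 / r - r)) * cos y < 0" for y
    proof -
      have "F y = - ((\<sigma> * s) * sin y + (\<sigma> * (1 / r - r)) * cos y)"
        by (simp add: F_def algebra_simps)
      then show ?thesis by linarith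
    qed
    ultimately have "F (z - e) > 0"
      using z that sin_cos_form_neg[of "x1 - e" "z - e" "x3 - e" "\<sigma> * s" "\<sigma> * (1 / r - r)"] by simp
    then show ?thesis using dF[of z] that z by simp
  qed (use that in auto)
  have c: "e - pi < c1" "c1 < e" "e - pi < c2" "c2 < e"
    using i1 i2 ne by (auto simp: c1_def c2_def)
  have seg: "d z > 0" if "min c1 c2 \<le> z" "z \<le> max c1 c2" for z
  proof (cases "c1 \<le> c2")
    case True
    then show ?thesis using key[of c1 z c2] that c dc by simp
  next
    case False
    then show ?thesis using key[of c2 z c1] that c dc by simp
  qed
  have "closed_segment \<beta>1 (\<beta>2 + pi * of_int (i2 - i1)) \<subseteq> D"
  proof (rule closed_segment_real_subset)
    fix z assume z: "min \<beta>1 (\<beta>2 + pi * of_int (i2 - i1)) \<le> z" "z \<le> max \<beta>1 (\<beta>2 + pi * of_int (i2 - i1))"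
    have e2: "\<beta>2 + pi * of_int (i2 - i1) = c2 - pi * of_int i1" "\<beta>1 = c1 - pi * of_int i1"
      by (simp_all add: c1_def c2_def algebra_simps)
    have "min c1 c2 \<le> z + pi * of_int i1" "z + pi * of_int i1 \<le> max c1 c2"
      using z unfolding e2 by linarith+
    then have "d (z + pi * of_int i1) > 0" by (rule seg)
    then show "z \<in> D" by (simp add: per dD)
  qed
  then show ?thesis by blast
qed auto

lemma arc_above:
  assumes "k \<in> AL" "k \<beta>1 > \<beta>1 + pi * of_int m" "k \<beta>2 > \<beta>2 + pi * of_int m"
  shows "\<exists>j::int. closed_segment \<beta>1 (\<beta>2 + pi * of_int j) \<subseteq> {\<beta>. k \<beta> > \<beta> + pi * of_int m}"
  by (rule arc_aux[OF assms(1), of 1 _ m]) (use assms in auto)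

lemma arc_below:
  assumes "k \<in> AL" "k \<beta>1 < \<beta>1 + pi * of_int m" "k \<beta>2 < \<beta>2 + pi * of_int m"
  shows "\<exists>j::int. closed_segment \<beta>1 (\<beta>2 + pi * of_int j) \<subseteq> {\<beta>. k \<beta> < \<beta> + pi * of_int m}"
  by (rule arc_aux[OF assms(1), of "-1" _ m]) (use assms in auto)

subsection \<open>Locally constant functions\<close>

definition loc_const :: "'a::topological_space set \<Rightarrow> ('a \<Rightarrow> 'v) \<Rightarrow> bool" where
  "loc_const S g \<longleftrightarrow> (\<forall>x\<in>S. \<exists>U. open U \<and> x \<in> U \<and> (\<forall>y\<in>U \<inter> S. g y = g x))"

lemma loc_constE:
  assumes "loc_const S g" "x \<in> S"
  obtains U where "open U" "x \<in> U" "\<And>y. y \<in> U \<Longrightarrow> y \<in> S \<Longrightarrow> g y = g x"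
proof -
  from bspec[OF assms(1)[unfolded loc_const_def] assms(2)]
  obtain U where "open U" "x \<in> U" "\<forall>y\<in>U \<inter> S. g y = g x" by auto
  then show thesis by (intro that[of U]) auto
qed

lemma loc_const_connected:
  assumes "loc_const S g" "connected S" "x \<in> S" "y \<in> S"
  shows "g x = g y"
proof (rule connected_local_const[OF assms(2-4)], rule ballI)
  fix z assume "z \<in> S"
  then obtain U where "open U" "z \<in> U" "\<And>y. y \<in> U \<Longrightarrow> y \<in> S \<Longrightarrow> g y = g z"
    using loc_constE[OF assms(1)] by blast
  then show "eventually (\<lambda>b. g z = g b) (at z within S)"
    unfolding eventually_at_topological by metis
qed

lemma loc_const_compose:
  assumes "loc_const S g" "continuous_on T f" "f ` T \<subseteq> S"
  shows "loc_const T (\<lambda>x. g (f x))"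
  unfolding loc_const_def
proof
  fix x assume x: "x \<in> T"
  then have "f x \<in> S" using assms(3) by blast
  then obtain U where U: "open U" "f x \<in> U" "\<And>y. y \<in> U \<Longrightarrow> y \<in> S \<Longrightarrow> g y = g (f x)"
    using loc_constE[OF assms(1)] by blast
  obtain W where W: "open W" "x \<in> W" "\<forall>y\<in>T. y \<in> W \<longrightarrow> f y \<in> U"
    using assms(2) x U(1,2) unfolding continuous_on_topological by meson
  then show "\<exists>W. open W \<and> x \<in> W \<and> (\<forall>y\<in>W \<inter> T. g (f y) = g (f x))"
    using U(3) assms(3) by (intro exI[of _ W]) auto
qed

lemma loc_const_subset:
  assumes "loc_const S g" "T \<subseteq> S" shows "loc_const T g"
  using loc_const_compose[OF assms(1), of T "\<lambda>x. x"] assms(2) by simp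

lemma loc_const_path:
  assumes "loc_const S g" "connected T" "continuous_on T f" "f ` T \<subseteq> S" "x \<in> T" "y \<in> T"
  shows "g (f x) = g (f y)"
  by (rule loc_const_connected[OF loc_const_compose[OF assms(1,3,4)] assms(2,5,6)])

lemma above_openin:
  assumes "\<And>x. continuous_on S (\<lambda>m. K m x)"
  shows "openin (top_of_set S) {m \<in> S. disp_above a (K m)}"
proof -
  have "{m \<in> S. disp_above a (K m)} = (\<Union>x. S \<inter> (\<lambda>m. K m x) -` {x + pi * of_int a <..})"
    by (auto simp: disp_above_def)
  moreover have "openin (top_of_set S) \<dots>"
    by (rule openin_Union) (use assms in \<open>auto intro!: continuous_openin_preimage_gen\<close>)
  ultimately show ?thesis by simp
qed

lemma below_openin:
  assumes "\<And>x. continuous_on S (\<lambda>m. K m x)"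
  shows "openin (top_of_set S) {m \<in> S. disp_below a (K m)}"
proof -
  have "{m \<in> S. disp_below a (K m)} = (\<Union>x. S \<inter> (\<lambda>m. K m x) -` {..< x + pi * of_int a})"
    by (auto simp: disp_below_def)
  moreover have "openin (top_of_set S) \<dots>"
    by (rule openin_Union) (use assms in \<open>auto intro!: continuous_openin_preimage_gen\<close>)
  ultimately show ?thesis by simp
qed

lemma disp_range_openin:
  assumes "\<And>x. continuous_on S (\<lambda>m. K m x)"
  shows "openin (top_of_set S) {m \<in> S. disp_range a b (K m)}"
proof -
  have "{m \<in> S. disp_range a b (K m)} = {m \<in> S. disp_above a (K m)} \<inter> {m \<in> S. disp_below b (K m)}"
    by (auto simp: disp_range_def)
  then show ?thesis using openin_Int[OF above_openin[OF assms] below_openin[OF assms]] by simp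
qed

lemma disp_range_nhd:
  assumes "\<And>x. continuous_on S (\<lambda>m. K m x)" "m \<in> S" "disp_range a b (K m)"
  obtains U where "open U" "m \<in> U" "\<And>m'. m' \<in> U \<Longrightarrow> m' \<in> S \<Longrightarrow> disp_range a b (K m')"
proof -
  obtain U where U: "open U" "{m \<in> S. disp_range a b (K m)} = S \<inter> U"
    using disp_range_openin[of S K a b] assms(1) unfolding openin_open by blast
  then show thesis using assms(2,3) by (intro that[of U]) auto
qed


subsection \<open>Products with elements of a fixed conjugacy class\<close>

text \<open>The elements \<open>cc l \<beta> s\<close> with \<open>s \<in> class_params l\<close> form the hyperbolic conjugacy class of
  trace \<open>l + 1 / l\<close> if \<open>l < 1\<close>, and the positive parabolics if \<open>l = 1\<close>; \<open>\<beta>\<close> is the repelling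
  (or the unique) fixed direction.\<close>

definition class_params :: "real \<Rightarrow> real set" where
  "class_params l = (if l < 1 then UNIV else {0<..})"

lemma class_params_convex:
  "s1 \<in> class_params l \<Longrightarrow> s1 \<le> s \<Longrightarrow> s \<in> class_params l"
  by (auto simp: class_params_def split: if_splits)

lemma connected_class_params: "connected (class_params l)"
  by (auto simp: class_params_def)

lemma continuous_on_cc [continuous_intros]:
  fixes S :: "'a::t2_space set"
  assumes "continuous_on S l" "continuous_on S \<beta>" "continuous_on S s" "\<And>x. x \<in> S \<Longrightarrow> l x \<noteq> 0"
  shows "continuous_on S (\<lambda>x. cc (l x) (\<beta> x) (s x))"
  unfolding cc_def rot_def tri_def using assms(4)
  by (intro continuous_intros assms) auto

lemma continuous_on_k_cc:
  assumes "k \<in> AL" "l > 0"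
  shows "continuous_on S (\<lambda>p. (k \<circ> plift (cc l (fst p) (snd p))) x)"
  unfolding comp_def using assms
  by (intro continuous_on_compose2[OF AL_cont[OF assms(1), of UNIV]] continuous_on_plift_joint
      continuous_intros) (auto simp: add_inverse_pos)

lemma plift_cc_ge_id:
  assumes "s > 0"
  shows "x \<le> plift (cc 1 \<beta> s) x" "sin (x - \<beta>) \<noteq> 0 \<Longrightarrow> x < plift (cc 1 \<beta> s) x"
  using plift_unipotent_ge[of s "x - \<beta>"] assms by (auto simp: plift_cc)

lemma plift_cc_bounds:
  assumes "l > 0"
  shows "\<beta> \<le> x \<Longrightarrow> x < \<beta> + pi \<Longrightarrow> plift (cc l \<beta> s) x < \<beta> + pi"
    "\<beta> - pi < x \<Longrightarrow> x \<le> \<beta> \<Longrightarrow> \<beta> - pi < plift (cc l \<beta> s) x"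
proof -
  note A = AL_plift_cc[OF assms, of \<beta> s]
  have 1: "plift (cc l \<beta> s) (\<beta> + pi) = \<beta> + pi" "plift (cc l \<beta> s) (\<beta> - pi) = \<beta> - pi"
    using plift_periodic[of "cc l \<beta> s" \<beta>] plift_periodic[of "cc l \<beta> s" "\<beta> - pi"] assms by simp_all
  show "\<beta> \<le> x \<Longrightarrow> x < \<beta> + pi \<Longrightarrow> plift (cc l \<beta> s) x < \<beta> + pi"
    using AL_less_iff[OF A, of x "\<beta> + pi"] 1 by simp
  show "\<beta> - pi < x \<Longrightarrow> x \<le> \<beta> \<Longrightarrow> \<beta> - pi < plift (cc l \<beta> s) x"
    using AL_less_iff[OF A, of "\<beta> - pi" x] 1 by simp
qed

lemma plift_cc_surj:
  assumes "0 < l" "l \<le> 1" "\<beta> - pi < x" "x < \<beta>" "\<beta> - pi < y" "y < \<beta>" "l < 1 \<or> x < y"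
  shows "\<exists>s\<in>class_params l. plift (cc l \<beta> s) x = y"
proof -
  obtain s where s: "plift (tri l s) (x - \<beta>) = y - \<beta>"
    using plift_tri_surj[of l "x - \<beta>" "y - \<beta>"] assms by auto
  have "s > 0" if "l = 1"
  proof (rule ccontr)
    assume "\<not> s > 0"
    then have "plift (tri 1 s) (x - \<beta>) \<le> plift (tri 1 0) (x - \<beta>)"
      by (intro plift_tri_mono) auto
    then show False using s that assms(7) by (simp add: plift_fixed[where r = 1])
  qed
  then show ?thesis using s assms(2) by (intro bexI[of _ s]) (auto simp: plift_cc class_params_def)
qed

lemma disp_product_necessary:
  assumes k: "k \<in> AL" and l: "0 < l" and s: "s \<in> class_params l"
  shows "disp_above a (k \<circ> plift (cc l \<beta> s)) \<Longrightarrow> k \<beta> > \<beta> + pi * of_int (a - 1)"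
    "disp_below b (k \<circ> plift (cc l \<beta> s)) \<Longrightarrow> k \<beta> < \<beta> + pi * of_int (b + 1)"
    "l = 1 \<Longrightarrow> disp_below b (k \<circ> plift (cc l \<beta> s)) \<Longrightarrow> disp_below b k"
proof -
  let ?c = "plift (cc l \<beta> s)"
  have c: "?c \<in> AL" using l by (rule AL_plift_cc)
  have kc: "k \<circ> ?c \<in> AL" using k c by (rule AL_comp)
  note per = AL_periodic[OF kc]
  have kpi: "k (\<beta> + pi) = k \<beta> + pi" "k (\<beta> - pi) = k \<beta> - pi"
    using AL_periodic[OF k, of \<beta> 1] AL_periodic[OF k, of \<beta> "-1"] by simp_all
  show "k \<beta> > \<beta> + pi * of_int (a - 1)" if ab: "disp_above a (k \<circ> ?c)"
  proof -
    obtain x0 where x0: "(k \<circ> ?c) x0 > x0 + pi * of_int a" using ab by (auto simp: disp_above_def)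
    obtain j :: int where j: "\<beta> \<le> x0 + pi * of_int j" "x0 + pi * of_int j < \<beta> + pi"
      by (rule translate_int_pi)
    define x where "x = x0 + pi * of_int j"
    have x: "(k \<circ> ?c) x > x + pi * of_int a" using x0 unfolding x_def per by simp
    have "?c x < \<beta> + pi" using plift_cc_bounds(1)[OF l] j by (simp add: x_def)
    then have "k (?c x) < k \<beta> + pi" using AL_less_iff[OF k, of "?c x" "\<beta> + pi"] kpi by simp
    then show ?thesis using x j by (simp add: x_def algebra_simps)
  qed
  show "k \<beta> < \<beta> + pi * of_int (b + 1)" if be: "disp_below b (k \<circ> ?c)"
  proof -
    obtain x0 where x0: "(k \<circ> ?c) x0 < x0 + pi * of_int b" using be by (auto simp: disp_below_def)
    obtain j :: int where j: "\<beta> - pi < x0 + pi * of_int j" "x0 + pi * of_int j \<le> \<beta>"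
      by (rule translate_int_pi')
    define x where "x = x0 + pi * of_int j"
    have x: "(k \<circ> ?c) x < x + pi * of_int b" using x0 unfolding x_def per by simp
    have "?c x > \<beta> - pi" using plift_cc_bounds(2)[OF l] j by (simp add: x_def)
    then have "k (?c x) > k \<beta> - pi" using AL_less_iff[OF k, of "\<beta> - pi" "?c x"] kpi by simp
    then show ?thesis using x j by (simp add: x_def algebra_simps)
  qed
  show "disp_below b k" if "l = 1" and be: "disp_below b (k \<circ> ?c)"
  proof -
    obtain x where x: "(k \<circ> ?c) x < x + pi * of_int b" using be by (auto simp: disp_below_def)
    have "s > 0" using s \<open>l = 1\<close> by (simp add: class_params_def)
    then have "x \<le> ?c x" using plift_cc_ge_id(1)[of s x \<beta>] \<open>l = 1\<close> by simp
    then have "k x \<le> k (?c x)" using AL_le_iff[OF k] by simp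
    then show ?thesis using x unfolding disp_below_def by (intro exI[of _ x]) simp
  qed
qed

lemma above_product_exists:
  assumes k: "k \<in> AL" and l: "0 < l" "l \<le> 1" and kb: "k \<beta> > \<beta> + pi * of_int (a - 1)"
  shows "\<exists>s\<in>class_params l. disp_above a (k \<circ> plift (cc l \<beta> s))"
proof -
  define \<eta> where "\<eta> = min (pi/2) ((k \<beta> - \<beta> - pi * of_int (a - 1)) / 2)"
  have \<eta>: "0 < \<eta>" "\<eta> < pi" "\<eta> < k \<beta> - \<beta> - pi * of_int (a - 1)"
    using kb pi_gt_zero by (auto simp: \<eta>_def min_def field_simps)
  define x where "x = \<beta> - pi + \<eta>"
  have x: "\<beta> - pi < x" "x < \<beta>" using \<eta> by (auto simp: x_def)
  have kx: "k \<beta> > x + pi * of_int a" using \<eta> by (simp add: x_def algebra_simps)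
  define y0 where "y0 = finv k (x + pi * of_int a)"
  have ky0: "k y0 = x + pi * of_int a" unfolding y0_def by (rule AL_f_inv[OF k])
  then have y0: "y0 < \<beta>" using AL_less_iff[OF k, of y0 \<beta>] kx by simp
  define y where "y = max ((x + \<beta>) / 2) ((y0 + \<beta>) / 2)"
  have y: "x < y" "y0 < y" "y < \<beta>" using x y0 by (auto simp: y_def max_def)
  obtain s where s: "s \<in> class_params l" "plift (cc l \<beta> s) x = y"
    using plift_cc_surj[of l \<beta> x y] l x y by auto
  have "k y > x + pi * of_int a" using AL_less_iff[OF k, of y0 y] y ky0 by simp
  then show ?thesis using s unfolding disp_above_def by (intro bexI[of _ s] exI[of _ x]) auto
qed

lemma below_product_exists:
  assumes k: "k \<in> AL" and l: "0 < l" "l < 1" and kb: "k \<beta> < \<beta> + pi * of_int (b + 1)"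
  shows "\<exists>s\<in>class_params l. disp_below b (k \<circ> plift (cc l \<beta> s))"
proof -
  define \<eta> where "\<eta> = min (pi/2) ((\<beta> + pi * of_int (b + 1) - k \<beta>) / 2)"
  have \<eta>: "0 < \<eta>" "\<eta> < pi" "\<eta> < \<beta> + pi * of_int (b + 1) - k \<beta>"
    using kb pi_gt_zero by (auto simp: \<eta>_def min_def field_simps)
  define x where "x = \<beta> - \<eta>"
  have x: "\<beta> - pi < x" "x < \<beta>" using \<eta> by (auto simp: x_def)
  have "k (\<beta> - pi) = k \<beta> - pi" using AL_periodic[OF k, of \<beta> "-1"] by simp
  then have kx: "k (\<beta> - pi) < x + pi * of_int b" using \<eta> by (simp add: x_def algebra_simps)
  define y0 where "y0 = finv k (x + pi * of_int b)"
  have ky0: "k y0 = x + pi * of_int b" unfolding y0_def by (rule AL_f_inv[OF k])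
  then have y0: "\<beta> - pi < y0" using AL_less_iff[OF k, of "\<beta> - pi" y0] kx by simp
  define y where "y = min ((\<beta> - pi + \<beta>) / 2) ((\<beta> - pi + y0) / 2)"
  have y: "\<beta> - pi < y" "y < y0" "y < \<beta>" using x y0 by (auto simp: y_def min_def)
  obtain s where s: "s \<in> class_params l" "plift (cc l \<beta> s) x = y"
    using plift_cc_surj[of l \<beta> x y] l x y by auto
  have "k y < x + pi * of_int b" using AL_less_iff[OF k, of y y0] y ky0 by simp
  then show ?thesis using s unfolding disp_below_def by (intro bexI[of _ s] exI[of _ x]) auto
qed

lemma below_product_exists_parabolic:
  assumes k: "k \<in> AL" and kb: "disp_below b k"
  shows "\<exists>s\<in>class_params 1. disp_below b (k \<circ> plift (cc 1 \<beta> s))"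
proof -
  obtain x0 where x0: "k x0 < x0 + pi * of_int b" using kb by (auto simp: disp_below_def)
  obtain j :: int where j: "\<beta> - pi < x0 + pi * of_int j" "x0 + pi * of_int j \<le> \<beta>"
    by (rule translate_int_pi')
  define x where "x = x0 + pi * of_int j"
  have x: "k x < x + pi * of_int b" using x0 unfolding x_def AL_periodic[OF k] by simp
  show ?thesis
  proof (cases "x = \<beta>")
    case True
    then have "(k \<circ> plift (cc 1 \<beta> 1)) x < x + pi * of_int b" using x by simp
    then show ?thesis by (intro bexI[of _ 1]) (auto simp: disp_below_def class_params_def)
  next
    case False
    then have xb: "\<beta> - pi < x" "x < \<beta>" using j by (auto simp: x_def)
    define y0 where "y0 = finv k (x + pi * of_int b)"
    have ky0: "k y0 = x + pi * of_int b" unfolding y0_def by (rule AL_f_inv[OF k])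
    then have y0: "x < y0" using AL_less_iff[OF k, of x y0] x by simp
    define y where "y = min ((x + \<beta>) / 2) ((x + y0) / 2)"
    have y: "x < y" "y < y0" "y < \<beta>" using xb y0 by (auto simp: y_def min_def)
    obtain s where s: "s \<in> class_params 1" "plift (cc 1 \<beta> s) x = y"
      using plift_cc_surj[of 1 \<beta> x y] xb y by auto
    have "k y < x + pi * of_int b" using AL_less_iff[OF k, of y y0] y ky0 by simp
    then show ?thesis using s unfolding disp_below_def by (intro bexI[of _ s] exI[of _ x]) auto
  qed
qed

definition admissible :: "real \<Rightarrow> int \<Rightarrow> int \<Rightarrow> (real \<Rightarrow> real) \<Rightarrow> real \<Rightarrow> bool" where
  "admissible l a b k \<beta> \<longleftrightarrow> k \<beta> > \<beta> + pi * of_int (a - 1) \<and>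
     (if l < 1 then k \<beta> < \<beta> + pi * of_int (b + 1) else disp_below b k)"

lemma admissible_necessary:
  assumes "k \<in> AL" "0 < l" "l \<le> 1" "s \<in> class_params l" "disp_range a b (k \<circ> plift (cc l \<beta> s))"
  shows "admissible l a b k \<beta>"
  using disp_product_necessary[OF assms(1,2,4)] assms(3,5)
  unfolding disp_range_def admissible_def by auto

text \<open>Along each fibre, the elements satisfying one of the two conditions form two open half-lines,
  so they overlap unless they leave out a point, at which the product is central.\<close>

lemma admissible_sufficient:
  assumes k: "k \<in> AL" and l: "0 < l" "l \<le> 1" and ab: "a \<le> b" and ad: "admissible l a b k \<beta>"
  shows "\<exists>s\<in>class_params l. disp_range a b (k \<circ> plift (cc l \<beta> s)) \<or>
    (a = b \<and> (\<forall>x. k (plift (cc l \<beta> s) x) = x + pi * of_int a))"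
proof (rule ccontr)
  assume "\<not> ?thesis"
  then have no: "\<not> disp_range a b (k \<circ> plift (cc l \<beta> s))"
      "\<not> (a = b \<and> (\<forall>x. k (plift (cc l \<beta> s) x) = x + pi * of_int a))" if "s \<in> class_params l" for s
    using that by blast+
  obtain s1 where s1: "s1 \<in> class_params l" "disp_above a (k \<circ> plift (cc l \<beta> s1))"
    using above_product_exists[OF k l] ad by (auto simp: admissible_def)
  obtain s2 where s2: "s2 \<in> class_params l" "disp_below b (k \<circ> plift (cc l \<beta> s2))"
    using below_product_exists[OF k l(1), of \<beta> b] below_product_exists_parabolic[OF k, of b \<beta>] ad l(2)
    by (cases "l < 1") (fastforce simp: admissible_def)+
  let ?A = "\<lambda>s. disp_above a (k \<circ> plift (cc l \<beta> s))" and ?B = "\<lambda>s. disp_below b (k \<circ> plift (cc l \<beta> s))"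
  have or: "?A s \<noteq> ?B s" if "s \<in> class_params l" for s
    using no[OF that] not_above_not_below[of a "k \<circ> plift (cc l \<beta> s)" b] ab
    by (auto simp: disp_range_def)
  have c: "continuous_on UNIV (\<lambda>s. (k \<circ> plift (cc l \<beta> s)) x)" for x
    using continuous_on_compose2[OF continuous_on_k_cc[OF k l(1), of UNIV x], of UNIV "\<lambda>s. (\<beta>, s)"]
    by (simp add: continuous_intros)
  have oA: "open {s. ?A s}" "open {s. ?B s}"
    using above_openin[of UNIV "\<lambda>s. k \<circ> plift (cc l \<beta> s)", OF c]
      below_openin[of UNIV "\<lambda>s. k \<circ> plift (cc l \<beta> s)", OF c] by (simp_all add: openin_subtopology_self)
  have "loc_const (class_params l) ?A"
    unfolding loc_const_def
  proof
    fix s assume s: "s \<in> class_params l"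
    show "\<exists>U. open U \<and> s \<in> U \<and> (\<forall>y\<in>U \<inter> class_params l. ?A y = ?A s)"
    proof (cases "?A s")
      case True
      then show ?thesis using oA(1) by (intro exI[of _ "{s. ?A s}"]) auto
    next
      case False
      then have "?B s" using or s by auto
      then show ?thesis using oA(2) or False by (intro exI[of _ "{s. ?B s}"]) auto
    qed
  qed
  then have "?A s1 = ?A s2"
    by (rule loc_const_connected[OF _ connected_class_params s1(1) s2(1)])
  then show False using or s1 s2 by auto
qed

lemma disp_range_fibre_convex:
  assumes "k \<in> AL" "0 < l" "s1 \<le> s" "s \<le> s2"
    "disp_range a b (k \<circ> plift (cc l \<beta> s1))" "disp_range a b (k \<circ> plift (cc l \<beta> s2))"
  shows "disp_range a b (k \<circ> plift (cc l \<beta> s))"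
proof -
  have "k (plift (cc l \<beta> s1) x) \<le> k (plift (cc l \<beta> s) x)"
    "k (plift (cc l \<beta> s) x) \<le> k (plift (cc l \<beta> s2) x)" for x
    using plift_cc_mono[OF assms(2,3)] plift_cc_mono[OF assms(2,4)] AL_le_iff[OF assms(1)] by auto
  then show ?thesis using assms(5,6) unfolding disp_range_def disp_above_def disp_below_def comp_def
    by (meson less_le_trans le_less_trans)
qed

lemma cc_params_unique:
  assumes l: "0 < l" "l \<le> 1" and s: "s0 \<in> class_params l" and e: "cc l \<beta> s = cc l \<beta>0 s0"
  shows "sin (\<beta> - \<beta>0) = 0"
proof -
  have "cis \<beta> * (l *\<^sub>R cis 0) = mact (cc l \<beta> s) (cis \<beta>)"
    by (simp add: mact_cc) (simp add: mact_def tri_def complex_eq_iff)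
  also have "\<dots> = cis \<beta>0 * mact (tri l s0) (cis (\<beta> - \<beta>0))" unfolding e by (rule mact_cc)
  finally have "cis (- \<beta>0) * (cis \<beta> * (l *\<^sub>R cis 0)) = cis (- \<beta>0) * (cis \<beta>0 * mact (tri l s0) (cis (\<beta> - \<beta>0)))"
    by simp
  then have "l *\<^sub>R cis (\<beta> - \<beta>0) = mact (tri l s0) (cis (\<beta> - \<beta>0))"
    by (simp add: cis_mult mult.assoc[symmetric] add.commute)
  then have 1: "s0 * sin (\<beta> - \<beta>0) = 0" and 2: "sin (\<beta> - \<beta>0) / l = l * sin (\<beta> - \<beta>0)"
    by (simp_all add: mact_def tri_def complex_eq_iff)
  show ?thesis
  proof (cases "l < 1")
    case True
    have "(1 - l * l) * sin (\<beta> - \<beta>0) = 0" using 2 l by (simp add: field_simps)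
    moreover have "l * l < 1 * 1" using True l by (intro mult_strict_mono) auto
    ultimately show ?thesis by auto
  next
    case False
    then show ?thesis using s 1 l by (simp add: class_params_def)
  qed
qed

lemma fibre_openness:
  assumes "k \<in> AL" "0 < l" "disp_range a b (k \<circ> plift (cc l \<beta> s))"
  obtains U where "open U" "\<beta> \<in> U" "\<And>\<beta>'. \<beta>' \<in> U \<Longrightarrow> disp_range a b (k \<circ> plift (cc l \<beta>' s))"
proof -
  have "continuous_on UNIV (\<lambda>\<beta>. (k \<circ> plift (cc l \<beta> s)) x)" for x
    using continuous_on_compose2[OF continuous_on_k_cc[OF assms(1,2), of UNIV x], of UNIV "\<lambda>\<beta>. (\<beta>, s)"]
    by (simp add: continuous_intros)
  from disp_range_nhd[of UNIV "\<lambda>\<beta>. k \<circ> plift (cc l \<beta> s)", OF this, of \<beta> a b] assms(3)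
  show thesis using that by auto
qed

lemma admissible_arc:
  assumes k: "k \<in> AL" and ab: "a \<le> b" and l: "l \<le> 1"
    and ad: "admissible l a b k \<beta>1" "admissible l a b k \<beta>2"
  shows "\<exists>j::int. closed_segment \<beta>1 (\<beta>2 + pi * of_int j) \<subseteq> {\<beta>. admissible l a b k \<beta>}"
proof (cases "l < 1")
  case False
  then have "{\<beta>. admissible l a b k \<beta>} = {\<beta>. k \<beta> > \<beta> + pi * of_int (a - 1)}"
    using ad by (auto simp: admissible_def)
  then show ?thesis using arc_above[OF k, of \<beta>1 "a - 1" \<beta>2] ad by (auto simp: admissible_def)
next
  case True
  show ?thesis
  proof (cases "\<forall>\<beta>. k \<beta> > \<beta> + pi * of_int (a - 1)")
    case T: True
    then have "{\<beta>. admissible l a b k \<beta>} = {\<beta>. k \<beta> < \<beta> + pi * of_int (b + 1)}"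
      using True by (auto simp: admissible_def)
    then show ?thesis using arc_below[OF k, of \<beta>1 "b + 1" \<beta>2] ad True by (auto simp: admissible_def)
  next
    case False
    then obtain e where e: "k e \<le> e + pi * of_int (a - 1)" by (auto simp: not_less)
    have "k \<beta> < \<beta> + pi * of_int (b + 1)" for \<beta>
    proof -
      obtain j :: int where j: "e \<le> \<beta> + pi * of_int j" "\<beta> + pi * of_int j < e + pi"
        by (rule translate_int_pi)
      have "k (\<beta> + pi * of_int j) < k e + pi"
        using AL_less_iff[OF k, of "\<beta> + pi * of_int j" "e + pi"] AL_periodic_pi[OF k] j by simp
      then have "k \<beta> + pi * of_int j < e + pi * of_int a"
        using e by (simp add: AL_periodic[OF k] algebra_simps)
      also have "\<dots> \<le> e + pi * of_int b" using ab by simp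
      finally have "k \<beta> < \<beta> + pi * of_int b + pi" using j(1) pi_gt_zero by linarith
      then show ?thesis by (simp add: distrib_left)
    qed
    then have "{\<beta>. admissible l a b k \<beta>} = {\<beta>. k \<beta> > \<beta> + pi * of_int (a - 1)}"
      using True by (auto simp: admissible_def)
    then show ?thesis using arc_above[OF k, of \<beta>1 "a - 1" \<beta>2] ad by (auto simp: admissible_def)
  qed
qed

definition fibre_base :: "real \<Rightarrow> int \<Rightarrow> int \<Rightarrow> (real \<Rightarrow> real) \<Rightarrow> real set" where
  "fibre_base l a b k = {\<beta>. \<exists>s\<in>class_params l. disp_range a b (k \<circ> plift (cc l \<beta> s))}"

lemma sin_zero_int_pi: "sin x = 0 \<Longrightarrow> \<exists>j::int. x = pi * of_int j"
  by (auto simp: sin_zero_iff_int2 mult.commute)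

text \<open>If some product \<open>k \<circ> c\<close> with \<open>c\<close> in the class equals \<open>z\<^sup>a\<close>, only its fixed direction is missing
  from the base.\<close>

lemma fibre_base_exceptional:
  assumes k: "k \<in> AL" and l: "0 < l" "l \<le> 1" and s0: "s0 \<in> class_params l"
    and ex: "\<And>x. k (plift (cc l \<beta>0 s0) x) = x + pi * of_int a"
    and nz: "sin (\<beta> - \<beta>0) \<noteq> 0"
  shows "\<beta> \<in> fibre_base l a a k"
proof -
  let ?c = "plift (cc l \<beta>0 s0)"
  have c: "?c \<in> AL" using l by (intro AL_plift_cc)
  have cb: "- pi < ?c x - x" "?c x - x < pi" for x
    using plift_minus_bounds[of "cc l \<beta>0 s0" x] l by (auto simp: add_inverse_pos)
  define y where "y = finv ?c \<beta>"
  have y: "?c y = \<beta>" unfolding y_def by (rule AL_f_inv[OF c])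
  have "k \<beta> = y + pi * of_int a" using ex[of y] y by simp
  moreover have "- pi < \<beta> - y" "\<beta> - y < pi" using cb[of y] y by auto
  moreover have "disp_below a k" if "\<not> l < 1"
  proof -
    have l1: "l = 1" "s0 > 0" using that l s0 by (auto simp: class_params_def)
    have "sin (\<beta>0 + pi/2 - \<beta>0) \<noteq> 0" by simp
    then have "?c (\<beta>0 + pi/2) > \<beta>0 + pi/2"
      using plift_cc_ge_id(2)[OF l1(2), of "\<beta>0 + pi/2" \<beta>0] l1(1) by simp
    then show ?thesis using ex[of "\<beta>0 + pi/2"] unfolding disp_below_def
      by (intro exI[of _ "?c (\<beta>0 + pi/2)"]) simp
  qed
  ultimately have "admissible l a a k \<beta>" by (auto simp: admissible_def algebra_simps)
  from admissible_sufficient[OF k l _ this]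
  obtain s where s: "s \<in> class_params l" "disp_range a a (k \<circ> plift (cc l \<beta> s)) \<or>
    (\<forall>x. k (plift (cc l \<beta> s) x) = x + pi * of_int a)" by auto
  have "\<not> (\<forall>x. k (plift (cc l \<beta> s) x) = x + pi * of_int a)"
  proof
    assume "\<forall>x. k (plift (cc l \<beta> s) x) = x + pi * of_int a"
    then have "k (plift (cc l \<beta> s) x) = k (?c x)" for x using ex by simp
    then have eq: "plift (cc l \<beta> s) = ?c" using AL_bij[OF k] by (auto simp: bij_def inj_eq)
    have al: "angle_lift (cc l \<beta> s) (plift (cc l \<beta> s))" "angle_lift (cc l \<beta>0 s0) ?c"
      using l by (auto intro!: angle_lift_plift simp: add_inverse_pos)
    have "cc l \<beta> s = cc l \<beta>0 s0"
      using l angle_lift_matrix_unique[OF al(1) al(2)[folded eq]] by simp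
    then show False using cc_params_unique[OF l s0] nz by blast
  qed
  then show ?thesis using s by (auto simp: fibre_base_def)
qed

lemma fibre_base_periodic: "\<beta> + pi * of_int j \<in> fibre_base l a b k \<longleftrightarrow> \<beta> \<in> fibre_base l a b k"
proof -
  have "cc l (\<beta> + pi * of_int j) s = cc l \<beta> s" for s
  proof (induction j rule: int_induct[where k = 0])
    case (step1 i)
    then show ?case using cc_add_pi[of l "\<beta> + pi * of_int i" s] by (simp add: algebra_simps)
  next
    case (step2 i)
    then show ?case using cc_add_pi[of l "\<beta> + pi * of_int (i - 1)" s] by (simp add: algebra_simps)
  qed simp
  then show ?thesis by (simp add: fibre_base_def)
qed

lemma fibre_base_arc:
  assumes k: "k \<in> AL" and l: "0 < l" "l \<le> 1" and ab: "a \<le> b"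
    and b: "\<beta>1 \<in> fibre_base l a b k" "\<beta>2 \<in> fibre_base l a b k"
  shows "\<exists>j::int. closed_segment \<beta>1 (\<beta>2 + pi * of_int j) \<subseteq> fibre_base l a b k"
proof (cases "{\<beta>. admissible l a b k \<beta>} \<subseteq> fibre_base l a b k")
  case True
  moreover have "admissible l a b k \<beta>1" "admissible l a b k \<beta>2"
    using b admissible_necessary[OF k l] by (auto simp: fibre_base_def)
  ultimately show ?thesis using admissible_arc[OF k ab l(2)] by (meson order_trans)
next
  case False
  then obtain \<beta>0 where ad: "admissible l a b k \<beta>0" and \<beta>0: "\<beta>0 \<notin> fibre_base l a b k" by blast
  from admissible_sufficient[OF k l ab ad] \<beta>0
  obtain s0 where s0: "s0 \<in> class_params l" "a = b" "\<And>x. k (plift (cc l \<beta>0 s0) x) = x + pi * of_int a"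
    by (auto simp: fibre_base_def)
  have ne: "z \<noteq> \<beta>0 + pi * of_int j" if "z \<in> fibre_base l a b k" for z j
    using that \<beta>0 fibre_base_periodic[of \<beta>0 j] by auto
  obtain i1 :: int where i1: "\<beta>0 \<le> \<beta>1 + pi * of_int i1" "\<beta>1 + pi * of_int i1 < \<beta>0 + pi"
    by (rule translate_int_pi)
  obtain i2 :: int where i2: "\<beta>0 \<le> \<beta>2 + pi * of_int i2" "\<beta>2 + pi * of_int i2 < \<beta>0 + pi"
    by (rule translate_int_pi)
  have lt: "\<beta>0 < \<beta>1 + pi * of_int i1" "\<beta>0 < \<beta>2 + pi * of_int i2"
    using i1(1) i2(1) ne[OF b(1), of "- i1"] ne[OF b(2), of "- i2"] by auto
  have e: "\<beta>2 + pi * of_int (i2 - i1) = (\<beta>2 + pi * of_int i2) - pi * of_int i1"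
    "\<beta>1 = (\<beta>1 + pi * of_int i1) - pi * of_int i1" by (simp_all add: algebra_simps)
  have "closed_segment \<beta>1 (\<beta>2 + pi * of_int (i2 - i1)) \<subseteq> fibre_base l a b k"
  proof (rule closed_segment_real_subset)
    fix z assume z: "min \<beta>1 (\<beta>2 + pi * of_int (i2 - i1)) \<le> z" "z \<le> max \<beta>1 (\<beta>2 + pi * of_int (i2 - i1))"
    have "\<beta>0 < z + pi * of_int i1" "z + pi * of_int i1 < \<beta>0 + pi"
      using z lt i1 i2 e by linarith+
    then have "sin (z + pi * of_int i1 - \<beta>0) > 0" by (intro sin_gt_zero) auto
    then have "z + pi * of_int i1 \<in> fibre_base l a a k"
      using fibre_base_exceptional[OF k l s0(1,3)] by auto
    then show "z \<in> fibre_base l a b k" using s0(2) fibre_base_periodic by simp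
  qed
  then show ?thesis by blast
qed

theorem class_product_const:
  assumes k: "k \<in> AL" and l: "0 < l" "l \<le> 1" and ab: "a \<le> b"
    and loc: "loc_const {p. snd p \<in> class_params l \<and> disp_range a b (k \<circ> plift (cc l (fst p) (snd p)))} G"
    and per: "\<And>\<beta> s. G (\<beta> + pi, s) = G (\<beta>, s)"
    and s: "s \<in> class_params l" "disp_range a b (k \<circ> plift (cc l \<beta> s))"
    and s': "s' \<in> class_params l" "disp_range a b (k \<circ> plift (cc l \<beta>' s'))"
  shows "G (\<beta>, s) = G (\<beta>', s')"
proof -
  let ?S = "{p. snd p \<in> class_params l \<and> disp_range a b (k \<circ> plift (cc l (fst p) (snd p)))}"
  let ?B = "fibre_base l a b k"
  have fib_le: "G (\<beta>, s1) = G (\<beta>, s2)" if "(\<beta>, s1) \<in> ?S" "(\<beta>, s2) \<in> ?S" "s1 \<le> s2" for \<beta> s1 s2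
  proof -
    have sub: "(\<lambda>s. (\<beta>, s)) ` {s1..s2} \<subseteq> ?S"
    proof
      fix p assume "p \<in> (\<lambda>s. (\<beta>, s)) ` {s1..s2}"
      then obtain s where s: "p = (\<beta>, s)" "s1 \<le> s" "s \<le> s2" by auto
      have "s \<in> class_params l" using class_params_convex[of s1 l s] that s by simp
      moreover have "disp_range a b (k \<circ> plift (cc l \<beta> s))"
        using disp_range_fibre_convex[OF k l(1) s(2,3)] that by simp
      ultimately show "p \<in> ?S" using s by simp
    qed
    have "continuous_on {s1..s2} (\<lambda>s. (\<beta>, s))" by (intro continuous_intros)
    from loc_const_path[OF loc connected_Icc this sub, of s1 s2] that(3) show ?thesis by simp
  qed
  have fib: "G (\<beta>, s1) = G (\<beta>, s2)" if "(\<beta>, s1) \<in> ?S" "(\<beta>, s2) \<in> ?S" for \<beta> s1 s2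
  proof (cases "s1 \<le> s2")
    case True
    then show ?thesis by (rule fib_le[OF that])
  next
    case False
    then have "s2 \<le> s1" by simp
    then show ?thesis by (rule fib_le[OF that(2,1), symmetric])
  qed
  define g where "g \<beta> = G (\<beta>, SOME s. (\<beta>, s) \<in> ?S)" for \<beta>
  have g: "g \<beta> = G (\<beta>, s)" if "(\<beta>, s) \<in> ?S" for \<beta> s
    unfolding g_def by (rule fib[OF _ that]) (rule someI[of "\<lambda>s. (\<beta>, s) \<in> ?S", OF that])
  have lg: "loc_const ?B g"
    unfolding loc_const_def
  proof
    fix \<beta> assume "\<beta> \<in> ?B"
    then obtain s where s: "s \<in> class_params l" "disp_range a b (k \<circ> plift (cc l \<beta> s))"
      by (auto simp: fibre_base_def)
    then have ps: "(\<beta>, s) \<in> ?S" by simp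
    obtain U where U: "open U" "\<beta> \<in> U" "\<And>\<beta>'. \<beta>' \<in> U \<Longrightarrow> disp_range a b (k \<circ> plift (cc l \<beta>' s))"
      using fibre_openness[OF k l(1) s(2)] by blast
    obtain W where W: "open W" "(\<beta>, s) \<in> W" "\<And>p. p \<in> W \<Longrightarrow> p \<in> ?S \<Longrightarrow> G p = G (\<beta>, s)"
      using loc_constE[OF loc ps] by blast
    obtain W1 W2 where W12: "open W1" "open W2" "\<beta> \<in> W1" "s \<in> W2" "W1 \<times> W2 \<subseteq> W"
      using W(1,2) by (auto elim!: open_prod_elim)
    have "g \<beta>' = g \<beta>" if "\<beta>' \<in> U \<inter> W1" for \<beta>'
    proof -
      have h: "(\<beta>', s) \<in> ?S" using U(3) that s by auto
      have "(\<beta>', s) \<in> W" using W12 that by auto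
      from W(3)[OF this h] show ?thesis unfolding g[OF h] g[OF ps] .
    qed
    moreover have "open (U \<inter> W1)" "\<beta> \<in> U \<inter> W1" using U W12 by auto
    ultimately show "\<exists>U. open U \<and> \<beta> \<in> U \<and> (\<forall>y\<in>U \<inter> ?B. g y = g \<beta>)" by blast
  qed
  have gper1: "g (\<beta> + pi) = g \<beta>" if "\<beta> \<in> ?B" for \<beta>
  proof -
    obtain s where s: "(\<beta>, s) \<in> ?S" using \<open>\<beta> \<in> ?B\<close> by (auto simp: fibre_base_def)
    then have s': "(\<beta> + pi, s) \<in> ?S" by (simp add: cc_add_pi)
    show ?thesis unfolding g[OF s] g[OF s'] by (rule per)
  qed
  have gper: "g (\<beta> + pi * of_int j) = g \<beta>" if "\<beta> \<in> ?B" for \<beta> j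
  proof (induction j rule: int_induct[where k = 0])
    case (step1 i)
    then show ?case using gper1[of "\<beta> + pi * of_int i"] that fibre_base_periodic[of \<beta> i]
      by (simp add: algebra_simps)
  next
    case (step2 i)
    then show ?case using gper1[of "\<beta> + pi * of_int (i - 1)"] that fibre_base_periodic[of \<beta> "i - 1"]
      by (simp add: algebra_simps)
  qed simp
  have B: "\<beta> \<in> ?B" "\<beta>' \<in> ?B" using s s' by (auto simp: fibre_base_def)
  obtain j :: int where j: "closed_segment \<beta> (\<beta>' + pi * of_int j) \<subseteq> ?B"
    using fibre_base_arc[OF k l ab B] by blast
  have "g \<beta> = g (\<beta>' + pi * of_int j)"
    by (rule loc_const_connected[OF loc_const_subset[OF lg j]]) auto
  then show ?thesis using gper[OF B(2)] g s s' by auto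
qed

theorem class_product_nonempty:
  assumes k: "k \<in> AL" and l: "0 < l" "l \<le> 1" and ab: "a \<le> b"
  shows "(\<exists>\<beta>. \<exists>s\<in>class_params l. disp_range a b (k \<circ> plift (cc l \<beta> s))) \<longleftrightarrow>
    disp_range (a - 1) (if l < 1 then b + 1 else b) k"
proof
  assume "\<exists>\<beta>. \<exists>s\<in>class_params l. disp_range a b (k \<circ> plift (cc l \<beta> s))"
  then obtain \<beta> where "admissible l a b k \<beta>" using admissible_necessary[OF k l] by blast
  then show "disp_range (a - 1) (if l < 1 then b + 1 else b) k"
    by (auto simp: admissible_def disp_range_def disp_above_def disp_below_def split: if_splits)
next
  assume d: "disp_range (a - 1) (if l < 1 then b + 1 else b) k"
  then obtain \<beta>1 where \<beta>1: "k \<beta>1 > \<beta>1 + pi * of_int (a - 1)" by (auto simp: disp_range_def disp_above_def)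
  have "\<exists>\<beta>. admissible l a b k \<beta>"
  proof (cases "l < 1 \<and> k \<beta>1 \<ge> \<beta>1 + pi * of_int (b + 1)")
    case False
    then show ?thesis using \<beta>1 d by (intro exI[of _ \<beta>1]) (auto simp: admissible_def disp_range_def)
  next
    case True
    obtain x where x: "k x < x + pi * of_int (b + 1)"
      using d True by (auto simp: disp_range_def disp_below_def)
    obtain j :: int where j: "\<beta>1 \<le> x + pi * of_int j" "x + pi * of_int j < \<beta>1 + pi"
      by (rule translate_int_pi)
    define y where "y = x + pi * of_int j"
    have y: "k y < y + pi * of_int (b + 1)" using x by (simp add: y_def AL_periodic[OF k])
    have "k y \<ge> k \<beta>1" using AL_le_iff[OF k] j by (simp add: y_def)
    then have "k y \<ge> \<beta>1 + pi * of_int (b + 1)" using True by simp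
    moreover have "\<beta>1 + pi * of_int (b + 1) > y + pi * of_int b" using j by (simp add: y_def algebra_simps)
    ultimately have "k y > y + pi * of_int b" by linarith
    moreover have "pi * of_int (a - 1) \<le> pi * of_int b" using ab by simp
    ultimately have "k y > y + pi * of_int (a - 1)" by linarith
    then have "admissible l a b k y" using y True by (auto simp: admissible_def)
    then show ?thesis by blast
  qed
  then obtain \<beta> where "admissible l a b k \<beta>" by blast
  from admissible_sufficient[OF k l ab this] obtain s where
    s: "s \<in> class_params l" "disp_range a b (k \<circ> plift (cc l \<beta> s)) \<or>
      a = b \<and> (\<forall>x. k (plift (cc l \<beta> s) x) = x + pi * of_int a)" by blast
  then show "\<exists>\<beta>. \<exists>s\<in>class_params l. disp_range a b (k \<circ> plift (cc l \<beta> s))"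
  proof (elim disjE)
    assume *: "a = b \<and> (\<forall>x. k (plift (cc l \<beta> s) x) = x + pi * of_int a)"
    have "\<beta> + pi/2 \<in> fibre_base l a a k"
      by (rule fibre_base_exceptional[OF k l s(1)]) (use * in auto)
    then show ?thesis using * by (auto simp: fibre_base_def)
  qed auto
qed

subsection \<open>Descent of locally constant functions\<close>

lemma loc_const_fibration:
  assumes g: "loc_const S g"
    and fib: "\<And>x y. x \<in> S \<Longrightarrow> y \<in> S \<Longrightarrow> f x = f y \<Longrightarrow> g x = g y"
    and sec: "\<And>x. x \<in> S \<Longrightarrow> \<exists>N \<sigma>. open N \<and> f x \<in> N \<and> continuous_on (N \<inter> f ` S) \<sigma> \<and> \<sigma> (f x) = x \<and>
      (\<forall>b\<in>N \<inter> f ` S. \<sigma> b \<in> S \<and> f (\<sigma> b) = b)"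
  obtains h where "loc_const (f ` S) h" "\<And>x. x \<in> S \<Longrightarrow> g x = h (f x)"
proof -
  define h where "h b = g (inv_into S f b)" for b
  have h: "g x = h (f x)" if "x \<in> S" for x
    unfolding h_def by (rule fib[OF that]) (use that in \<open>auto simp: inv_into_into f_inv_into_f\<close>)
  have "loc_const (f ` S) h"
    unfolding loc_const_def
  proof
    fix b assume "b \<in> f ` S"
    then obtain x where x: "x \<in> S" "b = f x" by blast
    obtain N \<sigma> where N: "open N" "b \<in> N" "continuous_on (N \<inter> f ` S) \<sigma>" "\<sigma> b = x"
      "\<And>b'. b' \<in> N \<Longrightarrow> b' \<in> f ` S \<Longrightarrow> \<sigma> b' \<in> S \<and> f (\<sigma> b') = b'"
      using sec[OF x(1)] x(2) by blast
    obtain U where U: "open U" "x \<in> U" "\<And>y. y \<in> U \<Longrightarrow> y \<in> S \<Longrightarrow> g y = g x"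
      using loc_constE[OF g x(1)] by blast
    have "b \<in> N \<inter> f ` S" using N x by auto
    then obtain W where W: "open W" "b \<in> W" "\<And>b'. b' \<in> N \<Longrightarrow> b' \<in> f ` S \<Longrightarrow> b' \<in> W \<Longrightarrow> \<sigma> b' \<in> U"
      using N(3)[unfolded continuous_on_topological, rule_format, of b U] N(4) U(1,2) by blast
    have "h b' = h b" if "b' \<in> (N \<inter> W) \<inter> f ` S" for b'
    proof -
      have s: "\<sigma> b' \<in> S" "f (\<sigma> b') = b'" "\<sigma> b' \<in> U" using N(5)[of b'] W(3)[of b'] that by auto
      have "h b' = g (\<sigma> b')" using h[OF s(1)] s(2) by simp
      also have "\<dots> = g x" by (rule U(3)[OF s(3,1)])
      finally show ?thesis using h[OF x(1)] x(2) by simp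
    qed
    moreover have "open (N \<inter> W)" "b \<in> N \<inter> W" using N W by auto
    ultimately show "\<exists>U. open U \<and> b \<in> U \<and> (\<forall>y\<in>U \<inter> f ` S. h y = h b)" by blast
  qed
  then show thesis using h by (rule that)
qed


subsection \<open>Normal forms\<close>

lemma eigenvector_exists:
  assumes "det A = 1" "l \<noteq> 0" "trace A = l + 1 / l"
  shows "\<exists>e. mact A (cis e) = l *\<^sub>R cis e"
proof -
  have *: "(A$1$1 - l) * (A$2$2 - l) = A$1$2 * A$2$1"
  proof -
    have "l * (A$1$1 + A$2$2) = l * l + 1" using assms(2,3) by (simp add: trace_2 distrib_left)
    then show ?thesis using assms(1) by (simp add: det_2 algebra_simps)
  qed
  have ex: "\<exists>w. w \<noteq> 0 \<and> mact A w = l *\<^sub>R w"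
  proof (cases "A$1$2 = 0 \<and> A$1$1 = l")
    case False
    then show ?thesis using *
      by (intro exI[of _ "Complex (A$1$2) (A$1$1 - l)"]) (auto simp: mact_def complex_eq_iff algebra_simps)
  next
    case True
    show ?thesis
    proof (cases "A$2$1 = 0 \<and> A$2$2 = l")
      case False
      then show ?thesis using True
        by (intro exI[of _ "Complex (A$2$2 - l) (A$2$1)"]) (auto simp: mact_def complex_eq_iff algebra_simps)
    next
      case True2: True
      then show ?thesis using True
        by (intro exI[of _ "Complex 1 0"]) (auto simp: mact_def complex_eq_iff)
    qed
  qed
  then obtain w where w: "w \<noteq> 0" "mact A w = l *\<^sub>R w" by blast
  have "cis (Arg w) = (1 / cmod w) *\<^sub>R w"
    using w(1) rcis_cmod_Arg[of w] by (simp add: rcis_def scaleR_conv_of_real field_simps)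
  then have "mact A (cis (Arg w)) = l *\<^sub>R cis (Arg w)"
    by (simp add: mact_scaleR w(2))
  then show ?thesis by blast
qed

lemma cc_normal_form:
  assumes "det A = 1" "l \<noteq> 0" "trace A = l + 1 / l"
  shows "\<exists>\<beta> s. A = cc l \<beta> s"
  using eigenvector_exists[OF assms] cc_of_eigenvector[OF assms(1) _ assms(2)] by blast

lemma trace_param:
  assumes "t > (2::real)"
  shows "\<exists>l. 0 < l \<and> l < 1 \<and> t = l + 1 / l"
proof -
  define d where "d = sqrt (t\<^sup>2 - 4)"
  have t4: "t\<^sup>2 > 4" using assms power_strict_mono[of 2 t 2] by simp
  then have d: "d > 0" "d\<^sup>2 = t\<^sup>2 - 4" by (auto simp: d_def)
  have dt: "d < t" using d assms by (intro power2_less_imp_less[of d t]) auto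
  define l where "l = (t - d) / 2"
  have l0: "l > 0" using dt by (simp add: l_def)
  have "l * ((t + d) / 2) = 1" using d(2) by (simp add: l_def power2_eq_square field_simps)
  then have inv: "1 / l = (t + d) / 2" using l0 by (simp add: field_simps)
  have "l < 1 / l" unfolding inv using d by (simp add: l_def)
  then have "l * l < 1 * 1" using l0 by (simp add: field_simps)
  then have "l < 1" using l0 by (meson mult_le_cancel_left1 not_less mult_mono' order_less_imp_le zero_le_one)
  then show ?thesis using l0 inv by (intro exI[of _ l]) (simp add: l_def field_simps)
qed

lemma hyperbolic_normal_form:
  assumes "det A = 1" "trace A > 2"
  obtains l \<beta> s where "0 < l" "l < 1" "A = cc l \<beta> s"
proof -
  obtain l where l: "0 < l" "l < 1" "trace A = l + 1 / l" using trace_param[OF assms(2)] by blast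
  then show thesis using cc_normal_form[OF assms(1), of l] that by auto
qed

lemma add_inverse_gt_2: "0 < l \<Longrightarrow> l \<noteq> 1 \<Longrightarrow> l + 1 / l > (2::real)"
proof -
  assume l: "0 < l" "l \<noteq> 1"
  have "0 < (l - 1)\<^sup>2 / l" using l by simp
  also have "(l - 1)\<^sup>2 / l = l + 1 / l - 2" using l by (simp add: power2_eq_square field_simps)
  finally show ?thesis by simp
qed

lemma plift_has_fixed_point:
  assumes "det A = 1" "trace A \<ge> 2"
  shows "\<exists>e. plift A e = e"
proof (cases "trace A = 2")
  case True
  then obtain \<beta> s where "A = cc 1 \<beta> s" using cc_normal_form[OF assms(1), of 1] by auto
  then show ?thesis by (intro exI[of _ \<beta>]) simp
next
  case False
  then have "trace A > 2" using assms by simp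
  then obtain l \<beta> s where "0 < l" "A = cc l \<beta> s" using hyperbolic_normal_form[OF assms(1)] by metis
  then show ?thesis by (intro exI[of _ \<beta>]) simp
qed

lemma angle_lift_fixed_eq_plift:
  assumes "det A = 1" "angle_lift A f" "f e = e" "trace A > -2"
  shows "f = plift A"
proof -
  obtain r where r: "r > 0" "mact A (cis e) = r *\<^sub>R cis e" using angle_liftE[OF assms(2), of e] assms(3) by metis
  show ?thesis
    by (rule angle_lift_eqI[OF assms(2) angle_lift_plift[OF assms(1,4)], of e])
      (simp add: assms(3) plift_fixed[OF r(2,1)])
qed

lemma plift_conj:
  assumes "det A = 1" "trace A \<ge> 2" "det y = 1" "angle_lift y h"
  shows "h \<circ> plift A \<circ> finv h = plift (y ** A ** sinv y)"
proof -
  have hA: "h \<in> AL" using AL_I assms by blast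
  obtain e where e: "plift A e = e" using plift_has_fixed_point[OF assms(1,2)] by blast
  have "angle_lift (y ** A ** sinv y) (h \<circ> plift A \<circ> finv h)"
    using assms by (intro angle_lift_comp angle_lift_plift angle_lift_inv) auto
  then show ?thesis
    by (rule angle_lift_fixed_eq_plift[where e = "h e", rotated])
      (use assms e in \<open>auto simp: det_mul trace_conj AL_inv_f[OF hA]\<close>)
qed

lemma plift_sinv:
  assumes "det A = 1" "trace A > -2"
  shows "plift (sinv A) = finv (plift A)"
proof -
  have al: "angle_lift A (plift A)" "angle_lift (sinv A) (plift (sinv A))"
    using assms by (auto intro!: angle_lift_plift)
  have "angle_lift (mat 1) (plift A \<circ> plift (sinv A))"
    using angle_lift_comp[OF al] by (simp add: sinv_mult assms)
  then obtain j :: int where j: "\<And>x. (plift A \<circ> plift (sinv A)) x = x + 2 * pi * of_int j"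
    using angle_lift_unique[OF _ angle_lift_id] by blast
  have 1: "\<bar>plift A (plift (sinv A) 0) - plift (sinv A) 0\<bar> < pi" "\<bar>plift (sinv A) 0 - 0\<bar> < pi"
    using plift_minus_bounds[of A "plift (sinv A) 0"] plift_minus_bounds[of "sinv A" 0] assms
    by auto
  have "2 * pi * of_int j = plift A (plift (sinv A) 0)" using j[of 0] by simp
  then have "\<bar>2 * pi * of_int j\<bar> < 2 * pi" using 1 by linarith
  then have "2 * pi * \<bar>of_int j\<bar> < 2 * pi * 1" by (simp add: abs_mult)
  then have "\<bar>of_int j :: real\<bar> < 1" by (subst (asm) mult_less_cancel_left_pos) auto
  then have "j = 0" by linarith
  then have 2: "plift A (plift (sinv A) x) = x" for x using j[of x] by simp
  have "plift A \<in> AL" using assms by (rule AL_plift)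
  then show ?thesis using 2 by (metis AL_inv_f ext)
qed


subsection \<open>Products with hyperbolic and parabolic elements\<close>

definition sign_class :: "int \<Rightarrow> (real^2^2) set" where
  "sign_class \<sigma> = (if \<sigma> = 0 then {c. det c = 1 \<and> trace c > 2}
     else if \<sigma> = 1 then {cc 1 \<beta> s |\<beta> s. s > 0} else {sinv (cc 1 \<beta> s) |\<beta> s. s > 0})"

definition lower_shift :: "int \<Rightarrow> int" where "lower_shift \<sigma> = (if \<sigma> = 0 \<or> \<sigma> = 1 then 1 else 0)"
definition upper_shift :: "int \<Rightarrow> int" where "upper_shift \<sigma> = (if \<sigma> = 1 then 0 else 1)"

lemma sign_class_det: "c \<in> sign_class \<sigma> \<Longrightarrow> det c = 1"
  by (auto simp: sign_class_def split: if_splits)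

lemma sign_class_trace: "c \<in> sign_class \<sigma> \<Longrightarrow> trace c \<ge> 2"
  by (auto simp: sign_class_def split: if_splits)

definition product_set :: "int \<Rightarrow> int \<Rightarrow> int \<Rightarrow> (real \<Rightarrow> real) \<Rightarrow> (real^2^2) set" where
  "product_set \<sigma> a b k = {c \<in> sign_class \<sigma>. disp_range a b (k \<circ> plift c)}"

lemma product_set_hyperbolic_nonempty:
  assumes k: "k \<in> AL" and ab: "a \<le> b"
  shows "product_set 0 a b k \<noteq> {} \<longleftrightarrow> disp_range (a - 1) (b + 1) k"
proof
  assume "product_set 0 a b k \<noteq> {}"
  then obtain c where c: "det c = 1" "trace c > 2" "disp_range a b (k \<circ> plift c)"
    by (auto simp: product_set_def sign_class_def)
  obtain l \<beta> s where l: "0 < l" "l < 1" "c = cc l \<beta> s" using hyperbolic_normal_form[OF c(1,2)] by blast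
  then have "s \<in> class_params l" by (simp add: class_params_def)
  then show "disp_range (a - 1) (b + 1) k"
    using class_product_nonempty[OF k l(1) _ ab] l(2,3) c(3) by auto
next
  assume d: "disp_range (a - 1) (b + 1) k"
  then obtain \<beta> s where "disp_range a b (k \<circ> plift (cc (1/2) \<beta> s))"
    using class_product_nonempty[OF k _ _ ab, of "1/2"] by auto
  then have "cc (1/2) \<beta> s \<in> product_set 0 a b k" by (simp add: product_set_def sign_class_def)
  then show "product_set 0 a b k \<noteq> {}" by blast
qed

lemma product_set_hyperbolic_const:
  assumes k: "k \<in> AL" and ab: "a \<le> b" and g: "loc_const (product_set 0 a b k) g"
    and c: "c \<in> product_set 0 a b k" "c' \<in> product_set 0 a b k"
  shows "g c = g c'"
proof -
  let ?L = "{0<..<(1::real)}"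
  define S where "S = {p. fst p \<in> ?L \<and> disp_range a b (k \<circ> plift (cc (fst p) (fst (snd p)) (snd (snd p))))}"
  define G where "G p = g (cc (fst p) (fst (snd p)) (snd (snd p)))" for p
  have SP: "cc l \<beta> s \<in> product_set 0 a b k" if "(l, \<beta>, s) \<in> S" for l \<beta> s
    using that by (auto simp: S_def product_set_def sign_class_def add_inverse_gt_2)
  have lG: "loc_const S G" unfolding G_def
    by (rule loc_const_compose[OF g]) (use SP in \<open>auto simp: S_def intro!: continuous_intros\<close>)
  have fib: "G (l, \<beta>, s) = G (l, \<beta>', s')" if "(l, \<beta>, s) \<in> S" "(l, \<beta>', s') \<in> S" for l \<beta> s \<beta>' s'
  proof -
    have l: "0 < l" "l \<le> 1" "l < 1" using that by (auto simp: S_def)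
    let ?T = "{p. snd p \<in> class_params l \<and> disp_range a b (k \<circ> plift (cc l (fst p) (snd p)))}"
    have "loc_const ?T (\<lambda>p. G (l, p))"
      by (rule loc_const_compose[OF lG]) (use l in \<open>auto simp: S_def intro!: continuous_intros\<close>)
    from class_product_const[OF k l(1,2) ab this, of s \<beta> s' \<beta>'] show ?thesis
      using that l by (auto simp: S_def G_def cc_add_pi class_params_def)
  qed
  have fS: "fst ` S \<subseteq> ?L" by (auto simp: S_def)
  have Sne: "\<exists>\<beta> s. (l, \<beta>, s) \<in> S" if l: "l \<in> ?L" for l
  proof -
    have "disp_range (a - 1) (b + 1) k"
      using c product_set_hyperbolic_nonempty[OF k ab] by blast
    then show ?thesis using class_product_nonempty[OF k _ _ ab, of l] l by (auto simp: S_def)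
  qed
  then have fSeq: "fst ` S = ?L" using fS by force
  obtain h where h: "loc_const (fst ` S) h" "\<And>p. p \<in> S \<Longrightarrow> G p = h (fst p)"
  proof (rule loc_const_fibration[OF lG, of fst])
    fix p q assume "p \<in> S" "q \<in> S" "fst p = fst q"
    then show "G p = G q" using fib by (metis prod.collapse)
  next
    fix p assume p: "p \<in> S"
    obtain l \<beta> s where lbs: "p = (l, \<beta>, s)" by (cases p)
    have l: "l \<in> ?L" and d: "disp_range a b (k \<circ> plift (cc l \<beta> s))" using p by (auto simp: S_def lbs)
    have cont: "continuous_on ?L (\<lambda>l. (k \<circ> plift (cc l \<beta> s)) x)" for x
      unfolding comp_def
      by (intro continuous_on_compose2[OF AL_cont[OF k, of UNIV]] continuous_on_plift_joint
          continuous_intros) (auto simp: add_inverse_pos)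
    obtain U where U: "open U" "l \<in> U" "\<And>l'. l' \<in> U \<Longrightarrow> l' \<in> ?L \<Longrightarrow> disp_range a b (k \<circ> plift (cc l' \<beta> s))"
      using disp_range_nhd[of ?L "\<lambda>l. k \<circ> plift (cc l \<beta> s)", OF cont l d] by blast
    have "continuous_on (U \<inter> fst ` S) (\<lambda>l. (l, \<beta>, s))" by (intro continuous_intros)
    then show "\<exists>N \<sigma>. open N \<and> fst p \<in> N \<and> continuous_on (N \<inter> fst ` S) \<sigma> \<and> \<sigma> (fst p) = p \<and>
        (\<forall>b\<in>N \<inter> fst ` S. \<sigma> b \<in> S \<and> fst (\<sigma> b) = b)"
      using U fS by (intro exI[of _ U] exI[of _ "\<lambda>l. (l, \<beta>, s)"]) (auto simp: lbs S_def)
  qed (use that in blast)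
  have hc: "h l = h l'" if "l \<in> ?L" "l' \<in> ?L" for l l'
    by (rule loc_const_connected[OF h(1)[unfolded fSeq] _ that]) auto
  have rep: "\<exists>p\<in>S. g c = G p" if "c \<in> product_set 0 a b k" for c
  proof -
    have c: "det c = 1" "trace c > 2" "disp_range a b (k \<circ> plift c)"
      using that by (auto simp: product_set_def sign_class_def)
    obtain l \<beta> s where "0 < l" "l < 1" "c = cc l \<beta> s" using hyperbolic_normal_form[OF c(1,2)] by blast
    then show ?thesis using c(3) by (intro bexI[of _ "(l, \<beta>, s)"]) (auto simp: S_def G_def)
  qed
  obtain p q where "p \<in> S" "g c = G p" "q \<in> S" "g c' = G q" using rep c by metis
  then show ?thesis using h(2) hc fS by (metis image_subset_iff)
qed

lemma disp_range_comp_plift_sinv: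
  assumes k: "k \<in> AL" and c: "det c = 1" "trace c \<ge> 2"
  shows "disp_range a b (k \<circ> plift (sinv c)) \<longleftrightarrow> disp_range (- b) (- a) (finv k \<circ> plift c)"
proof -
  have pc: "plift c \<in> AL" using c by (intro AL_plift) auto
  have e: "plift (sinv c) = finv (plift c)" using c by (intro plift_sinv) auto
  have "disp_range a b (k \<circ> finv (plift c)) \<longleftrightarrow> disp_range a b (finv (plift c) \<circ> k)"
    by (rule disp_range_commute[OF k AL_inv[OF pc]])
  also have "finv (plift c) \<circ> k = finv (finv k \<circ> plift c)"
  proof -
    have "finv (finv k \<circ> plift c) = finv (plift c) \<circ> k"
      by (rule inv_equality) (auto simp: AL_inv_f[OF pc] AL_f_inv[OF pc] AL_inv_f[OF k] AL_f_inv[OF k])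
    then show ?thesis by simp
  qed
  finally show ?thesis unfolding e disp_range_inv[OF AL_comp[OF AL_inv[OF k] pc]] .
qed

lemma product_set_nonempty:
  assumes k: "k \<in> AL" and ab: "a \<le> b" and \<sigma>: "\<sigma> \<in> {-1, 0, 1}"
  shows "product_set \<sigma> a b k \<noteq> {} \<longleftrightarrow> disp_range (a - lower_shift \<sigma>) (b + upper_shift \<sigma>) k"
proof -
  consider "\<sigma> = 0" | "\<sigma> = 1" | "\<sigma> = -1" using \<sigma> by auto
  then show ?thesis
  proof cases
    case 1
    then show ?thesis using product_set_hyperbolic_nonempty[OF k ab]
      by (simp add: lower_shift_def upper_shift_def)
  next
    case 2
    then have "product_set \<sigma> a b k \<noteq> {} \<longleftrightarrow> (\<exists>\<beta>. \<exists>s\<in>class_params 1. disp_range a b (k \<circ> plift (cc 1 \<beta> s)))"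
      by (auto simp: product_set_def sign_class_def class_params_def)
    then show ?thesis using class_product_nonempty[OF k _ _ ab, of 1] 2
      by (simp add: lower_shift_def upper_shift_def)
  next
    case 3
    have "product_set \<sigma> a b k \<noteq> {} \<longleftrightarrow> (\<exists>\<beta>. \<exists>s>0. disp_range a b (k \<circ> plift (sinv (cc 1 \<beta> s))))"
      using 3 by (auto simp: product_set_def sign_class_def)
    also have "\<dots> \<longleftrightarrow> (\<exists>\<beta>. \<exists>s\<in>class_params 1. disp_range (- b) (- a) (finv k \<circ> plift (cc 1 \<beta> s)))"
      by (auto simp: class_params_def disp_range_comp_plift_sinv[OF k])
    also have "\<dots> \<longleftrightarrow> disp_range (- b - 1) (- a) (finv k)"
      using class_product_nonempty[OF AL_inv[OF k], of 1 "- b" "- a"] ab by simp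
    also have "\<dots> \<longleftrightarrow> disp_range a (b + 1) k" by (simp add: disp_range_inv[OF k] add.commute)
    finally show ?thesis using 3 by (simp add: lower_shift_def upper_shift_def)
  qed
qed

lemma product_set_const:
  assumes k: "k \<in> AL" and ab: "a \<le> b" and \<sigma>: "\<sigma> \<in> {-1, 0, 1}" and g: "loc_const (product_set \<sigma> a b k) g"
    and c: "c \<in> product_set \<sigma> a b k" "c' \<in> product_set \<sigma> a b k"
  shows "g c = g c'"
proof -
  consider "\<sigma> = 0" | "\<sigma> = 1" | "\<sigma> = -1" using \<sigma> by auto
  then show ?thesis
  proof cases
    case 1
    then show ?thesis using product_set_hyperbolic_const[OF k ab] g c by simp
  next
    case 2
    let ?T = "{p. snd p \<in> class_params 1 \<and> disp_range a b (k \<circ> plift (cc 1 (fst p) (snd p)))}"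
    have l: "loc_const ?T (\<lambda>p. g (cc 1 (fst p) (snd p)))"
      by (rule loc_const_compose[OF g])
        (use 2 in \<open>auto simp: product_set_def sign_class_def class_params_def intro!: continuous_intros\<close>)
    obtain \<beta> s \<beta>' s' where "c = cc 1 \<beta> s" "s > 0" "c' = cc 1 \<beta>' s'" "s' > 0"
      using c 2 by (auto simp: product_set_def sign_class_def)
    then show ?thesis using class_product_const[OF k _ _ ab l, of s \<beta> s' \<beta>'] c
      by (auto simp: product_set_def class_params_def cc_add_pi)
  next
    case 3
    let ?T = "{p. snd p \<in> class_params 1 \<and> disp_range (-b) (-a) (finv k \<circ> plift (cc 1 (fst p) (snd p)))}"
    have l: "loc_const ?T (\<lambda>p. g (sinv (cc 1 (fst p) (snd p))))"
      by (rule loc_const_compose[OF g])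
        (use 3 in \<open>auto simp: product_set_def sign_class_def class_params_def
          disp_range_comp_plift_sinv[OF k] intro!: continuous_intros\<close>)
    obtain \<beta> s \<beta>' s' where "c = sinv (cc 1 \<beta> s)" "s > 0" "c' = sinv (cc 1 \<beta>' s')" "s' > 0"
      using c 3 by (auto simp: product_set_def sign_class_def)
    then show ?thesis using class_product_const[OF AL_inv[OF k] _ _ _ l, of s \<beta> s' \<beta>'] c ab
      by (auto simp: product_set_def class_params_def cc_add_pi disp_range_comp_plift_sinv[OF k])
  qed
qed

lemma loc_const_cong:
  assumes "loc_const S g" "\<And>x. x \<in> S \<Longrightarrow> h x = g x"
  shows "loc_const S h"
  using assms unfolding loc_const_def by auto

subsection \<open>Lifted commutators\<close>

definition slift :: "real^2^2 \<Rightarrow> real \<Rightarrow> real" where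
  "slift A = (SOME f. angle_lift A f)"

definition comm_lift :: "real^2^2 \<Rightarrow> real^2^2 \<Rightarrow> real \<Rightarrow> real" where
  "comm_lift x y = slift x \<circ> slift y \<circ> finv (slift x) \<circ> finv (slift y)"

definition comm_mat :: "real^2^2 \<Rightarrow> real^2^2 \<Rightarrow> real^2^2" where
  "comm_mat x y = x ** y ** sinv x ** sinv y"

lemma angle_lift_slift: "det A = 1 \<Longrightarrow> angle_lift A (slift A)"
  unfolding slift_def using angle_lift_exists someI_ex by metis

lemma finv_shift:
  assumes "f \<in> AL" "\<And>x. f' x = f x + pi * of_int i"
  shows "finv f' x = finv f x + pi * of_int (- i)"
proof -
  have f: "f' = (\<lambda>x. f x + pi * of_int i)" using assms(2) by auto
  have "finv f' = (\<lambda>x. finv f x + pi * of_int (- i))"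
  proof (rule inv_equality)
    fix x
    show "finv f (f' x) + pi * of_int (- i) = x"
      unfolding f using AL_periodic[OF AL_inv[OF assms(1)], of "f x" i] by (simp add: AL_inv_f[OF assms(1)])
    show "f' (finv f x + pi * of_int (- i)) = x"
      unfolding f using AL_periodic[OF assms(1), of "finv f x" "- i"] by (simp add: AL_f_inv[OF assms(1)])
  qed
  then show ?thesis by simp
qed

lemma commutator_shift:
  assumes f: "f \<in> AL" "\<And>x. f' x = f x + pi * of_int i" and h: "h \<in> AL" "\<And>x. h' x = h x + pi * of_int j"
  shows "f' \<circ> h' \<circ> finv f' \<circ> finv h' = f \<circ> h \<circ> finv f \<circ> finv h"
proof
  fix x
  note p = AL_periodic[OF f(1)] AL_periodic[OF h(1)] AL_periodic[OF AL_inv[OF f(1)]] AL_periodic[OF AL_inv[OF h(1)]]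
  show "(f' \<circ> h' \<circ> finv f' \<circ> finv h') x = (f \<circ> h \<circ> finv f \<circ> finv h) x"
    unfolding comp_def finv_shift[OF f] finv_shift[OF h] f(2) h(2) p by simp
qed

lemma angle_lift_pm_shift:
  assumes "angle_lift A f" "angle_lift A' f'" "det A = 1" "A' = A \<or> A' = - A"
  shows "\<exists>i::int. \<forall>x. f' x = f x + pi * of_int i"
  using assms(4)
proof
  assume "A' = A"
  then obtain j :: int where "\<And>x. f' x = f x + 2 * pi * of_int j"
    using angle_lift_unique[of A f' f] assms by blast
  then show ?thesis by (intro exI[of _ "2 * j"]) simp
next
  assume "A' = - A"
  then have "angle_lift A' (\<lambda>x. f x + pi * of_int 1)" using angle_lift_shift[OF assms(1), of 1] by simp
  then obtain j :: int where "\<And>x. f' x = f x + pi * of_int 1 + 2 * pi * of_int j"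
    using angle_lift_unique[OF assms(2)] by blast
  then show ?thesis by (intro exI[of _ "1 + 2 * j"]) (simp add: algebra_simps)
qed

lemma comm_lift_eq:
  assumes "angle_lift x' f" "angle_lift y' h" "det x = 1" "det y = 1"
    "x' = x \<or> x' = - x" "y' = y \<or> y' = - y"
  shows "comm_lift x y = f \<circ> h \<circ> finv f \<circ> finv h"
proof -
  have s: "slift x \<in> AL" "slift y \<in> AL" using assms angle_lift_slift AL_I by blast+
  obtain i :: int where i: "\<And>t. f t = slift x t + pi * of_int i"
    using angle_lift_pm_shift[OF angle_lift_slift[OF assms(3)] assms(1,3,5)] by blast
  obtain j :: int where j: "\<And>t. h t = slift y t + pi * of_int j"
    using angle_lift_pm_shift[OF angle_lift_slift[OF assms(4)] assms(2,4,6)] by blast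
  show ?thesis unfolding comm_lift_def by (rule commutator_shift[OF s(1) i s(2) j, symmetric])
qed

lemma comm_lift_minus:
  assumes "det x = 1" "det y = 1"
  shows "comm_lift (- x) y = comm_lift x y" "comm_lift x (- y) = comm_lift x y"
  using comm_lift_eq[OF angle_lift_slift angle_lift_slift, of x y "- x" y]
    comm_lift_eq[OF angle_lift_slift angle_lift_slift, of x y x "- y"] assms
  by (simp_all add: comm_lift_def)

lemma angle_lift_comm:
  assumes "det x = 1" "det y = 1"
  shows "angle_lift (comm_mat x y) (comm_lift x y)"
  unfolding comm_lift_def comm_mat_def
  using assms by (intro angle_lift_comp angle_lift_inv angle_lift_slift)

lemma det_comm_mat: "det x = 1 \<Longrightarrow> det y = 1 \<Longrightarrow> det (comm_mat x y) = 1"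
  by (simp add: comm_mat_def det_mul)

lemma AL_comm: "det x = 1 \<Longrightarrow> det y = 1 \<Longrightarrow> comm_lift x y \<in> AL"
  using angle_lift_comm det_comm_mat AL_I by blast

lemma comm_lift_conj:
  assumes "det x = 1" "det y = 1" "trace x \<ge> 2"
  shows "comm_lift x y = plift x \<circ> plift (y ** sinv x ** sinv y)"
proof -
  have "comm_lift x y = plift x \<circ> slift y \<circ> finv (plift x) \<circ> finv (slift y)"
    by (rule comm_lift_eq) (use assms in \<open>auto intro: angle_lift_slift angle_lift_plift\<close>)
  also have "finv (plift x) = plift (sinv x)" using assms by (intro plift_sinv[symmetric]) auto
  also have "plift x \<circ> slift y \<circ> plift (sinv x) \<circ> finv (slift y) =
      plift x \<circ> (slift y \<circ> plift (sinv x) \<circ> finv (slift y))" by (simp add: comp_assoc)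
  also have "slift y \<circ> plift (sinv x) \<circ> finv (slift y) = plift (y ** sinv x ** sinv y)"
    using assms by (intro plift_conj angle_lift_slift) auto
  finally show ?thesis .
qed

lemma continuous_on_locally:
  assumes "\<And>x. x \<in> S \<Longrightarrow> \<exists>U. open U \<and> x \<in> U \<and> continuous_on (U \<inter> S) f"
  shows "continuous_on S f"
  unfolding continuous_on_topological
proof safe
  fix x B assume x: "x \<in> S" "open B" "f x \<in> B"
  obtain U where U: "open U" "x \<in> U" "continuous_on (U \<inter> S) f" using assms[OF x(1)] by blast
  obtain A where A: "open A" "x \<in> A" "\<forall>y\<in>U \<inter> S. y \<in> A \<longrightarrow> f y \<in> B"
    using U(3)[unfolded continuous_on_topological, rule_format, of x B] x U(2) by blast
  show "\<exists>A. open A \<and> x \<in> A \<and> (\<forall>y\<in>S. y \<in> A \<longrightarrow> f y \<in> B)"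
    using A U by (intro exI[of _ "A \<inter> U"]) auto
qed

lemma continuous_on_trace [continuous_intros]:
  fixes A :: "'a::topological_space \<Rightarrow> real^2^2"
  assumes "continuous_on S A"
  shows "continuous_on S (\<lambda>x. trace (A x))"
  unfolding trace_2 by (intro continuous_intros assms)

lemma slift_near:
  assumes "det x0 = 1" "det x = 1" "trace (sinv x0 ** x) > -2"
  shows "angle_lift x (slift x0 \<circ> plift (sinv x0 ** x))"
    "finv (slift x0 \<circ> plift (sinv x0 ** x)) = plift (sinv x ** x0) \<circ> finv (slift x0)"
proof -
  let ?A = "sinv x0 ** x"
  have d: "det ?A = 1" using assms by (simp add: det_mul)
  have "angle_lift (x0 ** ?A) (slift x0 \<circ> plift ?A)"
    using assms d by (intro angle_lift_comp angle_lift_slift angle_lift_plift)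
  then show "angle_lift x (slift x0 \<circ> plift ?A)" using assms by simp
  have "plift (sinv ?A) = finv (plift ?A)" using d assms by (intro plift_sinv)
  moreover have "sinv ?A = sinv x ** x0" by (simp add: sinv_mult_distrib)
  ultimately have e: "plift (sinv x ** x0) = finv (plift ?A)" by simp
  have AL: "slift x0 \<in> AL" "plift ?A \<in> AL"
    using AL_I[OF assms(1) angle_lift_slift[OF assms(1)]] AL_plift[OF d assms(3)] by auto
  show "finv (slift x0 \<circ> plift ?A) = plift (sinv x ** x0) \<circ> finv (slift x0)"
    unfolding e by (rule inv_equality) (auto simp: AL_inv_f AL_f_inv AL)
qed

lemma continuous_on_comm_lift:
  fixes x y :: "'a::topological_space \<Rightarrow> real^2^2"
  assumes x: "continuous_on S x" and y: "continuous_on S y" and t: "continuous_on S t"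
    and d: "\<And>m. m \<in> S \<Longrightarrow> det (x m) = 1" "\<And>m. m \<in> S \<Longrightarrow> det (y m) = 1"
  shows "continuous_on S (\<lambda>m. comm_lift (x m) (y m) (t m))"
proof (rule continuous_on_locally)
  fix m0 assume m0: "m0 \<in> S"
  define x0 y0 where "x0 = x m0" and "y0 = y m0"
  have d0: "det x0 = 1" "det y0 = 1" using d m0 by (auto simp: x0_def y0_def)
  have "continuous_on S (\<lambda>m. trace (sinv x0 ** x m))" "continuous_on S (\<lambda>m. trace (sinv y0 ** y m))"
    by (intro continuous_intros x y)+
  then have op: "openin (top_of_set S) (S \<inter> (\<lambda>m. trace (sinv x0 ** x m)) -` {-2<..})"
    "openin (top_of_set S) (S \<inter> (\<lambda>m. trace (sinv y0 ** y m)) -` {-2<..})"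
    by (auto intro: continuous_openin_preimage_gen)
  obtain U where U: "open U" "S \<inter> (\<lambda>m. trace (sinv x0 ** x m)) -` {-2<..} = S \<inter> U"
    using op(1) unfolding openin_open by blast
  obtain V where V: "open V" "S \<inter> (\<lambda>m. trace (sinv y0 ** y m)) -` {-2<..} = S \<inter> V"
    using op(2) unfolding openin_open by blast
  have tr2: "trace (mat 1 :: real^2^2) = 2" by (simp add: trace_2)
  have mU: "m0 \<in> U" "m0 \<in> V" using U(2) V(2) m0 d0 by (auto simp: x0_def y0_def sinv_mult tr2)
  define f h where "f = slift x0" and "h = slift y0"
  have AL: "f \<in> AL" "h \<in> AL" unfolding f_def h_def using AL_I angle_lift_slift d0 by blast+
  have tr: "trace (sinv x0 ** x m) > -2" "trace (sinv y0 ** y m) > -2" if "m \<in> (U \<inter> V) \<inter> S" for m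
    using U(2) V(2) that by auto
  have tr': "trace (sinv (x m) ** x0) > -2" "trace (sinv (y m) ** y0) > -2" if "m \<in> (U \<inter> V) \<inter> S" for m
    using tr[OF that] trace_sinv[of "sinv x0 ** x m"] trace_sinv[of "sinv y0 ** y m"]
    by (simp_all add: sinv_mult_distrib)
  have eq: "comm_lift (x m) (y m) (t m) = f (plift (sinv x0 ** x m) (h (plift (sinv y0 ** y m)
      (plift (sinv (x m) ** x0) (finv f (plift (sinv (y m) ** y0) (finv h (t m))))))))"
    if m: "m \<in> (U \<inter> V) \<inter> S" for m
  proof -
    have dm: "det (x m) = 1" "det (y m) = 1" using m d by auto
    note X = slift_near[OF d0(1) dm(1) tr(1)[OF m]] and Y = slift_near[OF d0(2) dm(2) tr(2)[OF m]]
    show ?thesis unfolding comm_lift_eq[OF X(1) Y(1) dm disjI1[OF HOL.refl] disjI1[OF HOL.refl]] X(2) Y(2)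
      by (simp add: f_def h_def)
  qed
  have sub: "(U \<inter> V) \<inter> S \<subseteq> S" by blast
  note cs = continuous_on_subset[OF x sub] continuous_on_subset[OF y sub] continuous_on_subset[OF t sub]
  have "continuous_on ((U \<inter> V) \<inter> S) (\<lambda>m. f (plift (sinv x0 ** x m) (h (plift (sinv y0 ** y m)
      (plift (sinv (x m) ** x0) (finv f (plift (sinv (y m) ** y0) (finv h (t m)))))))))"
    using d d0 tr tr'
    by (intro continuous_on_compose2[OF AL_cont[OF AL(1), of UNIV]] continuous_on_compose2[OF AL_cont[OF AL(2), of UNIV]]
       continuous_on_compose2[OF AL_cont[OF AL_inv[OF AL(1)], of UNIV]]
       continuous_on_compose2[OF AL_cont[OF AL_inv[OF AL(2)], of UNIV]] continuous_on_plift_joint continuous_intros cs)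
     (auto simp: det_mul)
  then have "continuous_on ((U \<inter> V) \<inter> S) (\<lambda>m. comm_lift (x m) (y m) (t m))"
    by (rule continuous_on_eq) (use eq in auto)
  then show "\<exists>W. open W \<and> m0 \<in> W \<and> continuous_on (W \<inter> S) (\<lambda>m. comm_lift (x m) (y m) (t m))"
    using U V mU by (intro exI[of _ "U \<inter> V"]) auto
qed

lemma comm_lift_const_on_path:
  fixes x y :: "real \<Rightarrow> real^2^2"
  assumes "connected I" "continuous_on I x" "continuous_on I y"
    and d: "\<And>t. t \<in> I \<Longrightarrow> det (x t) = 1" "\<And>t. t \<in> I \<Longrightarrow> det (y t) = 1"
    and c: "\<And>t. t \<in> I \<Longrightarrow> comm_mat (x t) (y t) = C" and st: "s \<in> I" "t \<in> I"
  shows "comm_lift (x s) (y s) = comm_lift (x t) (y t)"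
proof -
  define F where "F r = (comm_lift (x r) (y r) 0 - comm_lift (x t) (y t) 0) / (2 * pi)" for r
  have al: "angle_lift C (comm_lift (x r) (y r))" if "r \<in> I" for r
    using angle_lift_comm[OF d(1)[OF that] d(2)[OF that]] c[OF that] by simp
  have "F r \<in> \<int>" if r: "r \<in> I" for r
  proof -
    obtain j :: int where "\<And>u. comm_lift (x r) (y r) u = comm_lift (x t) (y t) u + 2 * pi * of_int j"
      using angle_lift_unique[OF al[OF r] al[OF st(2)]] by blast
    then show ?thesis by (simp add: F_def)
  qed
  moreover have "continuous_on I F"
    unfolding F_def by (intro continuous_intros continuous_on_comm_lift assms) auto
  ultimately have "F s = F t" using connected_int_valued_const[OF assms(1)] st by blast
  then have "comm_lift (x s) (y s) 0 = comm_lift (x t) (y t) 0" by (simp add: F_def)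
  then show ?thesis by (rule angle_lift_eqI[OF al[OF st(1)] al[OF st(2)]])
qed


subsection \<open>Products with commutators\<close>

definition handle_set :: "int \<Rightarrow> int \<Rightarrow> (real \<Rightarrow> real) \<Rightarrow> ((real^2^2) \<times> (real^2^2)) set" where
  "handle_set a b h = {(x, y). det x = 1 \<and> det y = 1 \<and> disp_range a b (h \<circ> comm_lift x y)}"

lemma handle_set_minus:
  "(- x, y) \<in> handle_set a b h \<longleftrightarrow> (x, y) \<in> handle_set a b h"
  "(x, - y) \<in> handle_set a b h \<longleftrightarrow> (x, y) \<in> handle_set a b h"
  by (auto simp: handle_set_def comm_lift_minus)

lemma continuous_on_h_comm:
  assumes "h \<in> AL" "continuous_on S x" "continuous_on S y"
    "\<And>m. m \<in> S \<Longrightarrow> det (x m) = 1" "\<And>m. m \<in> S \<Longrightarrow> det (y m) = 1"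
  shows "continuous_on S (\<lambda>m. (h \<circ> comm_lift (x m) (y m)) t)"
  unfolding comp_def
  by (intro continuous_on_compose2[OF AL_cont[OF assms(1), of UNIV]] continuous_on_comm_lift assms
    continuous_intros) auto

lemma handle_set_nhd:
  assumes h: "h \<in> AL" and "(x, y) \<in> handle_set a b h"
  obtains U where "open U" "(x, y) \<in> U"
    "\<And>x' y'. (x', y') \<in> U \<Longrightarrow> det x' = 1 \<Longrightarrow> det y' = 1 \<Longrightarrow> (x', y') \<in> handle_set a b h"
proof -
  let ?S = "{p :: (real^2^2) \<times> (real^2^2). det (fst p) = 1 \<and> det (snd p) = 1}"
  have xy: "(x, y) \<in> ?S" "disp_range a b (h \<circ> comm_lift (fst (x, y)) (snd (x, y)))"
    using assms(2) by (auto simp: handle_set_def)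
  have "continuous_on ?S (\<lambda>p. (h \<circ> comm_lift (fst p) (snd p)) t)" for t
    by (intro continuous_on_h_comm h continuous_intros) auto
  from disp_range_nhd[of ?S "\<lambda>p. h \<circ> comm_lift (fst p) (snd p)", OF this xy]
  obtain U where "open U" "(x, y) \<in> U"
    "\<And>p. p \<in> U \<Longrightarrow> p \<in> ?S \<Longrightarrow> disp_range a b (h \<circ> comm_lift (fst p) (snd p))" by blast
  then show thesis by (intro that[of U]) (auto simp: handle_set_def)
qed

definition sign_inv :: "((real^2^2) \<times> (real^2^2)) set \<Rightarrow> ((real^2^2) \<times> (real^2^2) \<Rightarrow> 'v) \<Rightarrow> bool" where
  "sign_inv T g \<longleftrightarrow> (\<forall>x y. (x, y) \<in> T \<longrightarrow> g (- x, y) = g (x, y) \<and> g (x, - y) = g (x, y))"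

lemma handle_perturb:
  assumes h: "h \<in> AL" and g: "loc_const (handle_set a b h) g" and p: "\<gamma> 0 \<in> handle_set a b h"
    and c: "continuous_on {0..<1} \<gamma>" and d: "\<And>t. 0 \<le> t \<Longrightarrow> t < 1 \<Longrightarrow> det (fst (\<gamma> t)) = 1 \<and> det (snd (\<gamma> t)) = 1"
  obtains \<epsilon> :: real where "0 < \<epsilon>" "\<epsilon> < 1" "\<gamma> \<epsilon> \<in> handle_set a b h" "g (\<gamma> \<epsilon>) = g (\<gamma> 0)"
proof -
  obtain x y where xy: "\<gamma> 0 = (x, y)" by (cases "\<gamma> 0")
  obtain U where U: "open U" "(x, y) \<in> U"
    "\<And>x' y'. (x', y') \<in> U \<Longrightarrow> det x' = 1 \<Longrightarrow> det y' = 1 \<Longrightarrow> (x', y') \<in> handle_set a b h"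
    using handle_set_nhd[OF h p[unfolded xy]] by blast
  obtain V where V: "open V" "\<gamma> 0 \<in> V" "\<And>y. y \<in> V \<Longrightarrow> y \<in> handle_set a b h \<Longrightarrow> g y = g (\<gamma> 0)"
    using loc_constE[OF g p] by blast
  have "open (U \<inter> V)" "\<gamma> 0 \<in> U \<inter> V" using U V xy by auto
  then obtain W where W: "open W" "0 \<in> W" "\<forall>t\<in>{0..<1}. t \<in> W \<longrightarrow> \<gamma> t \<in> U \<inter> V"
    using c[unfolded continuous_on_topological, rule_format, of 0 "U \<inter> V"] by auto
  obtain e where e: "e > 0" "ball 0 e \<subseteq> W" using W(1,2) open_contains_ball by blast
  define \<epsilon> where "\<epsilon> = min (e / 2) (1 / 2)"
  have \<epsilon>: "0 < \<epsilon>" "\<epsilon> < 1" "\<epsilon> \<in> W" using e by (auto simp: \<epsilon>_def)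
  then have uv: "\<gamma> \<epsilon> \<in> U" "\<gamma> \<epsilon> \<in> V" using W(3) by auto
  have "\<gamma> \<epsilon> \<in> handle_set a b h" using U(3)[of "fst (\<gamma> \<epsilon>)" "snd (\<gamma> \<epsilon>)"] uv(1) d[of \<epsilon>] \<epsilon> by simp
  then show thesis using that \<epsilon> V(3) uv by blast
qed

lemma handle_path:
  fixes x y :: "real \<Rightarrow> real^2^2"
  assumes g: "loc_const (handle_set a b h) g"
    and I: "connected I" "continuous_on I x" "continuous_on I y"
    and d: "\<And>t. t \<in> I \<Longrightarrow> det (x t) = 1" "\<And>t. t \<in> I \<Longrightarrow> det (y t) = 1"
    and c: "\<And>t. t \<in> I \<Longrightarrow> comm_mat (x t) (y t) = C" and st: "s \<in> I" "t \<in> I"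
    and xs: "(x s, y s) \<in> handle_set a b h"
  shows "(x t, y t) \<in> handle_set a b h" "g (x t, y t) = g (x s, y s)"
proof -
  have all: "(x r, y r) \<in> handle_set a b h" if "r \<in> I" for r
    using comm_lift_const_on_path[OF I d c st(1) that] xs d[OF that] by (simp add: handle_set_def)
  then show "(x t, y t) \<in> handle_set a b h" using st by blast
  show "g (x t, y t) = g (x s, y s)"
    by (rule loc_const_path[OF g I(1), of "\<lambda>t. (x t, y t)"])
      (use all st I in \<open>auto intro!: continuous_intros\<close>)
qed

lemma comm_mat_commute_right:
  assumes "det x = 1" "det y = 1" "det k = 1" "k ** y = y ** k"
  shows "comm_mat (x ** k) y = comm_mat x y"
proof -
  have "comm_mat (x ** k) y = x ** (k ** y) ** sinv k ** sinv x ** sinv y"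
    by (simp add: comm_mat_def sinv_mult_distrib matrix_mul_assoc)
  also have "\<dots> = x ** y ** (k ** sinv k) ** sinv x ** sinv y"
    by (simp add: assms(4) matrix_mul_assoc)
  finally show ?thesis by (simp add: comm_mat_def sinv_mult assms)
qed

lemma comm_mat_commute_left:
  assumes "det x = 1" "det y = 1" "det k = 1" "k ** x = x ** k"
  shows "comm_mat x (y ** k) = comm_mat x y"
proof -
  have "k ** sinv x = sinv x ** (x ** k) ** sinv x" using assms by (simp add: sinv_mult matrix_mul_assoc)
  also have "\<dots> = sinv x ** k ** (x ** sinv x)" by (simp only: assms(4)[symmetric] matrix_mul_assoc)
  finally have kx: "k ** sinv x = sinv x ** k" by (simp add: sinv_mult assms)
  have "comm_mat x (y ** k) = x ** y ** (k ** sinv x) ** sinv k ** sinv y"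
    by (simp add: comm_mat_def sinv_mult_distrib matrix_mul_assoc)
  also have "\<dots> = x ** y ** sinv x ** (k ** sinv k) ** sinv y"
    unfolding kx by (simp add: matrix_mul_assoc)
  finally show ?thesis by (simp add: comm_mat_def sinv_mult assms)
qed

text \<open>The conjugator taking the diagonal form to \<open>cc l \<beta> s\<close>.\<close>

definition frame :: "real \<Rightarrow> real \<Rightarrow> real \<Rightarrow> real^2^2" where
  "frame l \<beta> s = rot \<beta> ** tri 1 (s / (1 / l - l))"

lemma det_frame [simp]: "det (frame l \<beta> s) = 1"
  by (simp add: frame_def det_mul)

lemma sinv_tri: "l \<noteq> 0 \<Longrightarrow> sinv (tri l s) = tri (1 / l) (- s)"
  by (simp add: sinv_def tri_def mat2_eq_iff)

lemma cc_frame: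
  assumes "0 < l" "l < 1"
  shows "cc l \<beta> s = frame l \<beta> s ** tri l 0 ** sinv (frame l \<beta> s)"
proof -
  define \<tau> where "\<tau> = s / (1 / l - l)"
  have "l * l < 1 * 1" using assms by (intro mult_strict_mono) auto
  then have "1 / l - l \<noteq> 0" using assms by (simp add: field_simps)
  then have \<tau>: "\<tau> * (1 / l - l) = s" by (simp add: \<tau>_def)
  have "tri 1 \<tau> ** tri l 0 ** tri 1 (- \<tau>) = tri l s"
    using assms \<tau> by (simp add: tri_mult algebra_simps)
  then have "rot \<beta> ** (tri 1 \<tau> ** tri l 0 ** tri 1 (- \<tau>)) ** rot (- \<beta>) = cc l \<beta> s"
    by (simp add: cc_def)
  then show ?thesis
    by (simp add: frame_def sinv_mult_distrib sinv_rot sinv_tri \<tau>_def matrix_mul_assoc)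
qed

lemma frame_add_pi: "frame l (\<beta> + pi) s = - frame l \<beta> s"
  by (simp add: frame_def rot_add_pi)

lemma continuous_on_rot [continuous_intros]:
  fixes S :: "'a::t2_space set"
  assumes "continuous_on S \<beta>" shows "continuous_on S (\<lambda>x. rot (\<beta> x))"
  unfolding rot_def by (intro continuous_intros assms)

lemma continuous_on_tri [continuous_intros]:
  assumes "continuous_on S l" "continuous_on S s" "\<And>x. x \<in> S \<Longrightarrow> l x \<noteq> 0"
  shows "continuous_on S (\<lambda>x. tri (l x) (s x))"
  unfolding tri_def by (intro continuous_intros assms) (use assms in auto)

lemma continuous_on_frame [continuous_intros]:
  fixes S :: "'a::t2_space set"
  assumes "continuous_on S \<beta>" "continuous_on S s" "1 / l - l \<noteq> 0"
  shows "continuous_on S (\<lambda>x. frame l (\<beta> x) (s x))"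
  unfolding frame_def by (intro continuous_intros assms) (use assms in auto)

lemma iwasawa:
  assumes "det B = 1"
  obtains \<beta> r s where "r > 0" "B = rot \<beta> ** tri r s"
proof -
  obtain r where r: "r > 0" "mact B (cis 0) = r *\<^sub>R cis (slift B 0)"
    using angle_liftE[OF angle_lift_slift[OF assms]] by blast
  define \<beta> where "\<beta> = slift B 0"
  define T where "T = rot (- \<beta>) ** B"
  have dT: "det T = 1" using assms by (simp add: T_def det_mul)
  have "mact T (cis 0) = r *\<^sub>R cis 0"
    unfolding T_def mact_mult r(2) by (simp add: mact_rot \<beta>_def cis_mult)
  then have "T$1$1 = r" "T$2$1 = 0" by (simp_all add: mact_def complex_eq_iff)
  then have "T = tri r (T$1$2)" using dT r(1) by (simp add: mat2_eq_iff tri_def det_2 field_simps)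
  moreover have "B = rot \<beta> ** T" by (simp add: T_def matrix_mul_assoc rot_add)
  ultimately show thesis using that r(1) by metis
qed

text \<open>For fixed hyperbolic \<open>x\<close>, the pair \<open>(x, y)\<close> is determined by the conjugate of \<open>x\<inverse>\<close> by \<open>y\<close> up to
  the centraliser of \<open>x\<close>, which is connected modulo signs.\<close>

lemma handle_fibre_const:
  assumes h: "h \<in> AL" and ab: "a \<le> b" and g: "loc_const (handle_set a b h) g" and si: "sign_inv (handle_set a b h) g"
    and tx: "trace x > 2" and y: "(x, y) \<in> handle_set a b h" "(x, y') \<in> handle_set a b h"
  shows "g (x, y) = g (x, y')"
proof -
  have dx: "det x = 1" using y by (simp add: handle_set_def)
  obtain l \<beta>0 s0 where l: "0 < l" "l < 1" "sinv x = cc l \<beta>0 s0"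
    using hyperbolic_normal_form[of "sinv x"] dx tx by auto
  have "l * l < 1 * 1" using l by (intro mult_strict_mono) auto
  then have lne: "1 / l - l \<noteq> 0" using l by (simp add: field_simps)
  define F0 where "F0 = frame l \<beta>0 s0"
  have dF0: "det F0 = 1" by (simp add: F0_def)
  have xF: "sinv x = F0 ** tri l 0 ** sinv F0" using cc_frame[OF l(1,2)] l(3) by (simp add: F0_def)
  define Y where "Y p = frame l (fst p) (snd p) ** sinv F0" for p
  define k where "k = h \<circ> plift x"
  have k: "k \<in> AL" unfolding k_def using AL_comp[OF h AL_plift[OF dx]] tx by simp
  have conj: "Y p ** sinv x ** sinv (Y p) = cc l (fst p) (snd p)" for p
  proof -
    have "Y p ** sinv x ** sinv (Y p) = frame l (fst p) (snd p) ** (sinv F0 ** F0) ** tri l 0 **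
        (sinv F0 ** F0) ** sinv (frame l (fst p) (snd p))"
      unfolding Y_def xF sinv_mult_distrib sinv_sinv by (simp only: matrix_mul_assoc)
    then show ?thesis by (simp add: sinv_mult dF0 cc_frame[OF l(1,2)])
  qed
  have dY: "det (Y p) = 1" for p by (simp add: Y_def det_mul dF0)
  have inT: "(x, Y p) \<in> handle_set a b h \<longleftrightarrow> disp_range a b (k \<circ> plift (cc l (fst p) (snd p)))" for p
    using dx dY[of p] tx by (simp add: handle_set_def comm_lift_conj conj k_def comp_assoc)
  let ?S = "{p. snd p \<in> class_params l \<and> disp_range a b (k \<circ> plift (cc l (fst p) (snd p)))}"
  define G where "G p = (if (x, Y p) \<in> handle_set a b h then g (x, Y p) else undefined)" for p
  have "loc_const ?S (\<lambda>p. g (x, Y p))"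
  proof (rule loc_const_compose[OF g])
    show "continuous_on ?S (\<lambda>p. (x, Y p))"
      unfolding Y_def by (intro continuous_intros lne)
    show "(\<lambda>p. (x, Y p)) ` ?S \<subseteq> handle_set a b h" using inT by auto
  qed
  then have lG: "loc_const ?S G"
    by (rule loc_const_cong) (simp add: G_def inT)
  have per: "G (\<beta> + pi, s) = G (\<beta>, s)" for \<beta> s
  proof -
    have "Y (\<beta> + pi, s) = - Y (\<beta>, s)" by (simp add: Y_def frame_add_pi)
    then show ?thesis using si by (simp add: G_def sign_inv_def handle_set_minus)
  qed
  have rep: "\<exists>p\<in>?S. g (x, y) = g (x, Y p)" if "(x, y) \<in> handle_set a b h" for y
  proof -
    have dy: "det y = 1" using that by (simp add: handle_set_def)
    have "det (y ** F0) = 1" by (simp add: det_mul dy dF0)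
    then obtain \<beta> r s where r: "r > 0" "y ** F0 = rot \<beta> ** tri r s" using iwasawa by blast
    define \<tau> where "\<tau> = s * r"
    define p where "p = (\<beta>, \<tau> * (1 / l - l))"
    define \<gamma> where "\<gamma> \<rho> = rot \<beta> ** tri 1 \<tau> ** tri \<rho> 0 ** sinv F0" for \<rho>
    have fr: "frame l (fst p) (snd p) = rot \<beta> ** tri 1 \<tau>" using lne by (simp add: frame_def p_def)
    have \<gamma>1: "\<gamma> 1 = Y p" by (simp add: \<gamma>_def Y_def fr)
    have "tri 1 \<tau> ** tri r 0 = tri r s" using r(1) by (simp add: tri_mult \<tau>_def)
    then have "\<gamma> r = (rot \<beta> ** tri r s) ** sinv F0" by (simp add: \<gamma>_def flip: matrix_mul_assoc)
    then have \<gamma>r: "\<gamma> r = y" unfolding r(2)[symmetric] by (simp add: dF0 sinv_mult flip: matrix_mul_assoc)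
    have d\<gamma>: "det (\<gamma> \<rho>) = 1" if "\<rho> \<in> {0<..}" for \<rho> using that by (simp add: \<gamma>_def det_mul dF0)
    have com: "comm_mat x (\<gamma> \<rho>) = comm_mat x (Y p)" if "\<rho> \<in> {0<..}" for \<rho>
    proof -
      have "\<gamma> \<rho> = Y p ** (F0 ** tri \<rho> 0 ** sinv F0)"
        unfolding \<gamma>_def Y_def fr by (simp add: matrix_mul_assoc) (simp add: sinv_mult dF0 flip: matrix_mul_assoc)
      moreover have "comm_mat x (Y p ** (F0 ** tri \<rho> 0 ** sinv F0)) = comm_mat x (Y p)"
      proof (rule comm_mat_commute_left[OF dx dY])
        show "det (F0 ** tri \<rho> 0 ** sinv F0) = 1" using that by (simp add: det_mul dF0)
        have x: "x = F0 ** tri (1 / l) 0 ** sinv F0"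
        proof -
          have "sinv (sinv x) = F0 ** tri (1 / l) 0 ** sinv F0"
            unfolding xF using l by (simp add: sinv_mult_distrib sinv_tri matrix_mul_assoc)
          then show ?thesis by simp
        qed
        have *: "(F0 ** A ** sinv F0) ** (F0 ** B ** sinv F0) = F0 ** (A ** B) ** sinv F0" for A B
        proof -
          have "(F0 ** A ** sinv F0) ** (F0 ** B ** sinv F0) = F0 ** A ** (sinv F0 ** F0) ** B ** sinv F0"
            by (simp only: matrix_mul_assoc)
          then show ?thesis by (simp add: sinv_mult dF0 matrix_mul_assoc)
        qed
        show "F0 ** tri \<rho> 0 ** sinv F0 ** x = x ** (F0 ** tri \<rho> 0 ** sinv F0)"
          unfolding x * using that l by (simp add: tri_mult mult.commute)
      qed
      ultimately show ?thesis by simp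
    qed
    have cont: "continuous_on {0<..} \<gamma>" unfolding \<gamma>_def by (intro continuous_intros) auto
    note P = handle_path[OF g, of "{0<..}" "\<lambda>_. x" \<gamma> "comm_mat x (Y p)" r 1]
    have "(x, \<gamma> 1) \<in> handle_set a b h" "g (x, \<gamma> 1) = g (x, \<gamma> r)"
      using P d\<gamma> com cont dx r(1) that \<gamma>r by (auto intro!: continuous_intros)
    then show ?thesis using inT[of p] \<gamma>1 \<gamma>r l by (intro bexI[of _ p]) (auto simp: class_params_def)
  qed
  obtain p where p: "p \<in> ?S" "g (x, y) = g (x, Y p)" using rep[OF y(1)] by blast
  obtain q where q: "q \<in> ?S" "g (x, y') = g (x, Y q)" using rep[OF y(2)] by blast
  have "G (fst p, snd p) = G (fst q, snd q)"
    by (rule class_product_const[OF k l(1) less_imp_le[OF l(2)] ab lG per]) (use p q in auto)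
  then show ?thesis using p q by (simp add: G_def inT)
qed

lemma handle_hyperbolic_projection:
  assumes h: "h \<in> AL" and ab: "a \<le> b" and S: "S = {p \<in> handle_set a b h. trace (fst p) > 2}"
  shows "fst ` S = product_set 0 (a - 1) (b + 1) h"
proof safe
    fix x y assume "(x, y) \<in> S"
    then have xy: "det x = 1" "det y = 1" "trace x > 2" "disp_range a b (h \<circ> comm_lift x y)"
      by (auto simp: S handle_set_def)
    have "disp_range a b ((h \<circ> plift x) \<circ> plift (y ** sinv x ** sinv y))"
      using xy by (simp add: comm_lift_conj comp_assoc)
    then have "y ** sinv x ** sinv y \<in> product_set 0 a b (h \<circ> plift x)"
      using xy by (simp add: product_set_def sign_class_def det_mul trace_conj)
    then have "disp_range (a - 1) (b + 1) (h \<circ> plift x)"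
      using product_set_hyperbolic_nonempty[OF AL_comp[OF h AL_plift] ab, of x] xy by auto
    then show "fst (x, y) \<in> product_set 0 (a - 1) (b + 1) h"
      using xy by (simp add: product_set_def sign_class_def)
next
    fix x assume "x \<in> product_set 0 (a - 1) (b + 1) h"
    then have x: "det x = 1" "trace x > 2" "disp_range (a - 1) (b + 1) (h \<circ> plift x)"
      by (auto simp: product_set_def sign_class_def)
    obtain l \<beta>0 s0 where l: "0 < l" "l < 1" "sinv x = cc l \<beta>0 s0"
      using hyperbolic_normal_form[of "sinv x"] x by auto
    have k: "h \<circ> plift x \<in> AL" using AL_comp[OF h AL_plift] x by simp
    obtain \<beta> s where d: "disp_range a b ((h \<circ> plift x) \<circ> plift (cc l \<beta> s))"
      using class_product_nonempty[OF k l(1) _ ab] x(3) l(2) by auto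
    define y where "y = frame l \<beta> s ** sinv (frame l \<beta>0 s0)"
    have y: "det y = 1" by (simp add: y_def det_mul)
    have "y ** sinv x ** sinv y = frame l \<beta> s ** (sinv (frame l \<beta>0 s0) ** frame l \<beta>0 s0) ** tri l 0 **
        (sinv (frame l \<beta>0 s0) ** frame l \<beta>0 s0) ** sinv (frame l \<beta> s)"
      unfolding y_def l(3) cc_frame[OF l(1,2)] sinv_mult_distrib sinv_sinv by (simp only: matrix_mul_assoc)
    then have "y ** sinv x ** sinv y = cc l \<beta> s" by (simp add: sinv_mult cc_frame[OF l(1,2)])
    then have "(x, y) \<in> S" using d x y by (simp add: S handle_set_def comm_lift_conj comp_assoc)
    then show "x \<in> fst ` S" by force
qed

lemma handle_hyperbolic_const:
  assumes h: "h \<in> AL" and ab: "a \<le> b" and g: "loc_const (handle_set a b h) g" and si: "sign_inv (handle_set a b h) g"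
    and p: "(x, y) \<in> handle_set a b h" "trace x > 2" "(x', y') \<in> handle_set a b h" "trace x' > 2"
  shows "g (x, y) = g (x', y')"
proof -
  define S where "S = {p \<in> handle_set a b h. trace (fst p) > 2}"
  have lS: "loc_const S g" by (rule loc_const_subset[OF g]) (auto simp: S_def)
  have fS: "fst ` S = product_set 0 (a - 1) (b + 1) h"
    by (rule handle_hyperbolic_projection[OF h ab S_def])
  obtain G where G: "loc_const (fst ` S) G" "\<And>p. p \<in> S \<Longrightarrow> g p = G (fst p)"
  proof (rule loc_const_fibration[OF lS, of fst])
    fix p q assume "p \<in> S" "q \<in> S" "fst p = fst q"
    then show "g p = g q"
      using handle_fibre_const[OF h ab g si, of "fst p" "snd p" "snd q"]
      by (cases p; cases q) (auto simp: S_def)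
  next
    fix p assume p: "p \<in> S"
    obtain x y where xy: "p = (x, y)" by (cases p)
    have T: "(x, y) \<in> handle_set a b h" using p xy by (auto simp: S_def)
    then have dy: "det y = 1" by (simp add: handle_set_def)
    obtain U where U: "open U" "(x, y) \<in> U"
      "\<And>x' y'. (x', y') \<in> U \<Longrightarrow> det x' = 1 \<Longrightarrow> det y' = 1 \<Longrightarrow> (x', y') \<in> handle_set a b h"
      using handle_set_nhd[OF h T] by blast
    obtain N W where N: "open N" "x \<in> N" "y \<in> W" "N \<times> W \<subseteq> U" by (rule open_prod_elim[OF U(1,2)]) auto
    have "(x', y) \<in> S" if "x' \<in> N" "x' \<in> fst ` S" for x'
    proof -
      have "det x' = 1" "trace x' > 2" using that(2) by (auto simp: S_def handle_set_def)
      then show ?thesis using U(3)[of x' y] N that dy by (auto simp: S_def)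
    qed
    then show "\<exists>N \<sigma>. open N \<and> fst p \<in> N \<and> continuous_on (N \<inter> fst ` S) \<sigma> \<and> \<sigma> (fst p) = p \<and>
        (\<forall>b\<in>N \<inter> fst ` S. \<sigma> b \<in> S \<and> fst (\<sigma> b) = b)"
      using N(1,2) by (intro exI[of _ N] exI[of _ "\<lambda>x. (x, y)"]) (auto simp: xy intro!: continuous_intros)
  qed (use that in blast)
  have S: "(x, y) \<in> S" "(x', y') \<in> S" using p by (auto simp: S_def)
  then have "x \<in> fst ` S" "x' \<in> fst ` S" by force+
  then have x: "x \<in> product_set 0 (a - 1) (b + 1) h" "x' \<in> product_set 0 (a - 1) (b + 1) h"
    unfolding fS .
  have ab': "a - 1 \<le> b + 1" using ab by simp
  have "G x = G x'" by (rule product_set_hyperbolic_const[OF h ab' G(1)[unfolded fS] x])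
  then show ?thesis using G(2)[OF S(1)] G(2)[OF S(2)] by simp
qed

lemma sum_squares_polar:
  obtains \<phi> :: real where "A * cos \<phi> + B * sin \<phi> = sqrt (A\<^sup>2 + B\<^sup>2)"
proof (cases "A = 0 \<and> B = 0")
  case True
  then show thesis using that[of 0] by simp
next
  case False
  define z where "z = Complex A B"
  have z: "z \<noteq> 0" using False by (auto simp: z_def complex_eq_iff)
  have "z = cmod z *\<^sub>R cis (Arg z)" by (metis rcis_cmod_Arg rcis_def scaleR_conv_of_real)
  then have AB: "A = cmod z * cos (Arg z)" "B = cmod z * sin (Arg z)"
    by (simp_all add: z_def complex_eq_iff)
  have "A * c + B * s = r" if "A = r * c" "B = r * s" "c\<^sup>2 + s\<^sup>2 = 1" for r c s :: real
  proof -
    have "A * c + B * s = r * (c\<^sup>2 + s\<^sup>2)" unfolding that(1,2) by (simp add: power2_eq_square algebra_simps)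
    then show ?thesis using that(3) by simp
  qed
  from this[OF AB] have "A * cos (Arg z) + B * sin (Arg z) = cmod z" by simp
  then show thesis using that by (simp add: z_def cmod_def)
qed

definition hyperbolic_reachable ::
    "(real \<Rightarrow> real) \<Rightarrow> int \<Rightarrow> int \<Rightarrow> ((real^2^2) \<times> (real^2^2) \<Rightarrow> 'v) \<Rightarrow> real^2^2 \<Rightarrow> real^2^2 \<Rightarrow> bool" where
  "hyperbolic_reachable h a b g x y \<longleftrightarrow>
     (\<exists>x' y'. (x', y') \<in> handle_set a b h \<and> trace x' > 2 \<and> g (x', y') = g (x, y))"

context
  fixes h :: "real \<Rightarrow> real" and a b :: int and g :: "(real^2^2) \<times> (real^2^2) \<Rightarrow> 'v"
  assumes h: "h \<in> AL" and g: "loc_const (handle_set a b h) g" and si: "sign_inv (handle_set a b h) g"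
begin

abbreviation "hyp_reachable \<equiv> hyperbolic_reachable h a b g"
lemmas hyp_reachable_def = hyperbolic_reachable_def[of h a b g]

lemma hyp_reachable_trans:
  "(x', y') \<in> handle_set a b h \<Longrightarrow> g (x', y') = g (x, y) \<Longrightarrow> hyp_reachable x' y' \<Longrightarrow> hyp_reachable x y"
  unfolding hyp_reachable_def by auto

lemma hyp_reachable_minus:
  assumes "(x, y) \<in> handle_set a b h"
  shows "hyp_reachable (- x) y \<Longrightarrow> hyp_reachable x y" "hyp_reachable x (- y) \<Longrightarrow> hyp_reachable x y"
  using si assms unfolding sign_inv_def hyp_reachable_def by auto

lemma hyp_reachable_abs:
  assumes "(x, y) \<in> handle_set a b h" "\<bar>trace x\<bar> > 2"
  shows "hyp_reachable x y"
proof (cases "trace x > 2")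
  case True
  then show ?thesis using assms unfolding hyp_reachable_def by blast
next
  case False
  then have "trace (- x) > 2" using assms(2) by simp
  then have "hyp_reachable (- x) y"
    using assms handle_set_minus(1)[of x y a b h] unfolding hyp_reachable_def by blast
  then show ?thesis by (rule hyp_reachable_minus(1)[OF assms(1)])
qed

lemma conj_mult:
  assumes "det (F::real^2^2) = 1"
  shows "(F ** A ** sinv F) ** (F ** B ** sinv F) = F ** (A ** B) ** sinv F"
proof -
  have "(F ** A ** sinv F) ** (F ** B ** sinv F) = F ** A ** (sinv F ** F) ** B ** sinv F"
    by (simp only: matrix_mul_assoc)
  then show ?thesis by (simp add: sinv_mult assms matrix_mul_assoc)
qed

lemma conj_conj:
  assumes "det (F::real^2^2) = 1"
  shows "F ** (sinv F ** A ** F) ** sinv F = A"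
proof -
  have "F ** (sinv F ** A ** F) ** sinv F = (F ** sinv F) ** A ** (F ** sinv F)"
    by (simp only: matrix_mul_assoc)
  then show ?thesis by (simp add: sinv_mult assms)
qed

lemma hyp_reachable_of_hyp_right1:
  assumes T: "(x, y) \<in> handle_set a b h" and F: "det F = 1" and l: "0 < l" "y = F ** tri l 0 ** sinv F"
    and pq: "(sinv F ** x ** F)$1$1 \<noteq> 0 \<or> (sinv F ** x ** F)$2$2 \<noteq> 0"
  shows "hyp_reachable x y"
proof -
  have dx: "det x = 1" "det y = 1" using T by (auto simp: handle_set_def)
  define X where "X = sinv F ** x ** F"
  have xX: "x = F ** X ** sinv F" by (simp add: X_def conj_conj F)
  define K where "K \<rho> = F ** tri \<rho> 0 ** sinv F" for \<rho>
  have dK: "det (K \<rho>) = 1" if "\<rho> \<in> {0<..}" for \<rho> using that by (simp add: K_def det_mul F)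
  have com: "comm_mat (x ** K \<rho>) y = comm_mat x y" if "\<rho> \<in> {0<..}" for \<rho>
    by (rule comm_mat_commute_right[OF dx dK[OF that]])
      (use that l in \<open>simp add: K_def conj_mult F tri_mult mult.commute\<close>)
  have cont: "continuous_on {0<..} (\<lambda>\<rho>. x ** K \<rho>)" unfolding K_def by (intro continuous_intros) auto
  have K1: "K 1 = mat 1" by (simp add: K_def sinv_mult F)
  have P: "(x ** K \<rho>, y) \<in> handle_set a b h" "g (x ** K \<rho>, y) = g (x, y)" if "\<rho> > 0" for \<rho>
    using handle_path[OF g, of "{0<..}" "\<lambda>\<rho>. x ** K \<rho>" "\<lambda>_. y" "comm_mat x y" 1 \<rho>]
      cont com dK dx T that by (auto simp: det_mul K1 intro!: continuous_intros)
  have tr: "trace (x ** K \<rho>) = X$1$1 * \<rho> + X$2$2 / \<rho>" for \<rho>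
  proof -
    have "x ** K \<rho> = F ** (X ** tri \<rho> 0) ** sinv F" unfolding xX K_def by (rule conj_mult[OF F])
    then have "trace (x ** K \<rho>) = trace (X ** tri \<rho> 0)" by (simp only: trace_conj[OF F])
    then show ?thesis by (simp add: trace_2 tri_def)
  qed
  obtain \<rho> where \<rho>: "\<rho> > 0" "\<bar>X$1$1 * \<rho> + X$2$2 / \<rho>\<bar> > 2"
  proof (cases "X$1$1 = 0")
    case False
    define \<rho> where "\<rho> = (\<bar>X$2$2\<bar> + 3) / \<bar>X$1$1\<bar> + 1"
    have r1: "\<rho> \<ge> 1" by (simp add: \<rho>_def)
    have "\<bar>X$1$1 * \<rho>\<bar> = \<bar>X$2$2\<bar> + 3 + \<bar>X$1$1\<bar>"
      using False r1 by (simp add: abs_mult) (simp add: \<rho>_def field_simps)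
    moreover have "\<bar>X$2$2\<bar> / \<rho> \<le> \<bar>X$2$2\<bar> / 1" using r1 by (intro divide_left_mono) auto
    then have "\<bar>X$2$2 / \<rho>\<bar> \<le> \<bar>X$2$2\<bar>" using r1 by (simp add: abs_divide)
    ultimately have "\<bar>X$1$1 * \<rho> + X$2$2 / \<rho>\<bar> > 2" by linarith
    then show thesis using that[of \<rho>] r1 by simp
  next
    case True
    then have s: "X$2$2 \<noteq> 0" using pq by (simp add: X_def)
    then show thesis using that[of "\<bar>X$2$2\<bar> / 3"] True by (simp add: abs_divide abs_mult)
  qed
  have "hyp_reachable (x ** K \<rho>) y" by (rule hyp_reachable_abs[OF P(1)[OF \<rho>(1)]]) (simp add: tr \<rho>)
  then show ?thesis by (rule hyp_reachable_trans[OF P[OF \<rho>(1)]])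
qed

lemma hyp_reachable_of_hyp_right2:
  assumes T: "(x, y) \<in> handle_set a b h" and ty: "trace y > 2"
  shows "hyp_reachable x y"
proof -
  have dx: "det x = 1" "det y = 1" using T by (auto simp: handle_set_def)
  obtain l \<beta> s where l: "0 < l" "l < 1" "y = cc l \<beta> s" using hyperbolic_normal_form[OF dx(2) ty] by blast
  define F where "F = frame l \<beta> s"
  have F: "det F = 1" by (simp add: F_def)
  have y: "y = F ** tri l 0 ** sinv F" unfolding l(3) F_def by (rule cc_frame[OF l(1,2)])
  define X where "X = sinv F ** x ** F"
  have xX: "x = F ** X ** sinv F" by (simp add: X_def conj_conj F)
  have dX: "det X = 1" by (simp add: X_def det_mul F dx)
  show ?thesis
  proof (cases "X$1$1 \<noteq> 0 \<or> X$2$2 \<noteq> 0")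
    case True
    then show ?thesis using hyp_reachable_of_hyp_right1[OF T F l(1) y] by (simp add: X_def)
  next
    case False
    then have r: "X$2$1 \<noteq> 0" using dX by (auto simp: det_2)
    define \<gamma> where "\<gamma> t = (F ** (X ** tri 1 t) ** sinv F, y)" for t
    have "continuous_on {0..<1} \<gamma>" unfolding \<gamma>_def by (intro continuous_intros) auto
    moreover have "\<gamma> 0 = (x, y)" by (simp add: \<gamma>_def xX)
    ultimately obtain \<epsilon> where \<epsilon>: "0 < \<epsilon>" "\<gamma> \<epsilon> \<in> handle_set a b h" "g (\<gamma> \<epsilon>) = g (x, y)"
      using handle_perturb[OF h g, of \<gamma>] T by (auto simp: \<gamma>_def det_mul F dX dx)
    define x' where "x' = F ** (X ** tri 1 \<epsilon>) ** sinv F"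
    have X': "sinv F ** x' ** F = X ** tri 1 \<epsilon>"
      using conj_conj[of "sinv F" "X ** tri 1 \<epsilon>"] by (simp add: x'_def F)
    have "(sinv F ** x' ** F)$2$2 \<noteq> 0" unfolding X' using r \<epsilon>(1) False by (simp add: tri_def)
    then have "hyp_reachable x' y"
      using hyp_reachable_of_hyp_right1[OF _ F l(1) y, of x'] \<epsilon>(2) by (simp add: \<gamma>_def x'_def)
    then show ?thesis using hyp_reachable_trans \<epsilon> by (auto simp: \<gamma>_def x'_def)
  qed
qed

lemma hyp_reachable_of_hyp_right:
  assumes T: "(x, y) \<in> handle_set a b h" and ty: "\<bar>trace y\<bar> > 2"
  shows "hyp_reachable x y"
proof (cases "trace y > 2")
  case True
  then show ?thesis by (rule hyp_reachable_of_hyp_right2[OF T])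
next
  case False
  then have "hyp_reachable x (- y)"
    using T ty handle_set_minus(2)[of x y a b h] by (intro hyp_reachable_of_hyp_right2) auto
  then show ?thesis by (rule hyp_reachable_minus(2)[OF T])
qed

lemma elliptic_normal_form:
  assumes "det x = 1" "\<bar>trace x\<bar> < 2"
  obtains F \<theta> where "det F = 1" "x = F ** rot \<theta> ** sinv F"
proof -
  define p q r s where "p = x$1$1" and "q = x$1$2" and "r = x$2$1" and "s = x$2$2"
  have d: "p * s - q * r = 1" using assms(1) by (simp add: det_2 p_def q_def r_def s_def)
  have t: "\<bar>p + s\<bar> < 2" using assms(2) by (simp add: trace_2 p_def s_def)
  have t4: "(p + s)\<^sup>2 < 4" using power2_strict_mono[of "p + s" 2] t by simp
  have "q * r < 0"
  proof -
    have "(p - s)\<^sup>2 + 4 * (q * r) = (p + s)\<^sup>2 - 4 * (p * s - q * r)" by (simp add: power2_eq_square algebra_simps)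
    then have "(p - s)\<^sup>2 + 4 * (q * r) = (p + s)\<^sup>2 - 4" using d by simp
    moreover have "(p - s)\<^sup>2 \<ge> 0" by simp
    ultimately show ?thesis using t4 by linarith
  qed
  then have r: "r \<noteq> 0" by auto
  define c where "c = (p + s) / 2"
  define v where "v = - sgn r * sqrt (1 - c\<^sup>2)"
  have c1: "c\<^sup>2 < 1" using t4 by (simp add: c_def power_divide)
  then have v2: "c\<^sup>2 + v\<^sup>2 = 1" using r by (simp add: v_def power_mult_distrib power2_eq_square[of "sgn r"] flip: abs_sgn)
  obtain \<theta> where \<theta>: "c = cos \<theta>" "v = sin \<theta>" using sincos_total_2pi[OF v2] by metis
  have vr: "- v / r > 0"
    using r c1 by (auto simp: v_def sgn_if zero_less_divide_iff divide_less_0_iff)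
  define m where "m = sqrt (- v / r)"
  have "m * m = - v / r" unfolding m_def real_sqrt_mult_self using vr by (rule abs_of_pos)
  then have m: "m > 0" "m * m * r = - v" using vr r by (auto simp: m_def)
  define u where "u = (p - c) / (r * m)"
  define F where "F = tri m u"
  have dF: "det F = 1" using m by (simp add: F_def)
  have rt: "rot \<theta> = mat2 c v (- v) c" by (simp add: rot_def \<theta>)
  have urm: "u * r * m = p - c" using r m by (simp add: u_def)
  have "x ** F = F ** rot \<theta>"
  proof -
    have 1: "p * m = m * c - u * v" 
    proof -
      have "m * (u * r * m) = u * (m * m * r)" by (simp add: algebra_simps)
      then have "m * (p - c) = - u * v" unfolding urm m(2) by simp
      then show ?thesis by (simp add: algebra_simps)
    qed
    have 3: "r * m = - v / m" using m by (simp add: field_simps)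
    have 4: "r * u + s / m = c / m"
    proof -
      have "m * (r * u + s / m) = u * r * m + s" using m by (simp add: field_simps)
      also have "\<dots> = c" unfolding urm by (simp add: c_def field_simps)
      finally have "m * (r * u + s / m) = c" .
      then show ?thesis using m(1) by (metis less_irrefl nonzero_mult_div_cancel_left)
    qed
    have 2: "p * u + q / m = m * v + u * c"
    proof -
      have "r * m * (p * u + q / m) = p * (u * r * m) + q * r" using m by (simp add: field_simps)
      also have "\<dots> = p * (p - c) + (p * s - 1)" unfolding urm using d by simp
      also have "\<dots> = p * (p + s) - p * c - 1" by (simp add: algebra_simps)
      also have "p + s = 2 * c" by (simp add: c_def)
      also have "p * (2 * c) - p * c - 1 = (p - c) * c + c * c - 1" by (simp add: algebra_simps)
      also have "\<dots> = (p - c) * c - v * v" using v2 by (simp add: power2_eq_square)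
      also have "\<dots> = r * m * (m * v + u * c)"
      proof -
        have "r * m * (m * v + u * c) = (m * m * r) * v + (u * r * m) * c" by (simp add: algebra_simps)
        then show ?thesis unfolding urm m(2) by simp
      qed
      finally show ?thesis using r m by simp
    qed
    show ?thesis using 1 2 3 4
      by (simp add: mat2_eq_iff F_def tri_def rt p_def q_def r_def s_def)
  qed
  then have "x ** F ** sinv F = F ** rot \<theta> ** sinv F" by simp
  then have "x = F ** rot \<theta> ** sinv F" by (simp add: dF sinv_mult flip: matrix_mul_assoc)
  then show thesis using that dF by blast
qed

lemma hyp_reachable_elliptic1:
  assumes T: "(x, y) \<in> handle_set a b h" and F: "det F = 1" "x = F ** rot \<theta> ** sinv F"
    and ne: "(sinv F ** y ** F)$1$1 \<noteq> (sinv F ** y ** F)$2$2 \<or> (sinv F ** y ** F)$1$2 \<noteq> - (sinv F ** y ** F)$2$1"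
  shows "hyp_reachable x y"
proof -
  have dx: "det x = 1" "det y = 1" using T by (auto simp: handle_set_def)
  define Y where "Y = sinv F ** y ** F"
  have yY: "y = F ** Y ** sinv F" by (simp add: Y_def conj_conj F(1))
  have dY: "det Y = 1" by (simp add: Y_def det_mul F(1) dx)
  define K where "K \<phi> = F ** rot \<phi> ** sinv F" for \<phi>
  have dK: "det (K \<phi>) = 1" for \<phi> by (simp add: K_def det_mul F(1))
  have com: "comm_mat x (y ** K \<phi>) = comm_mat x y" for \<phi>
    by (rule comm_mat_commute_left[OF dx dK])
      (simp add: F(2) K_def conj_mult F(1) rot_add add.commute)
  have cont: "continuous_on UNIV (\<lambda>\<phi>. y ** K \<phi>)" unfolding K_def by (intro continuous_intros)
  have K0: "K 0 = mat 1" by (simp add: K_def sinv_mult F(1))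
  have P: "(x, y ** K \<phi>) \<in> handle_set a b h" "g (x, y ** K \<phi>) = g (x, y)" for \<phi>
    using handle_path[OF g, of UNIV "\<lambda>_. x" "\<lambda>\<phi>. y ** K \<phi>" "comm_mat x y" 0 \<phi>]
      cont com dK dx T by (auto simp: det_mul K0 intro!: continuous_intros)
  define A B where "A = Y$1$1 + Y$2$2" and "B = Y$2$1 - Y$1$2"
  have tr: "trace (y ** K \<phi>) = A * cos \<phi> + B * sin \<phi>" for \<phi>
  proof -
    have "y ** K \<phi> = F ** (Y ** rot \<phi>) ** sinv F" unfolding yY K_def by (rule conj_mult[OF F(1)])
    then have "trace (y ** K \<phi>) = trace (Y ** rot \<phi>)" by (simp only: trace_conj[OF F(1)])
    then show ?thesis by (simp add: trace_2 rot_def A_def B_def algebra_simps)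
  qed
  have "A\<^sup>2 + B\<^sup>2 - 4 * det Y = (Y$1$1 - Y$2$2)\<^sup>2 + (Y$1$2 + Y$2$1)\<^sup>2"
    by (simp add: A_def B_def det_2 power2_eq_square algebra_simps)
  moreover have "(Y$1$1 - Y$2$2)\<^sup>2 + (Y$1$2 + Y$2$1)\<^sup>2 > 0"
    using ne by (auto simp: Y_def sum_power2_gt_zero_iff)
  ultimately have "A\<^sup>2 + B\<^sup>2 > 4" using dY by simp
  then have gt: "sqrt (A\<^sup>2 + B\<^sup>2) > 2" using real_less_rsqrt[of 2 "A\<^sup>2 + B\<^sup>2"] by simp
  obtain \<phi> where "A * cos \<phi> + B * sin \<phi> = sqrt (A\<^sup>2 + B\<^sup>2)" using sum_squares_polar by blast
  then have "\<bar>trace (y ** K \<phi>)\<bar> > 2" using gt by (simp add: tr)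
  then have "hyp_reachable x (y ** K \<phi>)" by (rule hyp_reachable_of_hyp_right[OF P(1)])
  then show ?thesis by (rule hyp_reachable_trans[OF P])
qed

lemma hyp_reachable_elliptic:
  assumes T: "(x, y) \<in> handle_set a b h" and tx: "\<bar>trace x\<bar> < 2"
  shows "hyp_reachable x y"
proof -
  have dx: "det x = 1" "det y = 1" using T by (auto simp: handle_set_def)
  obtain F \<theta> where F: "det F = 1" "x = F ** rot \<theta> ** sinv F" using elliptic_normal_form[OF dx(1) tx] by blast
  define Y where "Y = sinv F ** y ** F"
  have yY: "y = F ** Y ** sinv F" by (simp add: Y_def conj_conj F(1))
  have dY: "det Y = 1" by (simp add: Y_def det_mul F(1) dx)
  show ?thesis
  proof (cases "Y$1$1 \<noteq> Y$2$2 \<or> Y$1$2 \<noteq> - Y$2$1")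
    case True
    then show ?thesis using hyp_reachable_elliptic1[OF T F] by (simp add: Y_def)
  next
    case False
    define \<gamma> where "\<gamma> t = (x, F ** (Y ** tri (1 + t) 0) ** sinv F)" for t
    have "continuous_on {0..<1} \<gamma>" unfolding \<gamma>_def by (intro continuous_intros) auto
    moreover have "\<gamma> 0 = (x, y)" by (simp add: \<gamma>_def yY)
    ultimately obtain \<epsilon> where \<epsilon>: "0 < \<epsilon>" "\<gamma> \<epsilon> \<in> handle_set a b h" "g (\<gamma> \<epsilon>) = g (x, y)"
      using handle_perturb[OF h g, of \<gamma>] T by (auto simp: \<gamma>_def det_mul F dY dx)
    define y' where "y' = F ** (Y ** tri (1 + \<epsilon>) 0) ** sinv F"
    have Y': "sinv F ** y' ** F = Y ** tri (1 + \<epsilon>) 0"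
      using conj_conj[of "sinv F" "Y ** tri (1 + \<epsilon>) 0"] by (simp add: y'_def F)
    have ne: "(1 + \<epsilon>) - 1 / (1 + \<epsilon>) > 0" using \<epsilon>(1) by (simp add: field_simps add_pos_pos)
    have "(sinv F ** y' ** F)$1$1 \<noteq> (sinv F ** y' ** F)$2$2 \<or> (sinv F ** y' ** F)$1$2 \<noteq> - (sinv F ** y' ** F)$2$1"
    proof (rule ccontr)
      assume "\<not> ?thesis"
      then have "Y$1$1 * ((1 + \<epsilon>) - 1 / (1 + \<epsilon>)) = 0" "Y$2$1 * ((1 + \<epsilon>) - 1 / (1 + \<epsilon>)) = 0"
        unfolding Y' using False by (simp_all add: tri_def algebra_simps)
      then have "Y$1$1 = 0" "Y$2$1 = 0" using ne by auto
      then show False using dY by (simp add: det_2)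
    qed
    then have "hyp_reachable x y'"
      using hyp_reachable_elliptic1[OF _ F, of y'] \<epsilon>(2) by (simp add: \<gamma>_def y'_def)
    then show ?thesis using hyp_reachable_trans \<epsilon> by (auto simp: \<gamma>_def y'_def)
  qed
qed

lemma hyp_reachable_trace_2:
  assumes T: "(x, y) \<in> handle_set a b h" and tx: "trace x = 2"
  shows "hyp_reachable x y"
proof -
  have dx: "det x = 1" "det y = 1" using T by (auto simp: handle_set_def)
  obtain \<beta> s where x: "x = cc 1 \<beta> s" using cc_normal_form[OF dx(1), of 1] tx by auto
  define \<gamma> where "\<gamma> t = (cc (1 - t) \<beta> s, y)" for t
  have "continuous_on {0..<1} \<gamma>" unfolding \<gamma>_def by (intro continuous_intros) auto
  moreover have "\<gamma> 0 = (x, y)" by (simp add: \<gamma>_def x)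
  ultimately obtain \<epsilon> where \<epsilon>: "0 < \<epsilon>" "\<epsilon> < 1" "\<gamma> \<epsilon> \<in> handle_set a b h" "g (\<gamma> \<epsilon>) = g (x, y)"
    using handle_perturb[OF h g, of \<gamma>] T by (auto simp: \<gamma>_def dx)
  have "trace (cc (1 - \<epsilon>) \<beta> s) > 2" using add_inverse_gt_2[of "1 - \<epsilon>"] \<epsilon> by simp
  then show ?thesis using \<epsilon> unfolding hyp_reachable_def \<gamma>_def by blast
qed

lemma hyp_reachable_all:
  assumes T: "(x, y) \<in> handle_set a b h"
  shows "hyp_reachable x y"
proof -
  consider "\<bar>trace x\<bar> > 2" | "\<bar>trace x\<bar> < 2" | "trace x = 2" | "trace x = -2" by linarith
  then show ?thesis
  proof cases
    case 4
    then have "hyp_reachable (- x) y"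
      using T handle_set_minus(1)[of x y a b h] by (intro hyp_reachable_trace_2) auto
    then show ?thesis by (rule hyp_reachable_minus(1)[OF T])
  qed (use T hyp_reachable_abs hyp_reachable_elliptic hyp_reachable_trace_2 in blast)+
qed

end

theorem handle_set_const:
  assumes "h \<in> AL" "a \<le> b" "loc_const (handle_set a b h) g" "sign_inv (handle_set a b h) g"
    and "p \<in> handle_set a b h" "q \<in> handle_set a b h"
  shows "g p = g q"
proof -
  obtain x y where p: "p = (x, y)" by (cases p)
  obtain x' y' where q: "q = (x', y')" by (cases q)
  obtain u v where uv: "(u, v) \<in> handle_set a b h" "trace u > 2" "g (u, v) = g p"
    using hyp_reachable_all[OF assms(1,3,4), of x y] assms(1,3-5) p
    by (auto simp: hyperbolic_reachable_def)
  obtain u' v' where uv': "(u', v') \<in> handle_set a b h" "trace u' > 2" "g (u', v') = g q"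
    using hyp_reachable_all[OF assms(1,3,4), of x' y'] assms q
    by (auto simp: hyperbolic_reachable_def)
  show ?thesis using handle_hyperbolic_const[OF assms(1-4) uv(1,2) uv'(1,2)] uv(3) uv'(3) by simp
qed

theorem handle_set_nonempty:
  assumes h: "h \<in> AL" and ab: "a \<le> b"
  shows "handle_set a b h \<noteq> {} \<longleftrightarrow> disp_range (a - 2) (b + 2) h"
proof -
  have "handle_set a b h \<noteq> {} \<longleftrightarrow> (\<exists>x y. (x, y) \<in> handle_set a b h \<and> trace x > 2)"
  proof
    assume "handle_set a b h \<noteq> {}"
    then obtain x y where xy: "(x, y) \<in> handle_set a b h" by auto
    have lc: "loc_const (handle_set a b h) (\<lambda>_. ())" "sign_inv (handle_set a b h) (\<lambda>_. ())"
      by (auto simp: loc_const_def sign_inv_def)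
    show "\<exists>x y. (x, y) \<in> handle_set a b h \<and> trace x > 2"
      using hyp_reachable_all[OF h lc xy] by (auto simp: hyperbolic_reachable_def)
  qed auto
  also have "\<dots> \<longleftrightarrow> fst ` {p \<in> handle_set a b h. trace (fst p) > 2} \<noteq> {}" by auto
  also have "\<dots> \<longleftrightarrow> product_set 0 (a - 1) (b + 1) h \<noteq> {}"
    unfolding handle_hyperbolic_projection[OF h ab HOL.refl] ..
  also have "\<dots> \<longleftrightarrow> disp_range (a - 2) (b + 2) h"
    using product_set_hyperbolic_nonempty[OF h, of "a - 1" "b + 1"] ab by (simp add: add.commute)
  finally show ?thesis .
qed

subsection \<open>Words in commutators and boundary elements\<close>

datatype block = Handle nat | Cusp nat

type_synonym gen_images = "gen \<Rightarrow> real^2^2"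

fun block_gens :: "block \<Rightarrow> gen set" where
  "block_gens (Handle j) = {GenA j, GenB j}"
| "block_gens (Cusp i) = {GenC i}"

fun block_lift :: "block \<Rightarrow> gen_images \<Rightarrow> real \<Rightarrow> real" where
  "block_lift (Handle j) m = comm_lift (m (GenA j)) (m (GenB j))"
| "block_lift (Cusp i) m = plift (m (GenC i))"

fun block_ok :: "(nat \<Rightarrow> int) \<Rightarrow> block \<Rightarrow> gen_images \<Rightarrow> bool" where
  "block_ok s (Handle j) m \<longleftrightarrow> det (m (GenA j)) = 1 \<and> det (m (GenB j)) = 1"
| "block_ok s (Cusp i) m \<longleftrightarrow> m (GenC i) \<in> sign_class (s i)"

fun block_lower :: "(nat \<Rightarrow> int) \<Rightarrow> block \<Rightarrow> int" where
  "block_lower s (Handle j) = 2"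
| "block_lower s (Cusp i) = lower_shift (s i)"

fun block_upper :: "(nat \<Rightarrow> int) \<Rightarrow> block \<Rightarrow> int" where
  "block_upper s (Handle j) = 2"
| "block_upper s (Cusp i) = upper_shift (s i)"

definition word_lift :: "block list \<Rightarrow> gen_images \<Rightarrow> real \<Rightarrow> real" where
  "word_lift bs m = foldr (\<lambda>bl f. block_lift bl m \<circ> f) bs (\<lambda>x. x)"

definition word_gens :: "block list \<Rightarrow> gen set" where
  "word_gens bs = (\<Union>bl\<in>set bs. block_gens bl)"

definition word_ok :: "(nat \<Rightarrow> int) \<Rightarrow> block list \<Rightarrow> gen_images \<Rightarrow> bool" where
  "word_ok s bs m \<longleftrightarrow> (\<forall>bl\<in>set bs. block_ok s bl m) \<and> (\<forall>x. x \<notin> word_gens bs \<longrightarrow> m x = mat 1)"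

definition word_set :: "(nat \<Rightarrow> int) \<Rightarrow> block list \<Rightarrow> int \<Rightarrow> int \<Rightarrow> gen_images set" where
  "word_set s bs a b = {m. word_ok s bs m \<and> disp_range a b (word_lift bs m)}"

definition flip_inv :: "block list \<Rightarrow> gen_images set \<Rightarrow> (gen_images \<Rightarrow> 'v) \<Rightarrow> bool" where
  "flip_inv bs S g \<longleftrightarrow> (\<forall>m\<in>S. \<forall>j. Handle j \<in> set bs \<longrightarrow>
     g (m(GenA j := - m (GenA j))) = g m \<and> g (m(GenB j := - m (GenB j))) = g m)"

lemma word_lift_Nil [simp]: "word_lift [] m = (\<lambda>x. x)"
  by (simp add: word_lift_def)

lemma word_lift_Cons [simp]: "word_lift (bl # bs) m = block_lift bl m \<circ> word_lift bs m"
  by (simp add: word_lift_def)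

lemma word_lift_append: "word_lift (bs @ cs) m = word_lift bs m \<circ> word_lift cs m"
  by (induction bs) (simp_all add: comp_def)

lemma word_gens_Nil [simp]: "word_gens [] = {}"
  by (simp add: word_gens_def)

lemma word_gens_Cons [simp]: "word_gens (bl # bs) = block_gens bl \<union> word_gens bs"
  by (simp add: word_gens_def)

lemma block_gens_disjoint: "bl \<noteq> bl' \<Longrightarrow> block_gens bl \<inter> block_gens bl' = {}"
  by (cases bl; cases bl') auto

lemma word_gens_disjoint: "bl \<notin> set bs \<Longrightarrow> block_gens bl \<inter> word_gens bs = {}"
proof (rule equals0I)
  fix x assume bl: "bl \<notin> set bs" and "x \<in> block_gens bl \<inter> word_gens bs"
  then obtain bl' where "bl' \<in> set bs" "x \<in> block_gens bl'" "x \<in> block_gens bl"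
    unfolding word_gens_def by blast
  moreover from this bl have "bl \<noteq> bl'" by blast
  ultimately show False using block_gens_disjoint[of bl bl'] by blast
qed

lemma block_lift_cong: "(\<And>x. x \<in> block_gens bl \<Longrightarrow> m x = m' x) \<Longrightarrow> block_lift bl m = block_lift bl m'"
  by (cases bl) auto

lemma block_ok_cong: "(\<And>x. x \<in> block_gens bl \<Longrightarrow> m x = m' x) \<Longrightarrow> block_ok s bl m = block_ok s bl m'"
  by (cases bl) auto

lemma word_lift_cong: "(\<And>x. x \<in> word_gens bs \<Longrightarrow> m x = m' x) \<Longrightarrow> word_lift bs m = word_lift bs m'"
proof (induction bs)
  case (Cons bl bs)
  then show ?case using block_lift_cong[of bl m m'] by simp
qed simp

lemma AL_block_lift: "block_ok s bl m \<Longrightarrow> block_lift bl m \<in> AL"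
proof (cases bl)
  case (Cusp i)
  assume "block_ok s bl m"
  then have c: "m (GenC i) \<in> sign_class (s i)" using Cusp by simp
  have "plift (m (GenC i)) \<in> AL"
    using sign_class_det[OF c] sign_class_trace[OF c] by (intro AL_plift) auto
  then show ?thesis using Cusp by simp
qed (auto simp: AL_comm)

lemma AL_word_lift: "(\<And>bl. bl \<in> set bs \<Longrightarrow> block_ok s bl m) \<Longrightarrow> word_lift bs m \<in> AL"
proof (induction bs)
  case (Cons bl bs)
  have "block_lift bl m \<in> AL" "word_lift bs m \<in> AL"
    using Cons.prems by (auto intro: AL_block_lift Cons.IH)
  then show ?case unfolding word_lift_Cons by (rule AL_comp)
qed (simp add: AL_id)

lemma continuous_on_coord:
  fixes f :: "'a::topological_space \<Rightarrow> 'i \<Rightarrow> 'b::topological_space"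
  shows "continuous_on S f \<Longrightarrow> continuous_on S (\<lambda>m. f m x)"
  by (rule continuous_on_product_then_coordinatewise)

lemma continuous_on_block_lift:
  fixes m :: "'a::topological_space \<Rightarrow> gen_images"
  assumes "continuous_on S m" "continuous_on S t" "\<And>p. p \<in> S \<Longrightarrow> block_ok s bl (m p)"
  shows "continuous_on S (\<lambda>p. block_lift bl (m p) (t p))"
proof (cases bl)
  case (Handle j)
  have "continuous_on S (\<lambda>p. comm_lift (m p (GenA j)) (m p (GenB j)) (t p))"
    by (rule continuous_on_comm_lift[OF continuous_on_coord[OF assms(1)] continuous_on_coord[OF assms(1)] assms(2)])
      (use assms(3) Handle in force)+
  then show ?thesis using Handle by simp
next
  case (Cusp i)
  have "m p (GenC i) \<in> sign_class (s i)" if "p \<in> S" for p using assms(3)[OF that] Cusp by simp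
  then have d: "det (m p (GenC i)) = 1 \<and> trace (m p (GenC i)) > -2" if "p \<in> S" for p
    using that sign_class_det sign_class_trace by fastforce
  have "continuous_on S (\<lambda>p. plift (m p (GenC i)) (t p))"
    by (rule continuous_on_plift_joint[OF continuous_on_coord[OF assms(1)] assms(2) d])
  then show ?thesis using Cusp by simp
qed

lemma continuous_on_word_lift:
  fixes m :: "'a::topological_space \<Rightarrow> gen_images"
  assumes "continuous_on S m" "continuous_on S t" "\<And>p bl. p \<in> S \<Longrightarrow> bl \<in> set bs \<Longrightarrow> block_ok s bl (m p)"
  shows "continuous_on S (\<lambda>p. word_lift bs (m p) (t p))"
  using assms(3)
proof (induction bs)
  case (Cons bl bs)
  then show ?case
    using continuous_on_block_lift[OF assms(1) Cons.IH, of s bl] by simp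
qed (simp add: assms)

definition override_block :: "block \<Rightarrow> gen_images \<Rightarrow> gen_images \<Rightarrow> gen_images" where
  "override_block bl m m' = (\<lambda>x. if x \<in> block_gens bl then m' x else m x)"

lemma continuous_on_override_block:
  fixes m m' :: "'a::topological_space \<Rightarrow> gen_images"
  assumes "continuous_on S m" "continuous_on S m'"
  shows "continuous_on S (\<lambda>p. override_block bl (m p) (m' p))"
proof (rule continuous_on_coordinatewise_then_product)
  fix x
  show "continuous_on S (\<lambda>p. override_block bl (m p) (m' p) x)"
    by (cases "x \<in> block_gens bl") (simp_all add: override_block_def continuous_on_coord assms)
qed

lemma continuous_on_fun_upd:
  fixes m :: "'a::topological_space \<Rightarrow> gen_images"
  assumes "continuous_on S m" "continuous_on S c"
  shows "continuous_on S (\<lambda>p. (m p)(x := c p))"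
proof (rule continuous_on_coordinatewise_then_product)
  fix y
  show "continuous_on S (\<lambda>p. ((m p)(x := c p)) y)"
    by (cases "y = x") (simp_all add: continuous_on_coord assms)
qed

lemma disp_range_id: "disp_range a b (\<lambda>x. x) \<longleftrightarrow> a < 0 \<and> 0 < b"
  by (auto simp: disp_range_def disp_above_def disp_below_def mult_less_0_iff zero_less_mult_iff)

lemma word_set_Nil: "word_set s [] a b = (if a < 0 \<and> 0 < b then {\<lambda>_. mat 1} else {})"
  by (auto simp: word_set_def word_ok_def disp_range_id)

lemma word_ok_override:
  assumes "bl \<notin> set bs" "word_ok s bs m" "block_ok s bl m'"
  shows "word_ok s (bl # bs) (override_block bl m m')"
proof -
  have d: "x \<notin> block_gens bl" if "bl' \<in> set bs" "x \<in> block_gens bl'" for x bl'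
    using that assms(1) block_gens_disjoint[of bl bl'] by auto
  have "block_ok s bl' (override_block bl m m')" if "bl' \<in> set bs" for bl'
  proof -
    have "block_ok s bl' (override_block bl m m') = block_ok s bl' m"
      by (rule block_ok_cong) (use d[OF that] in \<open>auto simp: override_block_def\<close>)
    then show ?thesis using assms(2) that by (simp add: word_ok_def)
  qed
  moreover have "block_ok s bl (override_block bl m m') = block_ok s bl m'"
    by (rule block_ok_cong) (auto simp: override_block_def)
  ultimately show ?thesis using assms(2,3) by (auto simp: word_ok_def override_block_def)
qed

lemma word_lift_override:
  assumes "bl \<notin> set bs"
  shows "word_lift (bl # bs) (override_block bl m m') = block_lift bl m' \<circ> word_lift bs m"
proof -
  have "word_lift bs (override_block bl m m') = word_lift bs m"
    by (rule word_lift_cong) (use word_gens_disjoint[OF assms] in \<open>auto simp: override_block_def\<close>)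
  moreover have "block_lift bl (override_block bl m m') = block_lift bl m'"
    by (rule block_lift_cong) (auto simp: override_block_def)
  ultimately show ?thesis by simp
qed

definition fibre_set :: "(nat \<Rightarrow> int) \<Rightarrow> block \<Rightarrow> int \<Rightarrow> int \<Rightarrow> (real \<Rightarrow> real) \<Rightarrow> gen_images set" where
  "fibre_set s bl a b k = {m. block_ok s bl m \<and> disp_range a b (k \<circ> block_lift bl m)}"

lemma fibre_set_nonempty:
  assumes k: "k \<in> AL" and ab: "a \<le> b" and s: "\<And>i. bl = Cusp i \<Longrightarrow> s i \<in> {-1, 0, 1}"
  shows "fibre_set s bl a b k \<noteq> {} \<longleftrightarrow> disp_range (a - block_lower s bl) (b + block_upper s bl) k"
proof (cases bl)
  case (Handle j)
  have "fibre_set s bl a b k \<noteq> {} \<longleftrightarrow> handle_set a b k \<noteq> {}"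
  proof
    assume "fibre_set s bl a b k \<noteq> {}"
    then show "handle_set a b k \<noteq> {}" using Handle by (auto simp: fibre_set_def handle_set_def)
  next
    assume "handle_set a b k \<noteq> {}"
    then obtain x y where "(x, y) \<in> handle_set a b k" by auto
    then have "(\<lambda>_. mat 1)(GenA j := x, GenB j := y) \<in> fibre_set s bl a b k"
      using Handle by (simp add: fibre_set_def handle_set_def)
    then show "fibre_set s bl a b k \<noteq> {}" by blast
  qed
  then show ?thesis using handle_set_nonempty[OF k ab] Handle by simp
next
  case (Cusp i)
  have "fibre_set s bl a b k \<noteq> {} \<longleftrightarrow> product_set (s i) a b k \<noteq> {}"
  proof
    assume "fibre_set s bl a b k \<noteq> {}"
    then show "product_set (s i) a b k \<noteq> {}" using Cusp by (auto simp: fibre_set_def product_set_def)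
  next
    assume "product_set (s i) a b k \<noteq> {}"
    then obtain c where "c \<in> product_set (s i) a b k" by auto
    then have "(\<lambda>_. mat 1)(GenC i := c) \<in> fibre_set s bl a b k"
      using Cusp by (simp add: fibre_set_def product_set_def)
    then show "fibre_set s bl a b k \<noteq> {}" by blast
  qed
  then show ?thesis using product_set_nonempty[OF k ab s[OF Cusp]] Cusp by simp
qed

lemma word_set_Cons_iff:
  assumes bl: "bl \<notin> set bs" and m: "word_ok s bs m"
  shows "override_block bl m m' \<in> word_set s (bl # bs) a b \<longleftrightarrow> m' \<in> fibre_set s bl a b (word_lift bs m)"
proof -
  have AL: "word_lift bs m \<in> AL" using m by (intro AL_word_lift) (auto simp: word_ok_def)
  have "block_ok s bl (override_block bl m m') = block_ok s bl m'"
    by (rule block_ok_cong) (auto simp: override_block_def)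
  then have "word_ok s (bl # bs) (override_block bl m m') \<longleftrightarrow> block_ok s bl m'"
    using word_ok_override[OF bl m, of m'] by (auto simp: word_ok_def)
  then show ?thesis
    using disp_range_commute[OF AL AL_block_lift[of s bl m'], of a b]
    by (auto simp: word_set_def fibre_set_def word_lift_override[OF bl] simp del: word_lift_Cons)
qed

definition reset_block :: "block \<Rightarrow> gen_images \<Rightarrow> gen_images" where
  "reset_block bl m = override_block bl m (\<lambda>_. mat 1)"

lemma override_reset: "override_block bl (reset_block bl m) m = m"
  by (auto simp: override_block_def reset_block_def)

lemma reset_override: "reset_block bl (override_block bl m m') = reset_block bl m"
  by (auto simp: override_block_def reset_block_def)

lemma word_ok_reset:
  assumes bl: "bl \<notin> set bs" and m: "word_ok s (bl # bs) m"
  shows "word_ok s bs (reset_block bl m)"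
proof -
  have d: "x \<notin> block_gens bl" if "bl' \<in> set bs" "x \<in> block_gens bl'" for x bl'
    using that bl block_gens_disjoint[of bl bl'] by auto
  have "block_ok s bl' (reset_block bl m) = block_ok s bl' m" if "bl' \<in> set bs" for bl'
    by (rule block_ok_cong) (use d[OF that] in \<open>auto simp: override_block_def reset_block_def\<close>)
  then show ?thesis using m by (auto simp: word_ok_def reset_block_def override_block_def)
qed

lemma reset_word_ok:
  assumes bl: "bl \<notin> set bs" and m: "word_ok s bs m"
  shows "reset_block bl m = m"
proof
  fix x
  show "reset_block bl m x = m x"
    using m word_gens_disjoint[OF bl] by (auto simp: reset_block_def override_block_def word_ok_def)
qed

lemma reset_image_word_set:
  assumes bl: "bl \<notin> set bs" and ab: "a \<le> b" and s: "\<And>i. bl = Cusp i \<Longrightarrow> s i \<in> {-1, 0, 1}"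
  shows "reset_block bl ` word_set s (bl # bs) a b = word_set s bs (a - block_lower s bl) (b + block_upper s bl)"
proof (intro equalityI subsetI)
  have AL: "word_lift bs m \<in> AL" if "word_ok s bs m" for m
    using that by (intro AL_word_lift) (auto simp: word_ok_def)
  have fn: "fibre_set s bl a b k \<noteq> {} \<longleftrightarrow> disp_range (a - block_lower s bl) (b + block_upper s bl) k"
    if "k \<in> AL" for k by (rule fibre_set_nonempty[OF that ab]) (rule s)
  {
    fix m assume "m \<in> reset_block bl ` word_set s (bl # bs) a b"
    then obtain m1 where m1: "m1 \<in> word_set s (bl # bs) a b" "m = reset_block bl m1" by blast
    have ok: "word_ok s bs m" unfolding m1(2) by (rule word_ok_reset[OF bl]) (use m1 in \<open>simp add: word_set_def\<close>)
    have "m1 = override_block bl m m1" by (simp add: m1(2) override_reset)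
    then have "m1 \<in> fibre_set s bl a b (word_lift bs m)" using word_set_Cons_iff[OF bl ok] m1(1) by metis
    then show "m \<in> word_set s bs (a - block_lower s bl) (b + block_upper s bl)"
      using fn[OF AL[OF ok]] ok by (auto simp: word_set_def)
  next
    fix m assume m: "m \<in> word_set s bs (a - block_lower s bl) (b + block_upper s bl)"
    then have ok: "word_ok s bs m" by (simp add: word_set_def)
    obtain m' where "m' \<in> fibre_set s bl a b (word_lift bs m)"
      using fn[OF AL[OF ok]] m by (auto simp: word_set_def)
    then have "override_block bl m m' \<in> word_set s (bl # bs) a b" using word_set_Cons_iff[OF bl ok] by simp
    moreover have "m = reset_block bl (override_block bl m m')"
      by (simp add: reset_override reset_word_ok[OF bl ok])
    ultimately show "m \<in> reset_block bl ` word_set s (bl # bs) a b" by blast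
  }
qed

lemma word_set_flip:
  assumes "distinct bs" "Handle j \<in> set bs" "x = GenA j \<or> x = GenB j" "m \<in> word_set s bs a b"
  shows "m(x := - m x) \<in> word_set s bs a b"
proof -
  have ok: "block_ok s bl m" if "bl \<in> set bs" for bl using assms(4) that by (simp add: word_set_def word_ok_def)
  have "block_ok s (Handle j) m" using ok assms(2) by blast
  then have l: "block_lift bl (m(x := - m x)) = block_lift bl m" for bl
    using assms(3) by (cases bl) (auto simp: comm_lift_minus)
  have o: "block_ok s bl (m(x := - m x)) = block_ok s bl m" for bl
    using assms(3) by (cases bl) auto
  have "word_lift cs (m(x := - m x)) = word_lift cs m" for cs
  proof (induction cs)
    case (Cons bl cs)
    show ?case unfolding word_lift_Cons l Cons.IH ..
  qed simp
  moreover have "x \<in> word_gens bs" using assms(2,3) by (force simp: word_gens_def)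
  ultimately show ?thesis using assms(4) o by (auto simp: word_set_def word_ok_def)
qed

lemma fibre_const:
  assumes k: "k \<in> AL" and ab: "a \<le> b" and s: "\<And>i. bl = Cusp i \<Longrightarrow> s i \<in> {-1, 0, 1}"
    and g: "loc_const (fibre_set s bl a b k) g"
    and fl: "\<And>m j. bl = Handle j \<Longrightarrow> m \<in> fibre_set s bl a b k \<Longrightarrow>
      g (m(GenA j := - m (GenA j))) = g m \<and> g (m(GenB j := - m (GenB j))) = g m"
    and m: "m1 \<in> fibre_set s bl a b k" "m2 \<in> fibre_set s bl a b k"
    and eq: "\<And>x. x \<notin> block_gens bl \<Longrightarrow> m1 x = m2 x"
  shows "g m1 = g m2"
proof (cases bl)
  case (Cusp i)
  have "loc_const (product_set (s i) a b k) (\<lambda>c. g (m1(GenC i := c)))"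
  proof (rule loc_const_compose[OF g])
    show "continuous_on (product_set (s i) a b k) (\<lambda>c. m1(GenC i := c))"
      by (rule continuous_on_fun_upd[OF continuous_on_const continuous_on_id])
    show "(\<lambda>c. m1(GenC i := c)) ` product_set (s i) a b k \<subseteq> fibre_set s bl a b k"
      using Cusp by (auto simp: fibre_set_def product_set_def)
  qed
  then have "g (m1(GenC i := m1 (GenC i))) = g (m1(GenC i := m2 (GenC i)))"
    by (rule product_set_const[OF k ab s[OF Cusp]]) (use m Cusp in \<open>auto simp: fibre_set_def product_set_def\<close>)
  moreover have "m1(GenC i := m2 (GenC i)) = m2" using eq Cusp by auto
  ultimately show ?thesis by simp
next
  case (Handle j)
  define u where "u p = m1(GenA j := fst p, GenB j := snd p)" for p
  have u: "u p \<in> fibre_set s bl a b k \<longleftrightarrow> p \<in> handle_set a b k" for p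
    using Handle by (cases p) (auto simp: fibre_set_def handle_set_def u_def)
  have lc: "loc_const (handle_set a b k) (\<lambda>p. g (u p))"
  proof (rule loc_const_compose[OF g])
    show "continuous_on (handle_set a b k) u"
      unfolding u_def by (intro continuous_on_fun_upd continuous_on_const continuous_on_fst
        continuous_on_snd continuous_on_id)
    show "u ` handle_set a b k \<subseteq> fibre_set s bl a b k" using u by auto
  qed
  have si: "sign_inv (handle_set a b k) (\<lambda>p. g (u p))"
    unfolding sign_inv_def
  proof (intro allI impI)
    fix x y assume "(x, y) \<in> handle_set a b k"
    then have U: "u (x, y) \<in> fibre_set s bl a b k" using u by simp
    have "(u (x, y))(GenA j := - u (x, y) (GenA j)) = u (- x, y)"
      "(u (x, y))(GenB j := - u (x, y) (GenB j)) = u (x, - y)" by (auto simp: u_def)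
    then show "g (u (- x, y)) = g (u (x, y)) \<and> g (u (x, - y)) = g (u (x, y))" using fl[OF Handle U] by simp
  qed
  have e: "u (m1 (GenA j), m1 (GenB j)) = m1" "u (m2 (GenA j), m2 (GenB j)) = m2"
    using eq Handle by (auto simp: u_def)
  have "g (u (m1 (GenA j), m1 (GenB j))) = g (u (m2 (GenA j), m2 (GenB j)))"
    by (rule handle_set_const[OF k ab lc si]) (use e m u in \<open>metis\<close>)+
  then show ?thesis by (simp add: e)
qed

theorem word_set_nonempty_const:
  assumes "distinct bs" "a \<le> b" "\<And>i. Cusp i \<in> set bs \<Longrightarrow> s i \<in> {-1, 0, 1}"
  shows "(word_set s bs a b \<noteq> {} \<longleftrightarrow>
      a < (\<Sum>bl\<leftarrow>bs. block_lower s bl) \<and> 0 < b + (\<Sum>bl\<leftarrow>bs. block_upper s bl)) \<and>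
    (\<forall>g :: gen_images \<Rightarrow> 'v. loc_const (word_set s bs a b) g \<longrightarrow> flip_inv bs (word_set s bs a b) g \<longrightarrow>
      (\<forall>m\<in>word_set s bs a b. \<forall>m'\<in>word_set s bs a b. g m = g m'))"
  using assms
proof (induction bs arbitrary: a b)
  case Nil
  then show ?case by (auto simp: word_set_Nil)
next
  case (Cons bl bs)
  let ?S = "word_set s (bl # bs) a b" and ?B = "word_set s bs (a - block_lower s bl) (b + block_upper s bl)"
  have bl: "bl \<notin> set bs" and ds: "distinct bs" using Cons.prems(1) by auto
  have sb: "s i \<in> {-1, 0, 1}" if "bl = Cusp i" for i using Cons.prems(3) that by auto
  have le: "a - block_lower s bl \<le> b + block_upper s bl"
    using Cons.prems(2) by (cases bl) (auto simp: lower_shift_def upper_shift_def)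
  have im: "reset_block bl ` ?S = ?B" by (rule reset_image_word_set[OF bl Cons.prems(2)]) (rule sb)
  have IH: "(?B \<noteq> {} \<longleftrightarrow> a - block_lower s bl < (\<Sum>bl\<leftarrow>bs. block_lower s bl) \<and>
      0 < b + block_upper s bl + (\<Sum>bl\<leftarrow>bs. block_upper s bl)) \<and>
    (\<forall>g :: gen_images \<Rightarrow> 'v. loc_const ?B g \<longrightarrow> flip_inv bs ?B g \<longrightarrow> (\<forall>m\<in>?B. \<forall>m'\<in>?B. g m = g m'))"
    by (rule Cons.IH[OF ds le]) (use Cons.prems(3) in auto)
  have ne: "?S \<noteq> {} \<longleftrightarrow> a < (\<Sum>bl\<leftarrow>bl # bs. block_lower s bl) \<and> 0 < b + (\<Sum>bl\<leftarrow>bl # bs. block_upper s bl)"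
  proof -
    have "?S \<noteq> {} \<longleftrightarrow> ?B \<noteq> {}" using im by auto
    then show ?thesis using IH by (auto simp: algebra_simps)
  qed
  have const: "g m = g m'" if g: "loc_const ?S g" and fl: "flip_inv (bl # bs) ?S g" and m: "m \<in> ?S" "m' \<in> ?S"
    for g :: "gen_images \<Rightarrow> 'v" and m m'
  proof -
    have okr: "word_ok s bs (reset_block bl m)" if "m \<in> ?S" for m
      by (rule word_ok_reset[OF bl]) (use that in \<open>simp add: word_set_def\<close>)
    have AL: "word_lift bs m \<in> AL" if "word_ok s bs m" for m
      using that by (intro AL_word_lift) (auto simp: word_ok_def)
    have fib: "g m1 = g m2" if m1: "m1 \<in> ?S" and m2: "m2 \<in> ?S" and eq: "reset_block bl m1 = reset_block bl m2" for m1 m2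
    proof -
      define r where "r = reset_block bl m1"
      define k where "k = word_lift bs r"
      have ok: "word_ok s bs r" unfolding r_def by (rule okr[OF m1])
      have k: "k \<in> AL" unfolding k_def by (rule AL[OF ok])
      have iff: "override_block bl r m \<in> ?S \<longleftrightarrow> m \<in> fibre_set s bl a b k" for m
        unfolding k_def by (rule word_set_Cons_iff[OF bl ok])
      have o1: "override_block bl r m1 = m1" "override_block bl r m2 = m2"
        unfolding r_def by (simp add: override_reset) (simp add: eq override_reset)
      have lc: "loc_const (fibre_set s bl a b k) (\<lambda>m. g (override_block bl r m))"
      proof (rule loc_const_compose[OF g])
        show "continuous_on (fibre_set s bl a b k) (override_block bl r)"
          by (rule continuous_on_override_block[OF continuous_on_const continuous_on_id])
        show "override_block bl r ` fibre_set s bl a b k \<subseteq> ?S" using iff by auto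
      qed
      have "g (override_block bl r m1) = g (override_block bl r m2)"
      proof (rule fibre_const[OF k Cons.prems(2) _ lc])
        fix m j assume H: "bl = Handle j" and "m \<in> fibre_set s bl a b k"
        then have inS: "override_block bl r m \<in> ?S" using iff by simp
        have "override_block bl r (m(GenA j := - m (GenA j))) =
            (override_block bl r m)(GenA j := - override_block bl r m (GenA j))"
          "override_block bl r (m(GenB j := - m (GenB j))) =
            (override_block bl r m)(GenB j := - override_block bl r m (GenB j))"
          using H by (auto simp: override_block_def)
        then show "g (override_block bl r (m(GenA j := - m (GenA j)))) = g (override_block bl r m) \<and>
            g (override_block bl r (m(GenB j := - m (GenB j)))) = g (override_block bl r m)"
          using fl inS H unfolding flip_inv_def by simp
      next
        show "m1 \<in> fibre_set s bl a b k" "m2 \<in> fibre_set s bl a b k" using iff o1 m1 m2 by metis+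
      next
        fix x assume "x \<notin> block_gens bl"
        then show "m1 x = m2 x" using fun_cong[OF eq, of x] by (simp add: reset_block_def override_block_def)
      qed (use sb in auto)
      then show ?thesis by (simp add: o1)
    qed
    obtain h where h: "loc_const (reset_block bl ` ?S) h" "\<And>m. m \<in> ?S \<Longrightarrow> g m = h (reset_block bl m)"
    proof (rule loc_const_fibration[OF g, of "reset_block bl"])
      fix m1 m2 assume "m1 \<in> ?S" "m2 \<in> ?S" "reset_block bl m1 = reset_block bl m2"
      then show "g m1 = g m2" by (rule fib)
    next
      fix m assume m: "m \<in> ?S"
      let ?V = "{r. \<forall>bl\<in>set bs. block_ok s bl r}"
      define r where "r = reset_block bl m"
      have ok: "word_ok s bs r" unfolding r_def by (rule okr[OF m])
      have bo: "block_ok s bl m" using m by (simp add: word_set_def word_ok_def)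
      have mr: "override_block bl r m = m" by (simp add: r_def override_reset)
      have d: "disp_range a b (word_lift bs r \<circ> block_lift bl m)"
        using word_set_Cons_iff[OF bl ok, of m a b] m mr by (simp add: fibre_set_def)
      have "continuous_on ?V (\<lambda>r. (word_lift bs r \<circ> block_lift bl m) x)" for x
        unfolding comp_def by (rule continuous_on_word_lift[where s = s, OF continuous_on_id continuous_on_const]) auto
      then obtain U where U: "open U" "r \<in> U"
        "\<And>r'. r' \<in> U \<Longrightarrow> r' \<in> ?V \<Longrightarrow> disp_range a b (word_lift bs r' \<circ> block_lift bl m)"
        using disp_range_nhd[of ?V "\<lambda>r. word_lift bs r \<circ> block_lift bl m" r a b] ok d
        by (auto simp: word_ok_def)
      have sec: "override_block bl r' m \<in> ?S \<and> reset_block bl (override_block bl r' m) = r'"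
        if "r' \<in> U" "r' \<in> reset_block bl ` ?S" for r'
      proof -
        have ok': "word_ok s bs r'" using that(2) okr by blast
        then have "r' \<in> ?V" by (simp add: word_ok_def)
        then have "m \<in> fibre_set s bl a b (word_lift bs r')" using U(3) that(1) bo by (simp add: fibre_set_def)
        then show ?thesis using word_set_Cons_iff[OF bl ok'] reset_word_ok[OF bl ok'] by (simp add: reset_override)
      qed
      have "continuous_on (U \<inter> reset_block bl ` ?S) (\<lambda>r'. override_block bl r' m)"
        by (rule continuous_on_override_block[OF continuous_on_id continuous_on_const])
      then show "\<exists>N \<sigma>. open N \<and> reset_block bl m \<in> N \<and> continuous_on (N \<inter> reset_block bl ` ?S) \<sigma> \<and>
          \<sigma> (reset_block bl m) = m \<and> (\<forall>b\<in>N \<inter> reset_block bl ` ?S. \<sigma> b \<in> ?S \<and> reset_block bl (\<sigma> b) = b)"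
        using U(1,2) sec mr unfolding r_def by (intro exI[of _ U] exI[of _ "\<lambda>r'. override_block bl r' m"]) blast
    qed (use that in blast)
    have "flip_inv bs ?B h"
      unfolding flip_inv_def
    proof (intro ballI allI impI)
      fix r j assume r: "r \<in> ?B" and j: "Handle j \<in> set bs"
      then obtain m where m: "m \<in> ?S" "r = reset_block bl m" using im by blast
      have "h (r(x := - r x)) = h r" if x: "x = GenA j \<or> x = GenB j" for x
      proof -
        have "Handle j \<noteq> bl" using j bl by auto
        then have "x \<notin> block_gens bl" using x block_gens_disjoint[of "Handle j" bl] by auto
        then have "r(x := - r x) = reset_block bl (m(x := - m x))"
          unfolding m(2) by (auto simp: reset_block_def override_block_def)
        moreover have "m(x := - m x) \<in> ?S"
          by (rule word_set_flip[OF Cons.prems(1) _ x m(1)]) (use j in auto)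
        ultimately have "h (r(x := - r x)) = g (m(x := - m x))" using h(2) by simp
        also have "\<dots> = g m" using fl m(1) j x unfolding flip_inv_def by auto
        finally show ?thesis using h(2)[OF m(1)] m(2) by simp
      qed
      then show "h (r(GenA j := - r (GenA j))) = h r \<and> h (r(GenB j := - r (GenB j))) = h r" by blast
    qed
    moreover have "loc_const ?B h" using h(1) im by simp
    moreover have "reset_block bl m \<in> ?B" "reset_block bl m' \<in> ?B" using m im by blast+
    ultimately have "h (reset_block bl m) = h (reset_block bl m')" using IH by blast
    then show ?thesis using h(2) m by simp
  qed
  show ?case using ne const by blast
qed

subsection \<open>The group \<open>PSL2\<close> and its topology\<close>

lemma SL2_simps [simp]:
  "carrier SL2 = {A. det A = 1}" "A \<otimes>\<^bsub>SL2\<^esub> B = A ** B" "\<one>\<^bsub>SL2\<^esub> = mat 1"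
  by (simp_all add: SL2_def)

lemma group_SL2: "group SL2"
proof (rule groupI)
  fix A B :: "real^2^2" assume "A \<in> carrier SL2" "B \<in> carrier SL2"
  then show "A \<otimes>\<^bsub>SL2\<^esub> B \<in> carrier SL2" by (simp add: det_mul)
next
  fix A :: "real^2^2" assume "A \<in> carrier SL2"
  then show "\<exists>B\<in>carrier SL2. B \<otimes>\<^bsub>SL2\<^esub> A = \<one>\<^bsub>SL2\<^esub>"
    by (intro bexI[of _ "sinv A"]) (simp_all add: sinv_mult)
qed (simp_all add: matrix_mul_assoc)

lemma inv_SL2: "det A = 1 \<Longrightarrow> inv\<^bsub>SL2\<^esub> A = sinv A"
  by (rule group.inv_equality[OF group_SL2]) (simp_all add: sinv_mult)

lemma normal_center: "{mat 1, - mat 1} \<lhd> SL2"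
proof -
  have "subgroup {mat 1, - mat 1} SL2"
    by (rule group.subgroupI[OF group_SL2])
      (auto simp: inv_SL2 sinv_minus)
  then show ?thesis
    by (auto simp: group.normal_inv_iff[OF group_SL2] inv_SL2 sinv_mult)
qed

lemma r_coset_center: "{mat 1, - mat 1} #>\<^bsub>SL2\<^esub> A = pm A"
  by (auto simp: r_coset_def pm_def)

lemma carrier_PSL2: "carrier PSL2 = pm ` {A. det A = 1}"
  by (auto simp: PSL2_def FactGroup_def RCOSETS_def r_coset_center)

lemma pm_in_PSL2 [simp]: "det A = 1 \<Longrightarrow> pm A \<in> carrier PSL2"
  by (auto simp: carrier_PSL2)

lemma PSL2_E:
  assumes "x \<in> carrier PSL2" obtains A where "det A = 1" "x = pm A"
  using assms by (auto simp: carrier_PSL2)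

lemma mult_PSL2: "det A = 1 \<Longrightarrow> det B = 1 \<Longrightarrow> pm A \<otimes>\<^bsub>PSL2\<^esub> pm B = pm (A ** B)"
  using normal.rcos_sum[OF normal_center, of A B] by (simp add: PSL2_def FactGroup_def r_coset_center)

lemma one_PSL2: "\<one>\<^bsub>PSL2\<^esub> = pm (mat 1)"
  by (simp add: PSL2_def FactGroup_def pm_def)

lemma group_PSL2: "group PSL2"
  unfolding PSL2_def by (rule normal.factorgroup_is_group[OF normal_center])

lemma inv_PSL2: "det A = 1 \<Longrightarrow> inv\<^bsub>PSL2\<^esub> (pm A) = pm (sinv A)"
  by (rule group.inv_equality[OF group_PSL2]) (simp_all add: mult_PSL2 one_PSL2 sinv_mult)

lemma pm_eq_iff: "pm A = pm B \<longleftrightarrow> A = B \<or> A = - B"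
  by (auto simp: pm_def doubleton_eq_iff)

lemma pm_minus [simp]: "pm (- A) = pm A"
  by (auto simp: pm_def)

lemma quotient_map_pm: "quotient_map (top_of_set {A. det A = 1}) PSL2_top pm"
  using quotient_map_quotient_top[of "top_of_set (carrier SL2)" pm] by (simp add: PSL2_top_def)

lemma topspace_PSL2_top: "topspace PSL2_top = carrier PSL2"
  using quotient_imp_surjective_map[OF quotient_map_pm] by (simp add: carrier_PSL2)

lemma continuous_map_pm:
  assumes "continuous_on K M" "\<And>p. p \<in> K \<Longrightarrow> det (M p) = 1"
  shows "continuous_map (top_of_set K) PSL2_top (\<lambda>p. pm (M p))"
proof -
  have "continuous_map (top_of_set K) (top_of_set {A. det A = 1}) M"
    using assms by (auto simp: continuous_map_in_subtopology)
  from continuous_map_compose[OF this quotient_imp_continuous_map[OF quotient_map_pm]]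
  show ?thesis by (simp add: comp_def)
qed

definition pm_fun :: "(real^2^2 \<Rightarrow> 'b) \<Rightarrow> (real^2^2) set \<Rightarrow> 'b" where
  "pm_fun f x = f (SOME A. A \<in> x)"

lemma pm_fun_pm:
  assumes "\<And>A. f (- A) = f A" shows "pm_fun f (pm A) = f A"
proof -
  have "(SOME B. B \<in> pm A) \<in> pm A" by (rule someI[of _ A]) (simp add: pm_def)
  then show ?thesis using assms[of A] by (auto simp: pm_fun_def pm_def)
qed

lemma continuous_map_pm_fun:
  fixes f :: "real^2^2 \<Rightarrow> 'b::topological_space"
  assumes "\<And>A. f (- A) = f A" "continuous_on {A. det A = 1} f"
  shows "continuous_map PSL2_top euclidean (pm_fun f)"
  by (rule continuous_compose_quotient_map[OF quotient_map_pm])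
    (use assms in \<open>simp add: comp_def pm_fun_pm[of f]\<close>)

text \<open>Iwasawa coordinates, up to sign: the direction of the image of the first basis vector (squared),
  its length, and the shear parameter.\<close>

definition dir2 :: "real^2^2 \<Rightarrow> complex" where
  "dir2 A = (mact A 1 / of_real (cmod (mact A 1)))\<^sup>2"

definition rad :: "real^2^2 \<Rightarrow> real" where
  "rad A = cmod (mact A 1)"

definition shr :: "real^2^2 \<Rightarrow> real" where
  "shr A = (A$1$1 * A$1$2 + A$2$1 * A$2$2) / rad A"

lemma iwasawa_minus: "dir2 (- A) = dir2 A" "rad (- A) = rad A" "shr (- A) = shr A"
  by (simp_all add: dir2_def rad_def shr_def mact_minus power_divide)

lemma rad_pos: "det A = 1 \<Longrightarrow> rad A > 0"
  using mact_eq_0[of A 1] by (simp add: rad_def)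

lemma iwasawa_coords:
  assumes "det A = 1" "cis (2 * \<theta>) = dir2 A"
  shows "pm A = pm (rot \<theta> ** tri (rad A) (shr A))"
proof -
  let ?w = "\<lambda>A. mact A 1 / of_real (cmod (mact A 1))"
  have "(cis \<theta>)\<^sup>2 = (?w A)\<^sup>2" using assms(2) by (simp add: dir2_def power2_eq_square cis_mult)
  then have "cis \<theta> = ?w A \<or> cis \<theta> = - ?w A" by (simp add: power2_eq_iff)
  moreover have "?w (- A) = - ?w A" by (simp add: mact_minus)
  ultimately obtain B where B: "B = A \<or> B = - A" "cis \<theta> = ?w B" by metis
  have dB: "det B = 1" "pm B = pm A" "rad B = rad A" "shr B = shr A"
    using B(1) assms(1) by (auto simp: iwasawa_minus)
  define r where "r = rad B"
  have r: "r > 0" using rad_pos dB(1) by (simp add: r_def)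
  have "cis \<theta> = mact B 1 / of_real r" using B(2) by (simp add: r_def rad_def)
  then have cs: "cos \<theta> = B$1$1 / r" "sin \<theta> = - B$2$1 / r"
    by (simp_all add: complex_eq_iff mact_def Re_divide_of_real Im_divide_of_real)
  have r2: "r * r = B$1$1 * B$1$1 + B$2$1 * B$2$1"
    by (simp add: r_def rad_def cmod_def mact_def power2_eq_square)
  have d: "B$1$1 * B$2$2 - B$1$2 * B$2$1 = 1" using dB(1) by (simp add: det_2)
  have "rot \<theta> ** tri r (shr B) = B"
  proof -
    have 12: "B$1$1 * (B$1$1 * B$1$2 + B$2$1 * B$2$2) - B$2$1 = B$1$2 * (r * r)"
    proof -
      have "B$1$1 * (B$1$1 * B$1$2 + B$2$1 * B$2$2) - B$2$1 =
          B$1$2 * (B$1$1 * B$1$1 + B$2$1 * B$2$1) + B$2$1 * ((B$1$1 * B$2$2 - B$1$2 * B$2$1) - 1)"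
        by (simp add: algebra_simps)
      then show ?thesis unfolding d r2 by simp
    qed
    have 22: "B$2$1 * (B$1$1 * B$1$2 + B$2$1 * B$2$2) + B$1$1 = B$2$2 * (r * r)"
    proof -
      have "B$2$1 * (B$1$1 * B$1$2 + B$2$1 * B$2$2) + B$1$1 =
          B$2$2 * (B$1$1 * B$1$1 + B$2$1 * B$2$1) - B$1$1 * ((B$1$1 * B$2$2 - B$1$2 * B$2$1) - 1)"
        by (simp add: algebra_simps)
      then show ?thesis unfolding d r2 by simp
    qed
    have "B$1$1 / r * shr B - B$2$1 / r * (1 / r) = B$1$2"
    proof -
      have "B$1$1 / r * shr B - B$2$1 / r * (1 / r) =
          (B$1$1 * (B$1$1 * B$1$2 + B$2$1 * B$2$2) - B$2$1) / (r * r)"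
        by (simp add: shr_def r_def[symmetric] diff_divide_distrib)
      then show ?thesis unfolding 12 using r by simp
    qed
    moreover have "B$2$1 / r * shr B + B$1$1 / r * (1 / r) = B$2$2"
    proof -
      have "B$2$1 / r * shr B + B$1$1 / r * (1 / r) =
          (B$2$1 * (B$1$1 * B$1$2 + B$2$1 * B$2$2) + B$1$1) / (r * r)"
        using r by (simp add: shr_def r_def[symmetric] field_simps)
      then show ?thesis unfolding 22 using r by simp
    qed
    ultimately show ?thesis using r by (simp add: mat2_eq_iff rot_def tri_def cs)
  qed
  then show ?thesis using dB by (simp add: r_def)
qed

lemma continuous_on_iwasawa:
  "continuous_on {A. det A = 1} dir2" "continuous_on {A. det A = 1} rad" "continuous_on {A. det A = 1} shr"
proof -
  have nz: "cmod (mact A 1) \<noteq> 0" if "A \<in> {A. det A = 1}" for A using rad_pos[of A] that by (auto simp: rad_def)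
  show "continuous_on {A. det A = 1} dir2" "continuous_on {A. det A = 1} rad" "continuous_on {A. det A = 1} shr"
    unfolding dir2_def rad_def shr_def using nz by (intro continuous_intros; force)+
qed

definition iwasawa_matrix :: "real \<Rightarrow> real \<Rightarrow> real \<Rightarrow> real^2^2" where
  "iwasawa_matrix \<theta> r s = rot \<theta> ** tri r s"

definition iwasawa_lift :: "real \<Rightarrow> real \<Rightarrow> real \<Rightarrow> real \<Rightarrow> real" where
  "iwasawa_lift \<theta> r s x = \<theta> + plift (tri r s) x"

lemma det_iwasawa_matrix [simp]: "r \<noteq> 0 \<Longrightarrow> det (iwasawa_matrix \<theta> r s) = 1"
  by (simp add: iwasawa_matrix_def det_mul)

lemma angle_lift_rot: "angle_lift (rot \<theta>) (\<lambda>x. \<theta> + x)"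
  unfolding angle_lift_def by (auto simp: mact_rot cis_mult intro!: continuous_intros exI[of _ 1])

lemma angle_lift_iwasawa:
  assumes "r > 0" shows "angle_lift (iwasawa_matrix \<theta> r s) (iwasawa_lift \<theta> r s)"
proof -
  have "angle_lift (tri r s) (plift (tri r s))"
    using assms by (intro angle_lift_plift) (auto simp: add_inverse_pos)
  from angle_lift_comp[OF angle_lift_rot this, of \<theta>] show ?thesis
    by (simp add: iwasawa_matrix_def iwasawa_lift_def[abs_def] comp_def)
qed

lemma AL_iwasawa:
  assumes "f \<in> AL"
  obtains r s where "r > 0" "f = iwasawa_lift (f 0) r s"
proof -
  obtain A where A: "det A = 1" "angle_lift A f" using assms by (rule AL_E)
  obtain r where r: "r > 0" "mact A (cis 0) = r *\<^sub>R cis (f 0)" using angle_liftE[OF A(2)] by blast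
  define T where "T = rot (- f 0) ** A"
  have dT: "det T = 1" using A by (simp add: T_def det_mul)
  have "mact T (cis 0) = r *\<^sub>R cis 0"
    unfolding T_def mact_mult r(2) by (simp add: mact_rot cis_mult)
  then have "T$1$1 = r" "T$2$1 = 0" by (simp_all add: mact_def complex_eq_iff)
  then have "T = tri r (T$1$2)" using dT r(1) by (simp add: mat2_eq_iff tri_def det_2 field_simps)
  moreover have "A = rot (f 0) ** T" by (simp add: T_def matrix_mul_assoc rot_add)
  ultimately have "A = iwasawa_matrix (f 0) r (T$1$2)" unfolding iwasawa_matrix_def by metis
  then have "f = iwasawa_lift (f 0) r (T$1$2)"
    using angle_lift_eqI[OF A(2), of "iwasawa_lift (f 0) r (T$1$2)" 0] angle_lift_iwasawa[OF r(1)] r(1)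
    by (simp add: iwasawa_lift_def)
  then show thesis using that r(1) by blast
qed

lemma continuous_on_iwasawa_matrix:
  fixes S :: "'a::t2_space set"
  assumes "continuous_on S \<theta>" "continuous_on S r" "continuous_on S s" "\<And>p. p \<in> S \<Longrightarrow> r p > 0"
  shows "continuous_on S (\<lambda>p. iwasawa_matrix (\<theta> p) (r p) (s p))"
  unfolding iwasawa_matrix_def using assms(4) by (intro continuous_intros assms) force

lemma continuous_on_iwasawa_lift:
  assumes "continuous_on S \<theta>" "continuous_on S r" "continuous_on S s" "\<And>p. p \<in> S \<Longrightarrow> r p > 0" "continuous_on S x"
  shows "continuous_on S (\<lambda>p. iwasawa_lift (\<theta> p) (r p) (s p) (x p))"
  unfolding iwasawa_lift_def
  using assms(4) by (intro continuous_intros continuous_on_plift_joint assms) (force simp: add_inverse_pos)+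

text \<open>The coordinates \<open>(\<theta>, r, s)\<close> present \<open>PSL2\<close> as the quotient of a half-space, so maps from convex
  sets lift.\<close>

lemma PSL2_map_lifts:
  fixes K :: "'a::real_normed_vector set"
  assumes "convex K" "continuous_map (top_of_set K) PSL2_top f"
  obtains \<theta> r s where "continuous_on K \<theta>" "continuous_on K r" "continuous_on K s"
    "\<And>p. p \<in> K \<Longrightarrow> r p > 0" "\<And>p. p \<in> K \<Longrightarrow> f p = pm (iwasawa_matrix (\<theta> p) (r p) (s p))"
    "\<And>p. p \<in> K \<Longrightarrow> r p = pm_fun rad (f p)" "\<And>p. p \<in> K \<Longrightarrow> s p = pm_fun shr (f p)"
proof -
  have cm: "continuous_on K (\<lambda>p. pm_fun h (f p))"
    if "\<And>A. h (- A) = h A" "continuous_on {A. det A = 1} h" for h :: "real^2^2 \<Rightarrow> 'c::topological_space"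
    using continuous_map_compose[OF assms(2) continuous_map_pm_fun[OF that]] by (simp add: comp_def)
  have fA: "\<exists>A. det A = 1 \<and> f p = pm A" if "p \<in> K" for p
  proof -
    have "f p \<in> carrier PSL2"
      using assms(2) that unfolding topspace_PSL2_top[symmetric] continuous_map_def by auto
    then show ?thesis by (elim PSL2_E) blast
  qed
  have c: "continuous_on K (\<lambda>p. pm_fun dir2 (f p))" "continuous_on K (\<lambda>p. pm_fun rad (f p))"
    "continuous_on K (\<lambda>p. pm_fun shr (f p))"
    by (intro cm iwasawa_minus continuous_on_iwasawa)+
  have nd: "cmod (pm_fun dir2 (f p)) = 1" if p: "p \<in> K" for p
  proof -
    obtain A where A: "det A = 1" "f p = pm A" using fA[OF p] by blast
    then have "pm_fun dir2 (f p) = dir2 A" using pm_fun_pm[of dir2, OF iwasawa_minus(1)] by simp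
    then show ?thesis using rad_pos[OF A(1)] by (simp add: dir2_def rad_def norm_power norm_divide)
  qed
  have "pm_fun dir2 (f p) \<noteq> 0" if "p \<in> K" for p using nd[OF that] by auto
  from continuous_logarithm_on_contractible[OF c(1) convex_imp_contractible[OF assms(1)] this]
  obtain g where g: "continuous_on K g" "\<And>p. p \<in> K \<Longrightarrow> pm_fun dir2 (f p) = exp (g p)" by metis
  define \<theta> where "\<theta> p = Im (g p) / 2" for p
  have cis: "cis (2 * \<theta> p) = pm_fun dir2 (f p)" if "p \<in> K" for p
  proof -
    have "cmod (exp (g p)) = 1" using nd[OF that] g(2)[OF that] by simp
    then have "Re (g p) = 0" by simp
    then show ?thesis unfolding g(2)[OF that] \<theta>_def by (simp add: exp_eq_polar)
  qed
  show thesis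
  proof (rule that[of \<theta> "\<lambda>p. pm_fun rad (f p)" "\<lambda>p. pm_fun shr (f p)"])
    show "continuous_on K \<theta>" unfolding \<theta>_def by (intro continuous_intros g(1)) auto
    fix p assume p: "p \<in> K"
    obtain A where A: "det A = 1" "f p = pm A" using fA[OF p] by blast
    have e: "pm_fun dir2 (f p) = dir2 A" "pm_fun rad (f p) = rad A" "pm_fun shr (f p) = shr A"
      unfolding A(2) by (rule pm_fun_pm, rule iwasawa_minus)+
    show "pm_fun rad (f p) > 0" using e rad_pos[OF A(1)] by simp
    show "f p = pm (iwasawa_matrix (\<theta> p) (pm_fun rad (f p)) (pm_fun shr (f p)))"
      using iwasawa_coords[OF A(1), of "\<theta> p"] cis[OF p] e A(2) by (simp add: iwasawa_matrix_def)
  qed (use c in auto)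
qed

lemma pm_iwasawa_one:
  assumes "r > 0" "pm (iwasawa_matrix \<theta> r s) = pm (mat 1)"
  shows "r = 1" "s = 0" "\<exists>j::int. \<theta> = pi * of_int j"
proof -
  have "rot \<theta> ** tri r s = mat 1 \<or> rot \<theta> ** tri r s = - mat 1"
    using assms(2) by (simp add: pm_eq_iff iwasawa_matrix_def)
  then obtain \<epsilon> :: real where \<epsilon>: "\<epsilon> = 1 \<or> \<epsilon> = -1" "cos \<theta> * r = \<epsilon>" "sin \<theta> * r = 0"
      "cos \<theta> * s + sin \<theta> / r = 0"
    by (auto simp: mat2_eq_iff rot_def tri_def)
  then have s0: "sin \<theta> = 0" using assms(1) by simp
  then have c: "cos \<theta> = 1 \<or> cos \<theta> = -1" using sin_zero_abs_cos_one[OF s0] by linarith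
  then show "r = 1" using \<epsilon> assms(1) by auto
  show "s = 0" using \<epsilon>(4) s0 c by auto
  show "\<exists>j::int. \<theta> = pi * of_int j" by (rule sin_zero_int_pi[OF s0])
qed

lemma PSL2_map_lifts_normalized:
  fixes K :: "'a::real_normed_vector set"
  assumes K: "convex K" "continuous_map (top_of_set K) PSL2_top f" and p0: "p0 \<in> K" "f p0 = \<one>\<^bsub>PSL2\<^esub>"
  obtains \<theta> r s where "continuous_on K \<theta>" "continuous_on K r" "continuous_on K s"
    "\<And>p. p \<in> K \<Longrightarrow> r p > 0" "\<And>p. p \<in> K \<Longrightarrow> f p = pm (iwasawa_matrix (\<theta> p) (r p) (s p))"
    "\<And>p. p \<in> K \<Longrightarrow> r p = pm_fun rad (f p)" "\<And>p. p \<in> K \<Longrightarrow> s p = pm_fun shr (f p)"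
    "\<theta> p0 = 0" "r p0 = 1" "s p0 = 0"
proof -
  obtain \<theta> r s where *: "continuous_on K \<theta>" "continuous_on K r" "continuous_on K s"
    "\<And>p. p \<in> K \<Longrightarrow> r p > 0" "\<And>p. p \<in> K \<Longrightarrow> f p = pm (iwasawa_matrix (\<theta> p) (r p) (s p))"
    "\<And>p. p \<in> K \<Longrightarrow> r p = pm_fun rad (f p)" "\<And>p. p \<in> K \<Longrightarrow> s p = pm_fun shr (f p)"
  proof (rule PSL2_map_lifts[OF K])
    fix \<theta> r s
    assume "continuous_on K \<theta>"
      "continuous_on K r"
      "continuous_on K s"
      "\<And>p. p \<in> K \<Longrightarrow> r p > 0"
      "\<And>p. p \<in> K \<Longrightarrow> f p = pm (iwasawa_matrix (\<theta> p) (r p) (s p))"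
      "\<And>p. p \<in> K \<Longrightarrow> r p = pm_fun rad (f p)"
      "\<And>p. p \<in> K \<Longrightarrow> s p = pm_fun shr (f p)"
    then show thesis by (rule that)
  qed
  have "pm (iwasawa_matrix (\<theta> p0) (r p0) (s p0)) = pm (mat 1)"
    using *(5)[OF p0(1)] p0(2) by (simp add: one_PSL2)
  note one = pm_iwasawa_one[OF *(4)[OF p0(1)] this]
  obtain j :: int where j: "\<theta> p0 = pi * of_int j" using one(3) by blast
  define \<theta>' where "\<theta>' p = \<theta> p - pi * of_int j" for p
  have "rot (x - pi * of_int j) = (if even j then rot x else - rot x)" for x
  proof -
    have "cis (x + pi * of_int (- j)) = (if even j then cis x else - cis x)" using cis_add_int_pi[of x "- j"] by simp
    then show ?thesis by (auto simp: rot_def mat2_eq_iff complex_eq_iff)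
  qed
  then have "pm (iwasawa_matrix (\<theta>' p) (r p) (s p)) = pm (iwasawa_matrix (\<theta> p) (r p) (s p))" for p
    by (simp add: iwasawa_matrix_def \<theta>'_def)
  moreover have "continuous_on K \<theta>'" unfolding \<theta>'_def by (intro continuous_intros *(1))
  moreover have "\<theta>' p0 = 0" by (simp add: \<theta>'_def j)
  ultimately show thesis using that[of \<theta>' r s] * one by metis
qed


subsection \<open>Lifts of paths\<close>

definition path_lift :: "(real \<Rightarrow> (real^2^2) set) \<Rightarrow> (real \<Rightarrow> real \<Rightarrow> real) \<Rightarrow> bool" where
  "path_lift q F \<longleftrightarrow> continuous_on ({0..1} \<times> UNIV) (\<lambda>p. F (fst p) (snd p)) \<and> F 0 = (\<lambda>x. x) \<and>
     (\<forall>t\<in>{0..1}. \<exists>A. det A = 1 \<and> angle_lift A (F t) \<and> q t = pm A)"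

lemma path_lift_unique:
  assumes "path_lift q F" "path_lift q G"
  shows "F 1 = G 1"
proof -
  have sh: "\<exists>i::int. \<forall>x. F t x = G t x + pi * of_int i" if t: "t \<in> {0..1}" for t
  proof -
    obtain A where A: "det A = 1" "angle_lift A (F t)" "q t = pm A" using assms(1) t unfolding path_lift_def by blast
    obtain B where B: "det B = 1" "angle_lift B (G t)" "q t = pm B" using assms(2) t unfolding path_lift_def by blast
    have "pm A = pm B" using A(3) B(3) by simp
    then have "A = B \<or> A = - B" by (simp only: pm_eq_iff)
    then show ?thesis by (rule angle_lift_pm_shift[OF B(2) A(2) B(1)])
  qed
  define d where "d t = (F t 0 - G t 0) / pi" for t
  have dZ: "d t \<in> \<int>" if "t \<in> {0..1}" for t using sh[OF that] by (auto simp: d_def)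
  have at0: "continuous_on {0..1} (\<lambda>t. H t 0)" if "continuous_on ({0..1} \<times> UNIV) (\<lambda>p. H (fst p) (snd p))"
    for H :: "real \<Rightarrow> real \<Rightarrow> real"
  proof -
    have "continuous_on {0..1} (\<lambda>t::real. (t, 0::real))" by (intro continuous_intros)
    from continuous_on_compose2[OF that this] show ?thesis by auto
  qed
  have "continuous_on {0..1} d"
    unfolding d_def using assms by (intro continuous_intros at0) (auto simp: path_lift_def)
  then have "d 1 = d 0" by (intro connected_int_valued_const[OF _ _ dZ]) auto
  also have "d 0 = 0" using assms by (simp add: d_def path_lift_def)
  finally have "F 1 0 = G 1 0" by (simp add: d_def)
  moreover obtain i :: int where "\<forall>x. F 1 x = G 1 x + pi * of_int i" using sh[of 1] by auto
  ultimately show ?thesis by auto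
qed

definition lift_end :: "(real \<Rightarrow> (real^2^2) set) \<Rightarrow> real \<Rightarrow> real" where
  "lift_end q = (THE f. \<exists>F. path_lift q F \<and> F 1 = f)"

lemma lift_end_eq: "path_lift q F \<Longrightarrow> lift_end q = F 1"
  unfolding lift_end_def by (rule the_equality) (auto dest: path_lift_unique)

lemma path_lift_iwasawa:
  assumes "continuous_on {0..1} \<theta>" "continuous_on {0..1} r" "continuous_on {0..1} s"
    "\<And>t. t \<in> {0..1} \<Longrightarrow> r t > 0" "\<And>t. t \<in> {0..1} \<Longrightarrow> q t = pm (iwasawa_matrix (\<theta> t) (r t) (s t))"
    "\<theta> 0 = 0" "r 0 = 1" "s 0 = 0"
  shows "path_lift q (\<lambda>t. iwasawa_lift (\<theta> t) (r t) (s t))"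
  unfolding path_lift_def
proof (intro conjI ballI)
  have c: "continuous_on ({0..1} \<times> UNIV) (\<lambda>p :: real \<times> real. h (fst p))" if "continuous_on {0..1} h" for h :: "real \<Rightarrow> real"
    by (rule continuous_on_compose2[OF that]) (auto intro: continuous_intros)
  show "continuous_on ({0..1} \<times> UNIV) (\<lambda>p. iwasawa_lift (\<theta> (fst p)) (r (fst p)) (s (fst p)) (snd p))"
    using assms(4) by (intro continuous_on_iwasawa_lift c assms(1-3) continuous_intros) auto
  show "iwasawa_lift (\<theta> 0) (r 0) (s 0) = (\<lambda>x. x)"
    by (rule ext) (simp add: assms iwasawa_lift_def plift_fixed[where r = 1])
  fix t :: real assume t: "t \<in> {0..1}"
  show "\<exists>A. det A = 1 \<and> angle_lift A (iwasawa_lift (\<theta> t) (r t) (s t)) \<and> q t = pm A"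
    using assms(4)[OF t] assms(5)[OF t] angle_lift_iwasawa
    by (intro exI[of _ "iwasawa_matrix (\<theta> t) (r t) (s t)"]) auto
qed

abbreviation PSL2_paths :: "(real \<Rightarrow> (real^2^2) set) set" where
  "PSL2_paths \<equiv> paths_from_one PSL2_top PSL2"

lemma PSL2_path_coords:
  assumes "q \<in> PSL2_paths"
  obtains \<theta> r s where "continuous_on {0..1} \<theta>" "continuous_on {0..1} r" "continuous_on {0..1} s"
    "\<And>t. t \<in> {0..1} \<Longrightarrow> r t > 0" "\<And>t. t \<in> {0..1} \<Longrightarrow> q t = pm (iwasawa_matrix (\<theta> t) (r t) (s t))"
    "\<theta> 0 = 0" "r 0 = 1" "s 0 = 0" "lift_end q = iwasawa_lift (\<theta> 1) (r 1) (s 1)"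
proof -
  have q: "continuous_map (top_of_set {0..1}) PSL2_top q" "q 0 = \<one>\<^bsub>PSL2\<^esub>"
    using assms by (auto simp: paths_from_one_def pathin_def)
  have K: "convex {0..1::real}" "0 \<in> {0..1::real}" by auto
  obtain \<theta> r s where *: "continuous_on {0..1} \<theta>" "continuous_on {0..1} r" "continuous_on {0..1} s"
    "\<And>t. t \<in> {0..1} \<Longrightarrow> r t > 0" "\<And>t. t \<in> {0..1} \<Longrightarrow> q t = pm (iwasawa_matrix (\<theta> t) (r t) (s t))"
    "\<theta> 0 = 0" "r 0 = 1" "s 0 = 0"
  proof (rule PSL2_map_lifts_normalized[OF K(1) q(1) K(2) q(2)])
    fix \<theta> r s
    assume a: "continuous_on {0..1} \<theta>"
      "continuous_on {0..1} r"
      "continuous_on {0..1} s"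
      "\<And>p. p \<in> {0..1} \<Longrightarrow> r p > 0"
      "\<And>p. p \<in> {0..1} \<Longrightarrow> q p = pm (iwasawa_matrix (\<theta> p) (r p) (s p))"
      "\<And>p. p \<in> {0..1} \<Longrightarrow> r p = pm_fun rad (q p)"
      "\<And>p. p \<in> {0..1} \<Longrightarrow> s p = pm_fun shr (q p)"
      "\<theta> 0 = 0"
      "r 0 = 1"
      "s 0 = 0"
    show thesis by (rule that[OF a(1-5,8-10)])
  qed
  show thesis by (rule that[OF * lift_end_eq[OF path_lift_iwasawa[OF *]]])
qed

lemma path_lift_exists:
  assumes "q \<in> PSL2_paths"
  obtains F where "path_lift q F"
proof (rule PSL2_path_coords[OF assms])
  fix \<theta> r s
  assume "continuous_on {0..1} \<theta>"
      "continuous_on {0..1} r"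
      "continuous_on {0..1} s"
      "\<And>p. p \<in> {0..1} \<Longrightarrow> r p > 0"
      "\<And>p. p \<in> {0..1} \<Longrightarrow> q p = pm (iwasawa_matrix (\<theta> p) (r p) (s p))"
      "\<theta> 0 = 0"
      "r 0 = 1"
      "s 0 = 0"
  from path_lift_iwasawa[OF this] show thesis by (rule that)
qed

lemma lift_end_AL: "q \<in> PSL2_paths \<Longrightarrow> lift_end q \<in> AL \<and> (\<exists>A. det A = 1 \<and> angle_lift A (lift_end q) \<and> q 1 = pm A)"
proof -
  assume "q \<in> PSL2_paths"
  then obtain F where F: "path_lift q F" by (rule path_lift_exists)
  then obtain A where "det A = 1" "angle_lift A (F 1)" "q 1 = pm A" unfolding path_lift_def by force
  then show ?thesis using lift_end_eq[OF F] AL_I by auto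
qed

lemma paths_from_one_pm:
  assumes "continuous_on {0..1} M" "\<And>t. t \<in> {0..1} \<Longrightarrow> det (M t) = 1"
    "\<And>t. t \<in> {0..1} \<Longrightarrow> q t = pm (M t)" "pm (M 0) = pm (mat 1)"
  shows "q \<in> PSL2_paths"
proof -
  have "continuous_map (top_of_set {0..1}) PSL2_top q"
    by (rule continuous_map_eq[OF continuous_map_pm[OF assms(1,2)]]) (use assms(3) in auto)
  then show ?thesis using assms(3)[of 0] assms(4) by (simp add: paths_from_one_def pathin_def one_PSL2)
qed

lemma path_homotopic_iff:
  "path_homotopic PSL2_top q r \<longleftrightarrow> (\<exists>h. continuous_map (top_of_set ({0..1::real} \<times> {0..1::real})) PSL2_top h \<and>
     (\<forall>x\<in>{0..1}. h (0, x) = q x) \<and> (\<forall>x\<in>{0..1}. h (1, x) = r x) \<and>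
     (\<forall>t\<in>{0..1}. h (t, 0) = q 0 \<and> h (t, 1) = q 1))"
  unfolding path_homotopic_def by (subst homotopic_with) simp_all

lemma lift_end_homotopic:
  assumes q: "q \<in> PSL2_paths" and h: "path_homotopic PSL2_top q r"
  shows "r \<in> PSL2_paths" "lift_end r = lift_end q"
proof -
  from h[unfolded path_homotopic_iff] obtain h
    where hK: "continuous_map (top_of_set ({0..1::real} \<times> {0..1::real})) PSL2_top h"
    and h0': "\<forall>x\<in>{0..1}. h (0, x) = q x" and h1': "\<forall>x\<in>{0..1}. h (1, x) = r x"
    and he': "\<forall>t\<in>{0..1}. h (t, 0) = q 0 \<and> h (t, 1) = q 1"
    by (elim exE conjE)
  note h0 = bspec[OF h0'] and h1 = bspec[OF h1'] and he = bspec[OF he']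
  let ?K = "{0..1::real} \<times> {0..1::real}"
  have q0: "q 0 = \<one>\<^bsub>PSL2\<^esub>" using q by (simp add: paths_from_one_def)
  have hq: "h (0, 0) = \<one>\<^bsub>PSL2\<^esub>" using h0[of 0] q0 by simp
  have K: "convex ?K" "(0, 0) \<in> ?K" by (auto intro: convex_Times)
  obtain \<theta> \<rho> \<sigma> where *: "continuous_on ?K \<theta>" "continuous_on ?K \<rho>" "continuous_on ?K \<sigma>"
    "\<And>p. p \<in> ?K \<Longrightarrow> \<rho> p > 0" "\<And>p. p \<in> ?K \<Longrightarrow> h p = pm (iwasawa_matrix (\<theta> p) (\<rho> p) (\<sigma> p))"
    "\<And>p. p \<in> ?K \<Longrightarrow> \<rho> p = pm_fun rad (h p)" "\<And>p. p \<in> ?K \<Longrightarrow> \<sigma> p = pm_fun shr (h p)"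
    "\<theta> (0, 0) = 0" "\<rho> (0, 0) = 1" "\<sigma> (0, 0) = 0"
  proof (rule PSL2_map_lifts_normalized[OF K(1) hK K(2) hq])
    fix \<theta> \<rho> \<sigma>
    assume "continuous_on ?K \<theta>"
      "continuous_on ?K \<rho>"
      "continuous_on ?K \<sigma>"
      "\<And>p. p \<in> ?K \<Longrightarrow> \<rho> p > 0"
      "\<And>p. p \<in> ?K \<Longrightarrow> h p = pm (iwasawa_matrix (\<theta> p) (\<rho> p) (\<sigma> p))"
      "\<And>p. p \<in> ?K \<Longrightarrow> \<rho> p = pm_fun rad (h p)"
      "\<And>p. p \<in> ?K \<Longrightarrow> \<sigma> p = pm_fun shr (h p)"
      "\<theta> (0, 0) = 0"
      "\<rho> (0, 0) = 1"
      "\<sigma> (0, 0) = 0"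
    then show thesis by (rule that)
  qed
  have row: "continuous_on {0..1} (\<lambda>t. g (u, t))" "continuous_on {0..1} (\<lambda>u'. g (u', u))"
    if "continuous_on ?K g" "u \<in> {0..1}" for g :: "real \<times> real \<Rightarrow> real" and u
    by (rule continuous_on_compose2[OF that(1)]; use that(2) in \<open>auto intro!: continuous_intros\<close>)+
  text \<open>On each edge \<open>h\<close> is constant, so the angle moves continuously within a coset of \<open>\<pi>\<int>\<close>.\<close>
  have edge: "\<theta> (u, v) = \<theta> (0, v)" if u: "u \<in> {0..1}" and v: "v = 0 \<or> v = 1" for u v
  proof -
    have hv: "h (u, v) = h (0, v)" if "u \<in> {0..1}" for u using he[OF that] he[of 0] v by auto
    define d where "d u = (\<theta> (u, v) - \<theta> (0, v)) / pi" for u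
    have dZ: "d u \<in> \<int>" if u: "u \<in> {0..1}" for u
    proof -
      have p: "(u, v) \<in> ?K" "(0, v) \<in> ?K" using u v by auto
      have rs: "\<rho> (u, v) = \<rho> (0, v)" "\<sigma> (u, v) = \<sigma> (0, v)" using *(6,7) p hv[OF u] by metis+
      have pm: "pm (iwasawa_matrix (\<theta> (u, v)) (\<rho> (0, v)) (\<sigma> (0, v))) = pm (iwasawa_matrix (\<theta> (0, v)) (\<rho> (0, v)) (\<sigma> (0, v)))"
        using *(5)[OF p(1)] *(5)[OF p(2)] hv[OF u] rs by simp
      have "\<exists>i::int. \<forall>x. iwasawa_lift (\<theta> (u, v)) (\<rho> (0, v)) (\<sigma> (0, v)) x =
          iwasawa_lift (\<theta> (0, v)) (\<rho> (0, v)) (\<sigma> (0, v)) x + pi * of_int i"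
        using pm[unfolded pm_eq_iff] *(4)[OF p(2)]
        by (intro angle_lift_pm_shift[OF angle_lift_iwasawa angle_lift_iwasawa]) auto
      then show ?thesis by (auto simp: iwasawa_lift_def d_def)
    qed
    have "continuous_on {0..1} d"
      unfolding d_def using v by (intro continuous_intros row(2)[OF *(1)]) auto
    then have "d u = d 0" by (intro connected_int_valued_const[OF _ _ dZ]) (use u in auto)
    then show ?thesis by (simp add: d_def)
  qed
  have pl: "path_lift (\<lambda>t. h (u, t)) (\<lambda>t. iwasawa_lift (\<theta> (u, t)) (\<rho> (u, t)) (\<sigma> (u, t)))" if u: "u \<in> {0..1}" for u
  proof (rule path_lift_iwasawa)
    have e0: "\<theta> (u, 0) = 0" using edge[OF u, of 0] *(8) by simp
    have p: "(u, 0) \<in> ?K" "(0, 0) \<in> ?K" using u by auto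
    have h00: "h (u, 0) = h (0, 0)" using he[OF u] he[of 0] by simp
    show "\<theta> (u, 0) = 0" by (rule e0)
    show "\<rho> (u, 0) = 1" "\<sigma> (u, 0) = 0" using *(6,7)[OF p(1)] *(6,7)[OF p(2)] *(9,10) h00 by simp_all
    fix t :: real assume "t \<in> {0..1}"
    then have "(u, t) \<in> ?K" using u by simp
    then show "\<rho> (u, t) > 0" "h (u, t) = pm (iwasawa_matrix (\<theta> (u, t)) (\<rho> (u, t)) (\<sigma> (u, t)))"
      using *(4,5) by blast+
  qed (rule row(1)[OF *(1) u] row(1)[OF *(2) u] row(1)[OF *(3) u])+
  have cong: "path_lift r F" if "path_lift q F" "\<And>t. t \<in> {0..1} \<Longrightarrow> q t = r t" for q r F
    using that unfolding path_lift_def by auto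
  have "path_lift q (\<lambda>t. iwasawa_lift (\<theta> (0, t)) (\<rho> (0, t)) (\<sigma> (0, t)))"
    using cong[OF pl[of 0], of q] h0 by simp
  then have lq: "lift_end q = iwasawa_lift (\<theta> (0, 1)) (\<rho> (0, 1)) (\<sigma> (0, 1))" by (rule lift_end_eq)
  have "path_lift r (\<lambda>t. iwasawa_lift (\<theta> (1, t)) (\<rho> (1, t)) (\<sigma> (1, t)))"
    using cong[OF pl[of 1], of r] h1 by simp
  then have lr: "lift_end r = iwasawa_lift (\<theta> (1, 1)) (\<rho> (1, 1)) (\<sigma> (1, 1))" by (rule lift_end_eq)
  have "h (1, 1) = h (0, 1)" using he[of 1] he[of 0] by simp
  then have "\<rho> (1, 1) = \<rho> (0, 1)" "\<sigma> (1, 1) = \<sigma> (0, 1)" using *(6,7)[of "(1, 1)"] *(6,7)[of "(0, 1)"] by simp_all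
  then show "lift_end r = lift_end q" unfolding lq lr using edge[of 1 1] by simp
  have "continuous_map (top_of_set {0..1}) PSL2_top q \<and> continuous_map (top_of_set {0..1}) PSL2_top r"
    using h unfolding path_homotopic_def by (rule homotopic_with_imp_continuous_maps)
  moreover have "r 0 = q 0" using h1[of 0] he[of 1] by simp
  ultimately show "r \<in> PSL2_paths" using q0 by (simp add: paths_from_one_def pathin_def)
qed

lemma lift_end_inject:
  assumes q: "q \<in> PSL2_paths" and r: "r \<in> PSL2_paths" and e: "lift_end q = lift_end r"
  shows "path_homotopic PSL2_top q r"
proof -
  obtain \<theta> \<rho> \<sigma> where A: "continuous_on {0..1} \<theta>" "continuous_on {0..1} \<rho>" "continuous_on {0..1} \<sigma>"
    "\<And>t. t \<in> {0..1} \<Longrightarrow> \<rho> t > 0" "\<And>t. t \<in> {0..1} \<Longrightarrow> q t = pm (iwasawa_matrix (\<theta> t) (\<rho> t) (\<sigma> t))"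
    "\<theta> 0 = 0" "\<rho> 0 = 1" "\<sigma> 0 = 0" "lift_end q = iwasawa_lift (\<theta> 1) (\<rho> 1) (\<sigma> 1)"
  proof (rule PSL2_path_coords[OF q])
    fix \<theta> \<rho> \<sigma>
    assume "continuous_on {0..1} \<theta>"
      "continuous_on {0..1} \<rho>"
      "continuous_on {0..1} \<sigma>"
      "\<And>p. p \<in> {0..1} \<Longrightarrow> \<rho> p > 0"
      "\<And>p. p \<in> {0..1} \<Longrightarrow> q p = pm (iwasawa_matrix (\<theta> p) (\<rho> p) (\<sigma> p))"
      "\<theta> 0 = 0"
      "\<rho> 0 = 1"
      "\<sigma> 0 = 0"
      "lift_end q = iwasawa_lift (\<theta> 1) (\<rho> 1) (\<sigma> 1)"
    then show thesis by (rule that)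
  qed
  obtain \<theta>' \<rho>' \<sigma>' where B: "continuous_on {0..1} \<theta>'" "continuous_on {0..1} \<rho>'" "continuous_on {0..1} \<sigma>'"
    "\<And>t. t \<in> {0..1} \<Longrightarrow> \<rho>' t > 0" "\<And>t. t \<in> {0..1} \<Longrightarrow> r t = pm (iwasawa_matrix (\<theta>' t) (\<rho>' t) (\<sigma>' t))"
    "\<theta>' 0 = 0" "\<rho>' 0 = 1" "\<sigma>' 0 = 0" "lift_end r = iwasawa_lift (\<theta>' 1) (\<rho>' 1) (\<sigma>' 1)"
  proof (rule PSL2_path_coords[OF r])
    fix \<theta>' \<rho>' \<sigma>'
    assume "continuous_on {0..1} \<theta>'"
      "continuous_on {0..1} \<rho>'"
      "continuous_on {0..1} \<sigma>'"
      "\<And>p. p \<in> {0..1} \<Longrightarrow> \<rho>' p > 0"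
      "\<And>p. p \<in> {0..1} \<Longrightarrow> r p = pm (iwasawa_matrix (\<theta>' p) (\<rho>' p) (\<sigma>' p))"
      "\<theta>' 0 = 0"
      "\<rho>' 0 = 1"
      "\<sigma>' 0 = 0"
      "lift_end r = iwasawa_lift (\<theta>' 1) (\<rho>' 1) (\<sigma>' 1)"
    then show thesis by (rule that)
  qed
  have p1: "\<rho> 1 > 0" "\<rho>' 1 > 0" using A(4)[of 1] B(4)[of 1] by auto
  have eq: "iwasawa_lift (\<theta> 1) (\<rho> 1) (\<sigma> 1) = iwasawa_lift (\<theta>' 1) (\<rho>' 1) (\<sigma>' 1)" using e A(9) B(9) by simp
  from fun_cong[OF this, of 0] have t1: "\<theta> 1 = \<theta>' 1" using p1 by (simp add: iwasawa_lift_def)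
  have "iwasawa_matrix (\<theta> 1) (\<rho> 1) (\<sigma> 1) = iwasawa_matrix (\<theta>' 1) (\<rho>' 1) (\<sigma>' 1)"
  proof (rule angle_lift_matrix_unique)
    show "angle_lift (iwasawa_matrix (\<theta> 1) (\<rho> 1) (\<sigma> 1)) (iwasawa_lift (\<theta> 1) (\<rho> 1) (\<sigma> 1))"
      by (rule angle_lift_iwasawa[OF p1(1)])
    show "angle_lift (iwasawa_matrix (\<theta>' 1) (\<rho>' 1) (\<sigma>' 1)) (iwasawa_lift (\<theta> 1) (\<rho> 1) (\<sigma> 1))"
      unfolding eq by (rule angle_lift_iwasawa[OF p1(2)])
  qed (use p1 in auto)
  then have "rot (- \<theta> 1) ** iwasawa_matrix (\<theta> 1) (\<rho> 1) (\<sigma> 1) = rot (- \<theta> 1) ** iwasawa_matrix (\<theta> 1) (\<rho>' 1) (\<sigma>' 1)"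
    by (simp add: t1)
  then have "tri (\<rho> 1) (\<sigma> 1) = tri (\<rho>' 1) (\<sigma>' 1)" by (simp add: iwasawa_matrix_def matrix_mul_assoc rot_add)
  then have rs1: "\<rho> 1 = \<rho>' 1" "\<sigma> 1 = \<sigma>' 1" by (simp_all add: mat2_eq_iff tri_def)
  let ?K = "{0..1::real} \<times> {0..1::real}"
  define mix where "mix f g p = (1 - fst p) * f (snd p) + fst p * g (snd p)" for f g :: "real \<Rightarrow> real" and p :: "real \<times> real"
  have cmix: "continuous_on ?K (mix f g)" if "continuous_on {0..1} f" "continuous_on {0..1} g" for f g
    unfolding mix_def
    by (intro continuous_intros continuous_on_compose2[OF that(1)] continuous_on_compose2[OF that(2)]) auto
  define h where "h p = pm (iwasawa_matrix (mix \<theta> \<theta>' p) (mix \<rho> \<rho>' p) (mix \<sigma> \<sigma>' p))" for p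
  have pos: "mix \<rho> \<rho>' p > 0" if "p \<in> ?K" for p
  proof -
    have *: "\<rho> (snd p) > 0" "\<rho>' (snd p) > 0" "0 \<le> fst p" "fst p \<le> 1"
      using that A(4)[of "snd p"] B(4)[of "snd p"] by auto
    show ?thesis
    proof (cases "fst p = 0")
      case False
      then have "fst p * \<rho>' (snd p) > 0" using * by simp
      moreover have "(1 - fst p) * \<rho> (snd p) \<ge> 0" using * by simp
      ultimately show ?thesis unfolding mix_def by linarith
    qed (use * in \<open>simp add: mix_def\<close>)
  qed
  have "continuous_map (top_of_set ?K) PSL2_top h"
    unfolding h_def
    by (intro continuous_map_pm continuous_on_iwasawa_matrix cmix A B pos) (use pos in force)+
  moreover have "\<forall>x\<in>{0..1}. h (0, x) = q x" "\<forall>x\<in>{0..1}. h (1, x) = r x"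
    using A(5) B(5) by (auto simp: h_def mix_def)
  moreover have "\<forall>t\<in>{0..1}. h (t, 0) = q 0 \<and> h (t, 1) = q 1"
    using A(5)[of 0] A(5)[of 1] A(6-8) B(6-8) t1 rs1 by (simp add: h_def mix_def algebra_simps)
  ultimately show ?thesis unfolding path_homotopic_iff by blast
qed

subsection \<open>The covering group as a group of homeomorphisms of the line\<close>

definition AL_group :: "(real \<Rightarrow> real) monoid" where
  "AL_group = \<lparr>carrier = AL, monoid.mult = (\<circ>), one = (\<lambda>x. x)\<rparr>"

lemma AL_group_simps [simp]:
  "carrier AL_group = AL" "f \<otimes>\<^bsub>AL_group\<^esub> h = f \<circ> h" "\<one>\<^bsub>AL_group\<^esub> = (\<lambda>x. x)"
  by (simp_all add: AL_group_def)

lemma finv_comp: "f \<in> AL \<Longrightarrow> finv f \<circ> f = (\<lambda>x. x)"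
  by (auto simp: AL_inv_f)

lemma group_AL_group: "group AL_group"
proof (rule groupI)
  fix f assume f: "f \<in> carrier AL_group"
  then show "\<exists>h\<in>carrier AL_group. h \<otimes>\<^bsub>AL_group\<^esub> f = \<one>\<^bsub>AL_group\<^esub>"
    by (intro bexI[of _ "finv f"]) (simp_all add: AL_inv finv_comp)
qed (auto simp: AL_id comp_assoc intro: AL_comp)

lemma inv_AL_group: "f \<in> AL \<Longrightarrow> inv\<^bsub>AL_group\<^esub> f = finv f"
  by (rule group.inv_equality[OF group_AL_group]) (simp_all add: AL_inv finv_comp)

definition cover_elem :: "(real \<Rightarrow> real) \<Rightarrow> (real \<Rightarrow> (real^2^2) set) set" where
  "cover_elem f = {q \<in> PSL2_paths. lift_end q = f}"

lemma path_class_eq: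
  assumes q: "q \<in> PSL2_paths"
  shows "path_class PSL2_top q = cover_elem (lift_end q)"
proof (intro equalityI subsetI)
  fix r assume "r \<in> path_class PSL2_top q"
  then have "path_homotopic PSL2_top q r" by (simp add: path_class_def)
  from lift_end_homotopic[OF q this] show "r \<in> cover_elem (lift_end q)" by (simp add: cover_elem_def)
next
  fix r assume "r \<in> cover_elem (lift_end q)"
  then have r: "r \<in> PSL2_paths" "lift_end q = lift_end r" by (auto simp: cover_elem_def)
  from lift_end_inject[OF q r] show "r \<in> path_class PSL2_top q" by (simp add: path_class_def)
qed

lemma lift_end_surj:
  assumes "f \<in> AL"
  obtains q where "q \<in> PSL2_paths" "lift_end q = f"
proof -
  obtain r s where r: "r > 0" "f = iwasawa_lift (f 0) r s" by (rule AL_iwasawa[OF assms])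
  define q where "q t = pm (iwasawa_matrix (t * f 0) (1 + t * (r - 1)) (t * s))" for t
  have pos: "1 + t * (r - 1) > 0" if "t \<in> {0..1}" for t
  proof (cases "t = 0")
    case False
    have "t * r > 0" "1 - t \<ge> 0" using False that r by auto
    then show ?thesis by (simp add: algebra_simps)
  qed simp
  have q: "q \<in> PSL2_paths"
  proof (rule paths_from_one_pm)
    show "continuous_on {0..1} (\<lambda>t. iwasawa_matrix (t * f 0) (1 + t * (r - 1)) (t * s))"
      by (intro continuous_on_iwasawa_matrix continuous_intros pos)
    show "det (iwasawa_matrix (t * f 0) (1 + t * (r - 1)) (t * s)) = 1" if "t \<in> {0..1}" for t
      using pos[OF that] by simp
  qed (simp_all add: q_def iwasawa_matrix_def)
  have "path_lift q (\<lambda>t. iwasawa_lift (t * f 0) (1 + t * (r - 1)) (t * s))"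
    by (rule path_lift_iwasawa) (use pos in \<open>auto simp: q_def intro!: continuous_intros\<close>)
  from lift_end_eq[OF this] have "lift_end q = f" using r(2) by simp
  with q show thesis by (rule that)
qed

lemma cover_elem_nonempty: "f \<in> AL \<Longrightarrow> cover_elem f \<noteq> {}"
  by (rule lift_end_surj[of f]) (auto simp: cover_elem_def)

lemma cover_elem_inject: "f \<in> AL \<Longrightarrow> cover_elem f = cover_elem h \<Longrightarrow> f = h"
  using cover_elem_nonempty[of f] by (auto simp: cover_elem_def)

lemma carrier_SL2_tilde: "carrier SL2_tilde = cover_elem ` AL"
proof -
  have "path_class PSL2_top ` PSL2_paths = cover_elem ` AL"
  proof (intro equalityI subsetI)
    fix U assume "U \<in> path_class PSL2_top ` PSL2_paths"
    then obtain q where "q \<in> PSL2_paths" "U = path_class PSL2_top q" by blast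
    then show "U \<in> cover_elem ` AL" using path_class_eq lift_end_AL by auto
  next
    fix U assume "U \<in> cover_elem ` AL"
    then obtain f where f: "f \<in> AL" "U = cover_elem f" by blast
    obtain q where "q \<in> PSL2_paths" "lift_end q = f" by (rule lift_end_surj[OF f(1)])
    then show "U \<in> path_class PSL2_top ` PSL2_paths" using f path_class_eq by auto
  qed
  then show ?thesis by (simp add: universal_cover_def)
qed

lemma path_lift_mult:
  assumes "path_lift q F" "path_lift r G"
  shows "path_lift (\<lambda>t. q t \<otimes>\<^bsub>PSL2\<^esub> r t) (\<lambda>t. F t \<circ> G t)"
  unfolding path_lift_def
proof (intro conjI ballI)
  let ?K = "{0..1::real} \<times> (UNIV :: real set)"
  have F: "continuous_on ?K (\<lambda>p. F (fst p) (snd p))" and G: "continuous_on ?K (\<lambda>p. G (fst p) (snd p))"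
    using assms by (auto simp: path_lift_def)
  have "continuous_on ?K (\<lambda>p. (fst p, G (fst p) (snd p)))" by (intro continuous_intros G)
  moreover have "(\<lambda>p. (fst p, G (fst p) (snd p))) ` ?K \<subseteq> ?K" by auto
  ultimately have "continuous_on ?K (\<lambda>p. F (fst (fst p, G (fst p) (snd p))) (snd (fst p, G (fst p) (snd p))))"
    by (rule continuous_on_compose2[OF F])
  then show "continuous_on ?K (\<lambda>p. (F (fst p) \<circ> G (fst p)) (snd p))" by simp
  show "F 0 \<circ> G 0 = (\<lambda>x. x)" using assms by (auto simp: path_lift_def)
  fix t :: real assume t: "t \<in> {0..1}"
  obtain A where A: "det A = 1" "angle_lift A (F t)" "q t = pm A" using assms(1) t unfolding path_lift_def by blast
  obtain B where B: "det B = 1" "angle_lift B (G t)" "r t = pm B" using assms(2) t unfolding path_lift_def by blast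
  show "\<exists>C. det C = 1 \<and> angle_lift C (F t \<circ> G t) \<and> q t \<otimes>\<^bsub>PSL2\<^esub> r t = pm C"
    using A B by (intro exI[of _ "A ** B"]) (simp add: angle_lift_comp mult_PSL2 det_mul)
qed

lemma PSL2_paths_mult:
  assumes q: "q \<in> PSL2_paths" and r: "r \<in> PSL2_paths"
  shows "(\<lambda>t. q t \<otimes>\<^bsub>PSL2\<^esub> r t) \<in> PSL2_paths"
    "lift_end (\<lambda>t. q t \<otimes>\<^bsub>PSL2\<^esub> r t) = lift_end q \<circ> lift_end r"
proof -
  obtain F where F: "path_lift q F" by (rule path_lift_exists[OF q])
  obtain G where G: "path_lift r G" by (rule path_lift_exists[OF r])
  show "lift_end (\<lambda>t. q t \<otimes>\<^bsub>PSL2\<^esub> r t) = lift_end q \<circ> lift_end r"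
    unfolding lift_end_eq[OF path_lift_mult[OF F G]] lift_end_eq[OF F] lift_end_eq[OF G] ..
  have M: "\<exists>M. continuous_on {0..1} M \<and> (\<forall>t\<in>{0..1}. det (M t) = 1 \<and> q t = pm (M t)) \<and> pm (M 0) = pm (mat 1)"
    if "q \<in> PSL2_paths" for q
  proof (rule PSL2_path_coords[OF that])
    fix \<theta> r s
    assume a: "continuous_on {0..1} \<theta>" "continuous_on {0..1} r" "continuous_on {0..1} s"
      "\<And>t. t \<in> {0..1} \<Longrightarrow> r t > 0" "\<And>t. t \<in> {0..1} \<Longrightarrow> q t = pm (iwasawa_matrix (\<theta> t) (r t) (s t))"
      "\<theta> 0 = 0" "r 0 = 1" "s 0 = 0"
    have "det (iwasawa_matrix (\<theta> t) (r t) (s t)) = 1" if "t \<in> {0..1}" for t using a(4)[OF that] by simp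
    then show ?thesis
      by (intro exI[of _ "\<lambda>t. iwasawa_matrix (\<theta> t) (r t) (s t)"] conjI ballI continuous_on_iwasawa_matrix a)
        (simp_all add: a(6-8) iwasawa_matrix_def)
  qed
  obtain M where M1: "continuous_on {0..1} M" "\<And>t. t \<in> {0..1} \<Longrightarrow> det (M t) = 1 \<and> q t = pm (M t)" "pm (M 0) = pm (mat 1)"
    using M[OF q] by blast
  obtain N where N1: "continuous_on {0..1} N" "\<And>t. t \<in> {0..1} \<Longrightarrow> det (N t) = 1 \<and> r t = pm (N t)" "pm (N 0) = pm (mat 1)"
    using M[OF r] by blast
  show "(\<lambda>t. q t \<otimes>\<^bsub>PSL2\<^esub> r t) \<in> PSL2_paths"
  proof (rule paths_from_one_pm)
    show "continuous_on {0..1} (\<lambda>t. M t ** N t)" by (intro continuous_intros M1 N1)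
    show "det (M t ** N t) = 1" "q t \<otimes>\<^bsub>PSL2\<^esub> r t = pm (M t ** N t)" if "t \<in> {0..1}" for t
      using M1(2)[OF that] N1(2)[OF that] by (simp_all add: det_mul mult_PSL2)
    show "pm (M 0 ** N 0) = pm (mat 1)" using M1(3) N1(3) by (auto simp: pm_eq_iff)
  qed
qed

lemma mult_SL2_tilde:
  assumes "f \<in> AL" "h \<in> AL"
  shows "cover_elem f \<otimes>\<^bsub>SL2_tilde\<^esub> cover_elem h = cover_elem (f \<circ> h)"
proof -
  have "path_class PSL2_top (\<lambda>t. q t \<otimes>\<^bsub>PSL2\<^esub> r t) = cover_elem (f \<circ> h)" if "q \<in> cover_elem f" "r \<in> cover_elem h" for q r
    using that path_class_eq[OF PSL2_paths_mult(1)] PSL2_paths_mult(2) by (auto simp: cover_elem_def)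
  then have "(\<Union>q\<in>cover_elem f. \<Union>r\<in>cover_elem h. path_class PSL2_top (\<lambda>t. q t \<otimes>\<^bsub>PSL2\<^esub> r t)) =
      (\<Union>q\<in>cover_elem f. \<Union>r\<in>cover_elem h. cover_elem (f \<circ> h))" by simp
  also have "\<dots> = cover_elem (f \<circ> h)" using cover_elem_nonempty assms by auto
  finally show ?thesis by (simp add: universal_cover_def)
qed

lemma one_SL2_tilde: "\<one>\<^bsub>SL2_tilde\<^esub> = cover_elem (\<lambda>x. x)"
proof -
  have c: "(\<lambda>_. \<one>\<^bsub>PSL2\<^esub>) \<in> PSL2_paths"
    by (rule paths_from_one_pm[of "\<lambda>_. mat 1"]) (simp_all add: one_PSL2)
  have "path_lift (\<lambda>_. \<one>\<^bsub>PSL2\<^esub>) (\<lambda>_ x. x)"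
    unfolding path_lift_def
    by (auto intro!: continuous_intros exI[of _ "mat 1"] simp: angle_lift_id one_PSL2)
  from lift_end_eq[OF this] path_class_eq[OF c] show ?thesis by (simp add: universal_cover_def)
qed

lemma cover_elem_hom: "cover_elem \<in> hom AL_group SL2_tilde"
  by (auto simp: hom_def carrier_SL2_tilde mult_SL2_tilde)

lemma group_SL2_tilde: "group SL2_tilde"
proof -
  have "group (SL2_tilde \<lparr>carrier := cover_elem ` carrier AL_group, one := cover_elem \<one>\<^bsub>AL_group\<^esub>\<rparr>)"
    by (rule group.hom_imp_img_group[OF group_AL_group cover_elem_hom])
  moreover have "SL2_tilde \<lparr>carrier := cover_elem ` carrier AL_group, one := cover_elem \<one>\<^bsub>AL_group\<^esub>\<rparr> = SL2_tilde"
    using carrier_SL2_tilde one_SL2_tilde by (simp add: universal_cover_def)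
  ultimately show ?thesis by simp
qed

lemma group_hom_cover_elem: "group_hom AL_group SL2_tilde cover_elem"
  by (intro group_hom.intro group_hom_axioms.intro group_AL_group group_SL2_tilde cover_elem_hom)

lemma inv_SL2_tilde: "f \<in> AL \<Longrightarrow> inv\<^bsub>SL2_tilde\<^esub> (cover_elem f) = cover_elem (finv f)"
  using group_hom.hom_inv[OF group_hom_cover_elem, of f] by (simp add: inv_AL_group)

lemma commutator_SL2_tilde:
  assumes "f \<in> AL" "h \<in> AL"
  shows "commutator SL2_tilde (cover_elem f) (cover_elem h) = cover_elem (f \<circ> h \<circ> finv f \<circ> finv h)"
  using assms by (simp add: commutator_def inv_SL2_tilde mult_SL2_tilde AL_inv AL_comp)

lemma list_prod_SL2_tilde:
  assumes "\<And>f. f \<in> set fs \<Longrightarrow> f \<in> AL"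
  shows "list_prod SL2_tilde (map cover_elem fs) = cover_elem (foldr (\<circ>) fs (\<lambda>x. x)) \<and> foldr (\<circ>) fs (\<lambda>x. x) \<in> AL"
  using assms
proof (induction fs)
  case Nil
  then show ?case by (simp add: list_prod_def one_SL2_tilde AL_id)
next
  case (Cons f fs)
  have f: "f \<in> AL" by (rule Cons.prems) simp
  have "list_prod SL2_tilde (map cover_elem fs) = cover_elem (foldr (\<circ>) fs (\<lambda>x. x)) \<and> foldr (\<circ>) fs (\<lambda>x. x) \<in> AL"
    by (rule Cons.IH) (rule Cons.prems, simp)
  note IH = conjunct1[OF this] conjunct2[OF this] f
  have "list_prod SL2_tilde (map cover_elem (f # fs)) = cover_elem f \<otimes>\<^bsub>SL2_tilde\<^esub> list_prod SL2_tilde (map cover_elem fs)"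
    by (simp add: list_prod_def)
  also have "\<dots> = cover_elem (f \<circ> foldr (\<circ>) fs (\<lambda>x. x))" unfolding IH(1) by (rule mult_SL2_tilde[OF IH(3,2)])
  finally have "list_prod SL2_tilde (map cover_elem (f # fs)) = cover_elem (f \<circ> foldr (\<circ>) fs (\<lambda>x. x))" .
  moreover have "foldr (\<circ>) (f # fs) (\<lambda>x. x) = f \<circ> foldr (\<circ>) fs (\<lambda>x. x)"
    by (subst foldr.simps(2), subst comp_apply) (rule HOL.refl)
  ultimately show ?case using AL_comp[OF IH(3,2)] by metis
qed

lemma int_pow_translation:
  "(\<lambda>x. x + pi) [^]\<^bsub>AL_group\<^esub> (n::int) = (\<lambda>x. x + pi * of_int n)"
proof -
  interpret group AL_group by (rule group_AL_group)
  have tr: "(\<lambda>x. x + pi * of_int n) \<in> AL" for n :: int using AL_shift[OF AL_id, of n] by simp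
  then have t1: "(\<lambda>x. x + pi) \<in> carrier AL_group" using tr[of 1] by simp
  have step: "(\<lambda>x. x + pi) [^]\<^bsub>AL_group\<^esub> (n + 1) = (\<lambda>x. x + pi) [^]\<^bsub>AL_group\<^esub> n \<circ> (\<lambda>x. x + pi)" for n :: int
    using int_pow_mult[OF t1, of n 1] int_pow_1[OF t1] by simp
  show ?thesis
  proof (induction n rule: int_induct[where k = 0])
    case base
    then show ?case by simp
  next
    case (step1 i)
    then show ?case unfolding step by (auto simp: algebra_simps)
  next
    case (step2 i)
    have "(\<lambda>x. x + pi) [^]\<^bsub>AL_group\<^esub> (i - 1) \<circ> (\<lambda>x. x + pi) = (\<lambda>x. x + pi * of_int i)"
      using step[of "i - 1"] step2 by simp
    then have "((\<lambda>x. x + pi) [^]\<^bsub>AL_group\<^esub> (i - 1)) (y + pi) = y + pi * of_int i" for y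
      by (simp add: fun_eq_iff)
    from this[of "y - pi" for y] show ?case by (auto simp: algebra_simps)
  qed
qed

lemma lifts_PSL2:
  "lifts PSL2_top PSL2 x = cover_elem ` {f. \<exists>A. det A = 1 \<and> angle_lift A f \<and> x = pm A}"
proof (intro equalityI subsetI)
  fix U assume "U \<in> lifts PSL2_top PSL2 x"
  then obtain f q where f: "f \<in> AL" "U = cover_elem f" "q \<in> cover_elem f" "q 1 = x"
    by (auto simp: lifts_def carrier_SL2_tilde)
  then have "q \<in> PSL2_paths" "lift_end q = f" by (auto simp: cover_elem_def)
  then show "U \<in> cover_elem ` {f. \<exists>A. det A = 1 \<and> angle_lift A f \<and> x = pm A}"
    using lift_end_AL f by blast
next
  fix U assume "U \<in> cover_elem ` {f. \<exists>A. det A = 1 \<and> angle_lift A f \<and> x = pm A}"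
  then obtain f A where f: "U = cover_elem f" "det A = 1" "angle_lift A f" "x = pm A" by blast
  have AL: "f \<in> AL" using f by (intro AL_I)
  obtain q where q: "q \<in> PSL2_paths" "lift_end q = f" by (rule lift_end_surj[OF AL])
  obtain B where B: "det B = 1" "angle_lift B f" "q 1 = pm B" using lift_end_AL[OF q(1)] q(2) by blast
  have "A = B" using angle_lift_matrix_unique f B by blast
  then show "U \<in> lifts PSL2_top PSL2 x"
    using q f AL B by (auto simp: lifts_def carrier_SL2_tilde cover_elem_def)
qed

lemma lifts_nonempty: "det A = 1 \<Longrightarrow> lifts PSL2_top PSL2 (pm A) \<noteq> {}"
  using angle_lift_slift[of A] by (auto simp: lifts_PSL2)


subsection \<open>Exponentials\<close>

lemma scaleR_mat_mult: "(c *\<^sub>R A) ** B = c *\<^sub>R (A ** B)" "A ** (c *\<^sub>R B) = c *\<^sub>R (A ** B)" for A B :: "real^2^2"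
  by (simp_all add: mat2_eq_iff algebra_simps)

lemma add_mat_mult: "A ** (B + C) = A ** B + A ** C" for A B C :: "real^2^2"
  by (simp add: mat2_eq_iff algebra_simps)

lemma sl2_square: "X \<in> sl2 \<Longrightarrow> X ** X = (- det X) *\<^sub>R mat 1"
proof -
  assume "X \<in> sl2"
  then have "X$2$2 = - X$1$1" by (simp add: sl2_def trace_2)
  then show ?thesis by (simp add: mat2_eq_iff det_2 algebra_simps)
qed

lemma matrix_powers:
  assumes X: "X \<in> sl2" and "a 0 = 1" "b 0 = 0" "\<And>k. a (Suc k) = - det X * b k" "\<And>k. b (Suc k) = a k"
  shows "((\<lambda>Y. X ** Y) ^^ k) (mat 1) = a k *\<^sub>R mat 1 + b k *\<^sub>R X"
proof (induction k)
  case 0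
  then show ?case using assms by simp
next
  case (Suc k)
  have "((\<lambda>Y. X ** Y) ^^ Suc k) (mat 1) = X ** (a k *\<^sub>R mat 1 + b k *\<^sub>R X)" by (simp add: Suc)
  also have "\<dots> = a k *\<^sub>R X + b k *\<^sub>R ((- det X) *\<^sub>R mat 1)"
    by (simp add: add_mat_mult scaleR_mat_mult sl2_square[OF X])
  finally show ?case using assms(4,5) by (simp add: mult.commute)
qed

lemma mat_exp_sums:
  assumes X: "X \<in> sl2" and ab: "a 0 = 1" "b 0 = 0" "\<And>k. a (Suc k) = - det X * b k" "\<And>k. b (Suc k) = a k"
    and "(\<lambda>k. a k / fact k) sums A" "(\<lambda>k. b k / fact k) sums B"
  shows "mat_exp X = A *\<^sub>R mat 1 + B *\<^sub>R X"
proof -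
  have "(\<lambda>k. (a k / fact k) *\<^sub>R mat 1 + (b k / fact k) *\<^sub>R X) sums (A *\<^sub>R mat 1 + B *\<^sub>R X)"
    by (intro sums_add sums_scaleR_left assms)
  also have "(\<lambda>k. (a k / fact k) *\<^sub>R mat 1 + (b k / fact k) *\<^sub>R X) =
      (\<lambda>k. (1 / fact k) *\<^sub>R ((\<lambda>Y. X ** Y) ^^ k) (mat 1))"
    by (simp add: matrix_powers[OF X ab] scaleR_add_right)
  finally show ?thesis unfolding mat_exp_def by (simp add: sums_iff)
qed

lemma mat_exp_hyperbolic:
  assumes X: "X \<in> sl2" and w: "- det X = w\<^sup>2" "w \<noteq> 0"
  shows "mat_exp X = cosh w *\<^sub>R mat 1 + (sinh w / w) *\<^sub>R X"
proof (rule mat_exp_sums[OF X])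
  have e: "(\<lambda>k. x ^ k / fact k) sums exp x" for x :: real
    using exp_converges[of x] by (simp add: field_simps)
  show "(\<lambda>k. ((w ^ k + (- w) ^ k) / 2) / fact k) sums cosh w"
    using sums_divide[OF sums_add[OF e[of w] e[of "- w"]], of 2]
    by (simp add: cosh_field_def add_divide_distrib[symmetric] field_simps)
  show "(\<lambda>k. ((w ^ k - (- w) ^ k) / (2 * w)) / fact k) sums (sinh w / w)"
    using sums_divide[OF sums_diff[OF e[of w] e[of "- w"]], of "2 * w"] w(2)
    by (simp add: sinh_field_def diff_divide_distrib[symmetric] field_simps)
  show "(w ^ Suc k + (- w) ^ Suc k) / 2 = - det X * ((w ^ k - (- w) ^ k) / (2 * w))" for k
    using w(2) unfolding w(1) by (simp add: field_simps power2_eq_square)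
  show "(w ^ Suc k - (- w) ^ Suc k) / (2 * w) = (w ^ k + (- w) ^ k) / 2" for k
    using w(2) by (simp add: field_simps)
qed simp_all

lemma mat_exp_elliptic:
  assumes X: "X \<in> sl2" and w: "det X = w\<^sup>2" "w \<noteq> 0"
  shows "mat_exp X = cos w *\<^sub>R mat 1 + (sin w / w) *\<^sub>R X"
proof (rule mat_exp_sums[OF X])
  have e: "(\<lambda>k. (\<i> * of_real w) ^ k / of_real (fact k)) sums cis w"
    using exp_converges[of "\<i> * of_real w"] by (simp add: scaleR_conv_of_real field_simps cis_conv_exp)
  show "(\<lambda>k. Re ((\<i> * of_real w) ^ k) / fact k) sums cos w"
    using sums_Re[OF e] by (simp add: Re_divide_of_real del: of_real_fact)
  have "(\<lambda>k. Im ((\<i> * of_real w) ^ k) / fact k) sums sin w"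
    using sums_Im[OF e] by (simp add: Im_divide_of_real del: of_real_fact)
  from sums_divide[OF this, of w] show "(\<lambda>k. (Im ((\<i> * of_real w) ^ k) / w) / fact k) sums (sin w / w)"
    by (simp add: field_simps)
  show "Re ((\<i> * of_real w) ^ Suc k) = - det X * (Im ((\<i> * of_real w) ^ k) / w)" for k
    using w(2) unfolding w(1) by (simp add: power2_eq_square)
  show "Im ((\<i> * of_real w) ^ Suc k) / w = Re ((\<i> * of_real w) ^ k)" for k
    using w(2) by simp
qed simp_all

lemma mat_exp_nilpotent:
  assumes X: "X \<in> sl2" and w: "det X = 0"
  shows "mat_exp X = mat 1 + X"
proof -
  have "mat_exp X = 1 *\<^sub>R mat 1 + 1 *\<^sub>R X"
  proof (rule mat_exp_sums[OF X])
    show "(\<lambda>k. (if k = 0 then 1 else 0) / fact k) sums (1::real)"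
      using sums_If_finite_set[of "{0}" "\<lambda>k. 1 / fact k :: real"] by (simp add: if_distrib[of "\<lambda>x. x / _"] cong: if_cong)
    show "(\<lambda>k. (if k = 1 then 1 else 0) / fact k) sums (1::real)"
      using sums_If_finite_set[of "{1}" "\<lambda>k. 1 / fact k :: real"] by (simp add: if_distrib[of "\<lambda>x. x / _"] cong: if_cong)
  qed (simp_all add: w)
  then show ?thesis by simp
qed

lemma path_class_principal:
  assumes "continuous_on {0..1} M" "\<And>t. t \<in> {0..1} \<Longrightarrow> det (M t) = 1 \<and> trace (M t) > -2" "M 0 = mat 1"
  shows "path_class PSL2_top (\<lambda>t. pm (M t)) = cover_elem (plift (M 1))"
proof -
  have q: "(\<lambda>t. pm (M t)) \<in> PSL2_paths"
    by (rule paths_from_one_pm[OF assms(1)]) (use assms(2,3) in auto)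
  have "path_lift (\<lambda>t. pm (M t)) (\<lambda>t. plift (M t))"
    unfolding path_lift_def
  proof (intro conjI ballI)
    have "continuous_on ({0..1} \<times> UNIV) (\<lambda>p. M (fst p))"
      by (rule continuous_on_compose2[OF assms(1)]) (auto intro: continuous_intros)
    then show "continuous_on ({0..1} \<times> UNIV) (\<lambda>p. plift (M (fst p)) (snd p))"
      by (rule continuous_on_plift_joint) (use assms(2) in \<open>auto intro: continuous_intros\<close>)
    show "plift (M 0) = (\<lambda>x. x)" by (rule ext) (simp add: assms(3) plift_fixed[where r = 1])
    show "\<exists>A. det A = 1 \<and> angle_lift A (plift (M t)) \<and> pm (M t) = pm A" if "t \<in> {0..1}" for t
      using assms(2)[OF that] angle_lift_plift by blast
  qed
  from lift_end_eq[OF this] path_class_eq[OF q] show ?thesis by simp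
qed

lemma sl2_scaleR: "X \<in> sl2 \<Longrightarrow> t *\<^sub>R X \<in> sl2"
  by (simp add: sl2_def trace_2 flip: distrib_left)

lemma det_scaleR_2: "det (t *\<^sub>R X :: real^2^2) = t\<^sup>2 * det X"
  by (simp add: det_2 power2_eq_square algebra_simps)

lemma det_trace_affine:
  assumes "X \<in> sl2"
  shows "det (c *\<^sub>R mat 1 + s *\<^sub>R X) = c\<^sup>2 + s\<^sup>2 * det X" "trace (c *\<^sub>R mat 1 + s *\<^sub>R X) = 2 * c"
proof -
  have "X$2$2 = - X$1$1" using assms by (simp add: sl2_def trace_2)
  then show "det (c *\<^sub>R mat 1 + s *\<^sub>R X) = c\<^sup>2 + s\<^sup>2 * det X" "trace (c *\<^sub>R mat 1 + s *\<^sub>R X) = 2 * c"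
    by (simp_all add: det_2 trace_2 power2_eq_square algebra_simps)
qed

lemma mat_exp_0 [simp]: "mat_exp 0 = mat 1"
  using mat_exp_nilpotent[of 0] by (simp add: sl2_def trace_2 det_2)

lemma exp_tilde_nonelliptic:
  assumes X: "X \<in> sl2" and d: "det X \<le> 0"
  shows "exp_tilde X = cover_elem (plift (mat_exp X))" "det (mat_exp X) = 1" "trace (mat_exp X) \<ge> 2"
proof -
  obtain c s :: "real \<Rightarrow> real" where cs: "continuous_on {0..1} c" "continuous_on {0..1} s"
    "\<And>t. mat_exp (t *\<^sub>R X) = c t *\<^sub>R mat 1 + s t *\<^sub>R X" "\<And>t. (c t)\<^sup>2 + (s t)\<^sup>2 * det X = 1" "\<And>t. c t \<ge> 1"
  proof (cases "det X = 0")
    case True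
    show thesis
    proof (rule that[of "\<lambda>_. 1" "\<lambda>t. t"])
      show "mat_exp (t *\<^sub>R X) = 1 *\<^sub>R mat 1 + t *\<^sub>R X" for t
        using mat_exp_nilpotent[OF sl2_scaleR[OF X], of t] True by (simp add: det_scaleR_2)
    qed (use True in \<open>auto intro: continuous_intros\<close>)
  next
    case False
    define w where "w = sqrt (- det X)"
    have w: "w > 0" "- det X = w\<^sup>2" using False d by (auto simp: w_def)
    show thesis
    proof (rule that[of "\<lambda>t. cosh (t * w)" "\<lambda>t. sinh (t * w) / w"])
      show "mat_exp (t *\<^sub>R X) = cosh (t * w) *\<^sub>R mat 1 + (sinh (t * w) / w) *\<^sub>R X" for t
      proof (cases "t = 0")
        case False
        have "mat_exp (t *\<^sub>R X) = cosh (t * w) *\<^sub>R mat 1 + (sinh (t * w) / (t * w)) *\<^sub>R (t *\<^sub>R X)"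
          by (rule mat_exp_hyperbolic[OF sl2_scaleR[OF X]])
            (use False w in \<open>auto simp: det_scaleR_2 power_mult_distrib simp flip: w(2)\<close>)
        then show ?thesis using False by simp
      qed simp
      have dX: "det X = - w\<^sup>2" using w(2) by simp
      show "(cosh (t * w))\<^sup>2 + (sinh (t * w) / w)\<^sup>2 * det X = 1" for t
        using w(1) unfolding dX by (simp add: power_divide cosh_square_eq)
    qed (use w in \<open>auto intro!: continuous_intros cosh_real_ge_1\<close>)
  qed
  have M: "det (mat_exp (t *\<^sub>R X)) = 1" "trace (mat_exp (t *\<^sub>R X)) \<ge> 2" for t
    unfolding cs(3) using det_trace_affine[OF X] cs(4,5)[of t] by simp_all
  from M[of 1] show "det (mat_exp X) = 1" "trace (mat_exp X) \<ge> 2" by simp_all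
  have "continuous_on {0..1} (\<lambda>t. mat_exp (t *\<^sub>R X))"
    unfolding cs(3) by (intro continuous_intros cs(1,2))
  then have "path_class PSL2_top (\<lambda>t. pm (mat_exp (t *\<^sub>R X))) = cover_elem (plift (mat_exp (1 *\<^sub>R X)))"
    by (rule path_class_principal) (use M in \<open>auto intro: less_le_trans[of _ 2]\<close>)
  then show "exp_tilde X = cover_elem (plift (mat_exp X))" by (simp add: exp_tilde_def)
qed

lemma z_tilde_eq: "z_tilde = cover_elem (\<lambda>x. x + pi)"
proof -
  let ?X = "mat2 0 pi (- pi) 0"
  have X: "?X \<in> sl2" by (simp add: sl2_def trace_2)
  have e: "mat_exp (t *\<^sub>R ?X) = rot (t * pi)" for t
  proof (cases "t = 0")
    case False
    have "mat_exp (t *\<^sub>R ?X) = cos (t * pi) *\<^sub>R mat 1 + (sin (t * pi) / (t * pi)) *\<^sub>R (t *\<^sub>R ?X)"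
      by (rule mat_exp_elliptic[OF sl2_scaleR[OF X]])
        (use False in \<open>auto simp: det_2 power2_eq_square\<close>)
    then show ?thesis using False by (simp add: mat2_eq_iff rot_def)
  qed simp
  have q: "(\<lambda>t. pm (mat_exp (t *\<^sub>R ?X))) \<in> PSL2_paths"
    by (rule paths_from_one_pm[of "\<lambda>t. rot (t * pi)"]) (auto simp: e intro!: continuous_intros)
  have "path_lift (\<lambda>t. pm (mat_exp (t *\<^sub>R ?X))) (\<lambda>t x. t * pi + x)"
    unfolding path_lift_def e
  proof (intro conjI ballI)
    show "\<exists>A. det A = 1 \<and> angle_lift A (\<lambda>x. t * pi + x) \<and> pm (rot (t * pi)) = pm A" for t :: real
      using angle_lift_rot det_rot by blast
  qed (auto intro!: continuous_intros)
  from lift_end_eq[OF this] path_class_eq[OF q] show ?thesis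
    by (simp add: z_tilde_def exp_tilde_def add.commute)
qed

lemma z_tilde_pow: "z_tilde [^]\<^bsub>SL2_tilde\<^esub> (n::int) = cover_elem (\<lambda>x. x + pi * of_int n)"
proof -
  have "(\<lambda>x. x + pi) \<in> carrier AL_group" using AL_shift[OF AL_id, of 1] by simp
  from group_hom.hom_int_pow[OF group_hom_cover_elem this, of n] show ?thesis
    by (simp add: z_tilde_eq int_pow_translation)
qed

lemma logarithm_exists:
  assumes "det A = 1" "trace A \<ge> 2"
  shows "\<exists>X\<in>sl2. det X \<le> 0 \<and> mat_exp X = A"
proof (cases "trace A = 2")
  case True
  define X where "X = A - mat 1"
  have X: "X \<in> sl2" using True by (simp add: sl2_def X_def trace_2)
  have "det X = det A - trace A + 1" by (simp add: X_def det_2 trace_2 algebra_simps)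
  then have "det X = 0" using assms True by simp
  then show ?thesis using X mat_exp_nilpotent[OF X] by (intro bexI[of _ X]) (simp_all add: X_def)
next
  case False
  define c where "c = trace A / 2"
  have c: "c > 1" using False assms by (simp add: c_def)
  define w where "w = arcosh c"
  have cw: "cosh w = c" using c by (simp add: w_def)
  have w0: "w \<noteq> 0" using cw c by auto
  have sw: "sinh w \<noteq> 0" using w0 by simp
  define X where "X = (w / sinh w) *\<^sub>R (A - c *\<^sub>R mat 1)"
  have X: "X \<in> sl2" by (simp add: sl2_def X_def trace_2 c_def algebra_simps)
  have "det (A - c *\<^sub>R mat 1) = det A - c * trace A + c\<^sup>2"
    by (simp add: det_2 trace_2 power2_eq_square algebra_simps)
  also have "\<dots> = 1 - (cosh w)\<^sup>2" using assms(1) by (simp add: cw c_def power2_eq_square)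
  finally have "det (A - c *\<^sub>R mat 1) = - (sinh w)\<^sup>2" by (simp add: cosh_square_eq)
  then have dX: "- det X = w\<^sup>2" using sw by (simp add: X_def det_scaleR_2 power_divide)
  have "mat_exp X = cosh w *\<^sub>R mat 1 + (sinh w / w) *\<^sub>R X" by (rule mat_exp_hyperbolic[OF X dX w0])
  also have "\<dots> = A" using w0 sw by (simp add: X_def cw)
  finally have "mat_exp X = A" .
  moreover have "det X \<le> 0" using dX zero_le_power2[of w] by linarith
  ultimately show ?thesis using X by blast
qed

lemma exp_tilde_end:
  assumes "exp_tilde X \<in> lifts PSL2_top PSL2 x"
  shows "x = pm (mat_exp X)"
proof -
  obtain r where r: "r \<in> exp_tilde X" "r 1 = x" using assms by (auto simp: lifts_def)
  then have "path_homotopic PSL2_top (\<lambda>t. pm (mat_exp (t *\<^sub>R X))) r" by (simp add: exp_tilde_def path_class_def)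
  from homotopic_with_imp_property[OF this[unfolded path_homotopic_def]] show ?thesis using r(2) by simp
qed

lemma pm_inject_trace:
  assumes "pm A = pm B" "trace A \<ge> 2" "trace B \<ge> 2" shows "A = B"
  using assms by (auto simp: pm_eq_iff)

lemma exp_lift_eq:
  assumes A: "det A = 1" "trace A \<ge> 2" "A \<noteq> mat 1"
  shows "exp_lift (pm A) = cover_elem (plift A)"
  unfolding exp_lift_def
proof (rule the_equality)
  obtain X where X: "X \<in> sl2" "det X \<le> 0" "mat_exp X = A" using logarithm_exists[OF A(1,2)] by blast
  have e: "exp_tilde X = cover_elem (plift A)" using exp_tilde_nonelliptic(1)[OF X(1,2)] X(3) by simp
  have "angle_lift A (plift A)" using A by (intro angle_lift_plift) auto
  then have "cover_elem (plift A) \<in> lifts PSL2_top PSL2 (pm A)" using A(1) by (auto simp: lifts_PSL2)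
  then show "cover_elem (plift A) \<in> exp_tilde ` sl2 \<and> cover_elem (plift A) \<in> lifts PSL2_top PSL2 (pm A)"
    using e X(1) by blast
next
  fix U assume "U \<in> exp_tilde ` sl2 \<and> U \<in> lifts PSL2_top PSL2 (pm A)"
  then obtain X where X: "X \<in> sl2" "U = exp_tilde X" "exp_tilde X \<in> lifts PSL2_top PSL2 (pm A)" by blast
  have pA: "pm A = pm (mat_exp X)" by (rule exp_tilde_end[OF X(3)])
  show "U = cover_elem (plift A)"
  proof (cases "det X \<le> 0")
    case True
    note E = exp_tilde_nonelliptic[OF X(1) True]
    have "A = mat_exp X" by (rule pm_inject_trace[OF pA A(2) E(3)])
    then show ?thesis using E(1) X(2) by simp
  next
    case False
    define w where "w = sqrt (det X)"
    have w: "det X = w\<^sup>2" "w \<noteq> 0" using False by (auto simp: w_def)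
    have m: "mat_exp X = cos w *\<^sub>R mat 1 + (sin w / w) *\<^sub>R X" by (rule mat_exp_elliptic[OF X(1) w])
    have "\<bar>trace A\<bar> = \<bar>trace (mat_exp X)\<bar>" using pA by (auto simp: pm_eq_iff)
    also have "\<dots> = 2 * \<bar>cos w\<bar>" unfolding m det_trace_affine(2)[OF X(1)] by (simp add: abs_mult)
    finally have "\<bar>cos w\<bar> = 1" using A(2) abs_cos_le_one[of w] by linarith
    then have "\<bar>cos w\<bar>\<^sup>2 = 1" by simp
    then have "(cos w)\<^sup>2 = 1" by simp
    then have "sin w = 0" using sin_cos_squared_add[of w] by simp
    then have "mat_exp X = cos w *\<^sub>R mat 1" using m by simp
    moreover have "cos w = 1 \<or> cos w = -1" using \<open>\<bar>cos w\<bar> = 1\<close> by linarith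
    ultimately have "mat_exp X = mat 1 \<or> mat_exp X = - mat 1" by auto
    then have "A = mat 1 \<or> A = - mat 1" using pA by (auto simp: pm_eq_iff)
    then show ?thesis using A(2,3) by (auto simp: trace_2)
  qed
qed


subsection \<open>Hyperbolic and parabolic elements\<close>

lemma sinv_cc: "sinv (cc 1 \<beta> s) = cc 1 \<beta> (- s)"
  by (simp add: cc_def sinv_mult_distrib sinv_rot sinv_tri matrix_mul_assoc)

lemma plift_sign_class:
  assumes "c \<in> sign_class \<sigma>" "\<sigma> = 1 \<or> \<sigma> = -1"
  shows "\<exists>x. \<sigma> * (plift c x - x) > 0" "\<sigma> * (plift c x - x) \<ge> 0"
proof -
  show "\<exists>x. \<sigma> * (plift c x - x) > 0"
  proof (cases "\<sigma> = 1")
    case True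
    then obtain \<beta> s where c: "c = cc 1 \<beta> s" "s > 0" using assms by (auto simp: sign_class_def)
    have "plift c (\<beta> + pi/2) > \<beta> + pi/2" using plift_cc_ge_id(2)[OF c(2), of "\<beta> + pi/2" \<beta>] c(1) by simp
    then show ?thesis using True by (intro exI[of _ "\<beta> + pi/2"]) simp
  next
    case False
    then obtain \<beta> s where c: "c = sinv (cc 1 \<beta> s)" "s > 0" using assms by (auto simp: sign_class_def)
    have C: "plift (cc 1 \<beta> s) \<in> AL" by (rule AL_plift_cc) simp
    have "plift (cc 1 \<beta> s) (\<beta> + pi/2) > \<beta> + pi/2" using plift_cc_ge_id(2)[OF c(2), of "\<beta> + pi/2" \<beta>] by simp
    moreover have "plift c (plift (cc 1 \<beta> s) (\<beta> + pi/2)) = \<beta> + pi/2"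
      by (simp add: c(1) plift_sinv AL_inv_f[OF C])
    ultimately show ?thesis using assms(2) False by (intro exI[of _ "plift (cc 1 \<beta> s) (\<beta> + pi/2)"]) auto
  qed
  show "\<sigma> * (plift c x - x) \<ge> 0"
  proof (cases "\<sigma> = 1")
    case True
    then obtain \<beta> s where c: "c = cc 1 \<beta> s" "s > 0" using assms by (auto simp: sign_class_def)
    then show ?thesis using plift_cc_ge_id(1)[OF c(2), of x \<beta>] True by simp
  next
    case False
    then obtain \<beta> s where c: "c = sinv (cc 1 \<beta> s)" "s > 0" using assms by (auto simp: sign_class_def)
    have C: "plift (cc 1 \<beta> s) \<in> AL" by (rule AL_plift_cc) simp
    have "plift c x \<le> plift (cc 1 \<beta> s) (plift c x)" by (rule plift_cc_ge_id(1)[OF c(2)])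
    also have "\<dots> = x" by (simp add: c(1) plift_sinv AL_f_inv[OF C])
    finally show ?thesis using assms(2) False by auto
  qed
qed

lemma sign_class_ne_one:
  assumes "c \<in> sign_class \<sigma>" "\<sigma> \<in> {-1, 0, 1}" shows "c \<noteq> mat 1"
proof
  assume c: "c = mat 1"
  have p: "plift (mat 1) x = x" for x by (rule plift_fixed[where r = 1]) simp_all
  have "\<sigma> \<noteq> 0" using assms(1) c by (auto simp: sign_class_def trace_2)
  then have "\<sigma> = 1 \<or> \<sigma> = -1" using assms(2) by auto
  from plift_sign_class(1)[OF assms(1) this] show False unfolding c by (simp add: p)
qed

lemma sign_class_disjoint:
  assumes "A \<in> sign_class \<sigma>" "B \<in> sign_class \<tau>" "\<sigma> \<in> {-1, 0, 1}" "\<tau> \<in> {-1, 0, 1}" "pm A = pm B"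
  shows "\<sigma> = \<tau>"
proof (rule ccontr)
  assume ne: "\<sigma> \<noteq> \<tau>"
  have AB: "A = B" by (rule pm_inject_trace[OF assms(5) sign_class_trace[OF assms(1)] sign_class_trace[OF assms(2)]])
  have tr: "trace c = 2" if "c \<in> sign_class \<rho>" "\<rho> \<noteq> 0" for c \<rho>
    using that by (auto simp: sign_class_def split: if_splits)
  have tr0: "trace c > 2" if "c \<in> sign_class 0" for c using that by (simp add: sign_class_def)
  have "\<sigma> \<noteq> 0" "\<tau> \<noteq> 0"
    using ne tr0[of A] tr0[of B] tr[OF assms(1)] tr[OF assms(2)] assms(1,2) AB by auto
  then have s: "\<sigma> = 1 \<or> \<sigma> = -1" "\<tau> = 1 \<or> \<tau> = -1" "\<tau> = - \<sigma>" using assms(3,4) ne by auto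
  obtain x where "\<sigma> * (plift A x - x) > 0" using plift_sign_class(1)[OF assms(1) s(1)] by blast
  moreover have "\<tau> * (plift A x - x) \<ge> 0" using plift_sign_class(2)[OF assms(2) s(2)] AB by simp
  ultimately show False unfolding s(3) by simp
qed

lemma conj_unipotent:
  assumes "det H = 1"
  obtains \<beta> r where "r > 0" "\<And>u. H ** tri 1 u ** sinv H = cc 1 \<beta> (u * r\<^sup>2)"
proof -
  obtain \<beta> r s where H: "r > 0" "H = rot \<beta> ** tri r s" by (rule iwasawa[OF assms])
  have "H ** tri 1 u ** sinv H = cc 1 \<beta> (u * r\<^sup>2)" for u
  proof -
    have "H ** tri 1 u ** sinv H = rot \<beta> ** (tri r s ** tri 1 u ** tri (1 / r) (- s)) ** rot (- \<beta>)"
      using H(1) unfolding H(2) by (simp add: sinv_mult_distrib sinv_rot sinv_tri matrix_mul_assoc)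
    also have "tri r s ** tri 1 u ** tri (1 / r) (- s) = tri 1 (u * r\<^sup>2)"
      using H(1) by (simp add: tri_mult power2_eq_square algebra_simps)
    finally show ?thesis by (simp add: cc_def)
  qed
  then show thesis using that H(1) by blast
qed

lemma conj_PSL2:
  assumes "det H = 1" "det A = 1"
  shows "pm H \<otimes>\<^bsub>PSL2\<^esub> pm A \<otimes>\<^bsub>PSL2\<^esub> inv\<^bsub>PSL2\<^esub> (pm H) = pm (H ** A ** sinv H)"
  using assms by (simp add: inv_PSL2 mult_PSL2 det_mul)

lemma PSL2_conjugate_unipotent:
  "(\<exists>r>0. \<exists>\<beta>. x = pm (cc 1 \<beta> (u * r\<^sup>2))) \<longleftrightarrow> PSL2_conjugate x (pm (tri 1 u))"
proof
  assume "\<exists>r>0. \<exists>\<beta>. x = pm (cc 1 \<beta> (u * r\<^sup>2))"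
  then obtain r \<beta> where r: "r > 0" "x = pm (cc 1 \<beta> (u * r\<^sup>2))" by blast
  have "rot \<beta> ** tri r 0 ** tri 1 u ** sinv (rot \<beta> ** tri r 0) =
      rot \<beta> ** (tri r 0 ** tri 1 u ** tri (1 / r) 0) ** rot (- \<beta>)"
    using r(1) by (simp add: sinv_mult_distrib sinv_rot sinv_tri matrix_mul_assoc)
  also have "tri r 0 ** tri 1 u ** tri (1 / r) 0 = tri 1 (u * r\<^sup>2)"
    using r(1) by (simp add: tri_mult power2_eq_square algebra_simps)
  finally have "rot \<beta> ** tri r 0 ** tri 1 u ** sinv (rot \<beta> ** tri r 0) = cc 1 \<beta> (u * r\<^sup>2)" by (simp add: cc_def)
  then show "PSL2_conjugate x (pm (tri 1 u))"
    unfolding PSL2_conjugate_def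
    using r conj_PSL2[of "rot \<beta> ** tri r 0" "tri 1 u"]
    by (intro bexI[of _ "pm (rot \<beta> ** tri r 0)"]) (simp_all add: det_mul)
next
  assume "PSL2_conjugate x (pm (tri 1 u))"
  then obtain h where h: "h \<in> carrier PSL2" "x = h \<otimes>\<^bsub>PSL2\<^esub> pm (tri 1 u) \<otimes>\<^bsub>PSL2\<^esub> inv\<^bsub>PSL2\<^esub> h"
    unfolding PSL2_conjugate_def by blast
  obtain H where H: "det H = 1" "h = pm H" by (rule PSL2_E[OF h(1)])
  obtain \<beta> r where "r > 0" "\<And>u. H ** tri 1 u ** sinv H = cc 1 \<beta> (u * r\<^sup>2)" using conj_unipotent[OF H(1)] by blast
  then show "\<exists>r>0. \<exists>\<beta>. x = pm (cc 1 \<beta> (u * r\<^sup>2))"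
    using conj_PSL2[OF H(1), of "tri 1 u"] h(2) H(2) by auto
qed

lemma parabolic_iff: "parabolic x \<longleftrightarrow> (\<exists>A. det A = 1 \<and> trace A = 2 \<and> A \<noteq> mat 1 \<and> x = pm A)"
proof
  assume "parabolic x"
  then obtain A where A: "x \<in> carrier PSL2" "x \<noteq> pm (mat 1)" "A \<in> x" "\<bar>trace A\<bar> = 2"
    by (auto simp: parabolic_def one_PSL2)
  obtain B where B: "det B = 1" "x = pm B" by (rule PSL2_E[OF A(1)])
  have "A = B \<or> A = - B" using A(3) B(2) by (auto simp: pm_def)
  then have dA: "det A = 1" "x = pm A" using B by auto
  define C where "C = (if trace A = 2 then A else - A)"
  have "det C = 1" "x = pm C" "trace C = 2" using dA A(4) by (auto simp: C_def)
  moreover have "C \<noteq> mat 1" using A(2) calculation by auto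
  ultimately show "\<exists>A. det A = 1 \<and> trace A = 2 \<and> A \<noteq> mat 1 \<and> x = pm A" by blast
next
  assume "\<exists>A. det A = 1 \<and> trace A = 2 \<and> A \<noteq> mat 1 \<and> x = pm A"
  then obtain A where A: "det A = 1" "trace A = 2" "A \<noteq> mat 1" "x = pm A" by blast
  then have "A \<noteq> - mat 1" by (auto simp: trace_2)
  then show "parabolic x" using A by (auto simp: parabolic_def one_PSL2 pm_eq_iff) (auto simp: pm_def)
qed

lemma hyperbolic_iff: "hyperbolic x \<longleftrightarrow> (\<exists>A\<in>sign_class 0. x = pm A)"
proof
  assume "hyperbolic x"
  then obtain A where A: "x \<in> carrier PSL2" "A \<in> x" "\<bar>trace A\<bar> > 2" by (auto simp: hyperbolic_def)
  obtain B where B: "det B = 1" "x = pm B" by (rule PSL2_E[OF A(1)])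
  have "A = B \<or> A = - B" using A(2) B(2) by (auto simp: pm_def)
  then have dA: "det A = 1" "x = pm A" using B by auto
  define C where "C = (if trace A > 2 then A else - A)"
  have "det C = 1" "x = pm C" "trace C > 2" using dA A(3) by (auto simp: C_def)
  then show "\<exists>A\<in>sign_class 0. x = pm A" by (auto simp: sign_class_def)
next
  assume "\<exists>A\<in>sign_class 0. x = pm A"
  then obtain A where A: "det A = 1" "trace A > 2" "x = pm A" by (auto simp: sign_class_def)
  then have "A \<noteq> mat 1" "A \<noteq> - mat 1" by (auto simp: trace_2)
  then show "hyperbolic x" using A by (auto simp: hyperbolic_def one_PSL2 pm_eq_iff) (auto simp: pm_def)
qed

lemma sign_class_pm_form:
  assumes "\<sigma> = 1 \<or> \<sigma> = -1"
  shows "(\<exists>A\<in>sign_class \<sigma>. x = pm A) \<longleftrightarrow> (\<exists>r>0. \<exists>\<beta>. x = pm (cc 1 \<beta> (of_int \<sigma> * r\<^sup>2)))"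
proof
  assume "\<exists>A\<in>sign_class \<sigma>. x = pm A"
  then obtain \<beta> s where s: "s > 0" "x = pm (cc 1 \<beta> (of_int \<sigma> * s))"
    using assms by (auto simp: sign_class_def sinv_cc)
  then show "\<exists>r>0. \<exists>\<beta>. x = pm (cc 1 \<beta> (of_int \<sigma> * r\<^sup>2))" by (intro exI[of _ "sqrt s"]) auto
next
  assume "\<exists>r>0. \<exists>\<beta>. x = pm (cc 1 \<beta> (of_int \<sigma> * r\<^sup>2))"
  then obtain r \<beta> where r: "r > 0" "x = pm (cc 1 \<beta> (of_int \<sigma> * r\<^sup>2))" by blast
  have "cc 1 \<beta> (of_int \<sigma> * r\<^sup>2) \<in> sign_class \<sigma>"
  proof -
    define t where "t = r\<^sup>2"
    have t: "t > 0" using r(1) by (simp add: t_def)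
    have "cc 1 \<beta> t \<in> sign_class 1" "sinv (cc 1 \<beta> t) \<in> sign_class (-1)"
      using t unfolding sign_class_def by auto
    then show ?thesis using assms by (auto simp: t_def sinv_cc)
  qed
  then show "\<exists>A\<in>sign_class \<sigma>. x = pm A" using r(2) by blast
qed

lemma sign_class_parabolic:
  assumes "A \<in> sign_class \<sigma>" "\<sigma> = 1 \<or> \<sigma> = -1"
  shows "parabolic (pm A)"
proof -
  have "A \<noteq> mat 1" by (rule sign_class_ne_one[OF assms(1)]) (use assms(2) in auto)
  moreover have "det A = 1" "trace A = 2" using assms by (auto simp: sign_class_def)
  ultimately show ?thesis by (auto simp: parabolic_iff)
qed

lemma positive_parabolic_iff: "positive_parabolic x \<longleftrightarrow> (\<exists>A\<in>sign_class 1. x = pm A)"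
proof -
  have "mat2 1 1 0 1 = tri 1 1" by (simp add: mat2_eq_iff tri_def)
  then have "positive_parabolic x \<longleftrightarrow> parabolic x \<and> (\<exists>A\<in>sign_class 1. x = pm A)"
    using PSL2_conjugate_unipotent[of x 1] sign_class_pm_form[of 1 x] by (simp add: positive_parabolic_def)
  then show ?thesis using sign_class_parabolic by blast
qed

lemma negative_parabolic_iff: "negative_parabolic x \<longleftrightarrow> (\<exists>A\<in>sign_class (-1). x = pm A)"
proof -
  have "mat2 1 (-1) 0 1 = tri 1 (-1)" by (simp add: mat2_eq_iff tri_def)
  then have "negative_parabolic x \<longleftrightarrow> parabolic x \<and> (\<exists>A\<in>sign_class (-1). x = pm A)"
    using PSL2_conjugate_unipotent[of x "-1"] sign_class_pm_form[of "-1" x] by (simp add: negative_parabolic_def)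
  then show ?thesis using sign_class_parabolic by blast
qed

lemma parabolic_cases: "parabolic x \<Longrightarrow> positive_parabolic x \<or> negative_parabolic x"
proof -
  assume "parabolic x"
  then obtain A where A: "det A = 1" "trace A = 2" "A \<noteq> mat 1" "x = pm A" by (auto simp: parabolic_iff)
  obtain \<beta> s where c: "A = cc 1 \<beta> s" using cc_normal_form[OF A(1), of 1] A(2) by auto
  have "s \<noteq> 0" using A(3) c by (auto simp: cc_def rot_add)
  then have "A \<in> sign_class 1 \<or> A \<in> sign_class (-1)"
  proof (cases "s > 0")
    case True
    then have "A \<in> sign_class 1" unfolding c sign_class_def by auto
    then show ?thesis ..
  next
    case False
    define t where "t = - s"
    have "A = sinv (cc 1 \<beta> t)" "t > 0" using \<open>s \<noteq> 0\<close> False c by (simp_all add: sinv_cc t_def)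
    then have "A \<in> sign_class (-1)" unfolding sign_class_def by auto
    then show ?thesis ..
  qed
  then show ?thesis using A(4) by (auto simp: positive_parabolic_iff negative_parabolic_iff)
qed

lemma boundary_sign_iff:
  assumes s: "s \<in> {..<p} \<rightarrow>\<^sub>E {-1, 0, 1}"
  shows "mixed_boundary g p \<phi> \<and> rep_sign g p \<phi> = s \<longleftrightarrow>
    (\<forall>i<p. \<exists>A\<in>sign_class (s i). \<phi> (gen_elem g p (GenC i)) = pm A)"
proof -
  let ?x = "\<lambda>i. \<phi> (gen_elem g p (GenC i))" and ?in = "\<lambda>x \<sigma>. \<exists>A\<in>sign_class \<sigma>. x = pm A"
  have uniq: "\<sigma> = \<tau>" if "?in x \<sigma>" "?in x \<tau>" "\<sigma> \<in> {-1, 0, 1}" "\<tau> \<in> {-1, 0, 1}" for x \<sigma> \<tau>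
    using that sign_class_disjoint by metis
  have sgn: "(if positive_parabolic x then 1 else if negative_parabolic x then -1 else 0) = \<sigma>"
    if "?in x \<sigma>" "\<sigma> \<in> {-1, 0, 1}" for x and \<sigma> :: int
    using that uniq[OF that(1), of 1] uniq[OF that(1), of "-1"]
    unfolding positive_parabolic_iff negative_parabolic_iff by auto
  have ex: "hyperbolic x \<or> parabolic x \<longleftrightarrow> (\<exists>\<sigma>\<in>{-1, 0, 1}. ?in x \<sigma>)" for x
  proof
    assume "hyperbolic x \<or> parabolic x"
    then show "\<exists>\<sigma>\<in>{-1, 0, 1}. ?in x \<sigma>"
      using parabolic_cases[of x] unfolding hyperbolic_iff positive_parabolic_iff negative_parabolic_iff by blast
  next
    assume "\<exists>\<sigma>\<in>{-1, 0, 1}. ?in x \<sigma>"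
    then obtain \<sigma> A where \<sigma>: "\<sigma> \<in> {-1, 0, 1}" "A \<in> sign_class \<sigma>" "x = pm A" by blast
    then show "hyperbolic x \<or> parabolic x"
      using hyperbolic_iff[of x] sign_class_parabolic[OF \<sigma>(2)] by auto
  qed
  have si: "s i \<in> {-1, 0, 1}" if "i < p" for i using s that by (auto simp: PiE_def Pi_def)
  show ?thesis
  proof
    assume L: "mixed_boundary g p \<phi> \<and> rep_sign g p \<phi> = s"
    show "\<forall>i<p. ?in (?x i) (s i)"
    proof (intro allI impI)
      fix i assume i: "i < p"
      then have "hyperbolic (?x i) \<or> parabolic (?x i)" using L by (simp add: mixed_boundary_def)
      then obtain \<sigma> where \<sigma>: "\<sigma> \<in> {-1, 0, 1}" "?in (?x i) \<sigma>" unfolding ex by blast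
      have "s i = rep_sign g p \<phi> i" using L by simp
      also have "\<dots> = \<sigma>" using sgn[OF \<sigma>(2,1)] i by (simp add: rep_sign_def)
      finally show "?in (?x i) (s i)" using \<sigma>(2) by simp
    qed
  next
    assume R: "\<forall>i<p. ?in (?x i) (s i)"
    then have "mixed_boundary g p \<phi>" using ex si unfolding mixed_boundary_def by blast
    moreover have "rep_sign g p \<phi> = s"
    proof
      fix i
      show "rep_sign g p \<phi> i = s i"
      proof (cases "i < p")
        case True
        then show ?thesis using sgn[where x = "?x i" and \<sigma> = "s i"] R si[OF True] by (simp add: rep_sign_def)
      next
        case False
        then show ?thesis using s by (simp add: rep_sign_def PiE_def extensional_def)
      qed
    qed
    ultimately show "mixed_boundary g p \<phi> \<and> rep_sign g p \<phi> = s" ..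
  qed
qed


subsection \<open>The relative Euler class\<close>

definition surface_word :: "nat \<Rightarrow> nat \<Rightarrow> block list" where
  "surface_word g p = map Handle [0..<g] @ map Cusp [0..<p]"

lemma foldr_block_lift: "foldr (\<circ>) (map (\<lambda>bl. block_lift bl m) bs) (\<lambda>x. x) = word_lift bs m"
proof (induction bs)
  case (Cons bl bs)
  have "foldr (\<circ>) (map (\<lambda>bl. block_lift bl m) (bl # bs)) (\<lambda>x. x) =
      block_lift bl m \<circ> foldr (\<circ>) (map (\<lambda>bl. block_lift bl m) bs) (\<lambda>x. x)"
    by (subst list.map(2), subst foldr.simps(2), subst comp_apply) (rule HOL.refl)
  then show ?case unfolding Cons.IH word_lift_Cons .
qed simp

lemma rel_euler_class_eq:
  assumes ab: "\<And>j. j < g \<Longrightarrow> det (m (GenA j)) = 1 \<and> det (m (GenB j)) = 1"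
    and \<phi>ab: "\<And>j. j < g \<Longrightarrow> \<phi> (gen_elem g p (GenA j)) = pm (m (GenA j)) \<and> \<phi> (gen_elem g p (GenB j)) = pm (m (GenB j))"
    and c: "\<And>i. i < p \<Longrightarrow> m (GenC i) \<in> sign_class (s i)" "\<And>i. i < p \<Longrightarrow> s i \<in> {-1, 0, 1}"
    and \<phi>c: "\<And>i. i < p \<Longrightarrow> \<phi> (gen_elem g p (GenC i)) = pm (m (GenC i))"
    and E: "word_lift (surface_word g p) m = (\<lambda>x. x + pi * of_int n)"
  shows "rel_euler_class g p \<phi> = n"
proof -
  have prod: "list_prod SL2_tilde
       (map (\<lambda>j. commutator SL2_tilde (\<alpha> j) (\<beta> j)) [0..<g] @
        map (\<lambda>i. exp_lift (\<phi> (gen_elem g p (GenC i)))) [0..<p]) = cover_elem (\<lambda>x. x + pi * of_int n)"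
    if lf: "\<And>j. j < g \<Longrightarrow> \<alpha> j \<in> lifts PSL2_top PSL2 (\<phi> (gen_elem g p (GenA j))) \<and>
            \<beta> j \<in> lifts PSL2_top PSL2 (\<phi> (gen_elem g p (GenB j)))" for \<alpha> \<beta>
  proof -
    have h: "commutator SL2_tilde (\<alpha> j) (\<beta> j) = cover_elem (block_lift (Handle j) m)" if j: "j < g" for j
    proof -
      obtain f A where f: "\<alpha> j = cover_elem f" "det A = 1" "angle_lift A f" "pm (m (GenA j)) = pm A"
        using lf[OF j] \<phi>ab[OF j] by (auto simp: lifts_PSL2)
      obtain h B where h: "\<beta> j = cover_elem h" "det B = 1" "angle_lift B h" "pm (m (GenB j)) = pm B"
        using lf[OF j] \<phi>ab[OF j] by (auto simp: lifts_PSL2)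
      have "A = m (GenA j) \<or> A = - m (GenA j)" "B = m (GenB j) \<or> B = - m (GenB j)"
        using f(4) h(4) by (auto simp: pm_eq_iff)
      then have "comm_lift (m (GenA j)) (m (GenB j)) = f \<circ> h \<circ> finv f \<circ> finv h"
        using ab[OF j] by (intro comm_lift_eq[OF f(3) h(3)]) auto
      then show ?thesis
        using commutator_SL2_tilde[OF AL_I[OF f(2,3)] AL_I[OF h(2,3)]] f(1) h(1) by simp
    qed
    have e: "exp_lift (\<phi> (gen_elem g p (GenC i))) = cover_elem (block_lift (Cusp i) m)" if i: "i < p" for i
      using exp_lift_eq[OF sign_class_det[OF c(1)[OF i]] sign_class_trace[OF c(1)[OF i]]
        sign_class_ne_one[OF c(1)[OF i] c(2)[OF i]]] \<phi>c[OF i] by simp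
    have mapeq: "map (\<lambda>j. commutator SL2_tilde (\<alpha> j) (\<beta> j)) [0..<g] @
        map (\<lambda>i. exp_lift (\<phi> (gen_elem g p (GenC i)))) [0..<p] =
        map cover_elem (map (\<lambda>bl. block_lift bl m) (surface_word g p))"
      by (simp add: surface_word_def h e)
    have fAL: "f \<in> AL" if f: "f \<in> set (map (\<lambda>bl. block_lift bl m) (surface_word g p))" for f
    proof -
      obtain bl where bl: "bl \<in> set (surface_word g p)" "f = block_lift bl m" using f by auto
      have "block_ok s bl m" using bl(1) ab c(1) by (auto simp: surface_word_def)
      then show ?thesis unfolding bl(2) by (rule AL_block_lift)
    qed
    have "list_prod SL2_tilde
       (map (\<lambda>j. commutator SL2_tilde (\<alpha> j) (\<beta> j)) [0..<g] @
        map (\<lambda>i. exp_lift (\<phi> (gen_elem g p (GenC i)))) [0..<p]) =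
        cover_elem (foldr (\<circ>) (map (\<lambda>bl. block_lift bl m) (surface_word g p)) (\<lambda>x. x))"
      unfolding mapeq by (rule conjunct1[OF list_prod_SL2_tilde[OF fAL]])
    then show ?thesis by (simp only: foldr_block_lift E)
  qed
  have "\<exists>\<alpha> \<beta>. \<forall>j<g. \<alpha> j \<in> lifts PSL2_top PSL2 (\<phi> (gen_elem g p (GenA j))) \<and>
            \<beta> j \<in> lifts PSL2_top PSL2 (\<phi> (gen_elem g p (GenB j)))"
  proof -
    let ?L = "\<lambda>x. lifts PSL2_top PSL2 (\<phi> (gen_elem g p x))"
    have "?L (GenA j) \<noteq> {} \<and> ?L (GenB j) \<noteq> {}" if "j < g" for j
      using lifts_nonempty ab[OF that] \<phi>ab[OF that] by simp
    then show ?thesis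
      by (intro exI[of _ "\<lambda>j. SOME a. a \<in> ?L (GenA j)"] exI[of _ "\<lambda>j. SOME b. b \<in> ?L (GenB j)"])
        (simp add: some_in_eq)
  qed
  then obtain \<alpha> \<beta> where ab': "\<And>j. j < g \<Longrightarrow> \<alpha> j \<in> lifts PSL2_top PSL2 (\<phi> (gen_elem g p (GenA j))) \<and>
            \<beta> j \<in> lifts PSL2_top PSL2 (\<phi> (gen_elem g p (GenB j)))" by blast
  show ?thesis
    unfolding rel_euler_class_def
  proof (rule the_equality)
    fix k :: int
    assume *: "\<forall>\<alpha> \<beta>. (\<forall>j<g. \<alpha> j \<in> lifts PSL2_top PSL2 (\<phi> (gen_elem g p (GenA j))) \<and>
            \<beta> j \<in> lifts PSL2_top PSL2 (\<phi> (gen_elem g p (GenB j)))) \<longrightarrow>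
     list_prod SL2_tilde
       (map (\<lambda>j. commutator SL2_tilde (\<alpha> j) (\<beta> j)) [0..<g] @
        map (\<lambda>i. exp_lift (\<phi> (gen_elem g p (GenC i)))) [0..<p])
     = z_tilde [^]\<^bsub>SL2_tilde\<^esub> k"
    then have "cover_elem (\<lambda>x. x + pi * of_int n) = cover_elem (\<lambda>x. x + pi * of_int k)"
      using prod[OF ab'] ab' by (simp add: z_tilde_pow)
    then have "(\<lambda>x. x + pi * of_int n) = (\<lambda>x. x + pi * of_int k)"
      using AL_shift[OF AL_id] by (rule cover_elem_inject[rotated])
    from fun_cong[OF this, of 0] show "k = n" by simp
  qed (use prod in \<open>simp add: z_tilde_pow\<close>)
qed

subsection \<open>Homomorphisms and images of the generators\<close>

definition letter :: "gen_images \<Rightarrow> gen \<times> bool \<Rightarrow> real^2^2" where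
  "letter M l = (if snd l then M (fst l) else sinv (M (fst l)))"

definition word_mat :: "gen_images \<Rightarrow> (gen \<times> bool) list \<Rightarrow> real^2^2" where
  "word_mat M w = foldr (\<lambda>l A. letter M l ** A) w (mat 1)"

lemma word_mat_simps [simp]:
  "word_mat M [] = mat 1" "word_mat M (l # w) = letter M l ** word_mat M w"
  by (simp_all add: word_mat_def)

lemma word_mat_append: "word_mat M (u @ v) = word_mat M u ** word_mat M v"
  by (induction u) (simp_all add: matrix_mul_assoc)

lemma det_word_mat: "(\<And>x. det (M x) = 1) \<Longrightarrow> det (word_mat M w) = 1"
  by (induction w) (simp_all add: det_mul letter_def)

lemma continuous_on_word_mat:
  fixes M :: "'a::topological_space \<Rightarrow> gen_images"
  assumes "continuous_on S M"
  shows "continuous_on S (\<lambda>p. word_mat (M p) w)"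
proof (induction w)
  case (Cons l w)
  have "continuous_on S (\<lambda>p. letter (M p) l)"
    unfolding letter_def by (cases "snd l") (simp_all add: continuous_on_coord[OF assms] continuous_on_sinv)
  then show ?case using Cons by (simp add: continuous_on_mat_mult)
qed simp

lemma pres_eq_word_mat:
  assumes "pres_eq S {r} u v" "\<And>x. det (M x) = 1" "pm (word_mat M r) = pm (mat 1)"
  shows "pm (word_mat M u) = pm (word_mat M v)"
  using assms(1)
proof (induction rule: pres_eq.induct)
  case (cancel x u e v)
  have "letter M (x, e) ** (letter M (x, \<not> e) ** A) = A" for A :: "real^2^2"
    using assms(2)[of x] by (cases e) (simp_all add: letter_def)
  then show ?case by (simp add: word_mat_append)
next
  case (relator r' u v)
  have "word_mat M r = mat 1 \<or> word_mat M r = - mat 1" using assms(3) by (simp add: pm_eq_iff)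
  then show ?case using relator by (auto simp: word_mat_append)
qed simp_all

lemma pres_eq_append:
  assumes "pres_eq S R u v"
  shows "pres_eq S R (a @ u @ b) (a @ v @ b)"
  using assms
proof (induction rule: pres_eq.induct)
  case (refl u)
  show ?case by (rule pres_eq.refl)
next
  case (sym u v)
  then show ?case by (blast intro: pres_eq.sym)
next
  case (trans u v w)
  then show ?case by (blast intro: pres_eq.trans)
next
  case (cancel x u e v)
  then show ?case using pres_eq.cancel[of x S R "a @ u" e "v @ b"] by simp
next
  case (relator r u v)
  then show ?case using pres_eq.relator[of r R S "a @ u" "v @ b"] by simp
qed

lemma word_class_eqI: "pres_eq S R u v \<Longrightarrow> word_class S R u = word_class S R v"
  unfolding word_class_def by (blast intro: pres_eq.sym pres_eq.trans)

lemma word_class_self: "u \<in> lists (S \<times> UNIV) \<Longrightarrow> u \<in> word_class S R u"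
  by (simp add: word_class_def pres_eq.refl)

lemma word_classD: "v \<in> word_class S R u \<Longrightarrow> v \<in> lists (S \<times> UNIV) \<and> pres_eq S R u v"
  by (simp add: word_class_def)

lemma presented_group_mult:
  assumes "u \<in> lists (S \<times> UNIV)" "v \<in> lists (S \<times> UNIV)"
  shows "word_class S R u \<otimes>\<^bsub>presented_group S R\<^esub> word_class S R v = word_class S R (u @ v)"
proof -
  have "word_class S R (u' @ v') = word_class S R (u @ v)" if "u' \<in> word_class S R u" "v' \<in> word_class S R v" for u' v'
  proof -
    have "pres_eq S R (u @ v) (u' @ v)" using pres_eq_append[of S R u u' "[]" v] word_classD[OF that(1)] by simp
    moreover have "pres_eq S R (u' @ v) (u' @ v')" using pres_eq_append[of S R v v' u' "[]"] word_classD[OF that(2)] by simp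
    ultimately have "pres_eq S R (u @ v) (u' @ v')" by (rule pres_eq.trans)
    then show ?thesis by (rule word_class_eqI[symmetric])
  qed
  then have "(\<Union>u'\<in>word_class S R u. \<Union>v'\<in>word_class S R v. word_class S R (u' @ v')) =
     (\<Union>u'\<in>word_class S R u. \<Union>v'\<in>word_class S R v. word_class S R (u @ v))" by simp
  also have "\<dots> = word_class S R (u @ v)" using word_class_self[OF assms(1), of R] word_class_self[OF assms(2), of R] by auto
  finally show ?thesis by (simp add: presented_group_def)
qed

abbreviation surface_words :: "nat \<Rightarrow> nat \<Rightarrow> (gen \<times> bool) list set" where
  "surface_words g p \<equiv> lists (surface_gens g p \<times> UNIV)"

abbreviation surface_class :: "nat \<Rightarrow> nat \<Rightarrow> (gen \<times> bool) list \<Rightarrow> (gen \<times> bool) list set" where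
  "surface_class g p \<equiv> word_class (surface_gens g p) {surface_relator g p}"

lemma carrier_surface_group: "carrier (surface_group g p) = surface_class g p ` surface_words g p"
  by (simp add: surface_group_def presented_group_def)

lemma surface_group_mult:
  "u \<in> surface_words g p \<Longrightarrow> v \<in> surface_words g p \<Longrightarrow>
    surface_class g p u \<otimes>\<^bsub>surface_group g p\<^esub> surface_class g p v = surface_class g p (u @ v)"
  unfolding surface_group_def by (rule presented_group_mult)

definition rep_of :: "nat \<Rightarrow> nat \<Rightarrow> gen_images \<Rightarrow> rep" where
  "rep_of g p M = (\<lambda>U\<in>carrier (surface_group g p). pm (word_mat M (SOME w. w \<in> U)))"

locale surface_images =
  fixes g p :: nat and M :: gen_images
  assumes det1: "\<And>x. det (M x) = 1"
    and rel1: "pm (word_mat M (surface_relator g p)) = pm (mat 1)"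
begin

lemma rep_of_word:
  assumes "w \<in> surface_words g p"
  shows "rep_of g p M (surface_class g p w) = pm (word_mat M w)"
proof -
  define v where "v = (SOME v. v \<in> surface_class g p w)"
  have "v \<in> surface_class g p w" unfolding v_def by (rule someI, rule word_class_self[OF assms])
  then have "pres_eq (surface_gens g p) {surface_relator g p} w v" using word_classD by blast
  from pres_eq_word_mat[OF this det1 rel1] have "pm (word_mat M w) = pm (word_mat M v)" .
  then show ?thesis using assms by (simp add: rep_of_def carrier_surface_group v_def)
qed

lemma rep_of_Hom: "rep_of g p M \<in> Hom_PSL2 g p"
proof -
  have "rep_of g p M \<in> hom (surface_group g p) PSL2"
    unfolding hom_def
  proof (intro CollectI conjI ballI funcsetI)
    fix U assume "U \<in> carrier (surface_group g p)"
    then obtain u where "u \<in> surface_words g p" "U = surface_class g p u" unfolding carrier_surface_group by blast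
    then show "rep_of g p M U \<in> carrier PSL2"
      using rep_of_word det_word_mat[of M u] det1 by simp
  next
    fix U V assume "U \<in> carrier (surface_group g p)" "V \<in> carrier (surface_group g p)"
    then obtain u v where uv: "u \<in> surface_words g p" "v \<in> surface_words g p"
      "U = surface_class g p u" "V = surface_class g p v" unfolding carrier_surface_group by blast
    then have w: "u @ v \<in> surface_words g p" by auto
    show "rep_of g p M (U \<otimes>\<^bsub>surface_group g p\<^esub> V) = rep_of g p M U \<otimes>\<^bsub>PSL2\<^esub> rep_of g p M V"
      unfolding uv(3,4) surface_group_mult[OF uv(1,2)] rep_of_word[OF uv(1)] rep_of_word[OF uv(2)] rep_of_word[OF w]
      by (simp add: word_mat_append mult_PSL2 det_word_mat det1)
  qed
  then show ?thesis by (simp add: Hom_PSL2_def rep_of_def)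
qed

lemma rep_of_gen: "x \<in> surface_gens g p \<Longrightarrow> rep_of g p M (gen_elem g p x) = pm (M x)"
  unfolding gen_elem_def by (subst rep_of_word) (simp_all add: letter_def)

end

lemma Hom_PSL2_eq_rep_of:
  assumes \<phi>: "\<phi> \<in> Hom_PSL2 g p" and M: "\<And>x. det (M x) = 1"
    and gen: "\<And>x. x \<in> surface_gens g p \<Longrightarrow> \<phi> (gen_elem g p x) = pm (M x)"
    and rel: "surface_relator g p \<in> surface_words g p"
  shows "surface_images g p M" "\<phi> = rep_of g p M"
proof -
  let ?c = "surface_class g p"
  have hom: "\<phi> \<in> hom (surface_group g p) PSL2" and ext: "\<phi> \<in> extensional (carrier (surface_group g p))"
    using \<phi> by (auto simp: Hom_PSL2_def)
  have mult: "\<phi> (?c (u @ v)) = \<phi> (?c u) \<otimes>\<^bsub>PSL2\<^esub> \<phi> (?c v)" if "u \<in> surface_words g p" "v \<in> surface_words g p" for u v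
  proof -
    have "?c u \<in> carrier (surface_group g p)" "?c v \<in> carrier (surface_group g p)"
      using that by (auto simp: carrier_surface_group)
    from hom_mult[OF hom this] show ?thesis using surface_group_mult[OF that] by simp
  qed
  have car: "\<phi> (?c u) \<in> carrier PSL2" if "u \<in> surface_words g p" for u
    using hom that by (auto simp: hom_def carrier_surface_group)
  have nil: "\<phi> (?c []) = pm (mat 1)"
    using mult[of "[]" "[]"] car[of "[]"] group.l_cancel_one'[OF group_PSL2, of "\<phi> (?c [])" "\<phi> (?c [])"]
    by (simp add: one_PSL2)
  have let1: "\<phi> (?c [l]) = pm (letter M l)" if l: "[l] \<in> surface_words g p" for l
  proof -
    obtain x e where xe: "l = (x, e)" by (cases l)
    have x: "x \<in> surface_gens g p" using l xe by auto
    have T: "\<phi> (?c [(x, True)]) = pm (M x)" using gen[OF x] by (simp add: gen_elem_def)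
    show ?thesis
    proof (cases e)
      case True
      then show ?thesis using T xe by (simp add: letter_def)
    next
      case False
      have w: "[(x, True)] \<in> surface_words g p" "[(x, False)] \<in> surface_words g p" using x by auto
      have "pres_eq (surface_gens g p) {surface_relator g p} ([] @ [(x, True), (x, \<not> True)] @ []) ([] @ [])"
        by (rule pres_eq.cancel[OF x])
      then have "?c ([(x, True)] @ [(x, False)]) = ?c []" by (intro word_class_eqI) simp
      then have "pm (M x) \<otimes>\<^bsub>PSL2\<^esub> \<phi> (?c [(x, False)]) = \<one>\<^bsub>PSL2\<^esub>"
        using mult[OF w] T nil by (simp add: one_PSL2)
      then have "\<phi> (?c [(x, False)]) = inv\<^bsub>PSL2\<^esub> (pm (M x))"
        using group.inv_solve_left[OF group_PSL2] car[OF w(2)] M[of x]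
        by (metis group.inv_comm group.inv_equality group_PSL2 pm_in_PSL2)
      then show ?thesis using xe False M[of x] by (simp add: letter_def inv_PSL2)
    qed
  qed
  have word: "\<phi> (?c w) = pm (word_mat M w)" if "w \<in> surface_words g p" for w
    using that
  proof (induction w)
    case Nil
    then show ?case using nil by simp
  next
    case (Cons l w)
    then have lw: "[l] \<in> surface_words g p" "w \<in> surface_words g p" by auto
    have "\<phi> (?c ([l] @ w)) = pm (letter M l) \<otimes>\<^bsub>PSL2\<^esub> pm (word_mat M w)"
      unfolding mult[OF lw] let1[OF lw(1)] Cons.IH ..
    then show ?case using M by (simp add: mult_PSL2 det_word_mat letter_def)
  qed
  have "pres_eq (surface_gens g p) {surface_relator g p} ([] @ surface_relator g p @ []) ([] @ [])"
    by (rule pres_eq.relator) simp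
  then have "?c (surface_relator g p) = ?c []" by (intro word_class_eqI) simp
  then have "pm (word_mat M (surface_relator g p)) = pm (mat 1)" using word[OF rel] nil by simp
  then show si: "surface_images g p M" using M by unfold_locales auto
  interpret surface_images g p M by (rule si)
  have ext': "rep_of g p M \<in> extensional (carrier (surface_group g p))" by (simp add: rep_of_def)
  show "\<phi> = rep_of g p M"
  proof (rule extensionalityI[OF ext ext'])
    fix U assume "U \<in> carrier (surface_group g p)"
    then obtain u where u: "u \<in> surface_words g p" "U = ?c u" unfolding carrier_surface_group by blast
    show "\<phi> U = rep_of g p M U" unfolding u(2) word[OF u(1)] rep_of_word[OF u(1)] ..
  qed
qed

subsection \<open>The relator\<close>

fun block_mat :: "block \<Rightarrow> gen_images \<Rightarrow> real^2^2" where
  "block_mat (Handle j) M = comm_mat (M (GenA j)) (M (GenB j))"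
| "block_mat (Cusp i) M = M (GenC i)"

definition blocks_mat :: "block list \<Rightarrow> gen_images \<Rightarrow> real^2^2" where
  "blocks_mat bs M = foldr (\<lambda>bl A. block_mat bl M ** A) bs (mat 1)"

lemma blocks_mat_simps [simp]:
  "blocks_mat [] M = mat 1" "blocks_mat (bl # bs) M = block_mat bl M ** blocks_mat bs M"
  by (simp_all add: blocks_mat_def)

fun block_word :: "block \<Rightarrow> (gen \<times> bool) list" where
  "block_word (Handle j) = [(GenA j, True), (GenB j, True), (GenA j, False), (GenB j, False)]"
| "block_word (Cusp i) = [(GenC i, True)]"

lemma surface_relator_blocks: "surface_relator g p = concat (map block_word (surface_word g p))"
proof -
  have "concat (map block_word (map Cusp is)) = map (\<lambda>i. (GenC i, True)) is" for "is"
    by (induction "is") simp_all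
  then show ?thesis by (simp add: surface_relator_def surface_word_def comp_def)
qed

lemma word_mat_blocks: "word_mat M (concat (map block_word bs)) = blocks_mat bs M"
proof (induction bs)
  case (Cons bl bs)
  have "word_mat M (block_word bl) = block_mat bl M"
    by (cases bl) (simp_all add: letter_def comm_mat_def matrix_mul_assoc)
  then show ?case using Cons by (simp add: word_mat_append)
qed simp

lemma word_gens_surface_word: "word_gens (surface_word g p) = surface_gens g p"
  by (auto simp: word_gens_def surface_word_def surface_gens_def)

lemma surface_relator_in_words: "surface_relator g p \<in> surface_words g p"
proof -
  have "set (block_word bl) \<subseteq> block_gens bl \<times> UNIV" for bl by (cases bl) auto
  then have "set (concat (map block_word (surface_word g p))) \<subseteq> word_gens (surface_word g p) \<times> UNIV"
    by (fastforce simp: word_gens_def)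
  then show ?thesis unfolding surface_relator_blocks word_gens_surface_word in_lists_conv_set by blast
qed

lemma angle_lift_blocks:
  assumes "\<And>bl. bl \<in> set bs \<Longrightarrow> block_ok s bl m"
  shows "angle_lift (blocks_mat bs m) (word_lift bs m)" "det (blocks_mat bs m) = 1"
proof -
  have b: "angle_lift (block_mat bl m) (block_lift bl m) \<and> det (block_mat bl m) = 1" if ok: "block_ok s bl m" for bl
  proof (cases bl)
    case (Handle j)
    then show ?thesis using ok angle_lift_comm det_comm_mat by simp
  next
    case (Cusp i)
    then have c: "m (GenC i) \<in> sign_class (s i)" using ok by simp
    then show ?thesis using Cusp sign_class_det[OF c] sign_class_trace[OF c] by (auto intro!: angle_lift_plift)
  qed
  have "angle_lift (blocks_mat bs m) (word_lift bs m) \<and> det (blocks_mat bs m) = 1"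
    using assms
  proof (induction bs)
    case Nil
    then show ?case by (simp add: angle_lift_id)
  next
    case (Cons bl bs)
    then have IH: "angle_lift (blocks_mat bs m) (word_lift bs m)" "det (blocks_mat bs m) = 1" "block_ok s bl m" by auto
    have "angle_lift (block_mat bl m ** blocks_mat bs m) (block_lift bl m \<circ> word_lift bs m)"
      using b[OF IH(3)] IH(1) by (intro angle_lift_comp) auto
    moreover have "det (block_mat bl m ** blocks_mat bs m) = 1" using b[OF IH(3)] IH(2) by (simp add: det_mul)
    ultimately show ?case unfolding word_lift_Cons blocks_mat_simps by (rule conjI)
  qed
  then show "angle_lift (blocks_mat bs m) (word_lift bs m)" "det (blocks_mat bs m) = 1" by auto
qed

lemma continuous_on_blocks_mat:
  fixes m :: "'a::topological_space \<Rightarrow> gen_images"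
  assumes "continuous_on S m"
  shows "continuous_on S (\<lambda>q. blocks_mat bs (m q))"
  unfolding word_mat_blocks[symmetric] by (rule continuous_on_word_mat[OF assms])


subsection \<open>The representation space in terms of matrices\<close>

definition surface_set :: "nat \<Rightarrow> nat \<Rightarrow> int \<Rightarrow> (nat \<Rightarrow> int) \<Rightarrow> gen_images set" where
  "surface_set g p n s = {m. word_ok s (surface_word g p) m \<and>
     word_lift (surface_word g p) m = (\<lambda>x. x + pi * of_int n)}"

lemma surface_set_det:
  assumes "word_ok s (surface_word g p) m"
  shows "det (m x) = 1"
proof (cases "x \<in> surface_gens g p")
  case True
  then obtain bl where bl: "bl \<in> set (surface_word g p)" "x \<in> block_gens bl"
    using word_gens_surface_word[of g p] by (auto simp: word_gens_def)
  have "block_ok s bl m" using assms bl(1) by (simp add: word_ok_def)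
  then show ?thesis using bl(2) sign_class_det by (cases bl) auto
next
  case False
  then show ?thesis using assms by (simp add: word_ok_def word_gens_surface_word)
qed

lemma surface_set_images:
  assumes "m \<in> surface_set g p n s"
  shows "surface_images g p m"
proof
  have ok: "word_ok s (surface_word g p) m" using assms by (simp add: surface_set_def)
  show "det (m x) = 1" for x by (rule surface_set_det[OF ok])
  have al: "angle_lift (blocks_mat (surface_word g p) m) (\<lambda>x. x + pi * of_int n)"
    "det (blocks_mat (surface_word g p) m) = 1"
    using angle_lift_blocks[of "surface_word g p" s m] ok assms by (auto simp: word_ok_def surface_set_def)
  have "blocks_mat (surface_word g p) m = (if even n then mat 1 else - mat 1)"
    by (rule angle_lift_matrix_unique[OF al(1) angle_lift_shift[OF angle_lift_id] al(2)]) simp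
  then show "pm (word_mat m (surface_relator g p)) = pm (mat 1)"
    by (auto simp: surface_relator_blocks word_mat_blocks)
qed

lemma HP_eq_image:
  assumes s: "s \<in> {..<p} \<rightarrow>\<^sub>E {-1, 0, 1}"
  shows "HP g p n s = rep_of g p ` surface_set g p n s"
proof (intro equalityI subsetI)
  have si: "s i \<in> {-1, 0, 1}" if "i < p" for i using s that by (auto simp: PiE_def Pi_def)
  have gens: "GenA j \<in> surface_gens g p" "GenB j \<in> surface_gens g p" if "j < g" for j
    using that by (auto simp: surface_gens_def)
  have genC: "GenC i \<in> surface_gens g p" if "i < p" for i using that by (auto simp: surface_gens_def)
  {
    fix \<phi> assume "\<phi> \<in> rep_of g p ` surface_set g p n s"
    then obtain m where m: "m \<in> surface_set g p n s" "\<phi> = rep_of g p m" by blast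
    interpret surface_images g p m by (rule surface_set_images[OF m(1)])
    have ok: "block_ok s bl m" if "bl \<in> set (surface_word g p)" for bl
      using m(1) that by (simp add: surface_set_def word_ok_def)
    have c: "m (GenC i) \<in> sign_class (s i)" if "i < p" for i
      using ok[of "Cusp i"] that by (auto simp: surface_word_def)
    have \<phi>x: "\<phi> (gen_elem g p x) = pm (m x)" if "x \<in> surface_gens g p" for x
      using rep_of_gen[OF that] m(2) by simp
    have "mixed_boundary g p \<phi> \<and> rep_sign g p \<phi> = s"
      unfolding boundary_sign_iff[OF s] using c \<phi>x genC by blast
    moreover have "rel_euler_class g p \<phi> = n"
      by (rule rel_euler_class_eq[where m = m and s = s])
        (use det1 \<phi>x gens genC c si m(1) in \<open>auto simp: surface_set_def\<close>)
    ultimately show "\<phi> \<in> HP g p n s" using rep_of_Hom m(2) by (simp add: HP_def)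
  next
    fix \<phi> assume "\<phi> \<in> HP g p n s"
    then have \<phi>: "\<phi> \<in> Hom_PSL2 g p" "rel_euler_class g p \<phi> = n" "mixed_boundary g p \<phi> \<and> rep_sign g p \<phi> = s"
      by (auto simp: HP_def)
    have ex: "\<exists>A. (x \<in> surface_gens g p \<longrightarrow> det A = 1 \<and> \<phi> (gen_elem g p x) = pm A \<and>
        (\<forall>i. x = GenC i \<longrightarrow> A \<in> sign_class (s i))) \<and> (x \<notin> surface_gens g p \<longrightarrow> A = mat 1)" for x
    proof (cases "x \<in> surface_gens g p")
      case True
      have "gen_elem g p x \<in> carrier (surface_group g p)"
        using True by (auto simp: gen_elem_def carrier_surface_group)
      then have "\<phi> (gen_elem g p x) \<in> carrier PSL2" using \<phi>(1) by (auto simp: Hom_PSL2_def hom_def)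
      then obtain A where A: "det A = 1" "\<phi> (gen_elem g p x) = pm A" by (rule PSL2_E)
      show ?thesis
      proof (cases "\<exists>i. x = GenC i")
        case False
        then show ?thesis using A True by blast
      next
        case isC: True
        then obtain i where i: "x = GenC i" by blast
        then have "i < p" using True by (auto simp: surface_gens_def)
        then obtain B where B: "B \<in> sign_class (s i)" "\<phi> (gen_elem g p (GenC i)) = pm B"
          using \<phi>(3) unfolding boundary_sign_iff[OF s] by blast
        then show ?thesis using i True sign_class_det[OF B(1)] by (intro exI[of _ B]) auto
      qed
    qed auto
    have "\<exists>m. \<forall>x. (x \<in> surface_gens g p \<longrightarrow> det (m x) = 1 \<and> \<phi> (gen_elem g p x) = pm (m x) \<and>
        (\<forall>i. x = GenC i \<longrightarrow> m x \<in> sign_class (s i))) \<and> (x \<notin> surface_gens g p \<longrightarrow> m x = mat 1)"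
      by (rule choice, rule allI, rule ex)
    then obtain m where m: "\<And>x. x \<in> surface_gens g p \<Longrightarrow> det (m x) = 1 \<and> \<phi> (gen_elem g p x) = pm (m x) \<and>
        (\<forall>i. x = GenC i \<longrightarrow> m x \<in> sign_class (s i))" "\<And>x. x \<notin> surface_gens g p \<Longrightarrow> m x = mat 1"
      by blast
    have d: "det (m x) = 1" for x using m[of x] by (cases "x \<in> surface_gens g p") auto
    have gen: "\<phi> (gen_elem g p x) = pm (m x)" if "x \<in> surface_gens g p" for x using m(1)[OF that] by blast
    have si_m: "surface_images g p m" by (rule Hom_PSL2_eq_rep_of(1)[OF \<phi>(1) d gen surface_relator_in_words])
    have rep_m: "\<phi> = rep_of g p m" by (rule Hom_PSL2_eq_rep_of(2)[OF \<phi>(1) d gen surface_relator_in_words])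
    have bok: "block_ok s bl m" if bl: "bl \<in> set (surface_word g p)" for bl
    proof (cases bl)
      case (Cusp i)
      then have "i < p" using bl by (auto simp: surface_word_def)
      then show ?thesis using m(1)[OF genC] Cusp by simp
    qed (simp add: d)
    have ok: "word_ok s (surface_word g p) m"
      using bok m(2) by (simp add: word_ok_def word_gens_surface_word)
    note al = angle_lift_blocks[OF bok]
    have "pm (word_mat m (surface_relator g p)) = pm (mat 1)" using si_m by (rule surface_images.rel1)
    then have pmI: "blocks_mat (surface_word g p) m = mat 1 \<or> blocks_mat (surface_word g p) m = - mat 1"
      by (simp add: surface_relator_blocks word_mat_blocks pm_eq_iff)
    obtain k :: int where k: "\<forall>x. word_lift (surface_word g p) m x = x + pi * of_int k"
      using angle_lift_pm_shift[OF angle_lift_id al(1) _ pmI] by auto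
    have E: "word_lift (surface_word g p) m = (\<lambda>x. x + pi * of_int k)" using k by auto
    have "rel_euler_class g p \<phi> = k"
      by (rule rel_euler_class_eq[where m = m and s = s])
        (use m(1) gens genC si E in \<open>auto\<close>)
    then have "m \<in> surface_set g p n s" using ok E \<phi>(2) by (simp add: surface_set_def)
    then show "\<phi> \<in> rep_of g p ` surface_set g p n s" using rep_m by blast
  }
qed


subsection \<open>Hyperbolic elements as displacement range\<close>

lemma hyperbolic_of_disp_range:
  assumes "det c = 1" "angle_lift c f" "disp_range 0 0 f"
  shows "trace c > 2" "f = plift c"
proof -
  obtain x y where xy: "f x > x" "f y < y" using assms(3) by (auto simp: disp_range_def disp_above_def disp_below_def)
  have "connected (range (\<lambda>t. f t - t))"
    by (intro connected_continuous_image continuous_intros angle_lift_cont[OF assms(2)]) simp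
  then have "0 \<in> range (\<lambda>t. f t - t)"
    using connectedD_interval[of "range (\<lambda>t. f t - t)" "f y - y" "f x - x" 0] xy by auto
  then obtain e where e: "f e = e" by auto
  obtain r where r: "r > 0" "mact c (cis e) = r *\<^sub>R cis e" using angle_liftE[OF assms(2), of e] e by metis
  obtain s where s: "c = cc r e s" using cc_of_eigenvector[OF assms(1) r(2)] r(1) by auto
  show fp: "f = plift c"
    by (rule angle_lift_fixed_eq_plift[OF assms(1,2) e]) (use r(1) s in \<open>simp add: add_inverse_pos\<close>)
  have "r \<noteq> 1"
  proof
    assume r1: "r = 1"
    consider "s = 0" | "s > 0" | "s < 0" by linarith
    then show False
    proof cases
      case 1
      then have "c = mat 1" using s r1 by (simp add: cc_def rot_add)
      then show False using xy(1) fp by (simp add: plift_fixed[where r = 1])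
    next
      case 2
      then have "c \<in> sign_class 1" using s r1 by (auto simp: sign_class_def)
      from plift_sign_class(2)[OF this, of y] show False using xy(2) fp by simp
    next
      case 3
      define t where "t = - s"
      have "c = sinv (cc 1 e t)" "t > 0" using s r1 3 by (simp_all add: sinv_cc t_def)
      then have "c \<in> sign_class (-1)" by (auto simp: sign_class_def)
      from plift_sign_class(2)[OF this, of x] show False using xy(1) fp by simp
    qed
  qed
  then show "trace c > 2" using s add_inverse_gt_2[OF r(1)] by simp
qed

lemma disp_range_of_hyperbolic:
  assumes "det c = 1" "trace c > 2"
  shows "disp_range 0 0 (plift c)"
proof -
  obtain l \<beta> s where l: "0 < l" "l < 1" "c = cc l \<beta> s" using hyperbolic_normal_form[OF assms] by blast
  define t where "t = 1 / l - l"
  have "l * l < 1 * 1" using l by (intro mult_strict_mono) auto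
  then have t: "t > 0" using l by (simp add: t_def field_simps)
  define T where "T = t / (\<bar>s\<bar> + 1)"
  have T: "T > 0" "\<bar>s\<bar> * T < t" using t by (auto simp: T_def field_simps)
  define a where "a = arctan T"
  have a: "0 < a" "a < pi/2" using T(1) arctan_ubound[of T] by (simp_all add: a_def)
  have ca: "cos a > 0" "sin a = T * cos a"
    using a cos_gt_zero[of a] by (auto simp: a_def sin_arctan cos_arctan)
  have sT: "\<bar>s * T\<bar> < t" using T by (simp add: abs_mult)
  have "s * sin (- a) + t * cos (- a) = cos a * (t - s * T)" using ca(2) by (simp add: algebra_simps)
  moreover have "t - s * T > 0" using sT by linarith
  ultimately have "s * sin (- a) + t * cos (- a) > 0" using ca(1) by simp
  then have 1: "plift (tri l s) (- a) < - a" using plift_tri_sign(2)[of l "- a" s] l a by (simp add: t_def)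
  have "s * sin (a - pi) + t * cos (a - pi) = - (cos a * (t + s * T))"
    using ca(2) by (simp add: algebra_simps)
  moreover have "t + s * T > 0" using sT by linarith
  ultimately have "s * sin (a - pi) + t * cos (a - pi) < 0" using ca(1) by simp
  then have 2: "plift (tri l s) (a - pi) > a - pi" using plift_tri_sign(1)[of l "a - pi" s] l a by (simp add: t_def)
  have "plift c (\<beta> - a) < \<beta> - a" "plift c (\<beta> + (a - pi)) > \<beta> + (a - pi)"
    using 1 2 unfolding l(3) plift_cc by simp_all
  then show ?thesis unfolding disp_range_def disp_above_def disp_below_def
    by (metis mult_zero_right of_int_0 add.right_neutral)
qed

subsection \<open>Eliminating a hyperbolic boundary element\<close>

definition pre_word :: "nat \<Rightarrow> nat \<Rightarrow> block list" where
  "pre_word g i0 = map Handle [0..<g] @ map Cusp [0..<i0]"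

definition suf_word :: "nat \<Rightarrow> nat \<Rightarrow> block list" where
  "suf_word p i0 = map Cusp [Suc i0..<p]"

definition rest_word :: "nat \<Rightarrow> nat \<Rightarrow> nat \<Rightarrow> block list" where
  "rest_word g p i0 = suf_word p i0 @ pre_word g i0"

definition eliminated :: "nat \<Rightarrow> nat \<Rightarrow> nat \<Rightarrow> int \<Rightarrow> gen_images \<Rightarrow> real^2^2" where
  "eliminated g p i0 n m =
     (if even n then sinv (blocks_mat (pre_word g i0) m) ** sinv (blocks_mat (suf_word p i0) m)
      else - (sinv (blocks_mat (pre_word g i0) m) ** sinv (blocks_mat (suf_word p i0) m)))"

definition fill :: "nat \<Rightarrow> nat \<Rightarrow> nat \<Rightarrow> int \<Rightarrow> gen_images \<Rightarrow> gen_images" where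
  "fill g p i0 n m = override_block (Cusp i0) m (\<lambda>_. eliminated g p i0 n m)"

lemma surface_word_split:
  assumes "i0 < p"
  shows "surface_word g p = pre_word g i0 @ Cusp i0 # suf_word p i0"
proof -
  have "[0..<p] = [0..<i0] @ i0 # [Suc i0..<p]"
    using upt_add_eq_append[of 0 i0 "p - i0"] upt_conv_Cons[OF assms] assms by simp
  then show ?thesis by (simp add: surface_word_def pre_word_def suf_word_def)
qed

lemma cusp_notin_rest: "Cusp i0 \<notin> set (pre_word g i0)" "Cusp i0 \<notin> set (suf_word p i0)"
  "Cusp i0 \<notin> set (rest_word g p i0)"
  by (auto simp: pre_word_def suf_word_def rest_word_def)

lemma distinct_rest_word: "distinct (rest_word g p i0)"
  by (auto simp: pre_word_def suf_word_def rest_word_def distinct_map inj_on_def)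

lemma word_ok_surface_iff:
  assumes "i0 < p"
  shows "word_ok s (surface_word g p) m \<longleftrightarrow> word_ok s (Cusp i0 # rest_word g p i0) m"
  by (auto simp: word_ok_def word_gens_def surface_word_split[OF assms] rest_word_def)

lemma disp_range_elimination:
  assumes P: "P \<in> AL" and Q: "Q \<in> AL"
  shows "disp_range 0 0 (\<lambda>x. (finv P \<circ> finv Q) x + pi * of_int n) \<longleftrightarrow> disp_range n n (Q \<circ> P)"
proof -
  have "finv P \<circ> finv Q = finv (Q \<circ> P)"
  proof -
    have "finv (Q \<circ> P) = finv P \<circ> finv Q"
      by (rule inv_equality) (auto simp: AL_inv_f[OF P] AL_f_inv[OF P] AL_inv_f[OF Q] AL_f_inv[OF Q])
    then show ?thesis by simp
  qed
  then show ?thesis unfolding disp_range_shift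
    using disp_range_inv[OF AL_comp[OF Q P], of "0 - n" "0 - n"] by simp
qed

lemma word_lift_override_other:
  assumes "bl \<notin> set bs"
  shows "word_lift bs (override_block bl m m') = word_lift bs m"
  by (rule word_lift_cong) (use word_gens_disjoint[OF assms] in \<open>auto simp: override_block_def\<close>)

lemma eliminated_lift:
  assumes ok: "word_ok s (rest_word g p i0) m"
    and P: "P = word_lift (pre_word g i0) m" and Q: "Q = word_lift (suf_word p i0) m"
  shows "P \<in> AL" "Q \<in> AL" "det (eliminated g p i0 n m) = 1"
    "angle_lift (eliminated g p i0 n m) (\<lambda>x. (finv P \<circ> finv Q) x + pi * of_int n)"
    "word_lift (rest_word g p i0) m = Q \<circ> P"
proof -
  have b: "block_ok s bl m" if "bl \<in> set (pre_word g i0) \<or> bl \<in> set (suf_word p i0)" for bl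
    using ok that by (auto simp: word_ok_def rest_word_def)
  show "P \<in> AL" "Q \<in> AL" unfolding P Q by (rule AL_word_lift[of _ s], use b in blast)+
  have al: "angle_lift (blocks_mat (pre_word g i0) m) P" "det (blocks_mat (pre_word g i0) m) = 1"
    "angle_lift (blocks_mat (suf_word p i0) m) Q" "det (blocks_mat (suf_word p i0) m) = 1"
    unfolding P Q by (rule angle_lift_blocks[of _ s], use b in blast)+
  then show "det (eliminated g p i0 n m) = 1" by (simp add: eliminated_def det_mul)
  show "angle_lift (eliminated g p i0 n m) (\<lambda>x. (finv P \<circ> finv Q) x + pi * of_int n)"
    unfolding eliminated_def
    by (rule angle_lift_shift[OF angle_lift_comp[OF angle_lift_inv[OF al(1,2)] angle_lift_inv[OF al(3,4)]]])
  show "word_lift (rest_word g p i0) m = Q \<circ> P" unfolding rest_word_def word_lift_append P Q ..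
qed

lemma fill_surface_set:
  assumes i0: "i0 < p" "s i0 = 0" and m: "m \<in> word_set s (rest_word g p i0) n n"
  shows "fill g p i0 n m \<in> surface_set g p n s"
proof -
  have ok: "word_ok s (rest_word g p i0) m" using m by (simp add: word_set_def)
  define P where "P = word_lift (pre_word g i0) m"
  define Q where "Q = word_lift (suf_word p i0) m"
  note E = eliminated_lift[OF ok P_def Q_def] note E3 = E(3)[of n] note E4 = E(4)[of n]
  let ?c = "eliminated g p i0 n m" and ?f = "\<lambda>x. (finv P \<circ> finv Q) x + pi * of_int n"
  have "disp_range n n (Q \<circ> P)" using m E(5) by (simp add: word_set_def)
  then have "disp_range 0 0 ?f" unfolding disp_range_elimination[OF E(1,2)] .
  note H = hyperbolic_of_disp_range[OF E3 E4 this]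
  have "block_ok s (Cusp i0) (\<lambda>_. ?c)" using H(1) E3 i0(2) by (simp add: sign_class_def)
  then have "word_ok s (surface_word g p) (fill g p i0 n m)"
    unfolding word_ok_surface_iff[OF i0(1)] fill_def by (rule word_ok_override[OF cusp_notin_rest(3) ok])
  moreover have "word_lift (surface_word g p) (fill g p i0 n m) = (\<lambda>x. x + pi * of_int n)"
  proof -
    have "block_lift (Cusp i0) (fill g p i0 n m) = plift ?c" by (simp add: fill_def override_block_def)
    then have "word_lift (surface_word g p) (fill g p i0 n m) = P \<circ> (?f \<circ> Q)"
      unfolding surface_word_split[OF i0(1)] word_lift_append word_lift_Cons H(2)
      by (simp only: fill_def word_lift_override_other[OF cusp_notin_rest(1)]
          word_lift_override_other[OF cusp_notin_rest(2)] P_def Q_def)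
    also have "\<dots> = (\<lambda>x. x + pi * of_int n)"
      by (rule ext) (simp add: AL_inv_f[OF E(2)] AL_periodic[OF E(1)] AL_f_inv[OF E(1)])
    finally show ?thesis .
  qed
  ultimately show ?thesis by (simp add: surface_set_def)
qed

lemma surface_set_unfill:
  assumes i0: "i0 < p" "s i0 = 0" and M: "M \<in> surface_set g p n s"
  shows "reset_block (Cusp i0) M \<in> word_set s (rest_word g p i0) n n"
    "fill g p i0 n (reset_block (Cusp i0) M) = M"
proof -
  define m where "m = reset_block (Cusp i0) M"
  have okM: "word_ok s (Cusp i0 # rest_word g p i0) M"
    using M unfolding surface_set_def word_ok_surface_iff[OF i0(1), symmetric] by simp
  have ok: "word_ok s (rest_word g p i0) m" unfolding m_def by (rule word_ok_reset[OF cusp_notin_rest(3) okM])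
  define P where "P = word_lift (pre_word g i0) m"
  define Q where "Q = word_lift (suf_word p i0) m"
  note E = eliminated_lift[OF ok P_def Q_def] note E3 = E(3)[of n] note E4 = E(4)[of n]
  let ?c = "eliminated g p i0 n m" and ?f = "\<lambda>x. (finv P \<circ> finv Q) x + pi * of_int n"
  have "block_ok s (Cusp i0) M" using okM by (simp add: word_ok_def)
  then have c: "det (M (GenC i0)) = 1" "trace (M (GenC i0)) > 2" using i0(2) by (simp_all add: sign_class_def)
  have "word_lift (surface_word g p) M = P \<circ> (plift (M (GenC i0)) \<circ> Q)"
    unfolding surface_word_split[OF i0(1)] word_lift_append word_lift_Cons P_def Q_def m_def reset_block_def
      word_lift_override_other[OF cusp_notin_rest(1)] word_lift_override_other[OF cusp_notin_rest(2)] block_lift.simps ..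
  then have e: "P (plift (M (GenC i0)) (Q x)) = x + pi * of_int n" for x
    using M by (simp add: surface_set_def fun_eq_iff)
  have f: "plift (M (GenC i0)) = ?f"
  proof
    fix y
    have "P (plift (M (GenC i0)) y) = finv Q y + pi * of_int n" using e[of "finv Q y"] by (simp add: AL_f_inv[OF E(2)])
    then have "plift (M (GenC i0)) y = finv P (finv Q y + pi * of_int n)" by (metis AL_inv_f[OF E(1)])
    then show "plift (M (GenC i0)) y = ?f y" by (simp add: AL_periodic[OF AL_inv[OF E(1)]])
  qed
  have "disp_range 0 0 ?f" using disp_range_of_hyperbolic[OF c] unfolding f .
  then have "disp_range n n (Q \<circ> P)" unfolding disp_range_elimination[OF E(1,2)] .
  then show "reset_block (Cusp i0) M \<in> word_set s (rest_word g p i0) n n"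
    using ok E(5) unfolding m_def[symmetric] by (simp add: word_set_def)
  have al: "angle_lift (M (GenC i0)) (plift (M (GenC i0)))" using c by (intro angle_lift_plift) auto
  have "?c = M (GenC i0)"
    by (rule angle_lift_matrix_unique[OF E4[folded f] al E3 c(1)])
  then have "fill g p i0 n m = override_block (Cusp i0) m (\<lambda>_. M (GenC i0))" by (simp add: fill_def)
  also have "\<dots> = M" by (auto simp: m_def reset_block_def override_block_def)
  finally show "fill g p i0 n (reset_block (Cusp i0) M) = M" by (simp only: m_def)
qed

lemma surface_set_eq_fill:
  assumes "i0 < p" "s i0 = 0"
  shows "surface_set g p n s = fill g p i0 n ` word_set s (rest_word g p i0) n n"
  proof
  show "surface_set g p n s \<subseteq> fill g p i0 n ` word_set s (rest_word g p i0) n n"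
  proof
    fix M assume "M \<in> surface_set g p n s"
    from surface_set_unfill[where s = s, OF assms this]
    show "M \<in> fill g p i0 n ` word_set s (rest_word g p i0) n n" by (metis image_eqI)
  qed
  show "fill g p i0 n ` word_set s (rest_word g p i0) n n \<subseteq> surface_set g p n s"
    using fill_surface_set[where s = s, OF assms] by blast
qed

lemma continuous_on_fill: "continuous_on S (fill g p i0 n)"
proof -
  have "continuous_on S (eliminated g p i0 n)"
    unfolding eliminated_def
    by (cases "even n") (simp_all add: continuous_on_mat_mult continuous_on_sinv continuous_on_blocks_mat
        continuous_on_minus continuous_on_id)
  then have "continuous_on S (\<lambda>m. \<lambda>_ :: gen. eliminated g p i0 n m)"
    by (intro continuous_on_coordinatewise_then_product)
  then show ?thesis unfolding fill_def by (intro continuous_on_override_block continuous_on_id)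
qed


subsection \<open>Sign changes\<close>

lemma pm_word_mat_cong:
  assumes "\<And>l. letter M' l = letter M l \<or> letter M' l = - letter M l"
  shows "pm (word_mat M' w) = pm (word_mat M w)"
proof -
  have "word_mat M' w = word_mat M w \<or> word_mat M' w = - word_mat M w"
  proof (induction w)
    case (Cons a w)
    then show ?case using assms[of a] by (elim disjE) simp_all
  qed simp
  then show ?thesis by (auto simp: pm_eq_iff)
qed

lemma pm_word_mat_flip: "pm (word_mat (M(x := - M x)) w) = pm (word_mat M w)"
proof (rule pm_word_mat_cong)
  show "letter (M(x := - M x)) l = letter M l \<or> letter (M(x := - M x)) l = - letter M l" for l
    by (cases l) (auto simp: letter_def sinv_minus)
qed

lemma rep_of_flip: "rep_of g p (M(x := - M x)) = rep_of g p M"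
  unfolding rep_of_def pm_word_mat_flip ..

lemma fill_flip:
  assumes "x = GenA j \<or> x = GenB j"
  shows "fill g p i0 n (m(x := - m x)) = (fill g p i0 n m)(x := - fill g p i0 n m x)"
proof -
  have "block_mat bl (m(x := - m x)) = block_mat bl m" for bl
    using assms by (cases bl) (auto simp: comm_mat_def sinv_minus)
  then have b: "blocks_mat bs (m(x := - m x)) = blocks_mat bs m" for bs
    by (induction bs) simp_all
  have "eliminated g p i0 n (m(x := - m x)) = eliminated g p i0 n m" unfolding eliminated_def b ..
  then show ?thesis using assms by (auto simp: fill_def override_block_def)
qed


subsection \<open>The topology on the representation space\<close>

lemma continuous_map_rep_of:
  fixes F :: "'a::topological_space \<Rightarrow> gen_images"
  assumes F: "continuous_on W F" and im: "\<And>m. m \<in> W \<Longrightarrow> surface_images g p (F m)"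
  shows "continuous_map (top_of_set W) (Hom_PSL2_top g p) (\<lambda>m. rep_of g p (F m))"
proof -
  let ?C = "carrier (surface_group g p)" and ?R = "\<lambda>m. rep_of g p (F m)"
  have pt: "continuous_map (top_of_set W) PSL2_top (\<lambda>m. ?R m U)" if U: "U \<in> ?C" for U
  proof -
    obtain w where w: "w \<in> surface_words g p" "U = surface_class g p w" using U unfolding carrier_surface_group by blast
    have "continuous_map (top_of_set W) PSL2_top (\<lambda>m. pm (word_mat (F m) w))"
      by (rule continuous_map_pm[OF continuous_on_word_mat[OF F]])
        (rule det_word_mat, rule surface_images.det1[OF im])
    then show ?thesis
      by (rule continuous_map_eq) (use surface_images.rep_of_word[OF im w(1)] w(2) in simp)
  qed
  have Hom: "?R m \<in> Hom_PSL2 g p" if "m \<in> W" for m using surface_images.rep_of_Hom[OF im[OF that]] .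
  have ext: "?R m \<in> extensional ?C" and cm: "continuous_map (discrete_topology ?C) PSL2_top (?R m)" if "m \<in> W" for m
    using Hom[OF that] by (auto simp: Hom_PSL2_def hom_def topspace_PSL2_top)
  have "continuous_map (top_of_set W) (compact_open_topology (discrete_topology ?C) PSL2_top) ?R"
    unfolding compact_open_topology_def
  proof (rule continuous_on_generated_topo)
    fix B assume "B \<in> {{f \<in> extensional (topspace (discrete_topology ?C)). continuous_map (discrete_topology ?C) PSL2_top f \<and>
        f ` K \<subseteq> V} |K V. compactin (discrete_topology ?C) K \<and> openin PSL2_top V}"
    then obtain K V where KV: "B = {f \<in> extensional (topspace (discrete_topology ?C)). continuous_map (discrete_topology ?C) PSL2_top f \<and>
        f ` K \<subseteq> V}" "compactin (discrete_topology ?C) K" "openin PSL2_top V" by blast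
    have K: "finite K" "K \<subseteq> ?C" using KV(2) by (auto simp: compactin_discrete_topology)
    have "?R -` B \<inter> topspace (top_of_set W) = {m \<in> W. \<forall>U\<in>K. ?R m U \<in> V}"
      using ext cm unfolding KV(1) by auto
    moreover have "openin (top_of_set W) {m \<in> W. \<forall>U\<in>K. ?R m U \<in> V}"
      using K
    proof (induction K rule: finite_induct)
      case (insert U K)
      have "openin (top_of_set W) {m \<in> topspace (top_of_set W). ?R m U \<in> V}"
        by (rule openin_continuous_map_preimage[OF pt KV(3)]) (use insert.prems in simp)
      moreover have "{m \<in> W. \<forall>U\<in>insert U K. ?R m U \<in> V} = {m \<in> topspace (top_of_set W). ?R m U \<in> V} \<inter> {m \<in> W. \<forall>U\<in>K. ?R m U \<in> V}"
        by auto
      ultimately show ?case using insert by (simp add: openin_Int)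
    qed simp
    ultimately show "openin (top_of_set W) (?R -` B \<inter> topspace (top_of_set W))" by simp
  next
    have "?R m \<in> {f \<in> extensional (topspace (discrete_topology ?C)). continuous_map (discrete_topology ?C) PSL2_top f \<and> f ` {} \<subseteq> {}}"
      if "m \<in> W" for m using ext[OF that] cm[OF that] by simp
    moreover have "{f \<in> extensional (topspace (discrete_topology ?C)). continuous_map (discrete_topology ?C) PSL2_top f \<and> f ` {} \<subseteq> {}}
      \<in> {{f \<in> extensional (topspace (discrete_topology ?C)). continuous_map (discrete_topology ?C) PSL2_top f \<and>
        f ` K \<subseteq> V} |K V. compactin (discrete_topology ?C) K \<and> openin PSL2_top V}"
      by (intro CollectI exI[of _ "{}"]) auto
    ultimately show "?R ` topspace (top_of_set W) \<subseteq> \<Union> {{f \<in> extensional (topspace (discrete_topology ?C)).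
        continuous_map (discrete_topology ?C) PSL2_top f \<and> f ` K \<subseteq> V} |K V.
        compactin (discrete_topology ?C) K \<and> openin PSL2_top V}"
      by auto
  qed
  then show ?thesis using Hom by (auto simp: Hom_PSL2_top_def continuous_map_in_subtopology)
qed

lemma connectedin_image_of_const:
  assumes R: "continuous_map (top_of_set W) X R"
    and c: "\<And>g :: 'a::topological_space \<Rightarrow> bool. loc_const W g \<Longrightarrow> (\<And>m m'. m \<in> W \<Longrightarrow> m' \<in> W \<Longrightarrow> R m = R m' \<Longrightarrow> g m = g m') \<Longrightarrow>
      (\<forall>m\<in>W. \<forall>m'\<in>W. g m = g m')"
  shows "connectedin X (R ` W)"
  unfolding connectedin
proof (intro conjI notI)
  show "R ` W \<subseteq> topspace X" using continuous_map_image_subset_topspace[OF R] by simp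
  assume "\<exists>E1 E2. openin X E1 \<and> openin X E2 \<and> R ` W \<subseteq> E1 \<union> E2 \<and> E1 \<inter> E2 \<inter> R ` W = {} \<and>
    E1 \<inter> R ` W \<noteq> {} \<and> E2 \<inter> R ` W \<noteq> {}"
  then obtain E1 E2 where E: "openin X E1" "openin X E2" "R ` W \<subseteq> E1 \<union> E2" "E1 \<inter> E2 \<inter> R ` W = {}"
    "E1 \<inter> R ` W \<noteq> {}" "E2 \<inter> R ` W \<noteq> {}" by blast
  define g where "g m = (R m \<in> E1)" for m
  have op: "\<exists>U. open U \<and> {m \<in> W. R m \<in> E} = W \<inter> U" if "openin X E" for E
    using openin_continuous_map_preimage[OF R that] by (auto simp: openin_open)
  obtain U1 where U1: "open U1" "{m \<in> W. R m \<in> E1} = W \<inter> U1" using op[OF E(1)] by blast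
  obtain U2 where U2: "open U2" "{m \<in> W. R m \<in> E2} = W \<inter> U2" using op[OF E(2)] by blast
  have "loc_const W g"
    unfolding loc_const_def
  proof
    fix m assume m: "m \<in> W"
    show "\<exists>U. open U \<and> m \<in> U \<and> (\<forall>y\<in>U \<inter> W. g y = g m)"
    proof (cases "R m \<in> E1")
      case True
      then show ?thesis using U1 m unfolding g_def by (intro exI[of _ U1]) blast
    next
      case False
      then have "m \<in> U2" using E(3) m U2(2) by blast
      moreover have "R y \<notin> E1" if "y \<in> U2 \<inter> W" for y
      proof -
        have "R y \<in> E2" using U2(2) that by blast
        then show ?thesis using E(4) that by blast
      qed
      ultimately show ?thesis using U2(1) False unfolding g_def by (intro exI[of _ U2]) blast
    qed
  qed
  then have const: "\<forall>m\<in>W. \<forall>m'\<in>W. g m = g m'"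
    by (rule c) (simp only: g_def)
  obtain m1 m2 where "m1 \<in> W" "R m1 \<in> E1" "m2 \<in> W" "R m2 \<in> E2" using E(5,6) by blast
  moreover from this have "g m1 = g m2" using const by blast
  ultimately show False using E(4) unfolding g_def by blast
qed

lemma HP_connected:
  assumes s: "s \<in> {..<p} \<rightarrow>\<^sub>E {-1, 0, 1}" and i0: "i0 < p" "s i0 = 0"
  shows "connectedin (Hom_PSL2_top g p) (HP g p n s)"
proof -
  let ?W = "word_set s (rest_word g p i0) n n" and ?R = "\<lambda>m. rep_of g p (fill g p i0 n m)"
  have "HP g p n s = ?R ` ?W"
    unfolding HP_eq_image[OF s] surface_set_eq_fill[where s = s, OF i0] image_image ..
  moreover have "connectedin (Hom_PSL2_top g p) (?R ` ?W)"
  proof (rule connectedin_image_of_const)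
    show "continuous_map (top_of_set ?W) (Hom_PSL2_top g p) ?R"
      by (rule continuous_map_rep_of[OF continuous_on_fill])
        (rule surface_set_images, rule fill_surface_set[where s = s, OF i0])
  next
    fix h :: "gen_images \<Rightarrow> bool"
    assume lc: "loc_const ?W h" and R: "\<And>m m'. m \<in> ?W \<Longrightarrow> m' \<in> ?W \<Longrightarrow> ?R m = ?R m' \<Longrightarrow> h m = h m'"
    have "flip_inv (rest_word g p i0) ?W h"
      unfolding flip_inv_def
    proof (intro ballI allI impI)
      fix m j assume m: "m \<in> ?W" and j: "Handle j \<in> set (rest_word g p i0)"
      have "h (m(x := - m x)) = h m" if x: "x = GenA j \<or> x = GenB j" for x
        by (rule R[OF word_set_flip[OF distinct_rest_word j x m] m]) (simp only: fill_flip[OF x] rep_of_flip)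
      then show "h (m(GenA j := - m (GenA j))) = h m \<and> h (m(GenB j := - m (GenB j))) = h m" by blast
    qed
    moreover have "s i \<in> {-1, 0, 1}" if "Cusp i \<in> set (rest_word g p i0)" for i
    proof -
      have "i < p" using that i0(1) by (auto simp: rest_word_def suf_word_def pre_word_def)
      then show ?thesis using s by (simp add: PiE_def Pi_def)
    qed
    ultimately show "\<forall>m\<in>?W. \<forall>m'\<in>?W. h m = h m'"
      using word_set_nonempty_const[OF distinct_rest_word order_refl, of g p i0 s n] lc by blast
  qed
  ultimately show ?thesis by simp
qed

lemma int_num_sign: "int (num_sign p k s) = (\<Sum>i<p. if s i = k then 1 else 0)"
  by (simp add: num_sign_def sum.If_cases Int_def)

lemma sum_rest_word:
  assumes "i0 < p" "f (Cusp i0) = 1" "\<And>j. f (Handle j) = (2::int)"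
  shows "(\<Sum>bl\<leftarrow>rest_word g p i0. f bl) = 2 * int g + (\<Sum>i<p. f (Cusp i)) - 1"
proof -
  have "(\<Sum>i\<leftarrow>[a..<b]. f (Cusp i)) = (\<Sum>i=a..<b. f (Cusp i))" for a b
    by (simp add: interv_sum_list_conv_sum_set_nat)
  moreover have "(\<Sum>j\<leftarrow>[0..<g]. f (Handle j)) = 2 * int g"
    by (simp add: assms(3) sum_list_triv)
  ultimately have 1: "(\<Sum>bl\<leftarrow>rest_word g p i0. f bl) =
      (\<Sum>i=Suc i0..<p. f (Cusp i)) + (2 * int g + (\<Sum>i=0..<i0. f (Cusp i)))"
    by (simp add: rest_word_def suf_word_def pre_word_def comp_def)
  have "(\<Sum>i<p. f (Cusp i)) = (\<Sum>i=0..<i0. f (Cusp i)) + (\<Sum>i=i0..<p. f (Cusp i))"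
    using assms(1) by (simp add: lessThan_atLeast0 sum.atLeastLessThan_concat)
  also have "(\<Sum>i=i0..<p. f (Cusp i)) = f (Cusp i0) + (\<Sum>i=Suc i0..<p. f (Cusp i))"
    using assms(1) by (rule sum.atLeast_Suc_lessThan)
  finally show ?thesis using 1 assms(2) by simp
qed

lemma HP_nonempty_iff:
  assumes s: "s \<in> {..<p} \<rightarrow>\<^sub>E {-1, 0, 1}" and i0: "i0 < p" "s i0 = 0"
  shows "HP g p n s \<noteq> {} \<longleftrightarrow>
    euler_char g p + int (num_sign p 1 s) \<le> n \<and> n \<le> - euler_char g p - int (num_sign p (-1) s)"
proof -
  let ?W = "word_set s (rest_word g p i0) n n"
  have si: "s i \<in> {-1, 0, 1}" if "i < p" for i using s that by (auto simp: PiE_def Pi_def)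
  have rs: "s i \<in> {-1, 0, 1}" if "Cusp i \<in> set (rest_word g p i0)" for i
  proof -
    have "i < p" using that i0(1) by (auto simp: rest_word_def suf_word_def pre_word_def)
    then show ?thesis by (rule si)
  qed
  have "HP g p n s \<noteq> {} \<longleftrightarrow> ?W \<noteq> {}"
    unfolding HP_eq_image[OF s] surface_set_eq_fill[where s = s, OF i0] by auto
  also have "\<dots> \<longleftrightarrow> n < (\<Sum>bl\<leftarrow>rest_word g p i0. block_lower s bl) \<and> 0 < n + (\<Sum>bl\<leftarrow>rest_word g p i0. block_upper s bl)"
    by (rule word_set_nonempty_const[where 'v = bool, THEN conjunct1])
      (rule distinct_rest_word, rule order_refl, rule rs)
  also have "(\<Sum>bl\<leftarrow>rest_word g p i0. block_lower s bl) = 2 * int g + int p - int (num_sign p (-1) s) - 1"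
  proof -
    have "(\<Sum>i<p. block_lower s (Cusp i)) = (\<Sum>i<p. 1 - (if s i = -1 then 1 else 0))"
      by (rule sum.cong) (use si in \<open>auto simp: lower_shift_def\<close>)
    then show ?thesis using sum_rest_word[of i0 p "block_lower s" g] i0
      by (simp add: lower_shift_def int_num_sign sum_subtractf)
  qed
  also have "(\<Sum>bl\<leftarrow>rest_word g p i0. block_upper s bl) = 2 * int g + int p - int (num_sign p 1 s) - 1"
  proof -
    have "(\<Sum>i<p. block_upper s (Cusp i)) = (\<Sum>i<p. 1 - (if s i = 1 then 1 else 0))"
      by (rule sum.cong) (use si in \<open>auto simp: upper_shift_def\<close>)
    then show ?thesis using sum_rest_word[of i0 p "block_upper s" g] i0
      by (simp add: upper_shift_def int_num_sign sum_subtractf)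
  qed
  finally show ?thesis by (auto simp: euler_char_def)
qed

theorem theorem1p8:
  fixes g p :: nat and n :: int and s :: "nat \<Rightarrow> int"
  assumes "p \<ge> 1"
    and "s \<in> {..<p} \<rightarrow>\<^sub>E {-1, 0, 1}"
    and "num_sign p 0 s \<ge> 1"
  shows "(HP g p n s \<noteq> {} \<longleftrightarrow>
            euler_char g p + int (num_sign p 1 s) \<le> n \<and>
            n \<le> - euler_char g p - int (num_sign p (-1) s))
         \<and> (HP g p n s \<noteq> {} \<longrightarrow> connectedin (Hom_PSL2_top g p) (HP g p n s))"
proof -
  have "{i. i < p \<and> s i = 0} \<noteq> {}"
  proof
    assume "{i. i < p \<and> s i = 0} = {}"
    then show False using assms(3) by (simp add: num_sign_def del: Collect_empty_eq)
  qed
  then obtain i0 where "i0 < p" "s i0 = 0" by auto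
  then show ?thesis using HP_nonempty_iff[OF assms(2)] HP_connected[OF assms(2)] by blast
qed

end
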